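(* Let $T>0$ and $\alpha,\beta,\mu\in\mathbb{R}$ with $0\le\alpha<2$, $\alpha+\beta>1$ and $\mu<\mu(\alpha+\beta)$, where $\mu(\delta):=(\delta-1)^2/4$, and let $\gamma:=-\frac{1+\alpha+\beta}{2}-\sqrt{\mu(\alpha+\beta)-\mu}$. Put $\kappa_\alpha:=\frac{2-\alpha}{2}$ and $\nu:=\sqrt{\mu(\alpha+\beta)-\mu}\,/\kappa_\alpha$. Consider the control system $$\left\{\begin{aligned} &u_t-(x^\alpha u_x)_x-\beta x^{\alpha-1}u_x-\frac{\mu}{x^{2-\alpha}}u=0 &&\text{in }(0,1)\times(0,T),\\ &(x^{-\gamma}u_x)(0,t)=f(t),\quad u(1,t)=0 &&\text{on }(0,T),\\ &u(x,0)=u_0(x)&&\text{in }(0,1),\end{aligned}\right.$$ with solutions understood in the weak sense defined in the context, and its cost of controllability $\mathcal{K}(T,\alpha,\beta,\mu)$ defined in the context. The following hold. 1. (Existence of a control) For any $u_0\in L^2((0,1);x^\beta dx)$ there exists a control $f\in L^2(0,T)$ such that the solution $u$ satisfies $u(\cdot,T)\equiv 0$. 2. (Upper bound of the cost) There exists a constant $c>0$ such that for every $\delta\in(0,1)$ $$\mathcal{K}(T,\alpha,\beta,\mu)\le c\,M(T,\alpha,\nu,\delta)\,T^{1/2}\kappa_\alpha^{-1/2}\exp\left(-\frac{T}{2}\kappa_\alpha^2 j_{\nu,1}^2\right),$$ where $$M(T,\alpha,\nu,\delta)=\left(1+\frac{1}{(1-\delta)\kappa_\alpha^2T}\right)\left[\exp\left(\frac{1}{\sqrt2\,\kappa_\alpha}\right)+\frac{1}{\delta^3}\exp\left(\frac{3}{(1-\delta)\kappa_\alpha^2T}\right)\right]\exp\left(-\frac{(1-\delta)^{3/2}T^{3/2}}{8(1+T)^{1/2}}\kappa_\alpha^3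 j_{\nu,1}^2\right).$$ 3. (Lower bound of the cost) There exists a constant $c>0$ such that $$\frac{c\,2^{\nu}\Gamma(\nu+1)\,|J_\nu'(j_{\nu,1})|\exp\left(\left(\frac12-\frac{\log 2}{\pi}\right)j_{\nu,2}\right)}{(2T\kappa_\alpha)^{1/2}(j_{\nu,1})^{\nu}}\exp\left(-\left(j_{\nu,1}^2+\frac{j_{\nu,2}^2}{2}\right)\kappa_\alpha^2T\right)\le\mathcal{K}(T,\alpha,\beta,\mu).$$
   Context: $J_\nu$ is the Bessel function of the first kind of order $\nu$ and $0<j_{\nu,1}<j_{\nu,2}<\dots$ are its positive zeros. $L^2_\beta(0,1):=L^2((0,1);x^\beta dx)$ with inner product $\langle f,g\rangle_\beta=\int_0^1 f g\,x^\beta dx$ and norm $\|\cdot\|_\beta$. For $k\ge1$ let $$\Phi_k(x)=\frac{(2\kappa_\alpha)^{1/2}}{|J_\nu'(j_{\nu,k})|}x^{(1-\alpha-\beta)/2}J_\nu(j_{\nu,k}x^{\kappa_\alpha}),\qquad \lambda_k=\kappa_\alpha^2 j_{\nu,k}^2;$$ $(\Phi_k)_{k\ge1}$ is an orthonormal basis of $L^2_\beta(0,1)$ consisting of eigenfunctions, with eigenvalues $\lambda_k$, of $\mathcal{A}u=-(x^\alpha u_x)_x-\beta x^{\alpha-1}u_x-\mu x^{\alpha-2}u$. For $s\ge0$, $\mathcal{H}^s=\{u=\sum_k a_k\Phi_k:\ \|u\|_{\mathcal{H}^s}^2=\sum_k|a_k|^2\lambda_k^s<\infty\}$, and $\mathcal{H}^{-s}$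 is its dual with respect to the pivot space $L^2_\beta(0,1)$, i.e. the completion of $L^2_\beta(0,1)$ for the norm $\|u\|_{-s}^2=\sum_k\lambda_k^{-s}|\langle u,\Phi_k\rangle_\beta|^2$. The semigroup is $S(t)\sum_k a_k\Phi_k=\sum_k e^{-\lambda_kt}a_k\Phi_k$, $t\ge 0$. For $\delta\in\mathbb{R}$ and $z:(0,1)\to\mathbb{R}$, $\mathcal{O}_\delta(z):=\lim_{x\to0^+}x^\delta z(x)$. Weak solution: for $f\in L^2(0,T)$ and $u_0\in\mathcal{H}^{-s}$, a weak solution of the system is $u\in C^0([0,T];\mathcal{H}^{-s})$ such that for every $\tau\in(0,T]$ and $z^\tau\in\mathcal{H}^s$, $$\langle u(\tau),z^\tau\rangle_{\mathcal{H}^{-s},\mathcal{H}^s}=-\int_0^\tau f(t)\,\mathcal{O}_{\alpha+\beta+\gamma}(S(\tau-t)z^\tau)\,dt+\langle u_0,S(\tau)z^\tau\rangle_{\mathcal{H}^{-s},\mathcal{H}^s}.$$ For $u_0\in L^2_\beta(0,1)$ the solution is the unique weak solution in this sense, taken with any $s>\nu$. Admissible controls and cost: $U(T,\alpha,\beta,\mu,u_0)=\{f\in L^2(0,T): \text{the solution } u \text{ of the system satisfies } u(\cdot,T)\equiv0\}$ and $$\mathcal{K}(T,\alpha,\beta,\mu):=\sup_{\|u_0\|_\beta\le1}\inf\{\|f\|_{L^2(0,T)}: f\in U(T,\alpha,\beta,\mu,u_0)\}.$$ *)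

theory Defs
  imports "HOL-Analysis.Analysis"
begin

section \<open>Bessel functions of the first kind and their positive zeros\<close>

text \<open>The series is meant for \<open>x > 0\<close>. Since \<^term>\<open>Gamma\<close> vanishes at its poles and \<open>1 / 0 = 0\<close>,
  the coefficients are the right ones for every real order.\<close>

definition bessel_J :: "real \<Rightarrow> real \<Rightarrow> real" where
  "bessel_J \<nu> x =
     (\<Sum>m. (-1) ^ m / (fact m * Gamma (real m + \<nu> + 1)) * (x / 2) powr (2 * real m + \<nu>))"

text \<open>\<open>bessel_zero \<nu> k\<close> is the \<open>k\<close>-th positive zero for \<open>k \<ge> 1\<close>; index \<open>0\<close> only starts the recursion.\<close>

primrec bessel_zero :: "real \<Rightarrow> nat \<Rightarrow> real" where
  "bessel_zero \<nu> 0 = 0"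
| "bessel_zero \<nu> (Suc k) = (LEAST x. bessel_zero \<nu> k < x \<and> bessel_J \<nu> x = 0)"

section \<open>Real \<open>L\<^sup>2\<close> spaces\<close>

definition L2_space :: "real measure \<Rightarrow> (real \<Rightarrow> real) set" where
  "L2_space M = {f \<in> borel_measurable M. integrable M (\<lambda>x. (f x)\<^sup>2)}"

definition L2_inner :: "real measure \<Rightarrow> (real \<Rightarrow> real) \<Rightarrow> (real \<Rightarrow> real) \<Rightarrow> real" where
  "L2_inner M f g = (\<integral>x. f x * g x \<partial>M)"

definition L2_norm :: "real measure \<Rightarrow> (real \<Rightarrow> real) \<Rightarrow> real" where
  "L2_norm M f = sqrt (L2_inner M f f)"

abbreviation time_measure :: "real \<Rightarrow> real measure" where
  "time_measure T \<equiv> lebesgue_on {0<..<T}"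

definition weight_measure :: "real \<Rightarrow> real measure" where
  "weight_measure \<beta> = density (lebesgue_on {0<..<1}) (\<lambda>x. ennreal (x powr \<beta>))"

section \<open>Parameters\<close>

definition mu_crit :: "real \<Rightarrow> real" where
  "mu_crit d = (d - 1)\<^sup>2 / 4"

definition admissible :: "real \<Rightarrow> real \<Rightarrow> real \<Rightarrow> bool" where
  "admissible \<alpha> \<beta> \<mu> \<longleftrightarrow> 0 \<le> \<alpha> \<and> \<alpha> < 2 \<and> \<alpha> + \<beta> > 1 \<and> \<mu> < mu_crit (\<alpha> + \<beta>)"

definition gamma_exp :: "real \<Rightarrow> real \<Rightarrow> real \<Rightarrow> real" where
  "gamma_exp \<alpha> \<beta> \<mu> = - (1 + \<alpha> + \<beta>) / 2 - sqrt (mu_crit (\<alpha> + \<beta>) - \<mu>)"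

definition kappa :: "real \<Rightarrow> real" where
  "kappa \<alpha> = (2 - \<alpha>) / 2"

definition nu :: "real \<Rightarrow> real \<Rightarrow> real \<Rightarrow> real" where
  "nu \<alpha> \<beta> \<mu> = sqrt (mu_crit (\<alpha> + \<beta>) - \<mu>) / kappa \<alpha>"

section \<open>Spectral data, the spaces \<open>H\<^sup>s\<close> and their duals, the semigroup\<close>

text \<open>As for the zeros, the eigenpairs are indexed by \<open>k \<ge> 1\<close>.\<close>

definition eigenfun :: "real \<Rightarrow> real \<Rightarrow> real \<Rightarrow> nat \<Rightarrow> real \<Rightarrow> real" where
  "eigenfun \<alpha> \<beta> \<mu> k x =
     (let \<nu> = nu \<alpha> \<beta> \<mu>; \<kappa> = kappa \<alpha>; j = bessel_zero \<nu> k
      in sqrt (2 * \<kappa>) / \<bar>deriv (bessel_J \<nu>) j\<bar>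
           * x powr ((1 - \<alpha> - \<beta>) / 2) * bessel_J \<nu> (j * x powr \<kappa>))"

definition eigenval :: "real \<Rightarrow> real \<Rightarrow> real \<Rightarrow> nat \<Rightarrow> real" where
  "eigenval \<alpha> \<beta> \<mu> k = (kappa \<alpha>)\<^sup>2 * (bessel_zero (nu \<alpha> \<beta> \<mu>) k)\<^sup>2"

definition coef :: "real \<Rightarrow> real \<Rightarrow> real \<Rightarrow> (real \<Rightarrow> real) \<Rightarrow> nat \<Rightarrow> real" where
  "coef \<alpha> \<beta> \<mu> z k = L2_inner (weight_measure \<beta>) z (eigenfun \<alpha> \<beta> \<mu> k)"

definition Hs :: "real \<Rightarrow> real \<Rightarrow> real \<Rightarrow> real \<Rightarrow> (real \<Rightarrow> real) set" where
  "Hs \<alpha> \<beta> \<mu> s =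
     {z \<in> L2_space (weight_measure \<beta>). \<exists>a.
        ((\<lambda>n. L2_norm (weight_measure \<beta>) (\<lambda>x. z x - (\<Sum>k=1..n. a k * eigenfun \<alpha> \<beta> \<mu> k x)))
           \<longlonglongrightarrow> 0) \<and>
        summable (\<lambda>k. (a (Suc k))\<^sup>2 * eigenval \<alpha> \<beta> \<mu> (Suc k) powr s)}"

text \<open>By orthonormality, the coefficients \<open>a k\<close> above are \<open>coef \<alpha> \<beta> \<mu> z k\<close>.\<close>

definition Hs_norm :: "real \<Rightarrow> real \<Rightarrow> real \<Rightarrow> real \<Rightarrow> (real \<Rightarrow> real) \<Rightarrow> real" where
  "Hs_norm \<alpha> \<beta> \<mu> s z =
     sqrt (\<Sum>k. (coef \<alpha> \<beta> \<mu> z (Suc k))\<^sup>2 * eigenval \<alpha> \<beta> \<mu> (Suc k) powr s)"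

text \<open>The dual \<open>H\<^sup>-\<^sup>s\<close> consists of the bounded linear functionals on \<open>H\<^sup>s\<close>, so that the duality pairing
  of \<open>l\<close> with \<open>z\<close> is \<open>l z\<close>; only the values on \<open>H\<^sup>s\<close> are relevant. Boundedness forces functions that
  agree almost everywhere to have the same image. With \<open>L\<^sup>2\<close> as pivot space, an \<open>L\<^sup>2\<close> function \<open>v\<close> is
  identified with the functional \<open>pivot \<beta> v\<close>.\<close>

definition Hs_dual :: "real \<Rightarrow> real \<Rightarrow> real \<Rightarrow> real \<Rightarrow> ((real \<Rightarrow> real) \<Rightarrow> real) set" where
  "Hs_dual \<alpha> \<beta> \<mu> s =
     {l. (\<forall>z\<in>Hs \<alpha> \<beta> \<mu> s. \<forall>w\<in>Hs \<alpha> \<beta> \<mu> s. l (\<lambda>x. z x + w x) = l z + l w) \<and>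
         (\<forall>z\<in>Hs \<alpha> \<beta> \<mu> s. \<forall>c. l (\<lambda>x. c * z x) = c * l z) \<and>
         (\<exists>C. \<forall>z\<in>Hs \<alpha> \<beta> \<mu> s. \<bar>l z\<bar> \<le> C * Hs_norm \<alpha> \<beta> \<mu> s z)}"

definition Hs_dual_norm ::
    "real \<Rightarrow> real \<Rightarrow> real \<Rightarrow> real \<Rightarrow> ((real \<Rightarrow> real) \<Rightarrow> real) \<Rightarrow> real" where
  "Hs_dual_norm \<alpha> \<beta> \<mu> s l =
     sqrt (\<Sum>k. eigenval \<alpha> \<beta> \<mu> (Suc k) powr (- s) * (l (eigenfun \<alpha> \<beta> \<mu> (Suc k)))\<^sup>2)"

definition pivot :: "real \<Rightarrow> (real \<Rightarrow> real) \<Rightarrow> (real \<Rightarrow> real) \<Rightarrow> real" where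
  "pivot \<beta> v = (\<lambda>z. L2_inner (weight_measure \<beta>) v z)"

text \<open>For \<open>t > 0\<close> the series converges at every point of \<open>(0,1)\<close>; its pointwise sum is the continuous
  representative, whose behaviour at \<open>0\<close> is what \<open>bdry_limit\<close> below looks at.\<close>

definition semigroup_S ::
    "real \<Rightarrow> real \<Rightarrow> real \<Rightarrow> real \<Rightarrow> (real \<Rightarrow> real) \<Rightarrow> (real \<Rightarrow> real)" where
  "semigroup_S \<alpha> \<beta> \<mu> t z =
     (if t = 0 then z
      else (\<lambda>x. \<Sum>k. exp (- eigenval \<alpha> \<beta> \<mu> (Suc k) * t) * coef \<alpha> \<beta> \<mu> z (Suc k)
                      * eigenfun \<alpha> \<beta> \<mu> (Suc k) x))"

definition bdry_limit :: "real \<Rightarrow> (real \<Rightarrow> real) \<Rightarrow> real" where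
  "bdry_limit d z = Lim (at_right 0) (\<lambda>x. x powr d * z x)"

section \<open>Weak solutions, null controls and the cost of controllability\<close>

text \<open>Solutions, defined by transposition, of
  \<open>u\<^sub>t - (x\<^sup>\<alpha> u\<^sub>x)\<^sub>x - \<beta> x\<^bsup>\<alpha>-1\<^esup> u\<^sub>x - \<mu> x\<^bsup>\<alpha>-2\<^esup> u = 0\<close> on \<open>(0,1) \<times> (0,T)\<close> with
  \<open>(x\<^bsup>-\<gamma>\<^esup> u\<^sub>x)(0,t) = f t\<close>, \<open>u(1,t) = 0\<close>, \<open>u(x,0) = u0 x\<close>. The initial datum \<open>u0\<close> and the values \<open>u t\<close> are elements of \<open>H\<^sup>-\<^sup>s\<close>.\<close>

definition weak_solution ::
    "real \<Rightarrow> real \<Rightarrow> real \<Rightarrow> real \<Rightarrow> real \<Rightarrow> (real \<Rightarrow> real) \<Rightarrow> ((real \<Rightarrow> real) \<Rightarrow> real)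
      \<Rightarrow> (real \<Rightarrow> (real \<Rightarrow> real) \<Rightarrow> real) \<Rightarrow> bool" where
  "weak_solution \<alpha> \<beta> \<mu> s T f u0 u \<longleftrightarrow>
     (\<forall>t\<in>{0..T}. u t \<in> Hs_dual \<alpha> \<beta> \<mu> s) \<and>
     (\<forall>t\<in>{0..T}. ((\<lambda>r. Hs_dual_norm \<alpha> \<beta> \<mu> s (\<lambda>z. u r z - u t z)) \<longlongrightarrow> 0) (at t within {0..T})) \<and>
     (\<forall>\<tau>\<in>{0<..T}. \<forall>z\<in>Hs \<alpha> \<beta> \<mu> s.
        u \<tau> z =
          - (\<integral>t. f t * bdry_limit (\<alpha> + \<beta> + gamma_exp \<alpha> \<beta> \<mu>) (semigroup_S \<alpha> \<beta> \<mu> (\<tau> - t) z)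
               \<partial>time_measure \<tau>)
          + u0 (semigroup_S \<alpha> \<beta> \<mu> \<tau> z))"

text \<open>A weak solution is determined by \<open>f\<close> and \<open>u0\<close>: its values on \<open>H\<^sup>s\<close> are given by the identity above
  for \<open>\<tau> > 0\<close>, and by continuity for \<open>\<tau> = 0\<close>. Hence the solution vanishes at time \<open>T\<close> iff there is a
  weak solution that does.\<close>

definition null_controls ::
    "real \<Rightarrow> real \<Rightarrow> real \<Rightarrow> real \<Rightarrow> (real \<Rightarrow> real) \<Rightarrow> (real \<Rightarrow> real) set" where
  "null_controls T \<alpha> \<beta> \<mu> u0 =
     {f \<in> L2_space (time_measure T).
        \<forall>s > nu \<alpha> \<beta> \<mu>. \<exists>u. weak_solution \<alpha> \<beta> \<mu> s T f (pivot \<beta> u0) u \<and>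
                            (\<forall>z\<in>Hs \<alpha> \<beta> \<mu> s. u T z = 0)}"

text \<open>Extended reals, so that the infimum over an empty set and an unbounded supremum are \<open>\<infinity>\<close>.\<close>

definition cost :: "real \<Rightarrow> real \<Rightarrow> real \<Rightarrow> real \<Rightarrow> ereal" where
  "cost T \<alpha> \<beta> \<mu> =
     (SUP u0 \<in> {u0 \<in> L2_space (weight_measure \<beta>). L2_norm (weight_measure \<beta>) u0 \<le> 1}.
        INF f \<in> null_controls T \<alpha> \<beta> \<mu> u0. ereal (L2_norm (time_measure T) f))"

definition M_bound :: "real \<Rightarrow> real \<Rightarrow> real \<Rightarrow> real \<Rightarrow> real" where
  "M_bound T \<alpha> \<nu> \<delta> =
     (1 + 1 / ((1 - \<delta>) * (kappa \<alpha>)\<^sup>2 * T))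
     * (exp (1 / (sqrt 2 * kappa \<alpha>)) + 1 / \<delta> ^ 3 * exp (3 / ((1 - \<delta>) * (kappa \<alpha>)\<^sup>2 * T)))
     * exp (- ((1 - \<delta>) powr (3/2) * T powr (3/2) / (8 * (1 + T) powr (1/2))
               * (kappa \<alpha>) ^ 3 * (bessel_zero \<nu> 1)\<^sup>2))"

end

(*
  A control steers u_0 to rest at time T iff its exponential moments take prescribed values: with b_k
  the boundary limit of Phi_k, iff b_k int_0^T f(t) exp(-lambda_k (T-t)) dt = exp(-lambda_k T) <u_0, Phi_k>
  for all k. Writing J_nu(x) = (x/2)^nu F_nu(x^2) / Gamma(nu+1), everything is expressed through the
  entire function F_nu, which satisfies |F_nu| <= 1 on [0,oo) and F_nu' = -F_(nu+1) / (4(nu+1)).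

  Upper bound. Let E(s) = F_nu(-s/kappa^2), so that E vanishes exactly at the numbers -lambda_k, and let
  h be a bump on the last part of (0,T), with primitive H. Then E(d/dt)(H exp(-lambda_k t)) is orthogonal
  to all exp(lambda_m t), m <> k, and, since the derivatives of F_nu are again such functions, it is
  bounded uniformly in k once the derivatives of h do not grow faster than those of
  exp(-a/t - a/(L-t)) with a > 1/(4 kappa^2). Summing these functions gives the control.

  Lower bound. For u_0 = Phi_1 the control is orthogonal to exp(lambda_k t) for k >= 2, so that its norm
  is bounded below as soon as some exp(lambda_1 t) + sum_(k>=2) c_k exp(lambda_k t) is small on (0,T). Such
  sums arise from exp(lambda_1 t) by all-pass filtering, with gain prod (lambda_k-lambda_1)/(lambda_k+lambda_1+lambda_2).
  For large nu, Sturm comparison provides enough zeros of J_nu in (1.25 nu, 6 nu] to estimate this product.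
*)

theory Submission
  imports Defs "HOL-Complex_Analysis.Complex_Analysis"
begin

section \<open>Bessel functions and their zeros\<close>

text \<open>The constants c must not depend on nu, kappa or T. For the upper bound the obstacle is
  large nu: the target contains exp(-lambda_1 T/2) with lambda_1 > kappa^2 nu^2, while a control
  acting on nearly all of (0,T) can draw on little dissipation. Cauchy's inequality on discs almost
  touching the nearer end of the support makes a about 1/(2 kappa^2), and the height of the bump
  then costs exp(2.011/(kappa^2 L)) for a window of length L. With L near T, less than 1/(kappa^2 T)
  of the permitted 3/(kappa^2 T) is left to replace the missing dissipation, which suffices while nu
  kappa^2 T <= 1.15. Beyond that, the weights 1/(nu+1)_i on the derivatives of h are small enough to
  win a factor close to exp(-N), N about 1.15/(kappa^2 T). For the lower bound the exponent must be
  linear in j_2, hence in nu: each zero in (1.25 nu, 6 nu] contributes a factor bounded away from 1,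
  and their number is proportional to nu. Shifting all exponents by lambda_2/2 before filtering
  yields the denominators lambda_k+lambda_1+lambda_2 at the price exp(lambda_2 T/2).\<close>

definition bessel_coeff :: "real \<Rightarrow> nat \<Rightarrow> real" where
  "bessel_coeff \<nu> n = (-1) ^ n / (4 ^ n * fact n * pochhammer (\<nu> + 1) n)"

text \<open>The hypergeometric function 0F1(; nu + 1; -z / 4): entire in z, without the branch point
  of J_nu at 0.\<close>

definition bessel_F :: "real \<Rightarrow> real \<Rightarrow> real" where
  "bessel_F \<nu> z = (\<Sum>n. bessel_coeff \<nu> n * z ^ n)"

lemma pochhammer_ge_1:
  fixes \<nu> :: real
  assumes "\<nu> \<ge> 0"
  shows "1 \<le> pochhammer (\<nu> + 1) n"
proof -
  have "pochhammer (1::real) n \<le> pochhammer (\<nu> + 1) n"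
    unfolding pochhammer_prod using assms by (intro prod_mono) auto
  then show ?thesis
    by (metis fact_ge_1 order_trans pochhammer_fact)
qed

lemma bessel_coeff_abs_le:
  assumes "\<nu> \<ge> 0"
  shows "\<bar>bessel_coeff \<nu> n\<bar> \<le> 1 / fact n"
proof -
  have "1 \<le> pochhammer (\<nu> + 1) n" by (rule pochhammer_ge_1[OF assms])
  moreover have "(1::real) \<le> 4 ^ n" by simp
  ultimately have "1 * fact n * 1 \<le> 4 ^ n * fact n * pochhammer (\<nu> + 1) n"
    by (intro mult_mono) auto
  then show ?thesis
    using \<open>1 \<le> pochhammer (\<nu> + 1) n\<close>
    by (auto simp: bessel_coeff_def abs_mult power_abs intro!: divide_left_mono mult_pos_pos)
qed

lemma summable_bessel_F:
  assumes "\<nu> \<ge> 0"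
  shows "summable (\<lambda>n. bessel_coeff \<nu> n * z ^ n)"
proof (rule summable_comparison_test)
  show "summable (\<lambda>n. inverse (fact n) * \<bar>z\<bar> ^ n)"
    by (rule summable_exp)
  show "\<exists>N. \<forall>n\<ge>N. norm (bessel_coeff \<nu> n * z ^ n) \<le> inverse (fact n) * \<bar>z\<bar> ^ n"
  proof (intro exI allI impI)
    fix n
    show "norm (bessel_coeff \<nu> n * z ^ n) \<le> inverse (fact n) * \<bar>z\<bar> ^ n"
      using mult_right_mono[OF bessel_coeff_abs_le[OF assms, of n], of "\<bar>z\<bar> ^ n"]
      by (simp add: abs_mult power_abs inverse_eq_divide)
  qed
qed

lemma diffs_bessel_coeff:
  assumes "\<nu> \<ge> 0"
  shows "diffs (bessel_coeff \<nu>) n = - 1 / (4 * (\<nu> + 1)) * bessel_coeff (\<nu> + 1) n"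
proof -
  have p: "pochhammer (\<nu> + 2) n > 0" using assms by (intro pochhammer_pos) auto
  have "pochhammer (\<nu> + 1) (Suc n) = (\<nu> + 1) * pochhammer (\<nu> + 2) n"
    by (simp add: pochhammer_rec add.commute)
  then have 1: "bessel_coeff \<nu> (Suc n) =
      - ((-1) ^ n) / (4 * 4 ^ n * (real (Suc n) * fact n) * ((\<nu> + 1) * pochhammer (\<nu> + 2) n))"
    by (simp add: bessel_coeff_def)
  have 2: "bessel_coeff (\<nu> + 1) n = (-1) ^ n / (4 ^ n * fact n * pochhammer (\<nu> + 2) n)"
    by (simp add: bessel_coeff_def add.commute)
  show ?thesis
    unfolding diffs_def 1 2 using assms p by (simp add: divide_simps del: of_nat_Suc)
qed

lemma DERIV_bessel_F:
  assumes "\<nu> \<ge> 0"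
  shows "(bessel_F \<nu> has_real_derivative - bessel_F (\<nu> + 1) z / (4 * (\<nu> + 1))) (at z)"
proof -
  have "DERIV (\<lambda>z. \<Sum>n. bessel_coeff \<nu> n * z ^ n) z :> (\<Sum>n. diffs (bessel_coeff \<nu>) n * z ^ n)"
    by (rule termdiffs_strong_converges_everywhere) (rule summable_bessel_F[OF assms])
  moreover have "(\<Sum>n. diffs (bessel_coeff \<nu>) n * z ^ n) =
      (\<Sum>n. - 1 / (4 * (\<nu> + 1)) * (bessel_coeff (\<nu> + 1) n * z ^ n))"
    using assms by (simp add: diffs_bessel_coeff mult.assoc)
  moreover have "\<dots> = - 1 / (4 * (\<nu> + 1)) * bessel_F (\<nu> + 1) z"
    unfolding bessel_F_def using assms by (intro suminf_mult summable_bessel_F) auto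
  ultimately show ?thesis
    by (simp add: bessel_F_def[abs_def])
qed

lemma bessel_F_0: "bessel_F \<nu> 0 = 1"
  unfolding bessel_F_def powser_zero by (simp add: bessel_coeff_def)

section \<open>Derivatives of F_nu, Bessel's equation and the energy\<close>

definition bessel_F' :: "real \<Rightarrow> real \<Rightarrow> real" where
  "bessel_F' \<nu> z = - bessel_F (\<nu> + 1) z / (4 * (\<nu> + 1))"

definition bessel_F'' :: "real \<Rightarrow> real \<Rightarrow> real" where
  "bessel_F'' \<nu> z = bessel_F (\<nu> + 2) z / (16 * (\<nu> + 1) * (\<nu> + 2))"

lemma DERIV_bessel_F1:
  "\<nu> \<ge> 0 \<Longrightarrow> (bessel_F \<nu> has_real_derivative bessel_F' \<nu> z) (at z)"
  unfolding bessel_F'_def by (rule DERIV_bessel_F)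

lemma DERIV_bessel_F2:
  assumes "\<nu> \<ge> 0"
  shows "(bessel_F' \<nu> has_real_derivative bessel_F'' \<nu> z) (at z)"
proof -
  have "((\<lambda>z. - bessel_F (\<nu> + 1) z / (4 * (\<nu> + 1))) has_real_derivative
      - (- bessel_F (\<nu> + 1 + 1) z / (4 * (\<nu> + 1 + 1))) / (4 * (\<nu> + 1))) (at z)"
    using assms by (intro DERIV_cdivide DERIV_minus DERIV_bessel_F) auto
  moreover have "- (- bessel_F (\<nu> + 1 + 1) z / (4 * (\<nu> + 1 + 1))) / (4 * (\<nu> + 1)) = bessel_F'' \<nu> z"
    using assms by (simp add: bessel_F''_def add.assoc divide_simps) (simp add: algebra_simps)
  ultimately show ?thesis
    unfolding bessel_F'_def[abs_def] by simp
qed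

lemmas bessel_F_derivs [derivative_intros] =
  DERIV_bessel_F1[THEN DERIV_chain2] DERIV_bessel_F2[THEN DERIV_chain2]

lemma continuous_on_bessel_F:
  "\<nu> \<ge> 0 \<Longrightarrow> continuous_on S (bessel_F \<nu>)"
  by (intro DERIV_continuous_on) (rule has_field_derivative_at_within, rule DERIV_bessel_F1)

lemma continuous_on_bessel_F':
  "\<nu> \<ge> 0 \<Longrightarrow> continuous_on S (bessel_F' \<nu>)"
  by (intro DERIV_continuous_on) (rule has_field_derivative_at_within, rule DERIV_bessel_F2)

text \<open>Bessel's equation in the variable z = x^2, read off from the coefficient of z^n. The
  series of z F'' is shifted by one index, so n = 0 is separate; for n = m + 1 everything is reduced
  to \<open>pochhammer (\<nu> + 2) m\<close>.\<close>

lemma bessel_ode: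
  assumes "\<nu> \<ge> 0"
  shows "z * bessel_F'' \<nu> z + (\<nu> + 1) * bessel_F' \<nu> z + bessel_F \<nu> z / 4 = 0"
proof -
  let ?c = "\<lambda>n. bessel_coeff (\<nu> + 2) n * z ^ n"
  have s2: "(\<lambda>n. z * (bessel_coeff (\<nu> + 2) n * z ^ n) / (16 * (\<nu> + 1) * (\<nu> + 2))) sums (z * bessel_F'' \<nu> z)"
    unfolding bessel_F''_def bessel_F_def times_divide_eq_right
    using assms by (intro sums_divide sums_mult summable_sums summable_bessel_F) auto
  have s1: "(\<lambda>n. (\<nu> + 1) * (- (bessel_coeff (\<nu> + 1) n * z ^ n) / (4 * (\<nu> + 1)))) sums ((\<nu> + 1) * bessel_F' \<nu> z)"
    unfolding bessel_F'_def bessel_F_def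
    using assms by (intro sums_divide sums_mult sums_minus summable_sums summable_bessel_F) auto
  have s0: "(\<lambda>n. bessel_coeff \<nu> n * z ^ n / 4) sums (bessel_F \<nu> z / 4)"
    unfolding bessel_F_def
    using assms by (intro sums_divide summable_sums summable_bessel_F) auto
  have s2': "(\<lambda>n. case n of 0 \<Rightarrow> 0 | Suc n \<Rightarrow> z * (bessel_coeff (\<nu> + 2) n * z ^ n) / (16 * (\<nu> + 1) * (\<nu> + 2)))
      sums (z * bessel_F'' \<nu> z)"
    by (subst sums_Suc_iff[symmetric, where f = "\<lambda>n. case n of 0 \<Rightarrow> 0 | Suc n \<Rightarrow> _ n", simplified]) (use s2 in simp)
  have "(\<lambda>n. (case n of 0 \<Rightarrow> 0 | Suc n \<Rightarrow> z * (bessel_coeff (\<nu> + 2) n * z ^ n) / (16 * (\<nu> + 1) * (\<nu> + 2)))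
      + (\<nu> + 1) * (- (bessel_coeff (\<nu> + 1) n * z ^ n) / (4 * (\<nu> + 1))) + bessel_coeff \<nu> n * z ^ n / 4)
      sums (z * bessel_F'' \<nu> z + (\<nu> + 1) * bessel_F' \<nu> z + bessel_F \<nu> z / 4)"
    by (intro sums_add s2' s1 s0)
  moreover have "(case n of 0 \<Rightarrow> 0 | Suc n \<Rightarrow> z * (bessel_coeff (\<nu> + 2) n * z ^ n) / (16 * (\<nu> + 1) * (\<nu> + 2)))
      + (\<nu> + 1) * (- (bessel_coeff (\<nu> + 1) n * z ^ n) / (4 * (\<nu> + 1))) + bessel_coeff \<nu> n * z ^ n / 4 = 0" for n
  proof (cases n)
    case 0
    then show ?thesis using assms by (simp add: bessel_coeff_def)
  next
    case (Suc m)
    have p: "pochhammer (\<nu> + 3) m > 0" "pochhammer (\<nu> + 2) m > 0" using assms by (auto intro: pochhammer_pos)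
    have e1: "pochhammer (\<nu> + 2) (Suc m) = (\<nu> + 2) * pochhammer (\<nu> + 3) m"
      by (simp add: pochhammer_rec add.commute)
    have e2: "pochhammer (\<nu> + 1) (Suc m) = (\<nu> + 1) * pochhammer (\<nu> + 2) m"
      by (simp add: pochhammer_rec add.commute)
    have e3: "pochhammer (\<nu> + 2) (Suc m) = (\<nu> + 2 + m) * pochhammer (\<nu> + 2) m"
      by (simp add: pochhammer_Suc)
    have e4: "pochhammer (\<nu> + 3) m = (\<nu> + 2 + m) * pochhammer (\<nu> + 2) m / (\<nu> + 2)"
      using e1 e3 assms by (simp add: field_simps)
    have pos: "\<nu> + 2 > 0" "\<nu> + 1 > 0" "\<nu> + 2 + m > 0" using assms by auto
    have 1: "bessel_coeff (\<nu> + 2) m = (-1) ^ m * (\<nu> + 2) / (4 ^ m * fact m * ((\<nu> + 2 + m) * pochhammer (\<nu> + 2) m))"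
      unfolding bessel_coeff_def using e4 pos by (simp add: add.commute add.left_commute)
    have 2: "bessel_coeff (\<nu> + 1) (Suc m) = - ((-1) ^ m) / (4 * 4 ^ m * (real (Suc m) * fact m) * ((\<nu> + 2 + m) * pochhammer (\<nu> + 2) m))"
      unfolding bessel_coeff_def using e3 by (simp add: add.commute add.left_commute)
    have 3: "bessel_coeff \<nu> (Suc m) = - ((-1) ^ m) / (4 * 4 ^ m * (real (Suc m) * fact m) * ((\<nu> + 1) * pochhammer (\<nu> + 2) m))"
      unfolding bessel_coeff_def using e2 by simp
    show ?thesis
      unfolding Suc nat.case 1 2 3
      using p pos by (simp add: divide_simps) (simp add: algebra_simps)
  qed
  ultimately have "(\<lambda>n. 0::real) sums (z * bessel_F'' \<nu> z + (\<nu> + 1) * bessel_F' \<nu> z + bessel_F \<nu> z / 4)"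
    by simp
  then show ?thesis using sums_unique2 sums_zero by blast
qed

lemma bessel_J_eq_F:
  assumes "\<nu> \<ge> 0" "x > 0"
  shows "bessel_J \<nu> x = (x / 2) powr \<nu> / Gamma (\<nu> + 1) * bessel_F \<nu> (x\<^sup>2)"
proof -
  have np: "\<nu> + 1 \<notin> \<int>\<^sub>\<le>\<^sub>0" using assms by (auto elim!: nonpos_Ints_cases)
  have G: "Gamma (\<nu> + 1) > 0" using assms by (intro Gamma_real_pos) auto
  have "(-1) ^ m / (fact m * Gamma (real m + \<nu> + 1)) * (x / 2) powr (2 * real m + \<nu>)
      = (x / 2) powr \<nu> / Gamma (\<nu> + 1) * (bessel_coeff \<nu> m * (x\<^sup>2) ^ m)" for m
  proof -
    have "pochhammer (\<nu> + 1) m = Gamma (\<nu> + 1 + m) / Gamma (\<nu> + 1)"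
      using np by (rule pochhammer_Gamma)
    then have "Gamma (real m + \<nu> + 1) = pochhammer (\<nu> + 1) m * Gamma (\<nu> + 1)"
      using G by (simp add: add_ac)
    moreover have "(x / 2) powr (2 * real m + \<nu>) = (x\<^sup>2) ^ m / 4 ^ m * (x / 2) powr \<nu>"
    proof -
      have "(x / 2) powr (2 * real m) = (x / 2) ^ (2 * m)"
        using assms by (subst powr_realpow[symmetric]) auto
      then show ?thesis
        by (simp add: powr_add power_mult power_divide)
    qed
    ultimately show ?thesis
      by (simp add: bessel_coeff_def mult_ac)
  qed
  then have "bessel_J \<nu> x = (\<Sum>m. (x / 2) powr \<nu> / Gamma (\<nu> + 1) * (bessel_coeff \<nu> m * (x\<^sup>2) ^ m))"
    unfolding bessel_J_def by presburger
  also have "\<dots> = (x / 2) powr \<nu> / Gamma (\<nu> + 1) * bessel_F \<nu> (x\<^sup>2)"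
    unfolding bessel_F_def using assms by (intro suminf_mult summable_bessel_F) auto
  finally show ?thesis .
qed

text \<open>Inserting the equation for z F'' cancels the mixed term F F' and leaves only
  damping.\<close>

lemma bessel_energy_deriv:
  assumes "\<nu> \<ge> 0"
  shows "((\<lambda>z. (bessel_F \<nu> z)\<^sup>2 + 4 * z * (bessel_F' \<nu> z)\<^sup>2) has_real_derivative
           - 4 * (2 * \<nu> + 1) * (bessel_F' \<nu> z)\<^sup>2) (at z)"
proof -
  have "((\<lambda>z. (bessel_F \<nu> z)\<^sup>2 + 4 * z * (bessel_F' \<nu> z)\<^sup>2) has_real_derivative
      2 * bessel_F \<nu> z * bessel_F' \<nu> z + (4 * (bessel_F' \<nu> z)\<^sup>2 + 4 * z * (2 * bessel_F' \<nu> z * bessel_F'' \<nu> z))) (at z)"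
    using assms by (auto intro!: derivative_eq_intros)
  moreover have "4 * (z * bessel_F'' \<nu> z) + 4 * (\<nu> + 1) * bessel_F' \<nu> z + bessel_F \<nu> z = 0"
    using bessel_ode[OF assms, of z] by argo
  then have "2 * bessel_F \<nu> z * bessel_F' \<nu> z + (4 * (bessel_F' \<nu> z)\<^sup>2 + 4 * z * (2 * bessel_F' \<nu> z * bessel_F'' \<nu> z))
     = - 4 * (2 * \<nu> + 1) * (bessel_F' \<nu> z)\<^sup>2"
    by algebra
  ultimately show ?thesis by metis
qed

text \<open>The energy starts at 1 and decreases. Being uniform in nu and z, the bound later
  supplies the majorants for limits at x = 0 and, through \<open>bessel_Fd\<close>, the bounds for
  all Taylor coefficients.\<close>

lemma bessel_F_abs_le_1:
  assumes "\<nu> \<ge> 0" "z \<ge> 0"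
  shows "\<bar>bessel_F \<nu> z\<bar> \<le> 1"
proof -
  have "(bessel_F \<nu> z)\<^sup>2 + 4 * z * (bessel_F' \<nu> z)\<^sup>2 \<le> (bessel_F \<nu> 0)\<^sup>2 + 4 * 0 * (bessel_F' \<nu> 0)\<^sup>2"
    using assms
    by (intro DERIV_nonpos_imp_nonincreasing[where f = "\<lambda>z. (bessel_F \<nu> z)\<^sup>2 + 4 * z * (bessel_F' \<nu> z)\<^sup>2"])
       (auto intro!: exI bessel_energy_deriv mult_nonpos_nonneg simp: less_imp_le)
  then have "(bessel_F \<nu> z)\<^sup>2 + 4 * z * (bessel_F' \<nu> z)\<^sup>2 \<le> 1" by (simp add: bessel_F_0)
  moreover have "0 \<le> 4 * z * (bessel_F' \<nu> z)\<^sup>2" using assms by simp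
  ultimately have "(bessel_F \<nu> z)\<^sup>2 \<le> 1" by linarith
  then show ?thesis by (simp add: abs_square_le_1)
qed

text \<open>Uniqueness, propagated towards the singular point 0: z^(2 nu + 1) times the energy is
  nondecreasing, so a zero of the energy would force F = 0 on (0,z), against F(0) = 1. Positive
  zeros of F are therefore simple.\<close>

lemma bessel_energy_pos:
  assumes "\<nu> \<ge> 0" "z > 0"
  shows "(bessel_F \<nu> z)\<^sup>2 + 4 * z * (bessel_F' \<nu> z)\<^sup>2 > 0"
proof (rule ccontr)
  let ?E = "\<lambda>z. (bessel_F \<nu> z)\<^sup>2 + 4 * z * (bessel_F' \<nu> z)\<^sup>2"
  assume "\<not> ?thesis"
  have nn: "?E y \<ge> 0" if "y \<ge> 0" for y using that by auto
  with \<open>\<not> ?thesis\<close> assms have 0: "?E z = 0" by (smt (verit))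
  have deriv: "((\<lambda>z. z powr (2 * \<nu> + 1) * ?E z) has_real_derivative
      (2 * \<nu> + 1) * y powr (2 * \<nu>) * (bessel_F \<nu> y)\<^sup>2) (at y)" if "y > 0" for y
  proof -
    have "((\<lambda>z. z powr (2 * \<nu> + 1) * ?E z) has_real_derivative
      ((2 * \<nu> + 1) * y powr (2 * \<nu> + 1 - 1)) * ?E y + (- 4 * (2 * \<nu> + 1) * (bessel_F' \<nu> y)\<^sup>2) * y powr (2 * \<nu> + 1)) (at y)"
      using that assms by (intro DERIV_mult has_real_derivative_powr bessel_energy_deriv)
    moreover have "y powr (2 * \<nu> + 1) = y powr (2 * \<nu>) * y" using that by (simp add: powr_add)
    ultimately show ?thesis
      by (simp add: algebra_simps)
  qed
  have "?E y = 0" if y: "0 < y" "y < z" for y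
  proof -
    have "y powr (2 * \<nu> + 1) * ?E y \<le> z powr (2 * \<nu> + 1) * ?E z"
      using y assms
      by (intro DERIV_nonneg_imp_nondecreasing[where f = "\<lambda>z. z powr (2 * \<nu> + 1) * ?E z"])
         (auto intro!: exI deriv mult_nonneg_nonneg)
    with 0 have "y powr (2 * \<nu> + 1) * ?E y \<le> 0" by simp
    with y nn[of y] show ?thesis by (simp add: mult_le_0_iff not_less order_antisym)
  qed
  then have F0: "bessel_F \<nu> y = 0" if y: "0 < y" "y < z" for y
    using that by (smt (verit) mult_nonneg_nonneg zero_le_power2 zero_eq_power2)
  have "(bessel_F \<nu> \<longlongrightarrow> bessel_F \<nu> 0) (at_right 0)"
    using continuous_on_bessel_F[OF assms(1), of UNIV] by (auto simp: continuous_on_def intro: tendsto_within_subset)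
  moreover have "eventually (\<lambda>y. bessel_F \<nu> y = 0) (at_right 0)"
    using F0 assms(2) by (auto simp: eventually_at_right_field intro!: exI[of _ z])
  then have "(bessel_F \<nu> \<longlongrightarrow> 0) (at_right 0)" by (rule tendsto_eventually)
  ultimately have "bessel_F \<nu> 0 = 0" by (rule tendsto_unique[OF trivial_limit_at_right_real])
  then show False by (simp add: bessel_F_0)
qed

lemma bessel_F_zero_simple:
  assumes "\<nu> \<ge> 0" "z > 0" "bessel_F \<nu> z = 0"
  shows "bessel_F' \<nu> z \<noteq> 0"
  using bessel_energy_pos[OF assms(1,2)] assms(3) by auto

section \<open>Liouville normal form and Sturm comparison\<close>

lemma DERIV_at_continuous_on:
  fixes f :: "real \<Rightarrow> real"
  shows "(\<And>x. x \<in> S \<Longrightarrow> (f has_real_derivative D x) (at x)) \<Longrightarrow> continuous_on S f"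
  by (meson DERIV_isCont continuous_at_imp_continuous_on)

text \<open>Equal to 2^nu Gamma(nu + 1) sqrt x J_nu(x). The factor sqrt x removes the first-order
  term of Bessel's equation, which becomes u'' + (1 - (nu^2 - 1/4) / x^2) u = 0.\<close>

definition bessel_u :: "real \<Rightarrow> real \<Rightarrow> real" where
  "bessel_u \<nu> x = x powr (\<nu> + 1/2) * bessel_F \<nu> (x\<^sup>2)"

definition bessel_u' :: "real \<Rightarrow> real \<Rightarrow> real" where
  "bessel_u' \<nu> x = (\<nu> + 1/2) * x powr (\<nu> - 1/2) * bessel_F \<nu> (x\<^sup>2)
      + 2 * x powr (\<nu> + 3/2) * bessel_F' \<nu> (x\<^sup>2)"

lemma DERIV_bessel_u:
  assumes "\<nu> \<ge> 0" "x > 0"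
  shows "(bessel_u \<nu> has_real_derivative bessel_u' \<nu> x) (at x)"
proof -
  have "((\<lambda>x. x powr (\<nu> + 1/2) * bessel_F \<nu> (x\<^sup>2)) has_real_derivative
     ((\<nu> + 1/2) * x powr (\<nu> + 1/2 - 1)) * bessel_F \<nu> (x\<^sup>2)
      + (bessel_F' \<nu> (x\<^sup>2) * (2 * x)) * x powr (\<nu> + 1/2)) (at x)"
    using assms by (intro DERIV_mult has_real_derivative_powr) (auto intro!: derivative_eq_intros)
  moreover have "x powr (\<nu> + 3/2) = x * x powr (\<nu> + 1/2)"
    using assms powr_mult_base[of x "\<nu> + 1/2"] by (simp add: add_ac)
  ultimately show ?thesis
    by (simp add: bessel_u_def[abs_def] bessel_u'_def mult_ac)
qed

lemma DERIV_bessel_u':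
  assumes "\<nu> \<ge> 0" "x > 0"
  shows "(bessel_u' \<nu> has_real_derivative - (1 - (\<nu>\<^sup>2 - 1/4) / x\<^sup>2) * bessel_u \<nu> x) (at x)"
proof -
  let ?p = "x powr (\<nu> - 3/2)"
  have pw: "x powr (\<nu> - 1/2) = x * ?p" "x powr (\<nu> + 1/2) = x\<^sup>2 * ?p" "x powr (\<nu> + 3/2) = x ^ 3 * ?p"
  proof -
    have "x powr (real n) * ?p = x powr (real n + (\<nu> - 3/2))" for n by (simp add: powr_add)
    from this[of 1] this[of 2] this[of 3] assms
    show "x powr (\<nu> - 1/2) = x * ?p" "x powr (\<nu> + 1/2) = x\<^sup>2 * ?p" "x powr (\<nu> + 3/2) = x ^ 3 * ?p"
      by (simp_all add: add_ac powr_numeral)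
  qed
  have "(bessel_u' \<nu> has_real_derivative
     ((\<nu> + 1/2) * ((\<nu> - 1/2) * x powr (\<nu> - 1/2 - 1))) * bessel_F \<nu> (x\<^sup>2)
      + (bessel_F' \<nu> (x\<^sup>2) * (2 * x)) * ((\<nu> + 1/2) * x powr (\<nu> - 1/2))
      + (2 * ((\<nu> + 3/2) * x powr (\<nu> + 3/2 - 1)) * bessel_F' \<nu> (x\<^sup>2)
        + (bessel_F'' \<nu> (x\<^sup>2) * (2 * x)) * (2 * x powr (\<nu> + 3/2)))) (at x)"
    unfolding bessel_u'_def[abs_def] using assms
    by (intro DERIV_mult DERIV_add DERIV_cmult has_real_derivative_powr) (auto intro!: derivative_eq_intros)
  moreover have "\<nu> - 1/2 - 1 = \<nu> - 3/2" "\<nu> + 3/2 - 1 = \<nu> + 1/2" by auto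
  moreover have "4 * (x\<^sup>2 * bessel_F'' \<nu> (x\<^sup>2)) + 4 * (\<nu> + 1) * bessel_F' \<nu> (x\<^sup>2) + bessel_F \<nu> (x\<^sup>2) = 0"
    using bessel_ode[OF assms(1), of "x\<^sup>2"] by argo
  then have "((\<nu> + 1/2) * ((\<nu> - 1/2) * ?p)) * bessel_F \<nu> (x\<^sup>2)
      + (bessel_F' \<nu> (x\<^sup>2) * (2 * x)) * ((\<nu> + 1/2) * (x * ?p))
      + (2 * ((\<nu> + 3/2) * (x\<^sup>2 * ?p)) * bessel_F' \<nu> (x\<^sup>2)
        + (bessel_F'' \<nu> (x\<^sup>2) * (2 * x)) * (2 * (x ^ 3 * ?p)))
      = - (x\<^sup>2 - (\<nu>\<^sup>2 - 1/4)) * (?p * bessel_F \<nu> (x\<^sup>2))"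
    by algebra
  moreover have "- (1 - (\<nu>\<^sup>2 - 1/4) / x\<^sup>2) * bessel_u \<nu> x = - (x\<^sup>2 - (\<nu>\<^sup>2 - 1/4)) * (?p * bessel_F \<nu> (x\<^sup>2))"
    unfolding bessel_u_def pw using assms by (simp add: field_simps)
  ultimately show ?thesis
    unfolding pw(1,2,3) by (metis pw)
qed

lemma bessel_u_eq_0_iff: "x > 0 \<Longrightarrow> bessel_u \<nu> x = 0 \<longleftrightarrow> bessel_F \<nu> (x\<^sup>2) = 0"
  by (simp add: bessel_u_def)

lemma bessel_J_eq_0_iff:
  assumes "\<nu> \<ge> 0" "x > 0"
  shows "bessel_J \<nu> x = 0 \<longleftrightarrow> bessel_F \<nu> (x\<^sup>2) = 0"
proof -
  have "0 < Gamma (\<nu> + 1)" using assms by (intro Gamma_real_pos) auto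
  then have "Gamma (\<nu> + 1) \<noteq> 0" by linarith
  then show ?thesis using assms by (simp add: bessel_J_eq_F)
qed

lemma continuous_on_bessel_u: "\<nu> \<ge> 0 \<Longrightarrow> S \<subseteq> {0<..} \<Longrightarrow> continuous_on S (bessel_u \<nu>)"
  by (rule DERIV_at_continuous_on[where D = "bessel_u' \<nu>"])
     (auto intro!: DERIV_bessel_u)

text \<open>Sturm comparison with \<open>sin (w (x - a))\<close>.\<close>

lemma bessel_zero_in_interval:
  assumes nu: "\<nu> \<ge> 0" and a: "a > 0" and w: "w > 0" and q: "1 - (\<nu>\<^sup>2 - 1/4) / a\<^sup>2 \<ge> w\<^sup>2" "w \<le> 1"
  shows "\<exists>x. a < x \<and> x \<le> a + pi / w \<and> bessel_F \<nu> (x\<^sup>2) = 0"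
proof (rule ccontr)
  define b where "b = a + pi / w"
  assume "\<not> ?thesis"
  then have nz: "bessel_u \<nu> x \<noteq> 0" if "a < x" "x \<le> b" for x
    using that a by (auto simp: b_def bessel_u_eq_0_iff)
  have ab: "a < b" using w by (simp add: b_def)
  have cont: "continuous_on {a..b} (bessel_u \<nu>)"
    using nu a by (intro continuous_on_bessel_u) auto
  define c where "c = sgn (bessel_u \<nu> b)"
  have c: "c = 1 \<or> c = -1" using nz[of b] ab by (auto simp: c_def sgn_if)
  have pos: "c * bessel_u \<nu> x > 0" if x: "a < x" "x \<le> b" for x
  proof (rule ccontr)
    assume "\<not> ?thesis"
    then have "c * bessel_u \<nu> x \<le> 0" "0 \<le> c * bessel_u \<nu> b" by (auto simp: c_def sgn_if)
    moreover have "continuous_on {x..b} (\<lambda>x. c * bessel_u \<nu> x)"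
      using x by (intro continuous_intros continuous_on_subset[OF cont]) auto
    ultimately obtain y where "x \<le> y" "y \<le> b" "c * bessel_u \<nu> y = 0"
      using IVT'[of "\<lambda>x. c * bessel_u \<nu> x" x 0 b] x by auto
    then show False using nz[of y] x c by auto
  qed
  have "c * bessel_u \<nu> a \<ge> 0"
  proof (rule tendsto_lowerbound)
    show "((\<lambda>x. c * bessel_u \<nu> x) \<longlongrightarrow> c * bessel_u \<nu> a) (at_right a)"
      using cont ab by (intro tendsto_intros continuous_on_Icc_at_rightD)
    show "eventually (\<lambda>x. 0 \<le> c * bessel_u \<nu> x) (at_right a)"
      using pos ab by (auto simp: eventually_at_right_field intro!: exI[of _ b] less_imp_le)
  qed auto
  \<comment> \<open>The Wronskian of u and the sine, signed by \<open>c\<close>. The sine vanishes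
    at \<open>a\<close> and \<open>b\<close>, so \<open>?W b\<close> > 0 >= \<open>?W a\<close>,
    while the comparison of the potentials makes \<open>?W\<close> nonincreasing.\<close>
  let ?W = "\<lambda>x. c * (bessel_u' \<nu> x * sin (w * (x - a)) - bessel_u \<nu> x * (w * cos (w * (x - a))))"
  have W': "(?W has_real_derivative c * bessel_u \<nu> x * (w\<^sup>2 - (1 - (\<nu>\<^sup>2 - 1/4) / x\<^sup>2)) * sin (w * (x - a))) (at x)"
    if "x > 0" for x
    by (rule derivative_eq_intros DERIV_bessel_u[THEN DERIV_chain2] DERIV_bessel_u'[THEN DERIV_chain2] refl nu that)+
       (simp add: algebra_simps power2_eq_square)
  have "?W b \<le> ?W a"
  proof (rule DERIV_nonpos_imp_nonincreasing[where f = ?W])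
    fix x assume x: "a \<le> x" "x \<le> b"
    have "0 \<le> w * (x - a)" "w * (x - a) \<le> pi"
      using x w by (auto simp: b_def field_simps)
    then have "sin (w * (x - a)) \<ge> 0" by (rule sin_ge_zero)
    moreover have "c * bessel_u \<nu> x \<ge> 0"
      using x pos[of x] \<open>c * bessel_u \<nu> a \<ge> 0\<close> by (cases "x = a") auto
    moreover have "w\<^sup>2 - (1 - (\<nu>\<^sup>2 - 1/4) / x\<^sup>2) \<le> 0"
    proof (cases "\<nu>\<^sup>2 \<ge> 1/4")
      case True
      then have "(\<nu>\<^sup>2 - 1/4) / x\<^sup>2 \<le> (\<nu>\<^sup>2 - 1/4) / a\<^sup>2"
        using x a by (intro divide_left_mono power_mono) auto
      then show ?thesis using q by auto
    next
      \<comment> \<open>For nu < 1/2 the potential decreases in x but stays above 1; this is where w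
        <= 1 enters.\<close>
      case False
      then have "(\<nu>\<^sup>2 - 1/4) / x\<^sup>2 \<le> 0" by (auto simp: divide_le_0_iff)
      moreover have "w\<^sup>2 \<le> 1" using w q by (simp add: power_le_one)
      ultimately show ?thesis by auto
    qed
    ultimately show "\<exists>y. (?W has_real_derivative y) (at x) \<and> y \<le> 0"
      using x a
      by (intro exI[of _ "c * bessel_u \<nu> x * (w\<^sup>2 - (1 - (\<nu>\<^sup>2 - 1/4) / x\<^sup>2)) * sin (w * (x - a))"]
            conjI W' mult_nonpos_nonneg[OF mult_nonneg_nonpos]) auto
  qed (use ab in auto)
  moreover have "?W b = w * (c * bessel_u \<nu> b)" "?W a = - w * (c * bessel_u \<nu> a)"
    using w by (simp_all add: b_def)
  moreover have "w * (c * bessel_u \<nu> b) > 0" "w * (c * bessel_u \<nu> a) \<ge> 0"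
    using w pos[of b] ab \<open>c * bessel_u \<nu> a \<ge> 0\<close> by auto
  ultimately show False by linarith
qed

section \<open>Existence and enumeration of the positive zeros\<close>

lemma ex_bessel_F_zero_gt:
  assumes "\<nu> \<ge> 0"
  shows "\<exists>x>p. bessel_F \<nu> (x\<^sup>2) = 0"
proof -
  \<comment> \<open>From 2 nu on the potential is at least 3/4, so w = 1/2 is admissible in the
    comparison.\<close>
  define a where "a = 2 * \<nu> + \<bar>p\<bar> + 1"
  have a: "a > 0" "a > p" "2 * \<nu> \<le> a" using assms by (auto simp: a_def)
  have "4 * \<nu>\<^sup>2 \<le> a\<^sup>2" using power_mono[OF a(3), of 2] assms by (simp add: power_mult_distrib)
  then have "(\<nu>\<^sup>2 - 1/4) / a\<^sup>2 \<le> 1/4" using a by (simp add: divide_simps)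
  then have "1 - (\<nu>\<^sup>2 - 1/4) / a\<^sup>2 \<ge> (1/2)\<^sup>2" by (simp add: power2_eq_square)
  from bessel_zero_in_interval[OF assms a(1) _ this] obtain x where "a < x" "bessel_F \<nu> (x\<^sup>2) = 0" by auto
  then show ?thesis using a by (intro exI[of _ x]) auto
qed

text \<open>A \<open>LEAST\<close> over the reals is informative only if a minimum exists. The zeros
  of F(x^2) form a closed set and do not accumulate at p from the right, since F(0) = 1 and all
  positive zeros are simple; so the zeros beyond p form a closed set, which contains its
  infimum.\<close>

lemma bessel_LEAST:
  assumes nu: "\<nu> \<ge> 0" and p: "p = 0 \<or> p > 0 \<and> bessel_F \<nu> (p\<^sup>2) = 0"
  defines "m \<equiv> (LEAST x. p < x \<and> bessel_J \<nu> x = 0)"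
  shows "p < m" "bessel_F \<nu> (m\<^sup>2) = 0" "\<And>x. p < x \<Longrightarrow> bessel_F \<nu> (x\<^sup>2) = 0 \<Longrightarrow> m \<le> x"
proof -
  let ?S = "{x. p < x \<and> bessel_F \<nu> (x\<^sup>2) = 0}"
  have p0: "p \<ge> 0" using p by auto
  have J: "p < x \<and> bessel_J \<nu> x = 0 \<longleftrightarrow> p < x \<and> bessel_F \<nu> (x\<^sup>2) = 0" for x
    using bessel_J_eq_0_iff[OF nu, of x] p0 by auto
  have ne: "?S \<noteq> {}" using ex_bessel_F_zero_gt[OF nu, of p] by auto
  have bdd: "bdd_below ?S" by (rule bdd_belowI[of _ p]) auto
  let ?c = "\<lambda>x. bessel_F \<nu> (x\<^sup>2)"
  have d: "(?c has_real_derivative bessel_F' \<nu> (x\<^sup>2) * (2 * x)) (at x)" for x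
    using nu by (auto intro!: derivative_eq_intros)
  have ex: "\<exists>d>0. \<forall>x. p < x \<longrightarrow> x < p + d \<longrightarrow> ?c x \<noteq> 0"
  proof (cases "?c p = 0")
    case True
    then have pp: "p > 0" using p by (auto simp: bessel_F_0)
    then have "bessel_F' \<nu> (p\<^sup>2) * (2 * p) \<noteq> 0"
      using bessel_F_zero_simple[OF nu, of "p\<^sup>2"] True by auto
    then consider "bessel_F' \<nu> (p\<^sup>2) * (2 * p) > 0" | "bessel_F' \<nu> (p\<^sup>2) * (2 * p) < 0" by linarith
    then show ?thesis
    proof cases
      case 1
      from DERIV_pos_inc_right[OF d this] obtain e where "e > 0" "\<And>h. 0 < h \<Longrightarrow> h < e \<Longrightarrow> ?c p < ?c (p + h)" by auto
      from this(2)[of "x - p" for x] \<open>e > 0\<close> True show ?thesis by (intro exI[of _ e]) force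
    next
      case 2
      from DERIV_neg_dec_right[OF d this] obtain e where "e > 0" "\<And>h. 0 < h \<Longrightarrow> h < e \<Longrightarrow> ?c p > ?c (p + h)" by auto
      from this(2)[of "x - p" for x] \<open>e > 0\<close> True show ?thesis by (intro exI[of _ e]) force
    qed
  next
    case False
    have "isCont ?c p" using d by (rule DERIV_isCont)
    then have "eventually (\<lambda>x. ?c x \<noteq> 0) (at p)"
      using False by (intro tendsto_imp_eventually_ne) (auto simp: isCont_def)
    then obtain d where "d > 0" "\<And>x. x \<noteq> p \<Longrightarrow> dist x p < d \<Longrightarrow> ?c x \<noteq> 0"
      unfolding eventually_at by auto
    then show ?thesis by (intro exI[of _ d]) (auto simp: dist_real_def)
  qed
  then obtain e where e: "e > 0" "\<And>x. p < x \<Longrightarrow> x < p + e \<Longrightarrow> ?c x \<noteq> 0" by auto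
  have S: "?S = {p + e..} \<inter> {x. ?c x = 0}" using e by force
  have cl: "closed {x. ?c x = 0}"
    using d by (intro closed_Collect_eq continuous_intros DERIV_at_continuous_on) auto
  have "closed ?S" unfolding S using cl by (intro closed_Int) auto
  from closed_contains_Inf[OF ne bdd this] have I: "Inf ?S \<in> ?S" .
  have lower: "Inf ?S \<le> x" if "x \<in> ?S" for x using that bdd by (rule cInf_lower)
  have m: "m = Inf ?S" unfolding m_def J
  proof (rule Least_equality)
    show "p < Inf ?S \<and> bessel_F \<nu> ((Inf ?S)\<^sup>2) = 0" using I unfolding mem_Collect_eq .
  qed (rule lower, simp)
  show "p < m" "bessel_F \<nu> (m\<^sup>2) = 0" unfolding m using I unfolding mem_Collect_eq by blast+
  show "m \<le> x" if "p < x" "bessel_F \<nu> (x\<^sup>2) = 0" for x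
    unfolding m by (rule lower) (simp add: that)
qed

lemma bessel_zero_aux:
  assumes "\<nu> \<ge> 0"
  shows "bessel_zero \<nu> k = 0 \<or> bessel_zero \<nu> k > 0 \<and> bessel_F \<nu> ((bessel_zero \<nu> k)\<^sup>2) = 0"
proof (induction k)
  case (Suc k)
  have "0 \<le> bessel_zero \<nu> k" using Suc by auto
  with bessel_LEAST(1,2)[OF assms Suc] show ?case
    unfolding bessel_zero.simps by (meson le_less_trans)
qed simp

lemma bessel_zero_less_Suc: "\<nu> \<ge> 0 \<Longrightarrow> bessel_zero \<nu> k < bessel_zero \<nu> (Suc k)"
  unfolding bessel_zero.simps by (rule bessel_LEAST(1)[OF _ bessel_zero_aux])

lemma bessel_zero_Suc_le:
  "\<nu> \<ge> 0 \<Longrightarrow> bessel_zero \<nu> k < x \<Longrightarrow> bessel_F \<nu> (x\<^sup>2) = 0 \<Longrightarrow> bessel_zero \<nu> (Suc k) \<le> x"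
  unfolding bessel_zero.simps by (rule bessel_LEAST(3)[OF _ bessel_zero_aux])

lemma strict_mono_bessel_zero: "\<nu> \<ge> 0 \<Longrightarrow> strict_mono (bessel_zero \<nu>)"
  by (rule strict_mono_Suc_iff[THEN iffD2]) (simp add: bessel_zero_less_Suc del: bessel_zero.simps)

lemma bessel_zero_pos: "\<nu> \<ge> 0 \<Longrightarrow> k > 0 \<Longrightarrow> bessel_zero \<nu> k > 0"
  using strict_monoD[OF strict_mono_bessel_zero, of \<nu> 0 k] by simp

lemma bessel_F_bessel_zero: "\<nu> \<ge> 0 \<Longrightarrow> k > 0 \<Longrightarrow> bessel_F \<nu> ((bessel_zero \<nu> k)\<^sup>2) = 0"
  using bessel_zero_aux[of \<nu> k] bessel_zero_pos[of \<nu> k] by auto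

lemma DERIV_bessel_F_square:
  assumes "\<nu> \<ge> 0"
  shows "((\<lambda>x. bessel_F \<nu> (x\<^sup>2)) has_real_derivative bessel_F' \<nu> (x\<^sup>2) * (2 * x)) (at x)"
    "((\<lambda>x. bessel_F' \<nu> (x\<^sup>2)) has_real_derivative bessel_F'' \<nu> (x\<^sup>2) * (2 * x)) (at x)"
  using assms by (auto intro!: derivative_eq_intros)

lemma bessel_F_pos_below_first_zero:
  assumes "\<nu> \<ge> 0" "0 \<le> x" "x < bessel_zero \<nu> 1"
  shows "bessel_F \<nu> (x\<^sup>2) > 0"
proof (rule ccontr)
  assume "\<not> ?thesis"
  moreover have "continuous_on {0..x} (\<lambda>x. bessel_F \<nu> (x\<^sup>2))"
    by (rule DERIV_at_continuous_on) (rule DERIV_bessel_F_square(1)[OF assms(1)])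
  ultimately obtain y where y: "0 \<le> y" "y \<le> x" "bessel_F \<nu> (y\<^sup>2) = 0"
    using IVT2'[of "\<lambda>x. bessel_F \<nu> (x\<^sup>2)" x 0 0] assms by (auto simp: bessel_F_0)
  then have "y \<noteq> 0" by (auto simp: bessel_F_0)
  then have "bessel_zero \<nu> (Suc 0) \<le> y" using y assms by (intro bessel_zero_Suc_le) auto
  then show False using y assms by simp
qed

text \<open>On \<open>(0,\<nu>)\<close> the function \<open>w = x\<^sup>\<nu> F(x\<^sup>2)\<close> is increasing, because \<open>x (x w')' = (\<nu>\<^sup>2 - x\<^sup>2) w\<close>.\<close>

lemma first_bessel_zero_gt:
  assumes nu: "\<nu> > 0"
  shows "\<nu> < bessel_zero \<nu> 1"
proof (rule ccontr)
  define j where "j = bessel_zero \<nu> 1"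
  assume "\<not> ?thesis"
  then have j: "j \<le> \<nu>" "j > 0" using bessel_zero_pos[of \<nu> 1] nu by (auto simp: j_def)
  let ?F = "\<lambda>x. bessel_F \<nu> (x\<^sup>2)" and ?F' = "\<lambda>x. bessel_F' \<nu> (x\<^sup>2)"
  \<comment> \<open>\<open>?w1\<close> is x w'.\<close>
  let ?w1 = "\<lambda>x. x powr \<nu> * (\<nu> * ?F x + 2 * x\<^sup>2 * ?F' x)"
  have Fpos: "?F x > 0" if "0 \<le> x" "x < j" for x
    using that nu bessel_F_pos_below_first_zero[of \<nu> x] by (auto simp: j_def)
  have w1': "(?w1 has_real_derivative x powr (\<nu> - 1) * (\<nu>\<^sup>2 - x\<^sup>2) * ?F x) (at x)" if "x > 0" for x
  proof -
    have f1: "(?w1 has_real_derivative (\<nu> * x powr (\<nu> - 1)) * (\<nu> * ?F x + 2 * x\<^sup>2 * ?F' x)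
      + (\<nu> * (?F' x * (2 * x)) + (2 * (2 * x) * ?F' x + (bessel_F'' \<nu> (x\<^sup>2) * (2 * x)) * (2 * x\<^sup>2))) * x powr \<nu>) (at x)"
      using that nu by (intro DERIV_mult has_real_derivative_powr) (auto intro!: derivative_eq_intros simp: algebra_simps)
    have f2: "x powr \<nu> = x powr (\<nu> - 1) * x"
      using that by (simp add: powr_diff)
    have f3: "4 * (x\<^sup>2 * bessel_F'' \<nu> (x\<^sup>2)) + 4 * (\<nu> + 1) * bessel_F' \<nu> (x\<^sup>2) + bessel_F \<nu> (x\<^sup>2) = 0"
      using bessel_ode[OF less_imp_le[OF nu], of "x\<^sup>2"] by argo
    have f4: "(\<nu> * x powr (\<nu> - 1)) * (\<nu> * ?F x + 2 * x\<^sup>2 * ?F' x)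
      + (\<nu> * (?F' x * (2 * x)) + (2 * (2 * x) * ?F' x + (bessel_F'' \<nu> (x\<^sup>2) * (2 * x)) * (2 * x\<^sup>2))) * (x powr (\<nu> - 1) * x)
      = x powr (\<nu> - 1) * (\<nu>\<^sup>2 - x\<^sup>2) * ?F x
        + x powr (\<nu> - 1) * x\<^sup>2 * (4 * (x\<^sup>2 * bessel_F'' \<nu> (x\<^sup>2)) + 4 * (\<nu> + 1) * bessel_F' \<nu> (x\<^sup>2) + bessel_F \<nu> (x\<^sup>2))"
      by (simp add: algebra_simps power2_eq_square)
    show ?thesis
      by (rule DERIV_cong[OF f1]) (unfold f2 f4 f3, simp)
  qed
  have w': "((\<lambda>x. x powr \<nu> * ?F x) has_real_derivative ?w1 x / x) (at x)" if "x > 0" for x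
  proof -
    have "((\<lambda>x. x powr \<nu> * ?F x) has_real_derivative (\<nu> * x powr (\<nu> - 1)) * ?F x + (?F' x * (2 * x)) * x powr \<nu>) (at x)"
      using that nu by (intro DERIV_mult has_real_derivative_powr) (auto intro!: derivative_eq_intros)
    moreover have "(\<nu> * x powr (\<nu> - 1)) * ?F x + (?F' x * (2 * x)) * x powr \<nu> = ?w1 x / x"
      using that by (simp add: powr_diff divide_simps) (simp add: algebra_simps power2_eq_square)
    ultimately show ?thesis by simp
  qed
  have w1_mono: "?w1 x \<le> ?w1 y" if xy: "0 < x" "x \<le> y" "y < j" for x y
  proof (rule DERIV_nonneg_imp_nondecreasing[where f = ?w1])
    fix t assume "x \<le> t" "t \<le> y"
    then have "t > 0" "t < j" "t\<^sup>2 \<le> \<nu>\<^sup>2" using xy j by (auto intro!: power_mono)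
    then show "\<exists>d. (?w1 has_real_derivative d) (at t) \<and> 0 \<le> d"
      using Fpos[of t] by (intro exI[of _ "t powr (\<nu> - 1) * (\<nu>\<^sup>2 - t\<^sup>2) * ?F t"] conjI w1') auto
  qed (use xy in auto)
  \<comment> \<open>At 0 the bracket tends to nu > 0. As \<open>?w1\<close> is nondecreasing up to
    j, its sign near 0 propagates to all of (0,j), and w cannot return to 0 at j.\<close>
  have "((\<lambda>x. \<nu> * ?F x + 2 * x\<^sup>2 * ?F' x) \<longlongrightarrow> \<nu> * ?F 0 + 2 * 0\<^sup>2 * ?F' 0) (at 0)"
    using nu DERIV_bessel_F_square[of \<nu> 0, THEN DERIV_isCont]
    by (intro tendsto_intros) (auto simp: isCont_def)
  then have "eventually (\<lambda>x. \<nu> * ?F x + 2 * x\<^sup>2 * ?F' x > 0) (at 0)"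
    using nu by (intro order_tendstoD(1)) (auto simp: bessel_F_0)
  then obtain e where e: "e > 0" "\<And>x. x \<noteq> 0 \<Longrightarrow> \<bar>x\<bar> < e \<Longrightarrow> \<nu> * ?F x + 2 * x\<^sup>2 * ?F' x > 0"
    unfolding eventually_at by (auto simp: dist_real_def)
  have w1_pos: "?w1 x \<ge> 0" if "0 < x" "x < j" for x
  proof -
    define y where "y = min x (e / 2)"
    have y: "0 < y" "y \<le> x" "y < e" using that e by (auto simp: y_def)
    then have "0 \<le> ?w1 y" using e(2)[of y] by (intro mult_nonneg_nonneg) auto
    also have "\<dots> \<le> ?w1 x" using y that by (intro w1_mono) auto
    finally show ?thesis .
  qed
  have "j / 2 < j" using j by simp
  have "(j/2) powr \<nu> * ?F (j/2) \<le> j powr \<nu> * ?F j"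
  proof (rule DERIV_nonneg_imp_increasing_open[of "j/2" j "\<lambda>x. x powr \<nu> * ?F x"])
    show "j / 2 \<le> j" using j by simp
    show "\<exists>d. ((\<lambda>x. x powr \<nu> * ?F x) has_real_derivative d) (at x) \<and> 0 \<le> d" if "j/2 < x" "x < j" for x
      using that j w1_pos[of x] by (intro exI[of _ "?w1 x / x"] conjI w') auto
    show "continuous_on {j/2..j} (\<lambda>x. x powr \<nu> * ?F x)"
      using j by (intro DERIV_at_continuous_on[where D = "\<lambda>x. ?w1 x / x"] w') auto
  qed
  moreover have "?F j = 0" using nu bessel_F_bessel_zero[of \<nu> 1] by (simp add: j_def)
  moreover have "(j/2) powr \<nu> * ?F (j/2) > 0" using j Fpos[of "j/2"] by simp
  ultimately show False by simp
qed

subsection \<open>Amplitude and spacing\<close>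

lemma bessel_u_energy_deriv:
  assumes "\<nu> \<ge> 0" "x > 0"
  shows "((\<lambda>x. (bessel_u' \<nu> x)\<^sup>2 + (bessel_u \<nu> x)\<^sup>2) has_real_derivative
     2 * bessel_u' \<nu> x * bessel_u \<nu> x * ((\<nu>\<^sup>2 - 1/4) / x\<^sup>2)) (at x)"
  by (rule derivative_eq_intros DERIV_bessel_u[THEN DERIV_chain2] DERIV_bessel_u'[THEN DERIV_chain2] refl assms)+
     (simp add: algebra_simps)

text \<open>The logarithmic derivative of u'^2 + u^2 is at most m / x^2 in absolute value, which is
  integrable at infinity. So the energy at all later zeros is comparable to its value at the first
  one.\<close>

lemma bessel_u_energy_mono:
  assumes nu: "\<nu> \<ge> 0" and x: "0 < x" "x \<le> y"
  defines "m \<equiv> \<bar>\<nu>\<^sup>2 - 1/4\<bar>" and "En \<equiv> (\<lambda>x. (bessel_u' \<nu> x)\<^sup>2 + (bessel_u \<nu> x)\<^sup>2)"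
  shows "En x * exp (- m / x) \<le> En y * exp (- m / y)" "En y * exp (m / y) \<le> En x * exp (m / x)"
proof -
  have d: "\<bar>2 * bessel_u' \<nu> t * bessel_u \<nu> t * ((\<nu>\<^sup>2 - 1/4) / t\<^sup>2)\<bar> \<le> En t * (m / t\<^sup>2)" if "t > 0" for t
  proof -
    have "\<bar>2 * bessel_u' \<nu> t * bessel_u \<nu> t\<bar> \<le> En t"
      using sum_squares_bound[of "\<bar>bessel_u' \<nu> t\<bar>" "\<bar>bessel_u \<nu> t\<bar>"]
      by (simp add: En_def abs_mult)
    then have "\<bar>2 * bessel_u' \<nu> t * bessel_u \<nu> t\<bar> * (m / t\<^sup>2) \<le> En t * (m / t\<^sup>2)"
      by (intro mult_right_mono) (auto simp: m_def)
    then show ?thesis by (simp add: abs_mult m_def)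
  qed
  have D1: "((\<lambda>t. En t * exp (- m / t)) has_real_derivative
      (2 * bessel_u' \<nu> t * bessel_u \<nu> t * ((\<nu>\<^sup>2 - 1/4) / t\<^sup>2) + En t * (m / t\<^sup>2)) * exp (- m / t)) (at t)"
    if "t > 0" for t
  proof -
    have "((\<lambda>t. exp (- m / t)) has_real_derivative ( m / t\<^sup>2) * exp (- m / t)) (at t)"
      using that by (auto intro!: derivative_eq_intros simp: power2_eq_square)
    from DERIV_mult[OF bessel_u_energy_deriv[OF nu that] this]
    show ?thesis unfolding En_def by (simp add: algebra_simps)
  qed
  have D2: "((\<lambda>t. En t * exp (m / t)) has_real_derivative
      (2 * bessel_u' \<nu> t * bessel_u \<nu> t * ((\<nu>\<^sup>2 - 1/4) / t\<^sup>2) - En t * (m / t\<^sup>2)) * exp (m / t)) (at t)"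
    if "t > 0" for t
  proof -
    have "((\<lambda>t. exp (m / t)) has_real_derivative (- m / t\<^sup>2) * exp (m / t)) (at t)"
      using that by (auto intro!: derivative_eq_intros simp: power2_eq_square)
    from DERIV_mult[OF bessel_u_energy_deriv[OF nu that] this]
    show ?thesis unfolding En_def by (simp add: algebra_simps)
  qed
  show "En x * exp (- m / x) \<le> En y * exp (- m / y)"
  proof (rule DERIV_nonneg_imp_nondecreasing[where f = "\<lambda>t. En t * exp (- m / t)"])
    fix t assume "x \<le> t" "t \<le> y"
    then have "t > 0" using x by auto
    with d[OF this] show "\<exists>d. ((\<lambda>t. En t * exp (- m / t)) has_real_derivative d) (at t) \<and> 0 \<le> d"
      by (intro exI[of _ "(2 * bessel_u' \<nu> t * bessel_u \<nu> t * ((\<nu>\<^sup>2 - 1/4) / t\<^sup>2) + En t * (m / t\<^sup>2)) * exp (- m / t)"]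
            conjI D1 mult_nonneg_nonneg \<open>t > 0\<close>) (linarith, simp)
  qed (use x in auto)
  show "En y * exp (m / y) \<le> En x * exp (m / x)"
  proof (rule DERIV_nonpos_imp_nonincreasing[where f = "\<lambda>t. En t * exp (m / t)"])
    fix t assume "x \<le> t" "t \<le> y"
    then have "t > 0" using x by auto
    with d[OF this] show "\<exists>d. ((\<lambda>t. En t * exp (m / t)) has_real_derivative d) (at t) \<and> d \<le> 0"
      by (intro exI[of _ "(2 * bessel_u' \<nu> t * bessel_u \<nu> t * ((\<nu>\<^sup>2 - 1/4) / t\<^sup>2) - En t * (m / t\<^sup>2)) * exp (m / t)"]
            conjI D2 mult_nonpos_nonneg \<open>t > 0\<close>) (linarith, simp)
  qed (use x in auto)
qed

lemma bessel_u'_at_zero: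
  assumes "\<nu> \<ge> 0" "k > 0"
  defines "j \<equiv> bessel_zero \<nu> k"
  shows "bessel_u' \<nu> j = 2 * j powr (\<nu> + 3/2) * bessel_F' \<nu> (j\<^sup>2)" "bessel_u \<nu> j = 0" "bessel_u' \<nu> j \<noteq> 0"
proof -
  have j: "j > 0" "bessel_F \<nu> (j\<^sup>2) = 0"
    using bessel_zero_pos bessel_F_bessel_zero assms by auto
  then show 1: "bessel_u' \<nu> j = 2 * j powr (\<nu> + 3/2) * bessel_F' \<nu> (j\<^sup>2)" "bessel_u \<nu> j = 0"
    by (simp_all add: bessel_u'_def bessel_u_def)
  have "bessel_F' \<nu> (j\<^sup>2) \<noteq> 0" using j assms(1) by (intro bessel_F_zero_simple) auto
  then show "bessel_u' \<nu> j \<noteq> 0" unfolding 1 using j by simp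
qed

text \<open>At a zero u' = 2 x^(nu + 3/2) F', so the lower energy bound keeps sqrt x |J_nu'(x)| away
  from 0 at the zeros. This will control the growth of \<open>bk\<close>.\<close>

lemma bessel_F'_lower:
  assumes nu: "\<nu> \<ge> 0"
  shows "\<exists>c>0. \<forall>k>0. (bessel_zero \<nu> k) powr (2 * \<nu> + 3) * (bessel_F' \<nu> ((bessel_zero \<nu> k)\<^sup>2))\<^sup>2 \<ge> c"
proof -
  define j where "j = bessel_zero \<nu> 1"
  define m where "m = \<bar>\<nu>\<^sup>2 - 1/4\<bar>"
  have j: "j > 0" using bessel_zero_pos[of \<nu> 1] nu by (simp add: j_def)
  define c where "c = (bessel_u' \<nu> j)\<^sup>2 * exp (- m / j)"
  have "c > 0" using bessel_u'_at_zero(3)[OF nu, of 1] by (auto simp: c_def j_def)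
  have "(bessel_zero \<nu> k) powr (2 * \<nu> + 3) * (bessel_F' \<nu> ((bessel_zero \<nu> k)\<^sup>2))\<^sup>2 \<ge> c / 4" if "k > 0" for k
  proof -
    define x where "x = bessel_zero \<nu> k"
    have x: "j \<le> x" using strict_mono_less_eq[OF strict_mono_bessel_zero[OF nu], of 1 k] that by (simp add: x_def j_def)
    have "c \<le> (bessel_u' \<nu> x)\<^sup>2 * exp (- m / x)"
      using bessel_u_energy_mono(1)[OF nu j x] bessel_u'_at_zero(2)[OF nu, of 1] bessel_u'_at_zero(2)[OF nu that]
      by (simp add: c_def m_def j_def x_def)
    also have "\<dots> \<le> (bessel_u' \<nu> x)\<^sup>2 * 1"
      using x j by (intro mult_left_mono) (auto simp: m_def)
    also have "\<dots> = 4 * (x powr (2 * \<nu> + 3) * (bessel_F' \<nu> (x\<^sup>2))\<^sup>2)"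
    proof -
      have "(x powr (\<nu> + 3/2))\<^sup>2 = x powr (2 * \<nu> + 3)"
        using x j by (simp add: power2_eq_square flip: powr_add)
      then show ?thesis
        unfolding bessel_u'_at_zero(1)[OF nu that, folded x_def] by (simp add: power_mult_distrib)
    qed
    finally show ?thesis by (simp add: x_def)
  qed
  then show ?thesis using \<open>c > 0\<close> by (intro exI[of _ "c / 4"]) auto
qed

text \<open>Consecutive zeros keep a distance \<open>d\<close>: from a zero to the next critical
  point |u'| falls from at least sqrt e1 to 0, while |u''| <= Q sqrt e2 in between.\<close>

lemma bessel_zero_linear_growth:
  assumes nu: "\<nu> \<ge> 0"
  shows "\<exists>c>0. \<forall>k. bessel_zero \<nu> k \<ge> c * real k"
proof -
  define j where "j = bessel_zero \<nu> 1"
  define m where "m = \<bar>\<nu>\<^sup>2 - 1/4\<bar>"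
  have j: "j > 0" using bessel_zero_pos[of \<nu> 1] nu by (simp add: j_def)
  define e1 where "e1 = (bessel_u' \<nu> j)\<^sup>2 * exp (- m / j)"
  define e2 where "e2 = (bessel_u' \<nu> j)\<^sup>2 * exp (m / j)"
  define Q where "Q = 1 + m / j\<^sup>2"
  have e: "e1 > 0" "e2 > 0" using bessel_u'_at_zero(3)[OF nu, of 1] by (auto simp: e1_def e2_def j_def)
  have Q: "Q > 0" using j by (auto simp: Q_def m_def intro!: add_pos_nonneg)
  define d where "d = sqrt e1 / (Q * sqrt e2)"
  have d: "d > 0" using e Q by (simp add: d_def)
  have gap: "bessel_zero \<nu> k + d \<le> bessel_zero \<nu> (Suc k)" if k: "k > 0" for k
  proof -
    define a where "a = bessel_zero \<nu> k"
    define b where "b = bessel_zero \<nu> (Suc k)"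
    have ab: "j \<le> a" "a < b" using strict_mono_less_eq[OF strict_mono_bessel_zero[OF nu], of 1 k] k
        bessel_zero_less_Suc[OF nu, of k] by (simp_all add: a_def b_def j_def del: bessel_zero.simps)
    have u0: "bessel_u \<nu> a = 0" "bessel_u \<nu> b = 0" "bessel_u \<nu> j = 0"
      using bessel_u'_at_zero(2)[OF nu, of k] bessel_u'_at_zero(2)[OF nu, of "Suc k"] bessel_u'_at_zero(2)[OF nu, of 1] k
      by (auto simp: a_def b_def j_def simp del: bessel_zero.simps)
    obtain y where y: "a < y" "y < b" "(bessel_u' \<nu> y) = 0"
    proof -
      have "\<exists>z. a < z \<and> z < b \<and> ((*) (bessel_u' \<nu> z)) = (\<lambda>_. 0)"
        using ab u0 j nu
        by (intro Rolle_deriv[where f = "bessel_u \<nu>" and f' = "\<lambda>z. (*) (bessel_u' \<nu> z)"] continuous_on_bessel_u)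
           (auto intro!: DERIV_bessel_u[unfolded has_field_derivative_def])
      then obtain z where z: "a < z" "z < b" "(*) (bessel_u' \<nu> z) = (\<lambda>_. 0)" by blast
      from fun_cong[OF z(3), of 1] have "bessel_u' \<nu> z = 0" by simp
      with z show ?thesis using that by blast
    qed
    obtain t where t: "a < t" "t < y" "bessel_u' \<nu> y - bessel_u' \<nu> a = (y - a) * (- (1 - (\<nu>\<^sup>2 - 1/4) / t\<^sup>2) * bessel_u \<nu> t)"
      using MVT2[OF y(1), of "bessel_u' \<nu>" "\<lambda>t. - (1 - (\<nu>\<^sup>2 - 1/4) / t\<^sup>2) * bessel_u \<nu> t"] DERIV_bessel_u'[OF nu] j ab
      by (smt (verit, best))
    have tj: "t \<ge> j" using t ab by simp
    have "e1 \<le> (bessel_u' \<nu> a)\<^sup>2 * exp (- m / a)"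
      using bessel_u_energy_mono(1)[OF nu j ab(1)] u0 by (simp add: e1_def m_def)
    also have "\<dots> \<le> (bessel_u' \<nu> a)\<^sup>2 * 1"
      using ab j by (intro mult_left_mono) (auto simp: m_def)
    finally have "sqrt e1 \<le> \<bar>bessel_u' \<nu> a\<bar>" using real_sqrt_le_mono by fastforce
    also have "\<dots> = (y - a) * (\<bar>1 - (\<nu>\<^sup>2 - 1/4) / t\<^sup>2\<bar> * \<bar>bessel_u \<nu> t\<bar>)"
    proof -
      have "bessel_u' \<nu> a = (y - a) * ((1 - (\<nu>\<^sup>2 - 1/4) / t\<^sup>2) * bessel_u \<nu> t)"
        using t(3) unfolding y(3) by (simp add: algebra_simps)
      then show ?thesis using y by (simp add: abs_mult)
    qed
    also have "\<dots> \<le> (b - a) * (Q * sqrt e2)"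
    proof (intro mult_mono)
      have "\<bar>1 - (\<nu>\<^sup>2 - 1/4) / t\<^sup>2\<bar> \<le> 1 + m / t\<^sup>2"
        by (rule order_trans[OF abs_triangle_ineq4]) (simp add: m_def)
      also have "m / t\<^sup>2 \<le> m / j\<^sup>2"
        using tj j by (intro divide_left_mono power_mono) (auto simp: m_def)
      finally show "\<bar>1 - (\<nu>\<^sup>2 - 1/4) / t\<^sup>2\<bar> \<le> Q" by (simp add: Q_def)
      have "(bessel_u \<nu> t)\<^sup>2 \<le> ((bessel_u' \<nu> t)\<^sup>2 + (bessel_u \<nu> t)\<^sup>2) * 1" by simp
      also have "\<dots> \<le> ((bessel_u' \<nu> t)\<^sup>2 + (bessel_u \<nu> t)\<^sup>2) * exp (m / t)"
        using tj j by (intro mult_left_mono) (auto simp: m_def)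
      also have "\<dots> \<le> e2"
        using bessel_u_energy_mono(2)[OF nu j tj] u0 by (simp add: e2_def m_def)
      finally show "\<bar>bessel_u \<nu> t\<bar> \<le> sqrt e2" using real_sqrt_le_mono by fastforce
    qed (use y ab Q in auto)
    finally have "d \<le> b - a" using Q e by (simp add: d_def divide_simps)
    then show ?thesis by (simp add: a_def b_def del: bessel_zero.simps)
  qed
  define c where "c = min j d"
  have "c * real (Suc k) \<le> bessel_zero \<nu> (Suc k)" for k
  proof (induction k)
    case 0
    then show ?case by (simp add: c_def j_def)
  next
    case (Suc k)
    then show ?case using gap[of "Suc k"]
      by (simp add: algebra_simps c_def del: bessel_zero.simps)
  qed
  then have "c * real k \<le> bessel_zero \<nu> k" for k by (cases k) (auto simp del: bessel_zero.simps simp: bessel_zero.simps(1))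
  then show ?thesis using j d by (intro exI[of _ c]) (auto simp: c_def)
qed

lemma bessel_zero_at_top: "\<nu> \<ge> 0 \<Longrightarrow> \<exists>k. bessel_zero \<nu> k > x"
proof -
  assume "\<nu> \<ge> 0"
  then obtain c where c: "c > 0" "\<And>k. bessel_zero \<nu> k \<ge> c * real k" using bessel_zero_linear_growth by blast
  obtain k where "real k > x / c" using reals_Archimedean2 by blast
  then have "c * real k > x" using c by (simp add: field_simps)
  then show ?thesis using c(2)[of k] by (intro exI[of _ k]) linarith
qed

lemma ex_first_bessel_zero_gt:
  assumes "\<nu> \<ge> 0" "x \<ge> 0"
  shows "\<exists>k>0. bessel_zero \<nu> k > x \<and> (\<forall>y>x. bessel_F \<nu> (y\<^sup>2) = 0 \<longrightarrow> bessel_zero \<nu> k \<le> y)"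
proof -
  define k where "k = (LEAST k. bessel_zero \<nu> k > x)"
  have 1: "bessel_zero \<nu> k > x" unfolding k_def using bessel_zero_at_top[OF assms(1)] by (metis LeastI)
  then have "k \<noteq> 0" using assms by (intro notI) simp
  then obtain i where i: "k = Suc i" by (cases k) auto
  have "\<not> bessel_zero \<nu> i > x" using not_less_Least[of i "\<lambda>k. bessel_zero \<nu> k > x"] i k_def by auto
  then show ?thesis using 1 i assms bessel_zero_Suc_le[of \<nu> i]
    by (intro exI[of _ k]) (auto simp del: bessel_zero.simps)
qed

section \<open>Square-integrable functions\<close>

lemma L2_spaceD:
  assumes "f \<in> L2_space M"
  shows "f \<in> borel_measurable M" "integrable M (\<lambda>x. (f x)\<^sup>2)"
  using assms by (auto simp: L2_space_def)

lemma L2_prod_integrable: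
  assumes f: "f \<in> L2_space M" and g: "g \<in> L2_space M"
  shows "integrable M (\<lambda>x. f x * g x)"
proof (rule Bochner_Integration.integrable_bound)
  show "integrable M (\<lambda>x. (f x)\<^sup>2 + (g x)\<^sup>2)"
    using L2_spaceD f g by (intro Bochner_Integration.integrable_add) auto
  show "(\<lambda>x. f x * g x) \<in> borel_measurable M"
    using L2_spaceD f g by (intro borel_measurable_times) auto
  have "\<bar>a * b\<bar> \<le> a\<^sup>2 + b\<^sup>2" for a b :: real
  proof -
    have "2 * (\<bar>a\<bar> * \<bar>b\<bar>) \<le> a\<^sup>2 + b\<^sup>2" using sum_squares_bound[of "\<bar>a\<bar>" "\<bar>b\<bar>"] by simp
    moreover have "0 \<le> \<bar>a\<bar> * \<bar>b\<bar>" by simp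
    ultimately show ?thesis unfolding abs_mult by linarith
  qed
  then show "AE x in M. norm (f x * g x) \<le> norm ((f x)\<^sup>2 + (g x)\<^sup>2)"
    by auto
qed

lemma L2_add:
  assumes f: "f \<in> L2_space M" and g: "g \<in> L2_space M"
  shows "(\<lambda>x. f x + g x) \<in> L2_space M"
proof -
  have "integrable M (\<lambda>x. (f x)\<^sup>2 + 2 * (f x * g x) + (g x)\<^sup>2)"
    using L2_spaceD f g L2_prod_integrable[OF f g]
    by (intro Bochner_Integration.integrable_add integrable_mult_right) auto
  then have "integrable M (\<lambda>x. (f x + g x)\<^sup>2)"
    by (simp add: power2_sum algebra_simps)
  then show ?thesis using L2_spaceD(1)[OF f] L2_spaceD(1)[OF g] by (auto simp: L2_space_def)
qed

lemma L2_scale: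
  assumes f: "f \<in> L2_space M"
  shows "(\<lambda>x. c * f x) \<in> L2_space M"
  using L2_spaceD[OF f] by (auto simp: L2_space_def power_mult_distrib)

lemma L2_diff:
  assumes f: "f \<in> L2_space M" and g: "g \<in> L2_space M"
  shows "(\<lambda>x. f x - g x) \<in> L2_space M"
  using L2_add[OF f L2_scale[OF g, of "-1"]] by simp

lemma L2_sum:
  assumes "\<And>i. i \<in> I \<Longrightarrow> f i \<in> L2_space M"
  shows "(\<lambda>x. \<Sum>i\<in>I. f i x) \<in> L2_space M"
  using assms
proof (induction I rule: infinite_finite_induct)
  case (insert i I)
  then show ?case using L2_add[of "f i" M "\<lambda>x. \<Sum>i\<in>I. f i x"] by simp
qed (auto simp: L2_space_def)

lemma L2_inner_add_left:
  assumes "f \<in> L2_space M" "g \<in> L2_space M" "h \<in> L2_space M"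
  shows "L2_inner M (\<lambda>x. f x + g x) h = L2_inner M f h + L2_inner M g h"
  unfolding L2_inner_def using assms L2_prod_integrable
  by (simp add: distrib_right)

lemma L2_inner_scale_left: "L2_inner M (\<lambda>x. c * f x) h = c * L2_inner M f h"
  unfolding L2_inner_def mult.assoc by (rule integral_mult_right_zero)

lemma L2_inner_commute: "L2_inner M f g = L2_inner M g f"
  unfolding L2_inner_def by (simp add: mult.commute)

lemma L2_inner_diff_left:
  assumes "f \<in> L2_space M" "g \<in> L2_space M" "h \<in> L2_space M"
  shows "L2_inner M (\<lambda>x. f x - g x) h = L2_inner M f h - L2_inner M g h"
  unfolding L2_inner_def using assms L2_prod_integrable
  by (simp add: left_diff_distrib)

lemma L2_inner_sum_left:
  assumes "\<And>i. i \<in> I \<Longrightarrow> f i \<in> L2_space M" "h \<in> L2_space M"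
  shows "L2_inner M (\<lambda>x. \<Sum>i\<in>I. f i x) h = (\<Sum>i\<in>I. L2_inner M (f i) h)"
  unfolding L2_inner_def sum_distrib_right using assms
  by (intro Bochner_Integration.integral_sum L2_prod_integrable)

lemma L2_inner_self_nonneg: "L2_inner M f f \<ge> 0"
  unfolding L2_inner_def by (intro Bochner_Integration.integral_nonneg) auto

lemma L2_norm_power2: "(L2_norm M f)\<^sup>2 = L2_inner M f f"
  by (simp add: L2_norm_def L2_inner_self_nonneg)

lemma L2_norm_nonneg: "L2_norm M f \<ge> 0"
  by (simp add: L2_norm_def L2_inner_self_nonneg)

lemma L2_inner_diff_self:
  assumes f: "f \<in> L2_space M" and g: "g \<in> L2_space M"
  shows "L2_inner M (\<lambda>x. f x - g x) (\<lambda>x. f x - g x) = L2_inner M f f - 2 * L2_inner M f g + L2_inner M g g"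
proof -
  note [simp] = L2_inner_diff_left f g L2_diff
  have "L2_inner M (\<lambda>x. f x - g x) (\<lambda>x. f x - g x)
      = L2_inner M f (\<lambda>x. f x - g x) - L2_inner M g (\<lambda>x. f x - g x)"
    by simp
  also have "\<dots> = L2_inner M (\<lambda>x. f x - g x) f - L2_inner M (\<lambda>x. f x - g x) g"
    by (simp only: L2_inner_commute)
  also have "\<dots> = L2_inner M f f - 2 * L2_inner M f g + L2_inner M g g"
    by (simp add: L2_inner_commute[of M g f])
  finally show ?thesis .
qed

lemma L2_Cauchy_Schwarz:
  assumes f: "f \<in> L2_space M" and g: "g \<in> L2_space M"
  shows "\<bar>L2_inner M f g\<bar> \<le> L2_norm M f * L2_norm M g"
proof -
  let ?A = "L2_inner M f f" and ?B = "L2_inner M f g" and ?C = "L2_inner M g g"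
  have q: "0 \<le> ?A - 2 * t * ?B + t\<^sup>2 * ?C" for t
  proof -
    have "L2_inner M (\<lambda>x. t * g x) (\<lambda>x. t * g x) = t * (t * ?C)"
      by (metis L2_inner_scale_left L2_inner_commute)
    moreover have "L2_inner M f (\<lambda>x. t * g x) = t * ?B"
      by (metis L2_inner_scale_left L2_inner_commute)
    ultimately show ?thesis
      using L2_inner_self_nonneg[of M "\<lambda>x. f x - t * g x"] L2_inner_diff_self[OF f L2_scale[OF g, of t]]
      by (simp add: power2_eq_square mult_ac)
  qed
  have "?B\<^sup>2 \<le> ?A * ?C"
  proof (cases "?C = 0")
    case True
    have "?B = 0"
    proof (rule ccontr)
      assume "?B \<noteq> 0"
      \<comment> \<open>For ?C = 0 the quadratic is affine in t, and this t makes it equal to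
        -1.\<close>
      with q[of "(?A + 1) / (2 * ?B)"] True show False by simp
    qed
    then show ?thesis using True by simp
  next
    case False
    then have "?C > 0" using L2_inner_self_nonneg[of M g] by linarith
    with q[of "?B / ?C"] have "0 \<le> ?A - ?B\<^sup>2 / ?C"
      by (simp add: power2_eq_square divide_simps)
    then show ?thesis using \<open>?C > 0\<close> by (simp add: field_simps)
  qed
  then have "\<bar>?B\<bar> \<le> sqrt (?A * ?C)"
    by (metis real_sqrt_abs real_sqrt_le_mono)
  then show ?thesis by (simp add: L2_norm_def real_sqrt_mult)
qed

lemma L2_Bessel_inequality:
  assumes u: "u \<in> L2_space M" and e: "\<And>k. k \<in> K \<Longrightarrow> e k \<in> L2_space M" and K: "finite K"
    and orth: "\<And>k l. k \<in> K \<Longrightarrow> l \<in> K \<Longrightarrow> L2_inner M (e k) (e l) = (if k = l then 1 else 0)"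
  shows "(\<Sum>k\<in>K. (L2_inner M u (e k))\<^sup>2) \<le> (L2_norm M u)\<^sup>2"
proof -
  let ?c = "\<lambda>k. L2_inner M u (e k)"
  let ?g = "\<lambda>x. \<Sum>k\<in>K. ?c k * e k x"
  have g: "?g \<in> L2_space M" by (intro L2_sum L2_scale e)
  have gh: "L2_inner M ?g h = (\<Sum>k\<in>K. ?c k * L2_inner M (e k) h)" if "h \<in> L2_space M" for h
    using that by (subst L2_inner_sum_left) (auto intro: L2_scale e simp: L2_inner_scale_left)
  have "L2_inner M ?g u = (\<Sum>k\<in>K. (?c k)\<^sup>2)"
    unfolding gh[OF u] by (simp add: L2_inner_commute[of M "e _" u] power2_eq_square)
  moreover have "L2_inner M ?g ?g = (\<Sum>k\<in>K. (?c k)\<^sup>2)"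
  proof -
    have "L2_inner M (e k) ?g = ?c k" if "k \<in> K" for k
    proof -
      have "L2_inner M (e k) ?g = (\<Sum>l\<in>K. ?c l * L2_inner M (e l) (e k))"
        using gh[OF e[OF that]] by (metis L2_inner_commute)
      also have "\<dots> = (\<Sum>l\<in>K. if l = k then ?c l else 0)"
        using that by (intro sum.cong) (auto simp: orth)
      finally show ?thesis using that K by simp
    qed
    then show ?thesis using gh[OF g] by (simp add: power2_eq_square)
  qed
  ultimately show ?thesis
    using L2_inner_self_nonneg[of M "\<lambda>x. u x - ?g x"] L2_inner_diff_self[OF u g]
    by (simp add: L2_norm_power2 L2_inner_commute[of M u ?g])
qed

section \<open>The fundamental theorem of calculus for \<open>lebesgue_on\<close>\<close>

lemma integral_lebesgue_on_FTC:
  fixes H h :: "real \<Rightarrow> real"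
  assumes ab: "a \<le> b" and cont: "continuous_on {a..b} H"
    and deriv: "\<And>x. a < x \<Longrightarrow> x < b \<Longrightarrow> (H has_real_derivative h x) (at x)"
    and int: "integrable (lebesgue_on {a<..<b}) h"
  shows "integral\<^sup>L (lebesgue_on {a<..<b}) h = H b - H a"
proof -
  have "(h has_integral (H b - H a)) {a..b}"
    using ab cont deriv
    by (intro fundamental_theorem_of_calculus_interior) (auto simp: has_real_derivative_iff_has_vector_derivative)
  then have "(h has_integral (H b - H a)) {a<..<b}"
    by (simp add: has_integral_Icc_iff_Ioo)
  moreover have "(h has_integral (integral\<^sup>L (lebesgue_on {a<..<b}) h)) {a<..<b}"
    using int by (intro has_integral_integral_lebesgue_on) auto
  ultimately show ?thesis by (rule has_integral_unique[symmetric])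
qed

text \<open>A nonnegative derivative of a function continuous up to the endpoints is integrable
  without further estimates. This covers integrands that are singular at an endpoint, such as powers
  of x.\<close>

lemma integrable_lebesgue_on_FTC_nonneg:
  fixes H h :: "real \<Rightarrow> real"
  assumes ab: "a \<le> b" and cont: "continuous_on {a..b} H"
    and deriv: "\<And>x. a < x \<Longrightarrow> x < b \<Longrightarrow> (H has_real_derivative h x) (at x)"
    and nonneg: "\<And>x. a < x \<Longrightarrow> x < b \<Longrightarrow> h x \<ge> 0"
  shows "integrable (lebesgue_on {a<..<b}) h"
proof -
  have "(h has_integral (H b - H a)) {a..b}"
    using ab cont deriv
    by (intro fundamental_theorem_of_calculus_interior) (auto simp: has_real_derivative_iff_has_vector_derivative)
  then have "h integrable_on {a<..<b}"
    by (auto simp: has_integral_Icc_iff_Ioo)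
  then have "h absolutely_integrable_on {a<..<b}"
    using nonneg by (intro nonnegative_absolutely_integrable_1) auto
  then show ?thesis
    by (simp add: integrable_restrict_space set_integrable_def)
qed

lemma continuous_on_borel_measurable_lebesgue_on:
  fixes f :: "real \<Rightarrow> real"
  assumes "continuous_on S f" "S \<in> sets lebesgue"
  shows "f \<in> borel_measurable (lebesgue_on S)"
  using assms by (rule continuous_imp_measurable_on_sets_lebesgue)

section \<open>The eigenfunctions\<close>

locale degenerate_parabolic =
  fixes \<alpha> \<beta> \<mu> :: real
  assumes adm: "admissible \<alpha> \<beta> \<mu>"
begin

abbreviation "\<nu> \<equiv> nu \<alpha> \<beta> \<mu>"
abbreviation "\<kappa> \<equiv> kappa \<alpha>"
abbreviation "j \<equiv> bessel_zero \<nu>"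
abbreviation "lam \<equiv> eigenval \<alpha> \<beta> \<mu>"
abbreviation "\<Phi> \<equiv> eigenfun \<alpha> \<beta> \<mu>"
abbreviation "W \<equiv> weight_measure \<beta>"

text \<open>Near 0, Phi_k behaves like \<open>bk k\<close> times x^expo; by
  \<open>boundary_exponent\<close> the weight in the boundary limit is exactly x^(-expo).\<close>

definition expo :: real where "expo = (1 - \<alpha> - \<beta>) / 2 + \<kappa> * \<nu>"

definition zk :: "nat \<Rightarrow> real" where "zk k = (j k)\<^sup>2"

text \<open>The boundary limit of Phi_k, written with F' instead of J_nu', so that j_k^nu and
  Gamma(nu + 1) cancel; \<open>bk_eq_deriv\<close> translates back.\<close>

definition bk :: "nat \<Rightarrow> real" where
  "bk k = sqrt (2 * \<kappa>) / (2 * j k * \<bar>bessel_F' \<nu> (zk k)\<bar>)"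

lemma kappa_pos: "\<kappa> > 0" and kappa_le_1: "\<kappa> \<le> 1" and nu_pos: "\<nu> > 0" and nu_nonneg: "\<nu> \<ge> 0"
  using adm by (auto simp: admissible_def kappa_def nu_def)

lemma boundary_exponent: "\<alpha> + \<beta> + gamma_exp \<alpha> \<beta> \<mu> = - expo"
proof -
  have "\<kappa> * \<nu> = sqrt (mu_crit (\<alpha> + \<beta>) - \<mu>)" using kappa_pos by (simp add: nu_def)
  then show ?thesis by (simp add: expo_def gamma_exp_def field_simps)
qed

lemma lam_eq: "lam k = \<kappa>\<^sup>2 * zk k"
  by (simp add: eigenval_def zk_def)

lemma j_pos: "k > 0 \<Longrightarrow> j k > 0"
  using bessel_zero_pos nu_nonneg by simp

lemma zk_pos: "k > 0 \<Longrightarrow> zk k > 0"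
  using j_pos[of k] by (simp add: zk_def)

lemma lam_pos: "k > 0 \<Longrightarrow> lam k > 0"
  using zk_pos[of k] kappa_pos by (simp add: lam_eq)

lemma j_mono: "k \<le> l \<Longrightarrow> j k \<le> j l"
  using strict_mono_less_eq[OF strict_mono_bessel_zero[OF nu_nonneg]] by simp

lemma zk_mono: "k \<le> l \<Longrightarrow> zk k \<le> zk l"
  using j_mono[of k l] j_mono[of 0 k] by (simp add: zk_def power_mono)

lemma lam_mono: "k \<le> l \<Longrightarrow> lam k \<le> lam l"
  using zk_mono[of k l] by (simp add: lam_eq mult_left_mono)

lemma zk_inj: "zk k = zk l \<longleftrightarrow> k = l"
proof -
  have "j k \<ge> 0" "j l \<ge> 0" using j_mono[of 0] by auto
  then have "zk k = zk l \<longleftrightarrow> j k = j l" by (simp add: zk_def)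
  also have "\<dots> \<longleftrightarrow> k = l"
    using strict_mono_eq[OF strict_mono_bessel_zero[OF nu_nonneg]] by simp
  finally show ?thesis .
qed

lemma lam_inj: "lam k = lam l \<longleftrightarrow> k = l"
  using kappa_pos zk_inj by (simp add: lam_eq)

lemma F_zk: "k > 0 \<Longrightarrow> bessel_F \<nu> (zk k) = 0"
  using bessel_F_bessel_zero nu_nonneg by (simp add: zk_def)

lemma F'_zk: "k > 0 \<Longrightarrow> bessel_F' \<nu> (zk k) \<noteq> 0"
  using bessel_F_zero_simple[OF nu_nonneg zk_pos F_zk] by simp

lemma bk_pos: "k > 0 \<Longrightarrow> bk k > 0"
  using kappa_pos j_pos[of k] F'_zk[of k] by (simp add: bk_def)

lemma bk_power2: "k > 0 \<Longrightarrow> (bk k)\<^sup>2 = \<kappa> / (2 * zk k * (bessel_F' \<nu> (zk k))\<^sup>2)"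
proof -
  assume "k > 0"
  have "(bk k)\<^sup>2 = (sqrt (2 * \<kappa>))\<^sup>2 / (2\<^sup>2 * (j k)\<^sup>2 * \<bar>bessel_F' \<nu> (zk k)\<bar>\<^sup>2)"
    unfolding bk_def power_divide power_mult_distrib ..
  also have "(sqrt (2 * \<kappa>))\<^sup>2 = 2 * \<kappa>" using kappa_pos by simp
  finally show ?thesis by (simp add: zk_def[symmetric])
qed

lemma deriv_bessel_J:
  assumes "k > 0"
  shows "deriv (bessel_J \<nu>) (j k) = (j k / 2) powr \<nu> / Gamma (\<nu> + 1) * (bessel_F' \<nu> (zk k) * (2 * j k))"
proof (rule DERIV_imp_deriv)
  have j0: "j k > 0" using j_pos assms by simp
  have "((\<lambda>x. (x / 2) powr \<nu> / Gamma (\<nu> + 1) * bessel_F \<nu> (x\<^sup>2)) has_real_derivative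
     (\<nu> * (j k / 2) powr (\<nu> - 1) * (1/2)) / Gamma (\<nu> + 1) * bessel_F \<nu> ((j k)\<^sup>2)
      + (bessel_F' \<nu> ((j k)\<^sup>2) * (2 * j k)) * ((j k / 2) powr \<nu> / Gamma (\<nu> + 1))) (at (j k))"
    using j0 by (intro DERIV_mult DERIV_bessel_F_square nu_nonneg DERIV_cdivide)
      (auto intro!: derivative_eq_intros simp: powr_diff)
  then have "((\<lambda>x. (x / 2) powr \<nu> / Gamma (\<nu> + 1) * bessel_F \<nu> (x\<^sup>2)) has_real_derivative
     (j k / 2) powr \<nu> / Gamma (\<nu> + 1) * (bessel_F' \<nu> (zk k) * (2 * j k))) (at (j k))"
    using F_zk[OF assms] by (simp add: zk_def mult_ac)
  then show "(bessel_J \<nu> has_real_derivative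
     (j k / 2) powr \<nu> / Gamma (\<nu> + 1) * (bessel_F' \<nu> (zk k) * (2 * j k))) (at (j k))"
    by (rule has_field_derivative_transform_within_open[where S = "{0<..}"])
       (use j0 nu_nonneg in \<open>auto simp: bessel_J_eq_F\<close>)
qed

lemma bk_eq_deriv:
  assumes "k > 0"
  shows "bk k = sqrt (2 * \<kappa>) * (j k) powr \<nu> / (2 powr \<nu> * Gamma (\<nu> + 1) * \<bar>deriv (bessel_J \<nu>) (j k)\<bar>)"
proof -
  have j0: "j k > 0" using j_pos assms by simp
  have G: "Gamma (\<nu> + 1) > 0" using nu_nonneg by (intro Gamma_real_pos) auto
  have "\<bar>deriv (bessel_J \<nu>) (j k)\<bar> = (j k / 2) powr \<nu> / Gamma (\<nu> + 1) * (\<bar>bessel_F' \<nu> (zk k)\<bar> * (2 * j k))"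
    using G j0 by (simp add: deriv_bessel_J[OF assms] abs_mult)
  then show ?thesis
    using G j0 F'_zk[OF assms] by (simp add: bk_def powr_divide)
qed

lemma eigenfun_eq:
  assumes "k > 0" "x > 0"
  shows "\<Phi> k x = bk k * x powr expo * bessel_F \<nu> (zk k * x powr (2 * \<kappa>))"
proof -
  have j0: "j k > 0" using j_pos assms by simp
  have G: "Gamma (\<nu> + 1) > 0" using nu_nonneg by (intro Gamma_real_pos) auto
  have sq: "(j k * x powr \<kappa>)\<^sup>2 = zk k * x powr (2 * \<kappa>)"
    by (simp add: zk_def power_mult_distrib powr_add[symmetric] power2_eq_square[of "x powr \<kappa>"])
  have "\<Phi> k x = sqrt (2 * \<kappa>) / \<bar>deriv (bessel_J \<nu>) (j k)\<bar> * x powr ((1 - \<alpha> - \<beta>) / 2)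
      * ((j k * x powr \<kappa> / 2) powr \<nu> / Gamma (\<nu> + 1) * bessel_F \<nu> (zk k * x powr (2 * \<kappa>)))"
    using j0 assms nu_nonneg by (simp add: eigenfun_def Let_def bessel_J_eq_F sq)
  also have "(j k * x powr \<kappa> / 2) powr \<nu> = (j k) powr \<nu> * x powr (\<kappa> * \<nu>) / 2 powr \<nu>"
    using j0 by (simp add: powr_mult powr_divide powr_powr)
  also have "sqrt (2 * \<kappa>) / \<bar>deriv (bessel_J \<nu>) (j k)\<bar> * x powr ((1 - \<alpha> - \<beta>) / 2)
      * ((j k) powr \<nu> * x powr (\<kappa> * \<nu>) / 2 powr \<nu> / Gamma (\<nu> + 1) * bessel_F \<nu> (zk k * x powr (2 * \<kappa>)))
     = bk k * (x powr ((1 - \<alpha> - \<beta>) / 2) * x powr (\<kappa> * \<nu>)) * bessel_F \<nu> (zk k * x powr (2 * \<kappa>))"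
    unfolding bk_eq_deriv[OF assms(1)] by (simp add: mult_ac)
  also have "x powr ((1 - \<alpha> - \<beta>) / 2) * x powr (\<kappa> * \<nu>) = x powr expo"
    by (simp add: expo_def powr_add)
  finally show ?thesis .
qed

lemma eigenfun_bound:
  assumes "k > 0" "x > 0"
  shows "\<bar>\<Phi> k x\<bar> \<le> bk k * x powr expo"
proof -
  have "\<bar>bessel_F \<nu> (zk k * x powr (2 * \<kappa>))\<bar> \<le> 1"
    using zk_pos[OF assms(1)] nu_nonneg by (intro bessel_F_abs_le_1) auto
  then have "bk k * x powr expo * \<bar>bessel_F \<nu> (zk k * x powr (2 * \<kappa>))\<bar> \<le> bk k * x powr expo * 1"
    using bk_pos[OF assms(1)] by (intro mult_left_mono) auto
  then show ?thesis using bk_pos[OF assms(1)] by (simp add: eigenfun_eq[OF assms] abs_mult)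
qed

end

section \<open>Orthonormality of the eigenfunctions\<close>

context degenerate_parabolic
begin

text \<open>The flux z^(nu + 1) y' of y(z) = F(a z). In these terms the equation reads (z^(nu + 1)
  y')' = -(a / 4) z^nu y, the Sturm-Liouville form with weight z^nu.\<close>

definition zflux :: "real \<Rightarrow> real \<Rightarrow> real" where
  "zflux a z = z powr (\<nu> + 1) * (a * bessel_F' \<nu> (a * z))"

lemma DERIV_F_scaled:
  "((\<lambda>z. bessel_F \<nu> (a * z)) has_real_derivative a * bessel_F' \<nu> (a * z)) (at z)"
  "((\<lambda>z. bessel_F' \<nu> (a * z)) has_real_derivative a * bessel_F'' \<nu> (a * z)) (at z)"
  by (auto intro!: derivative_eq_intros nu_nonneg)

lemma DERIV_zflux:
  assumes "z > 0"
  shows "(zflux a has_real_derivative - (a / 4) * (z powr \<nu> * bessel_F \<nu> (a * z))) (at z)"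
proof -
  have f1: "(zflux a has_real_derivative ((\<nu> + 1) * z powr (\<nu> + 1 - 1)) * (a * bessel_F' \<nu> (a * z))
      + (a * (a * bessel_F'' \<nu> (a * z))) * z powr (\<nu> + 1)) (at z)"
    unfolding zflux_def[abs_def] using assms
    by (intro DERIV_mult has_real_derivative_powr DERIV_cmult DERIV_F_scaled)
  have "z powr (\<nu> + 1) = z powr \<nu> * z" using assms by (simp add: powr_add)
  then have "((\<nu> + 1) * z powr (\<nu> + 1 - 1)) * (a * bessel_F' \<nu> (a * z))
      + (a * (a * bessel_F'' \<nu> (a * z))) * z powr (\<nu> + 1)
    = a * z powr \<nu> * (a * z * bessel_F'' \<nu> (a * z) + (\<nu> + 1) * bessel_F' \<nu> (a * z) + bessel_F \<nu> (a * z) / 4)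
      - (a / 4) * (z powr \<nu> * bessel_F \<nu> (a * z))"
    by (simp add: algebra_simps)
  then show ?thesis
    using f1 unfolding bessel_ode[OF nu_nonneg] by (simp add: DERIV_cong)
qed

lemma continuous_on_zflux: "continuous_on {0..} (zflux a)"
  unfolding zflux_def[abs_def] using nu_nonneg
  by (intro continuous_intros continuous_on_powr' continuous_on_compose2[OF continuous_on_bessel_F'[of \<nu> UNIV]]) auto

lemma continuous_on_F_scaled: "continuous_on S (\<lambda>z. bessel_F \<nu> (a * z))"
  by (rule DERIV_at_continuous_on) (rule DERIV_F_scaled(1))

lemma continuous_on_F'_scaled: "continuous_on S (\<lambda>z. bessel_F' \<nu> (a * z))"
  by (rule DERIV_at_continuous_on) (rule DERIV_F_scaled(2))

text \<open>Lagrange's identity. The bracket vanishes at z = 0 and, if a and b are squares of zeros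
  of J_nu, also at z = 1, which gives orthogonality.\<close>

lemma DERIV_cross:
  assumes "z > 0"
  shows "((\<lambda>z. zflux b z * bessel_F \<nu> (a * z) - zflux a z * bessel_F \<nu> (b * z)) has_real_derivative
     (a - b) / 4 * (z powr \<nu> * (bessel_F \<nu> (a * z) * bessel_F \<nu> (b * z)))) (at z)"
proof -
  have "((\<lambda>z. zflux b z * bessel_F \<nu> (a * z) - zflux a z * bessel_F \<nu> (b * z)) has_real_derivative
     (- (b / 4) * (z powr \<nu> * bessel_F \<nu> (b * z)) * bessel_F \<nu> (a * z) + a * bessel_F' \<nu> (a * z) * zflux b z)
     - (- (a / 4) * (z powr \<nu> * bessel_F \<nu> (a * z)) * bessel_F \<nu> (b * z) + b * bessel_F' \<nu> (b * z) * zflux a z)) (at z)"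
    using assms by (intro DERIV_mult DERIV_diff DERIV_zflux DERIV_F_scaled)
  then show ?thesis
    by (rule DERIV_cong) (simp add: zflux_def algebra_simps diff_divide_distrib)
qed

text \<open>For a = b Lagrange's identity is void. The multiplier z y' supplies a primitive of z^nu
  y^2 instead, from which the norm of Phi_k is read off.\<close>

lemma DERIV_square:
  assumes "z > 0"
  shows "((\<lambda>z. z * (a * bessel_F' \<nu> (a * z)) * zflux a z + a / 4 * (z powr (\<nu> + 1) * (bessel_F \<nu> (a * z))\<^sup>2)
        + \<nu> * (zflux a z * bessel_F \<nu> (a * z))) has_real_derivative
     a / 4 * (z powr \<nu> * (bessel_F \<nu> (a * z) * bessel_F \<nu> (a * z)))) (at z)"
proof -
  let ?F = "bessel_F \<nu> (a * z)" and ?F' = "bessel_F' \<nu> (a * z)" and ?F'' = "bessel_F'' \<nu> (a * z)"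
  have zp: "z powr (\<nu> + 1) = z powr \<nu> * z" using assms by (simp add: powr_add)
  have 1: "((\<lambda>z. z * (a * bessel_F' \<nu> (a * z))) has_real_derivative - a * (\<nu> * ?F' + ?F / 4)) (at z)"
  proof -
    have "((\<lambda>z. z * (a * bessel_F' \<nu> (a * z))) has_real_derivative 1 * (a * ?F') + a * (a * ?F'') * z) (at z)"
      by (intro DERIV_mult DERIV_ident DERIV_cmult DERIV_F_scaled)
    moreover have "1 * (a * ?F') + a * (a * ?F'') * z
        = a * (a * z * ?F'' + (\<nu> + 1) * ?F' + ?F / 4) - a * (\<nu> * ?F' + ?F / 4)"
      by (simp add: algebra_simps)
    ultimately show ?thesis unfolding bessel_ode[OF nu_nonneg] by simp
  qed
  have 2: "((\<lambda>z. z powr (\<nu> + 1) * (bessel_F \<nu> (a * z))\<^sup>2) has_real_derivative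
      ((\<nu> + 1) * z powr (\<nu> + 1 - 1)) * ?F\<^sup>2 + (2 * (a * ?F') * ?F) * z powr (\<nu> + 1)) (at z)"
    using assms
    by (intro DERIV_mult has_real_derivative_powr) (auto intro!: derivative_eq_intros nu_nonneg)
  have "((\<lambda>z. z * (a * bessel_F' \<nu> (a * z)) * zflux a z + a / 4 * (z powr (\<nu> + 1) * (bessel_F \<nu> (a * z))\<^sup>2)
        + \<nu> * (zflux a z * bessel_F \<nu> (a * z))) has_real_derivative
     ((- a * (\<nu> * ?F' + ?F / 4)) * zflux a z + (- (a / 4) * (z powr \<nu> * ?F)) * (z * (a * ?F')))
     + a / 4 * (((\<nu> + 1) * z powr (\<nu> + 1 - 1)) * ?F\<^sup>2 + (2 * (a * ?F') * ?F) * z powr (\<nu> + 1))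
     + \<nu> * ((- (a / 4) * (z powr \<nu> * ?F)) * ?F + (a * ?F') * zflux a z)) (at z)"
    using assms by (intro DERIV_add DERIV_cmult DERIV_mult[OF _ DERIV_zflux] DERIV_mult[OF DERIV_zflux] 1 2 DERIV_F_scaled)
  then show ?thesis
    by (rule DERIV_cong) (unfold zflux_def zp, simp add: algebra_simps power2_eq_square)
qed

lemma sets_W [measurable_cong, simp]: "sets W = sets (lebesgue_on {0<..<1})"
  by (simp add: weight_measure_def)

lemma space_W [simp]: "space W = {0<..<1}"
  by (simp add: weight_measure_def)

lemma measurable_W: "borel_measurable W = borel_measurable (lebesgue_on {0<..<1})"
  by (rule measurable_cong_sets) auto

lemma measurable_powr [measurable]: "(\<lambda>x::real. x powr c) \<in> borel_measurable (lebesgue_on {0<..<1})"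
  by (intro continuous_on_borel_measurable_lebesgue_on continuous_intros) auto

lemma integral_W:
  fixes f :: "real \<Rightarrow> real"
  assumes "f \<in> borel_measurable (lebesgue_on {0<..<1})"
  shows "integrable W f \<longleftrightarrow> integrable (lebesgue_on {0<..<1}) (\<lambda>x. x powr \<beta> * f x)"
    "integral\<^sup>L W f = integral\<^sup>L (lebesgue_on {0<..<1}) (\<lambda>x. x powr \<beta> * f x)"
  unfolding weight_measure_def using assms
  by (simp_all add: integrable_density integral_density measurable_powr)

lemma measurable_eigenfun:
  assumes "k > 0"
  shows "\<Phi> k \<in> borel_measurable (lebesgue_on {0<..<1})"
proof (intro continuous_on_borel_measurable_lebesgue_on)
  have "continuous_on {0<..<1} (\<lambda>x. bk k * x powr expo * bessel_F \<nu> (zk k * x powr (2 * \<kappa>)))"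
    by (intro continuous_intros continuous_on_compose2[OF continuous_on_F_scaled[of UNIV]]) auto
  then show "continuous_on {0<..<1} (\<Phi> k)"
    using assms by (subst continuous_on_cong[OF refl]) (auto simp: eigenfun_eq)
qed auto

text \<open>The substitution z = x^(2 kappa), carried out on the primitive H rather than on the
  integral, so that only the fundamental theorem of calculus is used.\<close>

lemma
  fixes H h g :: "real \<Rightarrow> real"
  assumes cont: "continuous_on {0..1} H"
    and deriv: "\<And>z. 0 < z \<Longrightarrow> z < 1 \<Longrightarrow> (H has_real_derivative h z) (at z)"
  defines "g \<equiv> (\<lambda>x. x powr (2 * \<kappa> - 1) * h (x powr (2 * \<kappa>)))"
  shows integrable_subst: "(\<And>z. 0 < z \<Longrightarrow> z < 1 \<Longrightarrow> h z \<ge> 0) \<Longrightarrow> integrable (lebesgue_on {0<..<1}) g"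
    and integral_subst: "integrable (lebesgue_on {0<..<1}) g \<Longrightarrow>
      integral\<^sup>L (lebesgue_on {0<..<1}) g = (H 1 - H 0) / (2 * \<kappa>)"
proof -
  let ?K = "\<lambda>x. H (x powr (2 * \<kappa>)) / (2 * \<kappa>)"
  have z: "x powr (2 * \<kappa>) > 0 \<and> x powr (2 * \<kappa>) < 1" if "0 < x" "x < 1" for x
    using that kappa_pos by (simp add: powr01_less_one)
  have z': "x powr (2 * \<kappa>) \<le> 1" if "0 \<le> x" "x \<le> 1" for x
    using that kappa_pos powr_mono2[of "2 * \<kappa>" x 1] by auto
  have "continuous_on {0..1} (\<lambda>x::real. x powr (2 * \<kappa>))"
    using kappa_pos by (intro continuous_on_powr' continuous_intros) auto
  then have "continuous_on {0..1} (\<lambda>x. H (x powr (2 * \<kappa>)))"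
    using z' by (intro continuous_on_compose2[OF cont]) auto
  then have c: "continuous_on {0..1} ?K"
    using kappa_pos by (intro continuous_intros) auto
  have d: "(?K has_real_derivative g x) (at x)" if x: "0 < x" "x < 1" for x
  proof -
    have "((\<lambda>x. H (x powr (2 * \<kappa>))) has_real_derivative h (x powr (2 * \<kappa>)) * (2 * \<kappa> * x powr (2 * \<kappa> - 1))) (at x)"
      using x z by (intro DERIV_chain2[OF deriv] has_real_derivative_powr) auto
    from DERIV_cdivide[OF this, of "2 * \<kappa>"] show ?thesis
      using kappa_pos by (simp add: g_def mult_ac)
  qed
  show "integrable (lebesgue_on {0<..<1}) g" if "\<And>z. 0 < z \<Longrightarrow> z < 1 \<Longrightarrow> h z \<ge> 0"
  proof (rule integrable_lebesgue_on_FTC_nonneg[OF _ c d])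
    show "0 \<le> g x" if "0 < x" "x < 1" for x
      using z[OF that] \<open>\<And>z. 0 < z \<Longrightarrow> z < 1 \<Longrightarrow> h z \<ge> 0\<close> by (auto simp: g_def intro!: mult_nonneg_nonneg)
  qed auto
  show "integral\<^sup>L (lebesgue_on {0<..<1}) g = (H 1 - H 0) / (2 * \<kappa>)" if "integrable (lebesgue_on {0<..<1}) g"
    using integral_lebesgue_on_FTC[OF _ c d that] by (simp add: diff_divide_distrib)
qed

text \<open>Since beta + 2 expo = 2 kappa - 1 + 2 kappa nu, the weight x^beta turns into z^nu times
  the Jacobian of z = x^(2 kappa), up to the factor 2 kappa.\<close>

lemma weight_expo: "x > 0 \<Longrightarrow> x powr \<beta> * (x powr expo * x powr expo) = x powr (2 * \<kappa> - 1) * (x powr (2 * \<kappa>)) powr \<nu>"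
  by (simp add: powr_powr powr_add[symmetric]) (simp add: expo_def kappa_def field_simps)

lemma eigenfun_prod:
  assumes "k > 0" "l > 0" "x > 0"
  shows "x powr \<beta> * (\<Phi> k x * \<Phi> l x) = bk k * bk l * (x powr (2 * \<kappa> - 1) *
      ((x powr (2 * \<kappa>)) powr \<nu> * (bessel_F \<nu> (zk k * x powr (2 * \<kappa>)) * bessel_F \<nu> (zk l * x powr (2 * \<kappa>)))))"
proof -
  have "x powr \<beta> * (\<Phi> k x * \<Phi> l x) = (x powr \<beta> * (x powr expo * x powr expo))
      * (bk k * bk l * (bessel_F \<nu> (zk k * x powr (2 * \<kappa>)) * bessel_F \<nu> (zk l * x powr (2 * \<kappa>))))"
    by (simp only: eigenfun_eq[OF assms(1,3)] eigenfun_eq[OF assms(2,3)] mult_ac)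
  then show ?thesis unfolding weight_expo[OF assms(3)] by (simp only: mult_ac)
qed

lemma integrable_lebesgue_on_cong:
  fixes f g :: "real \<Rightarrow> real"
  shows "(\<And>x. x \<in> S \<Longrightarrow> f x = g x) \<Longrightarrow> integrable (lebesgue_on S) f \<longleftrightarrow> integrable (lebesgue_on S) g"
  by (intro Bochner_Integration.integrable_cong) (auto simp: space_restrict_space)

lemma integral_lebesgue_on_cong:
  fixes f g :: "real \<Rightarrow> real"
  shows "(\<And>x. x \<in> S \<Longrightarrow> f x = g x) \<Longrightarrow> integral\<^sup>L (lebesgue_on S) f = integral\<^sup>L (lebesgue_on S) g"
  by (intro Bochner_Integration.integral_cong) (auto simp: space_restrict_space)

lemma
  fixes f g :: "real \<Rightarrow> real"
  assumes m: "f \<in> borel_measurable (lebesgue_on {0<..<1})"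
    and eq: "\<And>x. x \<in> {0<..<1} \<Longrightarrow> x powr \<beta> * f x = c * g x"
  shows integrable_W_iff: "c \<noteq> 0 \<Longrightarrow> integrable W f \<longleftrightarrow> integrable (lebesgue_on {0<..<1}) g"
    and integral_W_eq: "integral\<^sup>L W f = c * integral\<^sup>L (lebesgue_on {0<..<1}) g"
proof -
  have "integrable W f \<longleftrightarrow> integrable (lebesgue_on {0<..<1}) (\<lambda>x. c * g x)"
    unfolding integral_W(1)[OF m] by (intro integrable_lebesgue_on_cong eq)
  then show "c \<noteq> 0 \<Longrightarrow> integrable W f \<longleftrightarrow> integrable (lebesgue_on {0<..<1}) g"
    by simp
  have "integral\<^sup>L W f = integral\<^sup>L (lebesgue_on {0<..<1}) (\<lambda>x. c * g x)"
    unfolding integral_W(2)[OF m] by (intro integral_lebesgue_on_cong eq)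
  then show "integral\<^sup>L W f = c * integral\<^sup>L (lebesgue_on {0<..<1}) g"
    by simp
qed

lemma eigenfun_square:
  assumes k: "k > 0"
  shows "integrable W (\<lambda>x. \<Phi> k x * \<Phi> k x)" "integral\<^sup>L W (\<lambda>x. \<Phi> k x * \<Phi> k x) = 1"
proof -
  let ?a = "zk k"
  let ?h = "\<lambda>z. z powr \<nu> * (bessel_F \<nu> (?a * z) * bessel_F \<nu> (?a * z))"
  let ?H = "\<lambda>z. (z * (?a * bessel_F' \<nu> (?a * z)) * zflux ?a z + ?a / 4 * (z powr (\<nu> + 1) * (bessel_F \<nu> (?a * z))\<^sup>2)
        + \<nu> * (zflux ?a z * bessel_F \<nu> (?a * z))) / (?a / 4)"
  have a: "?a > 0" using zk_pos k by simp
  have d: "(?H has_real_derivative ?h z) (at z)" if "0 < z" for z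
    using DERIV_cdivide[OF DERIV_square[OF that, of ?a], of "?a / 4"] a by simp
  have c: "continuous_on {0..1} ?H"
    using a nu_nonneg
    by (intro continuous_intros continuous_on_powr' continuous_on_F_scaled continuous_on_F'_scaled
        continuous_on_subset[OF continuous_on_zflux]) auto
  let ?g = "\<lambda>x. x powr (2 * \<kappa> - 1) * ?h (x powr (2 * \<kappa>))"
  have ig: "integrable (lebesgue_on {0<..<1}) ?g"
    by (rule integrable_subst[OF c d]) auto
  have "integral\<^sup>L (lebesgue_on {0<..<1}) ?g = (?H 1 - ?H 0) / (2 * \<kappa>)"
    by (rule integral_subst[OF c d ig])
  \<comment> \<open>Because F(z_k) = 0, only the term with F'^2 survives at z = 1.\<close>
  also have "?H 1 - ?H 0 = 4 * (?a * (bessel_F' \<nu> ?a)\<^sup>2)"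
    using a F_zk[OF k] by (simp add: zflux_def power2_eq_square)
  finally have I: "integral\<^sup>L (lebesgue_on {0<..<1}) ?g = 4 * (?a * (bessel_F' \<nu> ?a)\<^sup>2) / (2 * \<kappa>)" .
  have m: "(\<lambda>x. \<Phi> k x * \<Phi> k x) \<in> borel_measurable (lebesgue_on {0<..<1})"
    using measurable_eigenfun[OF k] by (intro borel_measurable_times)
  have eq: "x powr \<beta> * (\<Phi> k x * \<Phi> k x) = bk k * bk k * ?g x" if "x \<in> {0<..<1}" for x
    using that eigenfun_prod[OF k k, of x] by auto
  show "integrable W (\<lambda>x. \<Phi> k x * \<Phi> k x)"
    using integrable_W_iff[OF m eq] ig bk_pos[OF k] by simp
  have "integral\<^sup>L W (\<lambda>x. \<Phi> k x * \<Phi> k x) = bk k * bk k * integral\<^sup>L (lebesgue_on {0<..<1}) ?g"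
    by (rule integral_W_eq[OF m eq])
  also have "\<dots> = (bk k)\<^sup>2 * (4 * (?a * (bessel_F' \<nu> ?a)\<^sup>2) / (2 * \<kappa>))"
    unfolding I by (simp add: power2_eq_square)
  also have "\<dots> = 1"
    unfolding bk_power2[OF k] using a F'_zk[OF k] kappa_pos by (simp add: field_simps)
  finally show "integral\<^sup>L W (\<lambda>x. \<Phi> k x * \<Phi> k x) = 1" .
qed

lemma eigenfun_L2: "k > 0 \<Longrightarrow> \<Phi> k \<in> L2_space W"
  using eigenfun_square(1)[of k] measurable_eigenfun[of k]
  by (simp add: L2_space_def measurable_W power2_eq_square)

lemma eigenfun_orthonormal:
  assumes k: "k > 0" and l: "l > 0"
  shows "L2_inner W (\<Phi> k) (\<Phi> l) = (if k = l then 1 else 0)"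
proof (cases "k = l")
  case True
  then show ?thesis using eigenfun_square(2)[OF k] by (simp add: L2_inner_def)
next
  case False
  let ?a = "zk k" and ?b = "zk l"
  have ab: "?a \<noteq> ?b" using zk_inj False by simp
  let ?h = "\<lambda>z. z powr \<nu> * (bessel_F \<nu> (?a * z) * bessel_F \<nu> (?b * z))"
  let ?H = "\<lambda>z. (zflux ?b z * bessel_F \<nu> (?a * z) - zflux ?a z * bessel_F \<nu> (?b * z)) / ((?a - ?b) / 4)"
  have d: "(?H has_real_derivative ?h z) (at z)" if "0 < z" for z
    using DERIV_cdivide[OF DERIV_cross[OF that, of ?b ?a], of "(?a - ?b) / 4"] ab by simp
  have c: "continuous_on {0..1} ?H"
    using ab
    by (intro continuous_intros continuous_on_F_scaled continuous_on_subset[OF continuous_on_zflux]) auto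
  let ?g = "\<lambda>x. x powr (2 * \<kappa> - 1) * ?h (x powr (2 * \<kappa>))"
  have m: "(\<lambda>x. \<Phi> k x * \<Phi> l x) \<in> borel_measurable (lebesgue_on {0<..<1})"
    using measurable_eigenfun k l by (intro borel_measurable_times)
  have eq: "x powr \<beta> * (\<Phi> k x * \<Phi> l x) = bk k * bk l * ?g x" if "x \<in> {0<..<1}" for x
    using that eigenfun_prod[OF k l, of x] by auto
  have "integrable W (\<lambda>x. \<Phi> k x * \<Phi> l x)"
    using k l by (intro L2_prod_integrable eigenfun_L2)
  then have ig: "integrable (lebesgue_on {0<..<1}) ?g"
    using integrable_W_iff[OF m eq] bk_pos[OF k] bk_pos[OF l] by simp
  have "integral\<^sup>L (lebesgue_on {0<..<1}) ?g = (?H 1 - ?H 0) / (2 * \<kappa>)"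
    by (rule integral_subst[OF c d ig])
  also have "\<dots> = 0"
    using F_zk[OF k] F_zk[OF l] by (simp add: zflux_def)
  finally have "integral\<^sup>L W (\<lambda>x. \<Phi> k x * \<Phi> l x) = 0"
    using integral_W_eq[OF m eq] by simp
  then show ?thesis using False by (simp add: L2_inner_def)
qed

text \<open>Bessel's inequality for \<open>x\<^bsup>expo\<^esup>\<close>, whose coefficients are \<open>\<plusminus>(2 / (\<kappa> z\<^sub>k))\<^bsup>1/2\<^esup>\<close>.\<close>

lemma sum_inverse_zk:
  assumes K: "finite K" "0 \<notin> K"
  shows "(\<Sum>k\<in>K. 1 / zk k) \<le> 1 / 4"
proof -
  let ?u = "\<lambda>x::real. x powr expo"
  have mu: "?u \<in> borel_measurable (lebesgue_on {0<..<1})" by (rule measurable_powr)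
  let ?g = "\<lambda>x::real. x powr (2 * \<kappa> - 1) * (x powr (2 * \<kappa>)) powr \<nu>"
  let ?H = "\<lambda>z::real. z powr (\<nu> + 1) / (\<nu> + 1)"
  have dH: "(?H has_real_derivative z powr \<nu>) (at z)" if "0 < z" for z
    using DERIV_cdivide[OF has_real_derivative_powr[OF that, of "\<nu> + 1"], of "\<nu> + 1"] nu_nonneg by simp
  have cH: "continuous_on {0..1} ?H"
    using nu_nonneg by (intro continuous_intros continuous_on_powr') auto
  have ig: "integrable (lebesgue_on {0<..<1}) ?g"
    by (rule integrable_subst[OF cH dH]) auto
  have I: "integral\<^sup>L (lebesgue_on {0<..<1}) ?g = 1 / (\<nu> + 1) / (2 * \<kappa>)"
    using integral_subst[OF cH dH ig] nu_nonneg by simp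
  have eq: "x powr \<beta> * (?u x * ?u x) = 1 * ?g x" if "x \<in> {0<..<1}" for x
    using that weight_expo[of x] by auto
  have m: "(\<lambda>x. ?u x * ?u x) \<in> borel_measurable (lebesgue_on {0<..<1})"
    using mu by (intro borel_measurable_times)
  have "integrable W (\<lambda>x. ?u x * ?u x)"
    using integrable_W_iff[OF m eq] ig by simp
  then have uL2: "?u \<in> L2_space W" using mu by (simp add: L2_space_def measurable_W power2_eq_square)
  have nu: "L2_inner W ?u ?u = 1 / (\<nu> + 1) / (2 * \<kappa>)"
    unfolding L2_inner_def using integral_W_eq[OF m eq] I by simp
  have coef: "(L2_inner W ?u (\<Phi> k))\<^sup>2 = 2 / (\<kappa> * zk k)" if k: "k > 0" for k
  proof -
    let ?a = "zk k"
    have a: "?a > 0" using zk_pos k by simp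
    let ?h = "\<lambda>z. z powr \<nu> * bessel_F \<nu> (?a * z)"
    let ?g = "\<lambda>x. x powr (2 * \<kappa> - 1) * ?h (x powr (2 * \<kappa>))"
    let ?H = "\<lambda>z. zflux ?a z / (- (?a / 4))"
    have d: "(?H has_real_derivative ?h z) (at z)" if "0 < z" for z
      using DERIV_cdivide[OF DERIV_zflux[OF that, of ?a], of "- (?a / 4)"] a by simp
    have c: "continuous_on {0..1} ?H"
      using a by (intro continuous_intros continuous_on_subset[OF continuous_on_zflux]) auto
    have m: "(\<lambda>x. ?u x * \<Phi> k x) \<in> borel_measurable (lebesgue_on {0<..<1})"
      using mu measurable_eigenfun k by (intro borel_measurable_times)
    have eq: "x powr \<beta> * (?u x * \<Phi> k x) = bk k * ?g x" if "x \<in> {0<..<1}" for x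
    proof -
      have x: "x > 0" using that by simp
      have "x powr \<beta> * (?u x * \<Phi> k x) = (x powr \<beta> * (?u x * ?u x)) * (bk k * bessel_F \<nu> (zk k * x powr (2 * \<kappa>)))"
        by (simp only: eigenfun_eq[OF k x] mult_ac)
      also have "x powr \<beta> * (?u x * ?u x) = x powr (2 * \<kappa> - 1) * (x powr (2 * \<kappa>)) powr \<nu>"
        using that by (intro weight_expo) auto
      finally show ?thesis by (simp only: mult_ac)
    qed
    have "integrable W (\<lambda>x. ?u x * \<Phi> k x)"
      using k uL2 by (intro L2_prod_integrable eigenfun_L2)
    then have ig: "integrable (lebesgue_on {0<..<1}) ?g"
      using integrable_W_iff[OF m eq] bk_pos[OF k] by simp
    have "integral\<^sup>L (lebesgue_on {0<..<1}) ?g = (?H 1 - ?H 0) / (2 * \<kappa>)"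
      by (rule integral_subst[OF c d ig])
    also have "\<dots> = - (2 * bessel_F' \<nu> ?a / \<kappa>)"
      using a kappa_pos by (simp add: zflux_def field_simps)
    finally have "L2_inner W ?u (\<Phi> k) = bk k * - (2 * bessel_F' \<nu> ?a / \<kappa>)"
      unfolding L2_inner_def using integral_W_eq[OF m eq] by simp
    then have "(L2_inner W ?u (\<Phi> k))\<^sup>2 = (bk k)\<^sup>2 * (4 * (bessel_F' \<nu> ?a)\<^sup>2 / \<kappa>\<^sup>2)"
      by (simp add: power_mult_distrib power_divide)
    also have "\<dots> = 2 / (\<kappa> * zk k)"
      unfolding bk_power2[OF k] using a F'_zk[OF k] kappa_pos by (simp add: field_simps power2_eq_square)
    finally show ?thesis .
  qed
  have pos: "k > 0" if "k \<in> K" for k using that K by (cases k) auto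
  have "(\<Sum>k\<in>K. (L2_inner W ?u (\<Phi> k))\<^sup>2) \<le> (L2_norm W ?u)\<^sup>2"
    using pos by (intro L2_Bessel_inequality uL2 eigenfun_L2 K eigenfun_orthonormal) auto
  then have "(\<Sum>k\<in>K. 2 / (\<kappa> * zk k)) \<le> 1 / (\<nu> + 1) / (2 * \<kappa>)"
    using pos by (simp add: coef L2_norm_power2 nu)
  also have "(\<Sum>k\<in>K. 2 / (\<kappa> * zk k)) = 2 / \<kappa> * (\<Sum>k\<in>K. 1 / zk k)"
    by (simp add: sum_distrib_left)
  finally have "\<kappa> / 2 * (2 / \<kappa> * (\<Sum>k\<in>K. 1 / zk k)) \<le> \<kappa> / 2 * (1 / (\<nu> + 1) / (2 * \<kappa>))"
    using kappa_pos by (intro mult_left_mono) auto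
  also have "\<kappa> / 2 * (2 / \<kappa> * (\<Sum>k\<in>K. 1 / zk k)) = (\<Sum>k\<in>K. 1 / zk k)"
    using kappa_pos by simp
  also have "\<kappa> / 2 * (1 / (\<nu> + 1) / (2 * \<kappa>)) = 1 / (4 * (\<nu> + 1))"
    using kappa_pos by simp
  \<comment> \<open>The value 1 / (4 (nu + 1)) is Rayleigh's sum over all zeros; a bound uniform in
    nu is kept.\<close>
  also have "\<dots> \<le> 1 / 4" using nu_nonneg by (simp add: field_simps)
  finally show ?thesis .
qed

end

section \<open>Weak solutions and the moment problem\<close>

lemma power_exp_le:
  fixes x y :: real
  assumes "x \<ge> 0" "y > 0"
  shows "x ^ n * exp (- y * x) \<le> fact n / y ^ n"
proof -
  have s: "(\<lambda>k. inverse (fact k) * (y * x) ^ k) sums exp (y * x)"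
    using exp_converges[of "y * x"] by simp
  have "(\<Sum>k\<in>{n}. inverse (fact k) * (y * x) ^ k) \<le> (\<Sum>k. inverse (fact k) * (y * x) ^ k)"
    using assms by (intro sum_le_suminf sums_summable[OF s]) auto
  then have "(y * x) ^ n / fact n \<le> exp (y * x)" using sums_unique[OF s] by (simp add: field_simps)
  then show ?thesis using assms by (simp add: exp_minus field_simps power_mult_distrib)
qed

lemma powr_exp_bound:
  fixes p t x0 :: real
  assumes "t > 0" "x0 > 0"
  shows "\<exists>C>0. \<forall>x\<ge>x0. x powr p * exp (- t * x) \<le> C"
proof -
  define n where "n = nat \<lceil>\<bar>p\<bar>\<rceil>"
  have n: "p - real n \<le> 0" unfolding n_def by linarith
  define C where "C = x0 powr (p - real n) * (fact n / t ^ n)"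
  have "x powr p * exp (- t * x) \<le> C" if "x \<ge> x0" for x
  proof -
    have x: "x > 0" using that assms by simp
    have "x powr p = x powr (p - real n) * x ^ n"
      using x by (simp add: powr_diff powr_realpow)
    moreover have "x powr (p - real n) \<le> x0 powr (p - real n)"
      using that assms n by (intro powr_mono2') auto
    moreover have "x ^ n * exp (- t * x) \<le> fact n / t ^ n"
      using x assms by (intro power_exp_le) auto
    ultimately show ?thesis
      unfolding C_def using x by (simp only: mult.assoc) (intro mult_mono, auto)
  qed
  moreover have "C > 0" using assms by (simp add: C_def)
  ultimately show ?thesis by blast
qed

lemma summable_suminf_Cauchy_Schwarz:
  fixes a b :: "nat \<Rightarrow> real"
  assumes a: "summable (\<lambda>k. (a k)\<^sup>2)" and b: "summable (\<lambda>k. (b k)\<^sup>2)"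
  shows "summable (\<lambda>k. \<bar>a k * b k\<bar>)"
    "\<bar>\<Sum>k. a k * b k\<bar> \<le> sqrt (\<Sum>k. (a k)\<^sup>2) * sqrt (\<Sum>k. (b k)\<^sup>2)"
    "(\<Sum>k. \<bar>a k * b k\<bar>) \<le> sqrt (\<Sum>k. (a k)\<^sup>2) * sqrt (\<Sum>k. (b k)\<^sup>2)"
proof -
  have le: "(\<Sum>k<n. \<bar>a k * b k\<bar>) \<le> sqrt (\<Sum>k. (a k)\<^sup>2) * sqrt (\<Sum>k. (b k)\<^sup>2)" for n
  proof -
    have "(\<Sum>k<n. \<bar>a k\<bar> * \<bar>b k\<bar>)\<^sup>2 \<le> (\<Sum>k<n. \<bar>a k\<bar>\<^sup>2) * (\<Sum>k<n. \<bar>b k\<bar>\<^sup>2)"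
      by (rule Cauchy_Schwarz_ineq_sum)
    also have "\<dots> \<le> (\<Sum>k. (a k)\<^sup>2) * (\<Sum>k. (b k)\<^sup>2)"
      using a b by (intro mult_mono) (auto intro!: sum_le_suminf suminf_nonneg sum_nonneg)
    finally have "\<bar>\<Sum>k<n. \<bar>a k\<bar> * \<bar>b k\<bar>\<bar> \<le> sqrt ((\<Sum>k. (a k)\<^sup>2) * (\<Sum>k. (b k)\<^sup>2))"
      by (metis real_sqrt_abs real_sqrt_le_mono)
    then show ?thesis by (simp add: real_sqrt_mult abs_mult)
  qed
  show s: "summable (\<lambda>k. \<bar>a k * b k\<bar>)"
  proof (rule bounded_imp_summable)
    show "(\<Sum>k\<le>n. \<bar>a k * b k\<bar>) \<le> sqrt (\<Sum>k. (a k)\<^sup>2) * sqrt (\<Sum>k. (b k)\<^sup>2)" for n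
      using le[of "Suc n"] unfolding lessThan_Suc_atMost .
  qed simp
  show c: "(\<Sum>k. \<bar>a k * b k\<bar>) \<le> sqrt (\<Sum>k. (a k)\<^sup>2) * sqrt (\<Sum>k. (b k)\<^sup>2)"
    by (rule suminf_le_const[OF s le])
  show "\<bar>\<Sum>k. a k * b k\<bar> \<le> sqrt (\<Sum>k. (a k)\<^sup>2) * sqrt (\<Sum>k. (b k)\<^sup>2)"
    using summable_rabs[OF s] c by simp
qed

lemma lebesgue_on_subset:
  fixes f :: "real \<Rightarrow> real"
  assumes "A \<subseteq> B" "A \<in> sets lebesgue" "B \<in> sets lebesgue"
  shows "f \<in> borel_measurable (lebesgue_on B) \<Longrightarrow> f \<in> borel_measurable (lebesgue_on A)"
    "integrable (lebesgue_on B) f \<Longrightarrow> integrable (lebesgue_on A) f"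
proof -
  show "f \<in> borel_measurable (lebesgue_on B) \<Longrightarrow> f \<in> borel_measurable (lebesgue_on A)"
    by (rule measurable_restrict_mono[OF _ assms(1)])
  assume "integrable (lebesgue_on B) f"
  then have "set_integrable lebesgue B f"
    using assms by (simp add: integrable_restrict_space set_integrable_def)
  then have "set_integrable lebesgue A f"
    by (rule set_integrable_subset) (use assms in auto)
  then show "integrable (lebesgue_on A) f"
    using assms by (simp add: integrable_restrict_space set_integrable_def)
qed

lemma L2_time_subset:
  assumes "f \<in> L2_space (time_measure T)" "\<tau> \<le> T"
  shows "f \<in> L2_space (time_measure \<tau>)" "L2_norm (time_measure \<tau>) f \<le> L2_norm (time_measure T) f"
proof -
  have sub: "{0<..<\<tau>} \<subseteq> {0<..<T}" using assms by auto
  show 1: "f \<in> L2_space (time_measure \<tau>)"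
    using L2_spaceD[OF assms(1)] lebesgue_on_subset(1)[OF sub, of f]
      lebesgue_on_subset(2)[OF sub, of "\<lambda>x. (f x)\<^sup>2"]
    by (simp add: L2_space_def)
  have "(\<integral>x. (f x)\<^sup>2 \<partial>time_measure \<tau>) \<le> (\<integral>x. (f x)\<^sup>2 \<partial>time_measure T)"
  proof -
    have i: "integrable lebesgue (\<lambda>x. indicator {0<..<\<tau>} x *\<^sub>R (f x)\<^sup>2)" "integrable lebesgue (\<lambda>x. indicator {0<..<T} x *\<^sub>R (f x)\<^sup>2)"
      using 1 assms by (simp_all add: L2_space_def integrable_restrict_space)
    show ?thesis
      using sub by (subst (1 2) integral_restrict_space) (auto intro!: integral_mono i[simplified] split: split_indicator)
  qed
  then show "L2_norm (time_measure \<tau>) f \<le> L2_norm (time_measure T) f"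
    by (simp add: L2_norm_def L2_inner_def power2_eq_square)
qed

section \<open>Exponential moments of controls\<close>

lemma exp_L2_time:
  assumes "l > 0" "\<tau> \<ge> 0"
  shows "(\<lambda>t. exp (- l * (\<tau> - t))) \<in> L2_space (time_measure \<tau>)"
    "L2_norm (time_measure \<tau>) (\<lambda>t. exp (- l * (\<tau> - t))) \<le> 1 / sqrt (2 * l)"
proof -
  let ?H = "\<lambda>t. exp (- (2 * l) * (\<tau> - t)) / (2 * l)"
  have sq: "(exp (- l * (\<tau> - t)))\<^sup>2 = exp (- (2 * l) * (\<tau> - t))" for t
    by (simp add: power2_eq_square flip: exp_add)
  have d: "(?H has_real_derivative (exp (- l * (\<tau> - t)))\<^sup>2) (at t)" for t
    unfolding sq using assms by (auto intro!: derivative_eq_intros)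
  have c: "continuous_on {0..\<tau>} ?H"
    by (rule DERIV_at_continuous_on[OF d])
  have i: "integrable (time_measure \<tau>) (\<lambda>t. (exp (- l * (\<tau> - t)))\<^sup>2)"
    by (rule integrable_lebesgue_on_FTC_nonneg[OF assms(2) c d]) auto
  have m: "(\<lambda>t. exp (- l * (\<tau> - t))) \<in> borel_measurable (time_measure \<tau>)"
    by (intro continuous_on_borel_measurable_lebesgue_on continuous_intros) auto
  show "(\<lambda>t. exp (- l * (\<tau> - t))) \<in> L2_space (time_measure \<tau>)"
    using i m by (simp add: L2_space_def)
  have "integral\<^sup>L (time_measure \<tau>) (\<lambda>t. (exp (- l * (\<tau> - t)))\<^sup>2) = ?H \<tau> - ?H 0"
    by (rule integral_lebesgue_on_FTC[OF assms(2) c d i])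
  also have "\<dots> \<le> 1 / (2 * l)" using assms by simp
  finally have "L2_inner (time_measure \<tau>) (\<lambda>t. exp (- l * (\<tau> - t))) (\<lambda>t. exp (- l * (\<tau> - t))) \<le> 1 / (2 * l)"
    by (simp add: L2_inner_def power2_eq_square)
  then show "L2_norm (time_measure \<tau>) (\<lambda>t. exp (- l * (\<tau> - t))) \<le> 1 / sqrt (2 * l)"
    unfolding L2_norm_def by (metis real_sqrt_divide real_sqrt_le_mono real_sqrt_one)
qed

text \<open>For l = lam k and up to the factor -\<open>bk k\<close>, this is the k-th coefficient at
  time tau of the response to f.\<close>

definition exp_moment :: "(real \<Rightarrow> real) \<Rightarrow> real \<Rightarrow> real \<Rightarrow> real" where
  "exp_moment f l \<tau> = (\<integral>t. f t * exp (- l * (\<tau> - t)) \<partial>time_measure \<tau>)"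

lemma exp_moment_bound:
  assumes "f \<in> L2_space (time_measure T)" "l > 0" "0 \<le> \<tau>" "\<tau> \<le> T"
  shows "integrable (time_measure \<tau>) (\<lambda>t. f t * exp (- l * (\<tau> - t)))"
    "(\<integral>t. \<bar>f t * exp (- l * (\<tau> - t))\<bar> \<partial>time_measure \<tau>) \<le> L2_norm (time_measure T) f / sqrt (2 * l)"
    "\<bar>exp_moment f l \<tau>\<bar> \<le> L2_norm (time_measure T) f / sqrt (2 * l)"
proof -
  let ?e = "\<lambda>t. exp (- l * (\<tau> - t))"
  note f = L2_time_subset[OF assms(1,4)] and e = exp_L2_time[OF assms(2,3)]
  show i: "integrable (time_measure \<tau>) (\<lambda>t. f t * ?e t)"
    using f e by (intro L2_prod_integrable)
  have fa: "(\<lambda>t. \<bar>f t\<bar>) \<in> L2_space (time_measure \<tau>)"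
    using f by (auto simp: L2_space_def)
  have "\<bar>L2_inner (time_measure \<tau>) (\<lambda>t. \<bar>f t\<bar>) ?e\<bar> \<le> L2_norm (time_measure \<tau>) (\<lambda>t. \<bar>f t\<bar>) * L2_norm (time_measure \<tau>) ?e"
    by (rule L2_Cauchy_Schwarz[OF fa e(1)])
  also have "L2_norm (time_measure \<tau>) (\<lambda>t. \<bar>f t\<bar>) = L2_norm (time_measure \<tau>) f"
    by (simp add: L2_norm_def L2_inner_def)
  also have "L2_norm (time_measure \<tau>) f * L2_norm (time_measure \<tau>) ?e \<le> L2_norm (time_measure T) f * (1 / sqrt (2 * l))"
    by (intro mult_mono f e L2_norm_nonneg)
  finally show b: "(\<integral>t. \<bar>f t * ?e t\<bar> \<partial>time_measure \<tau>) \<le> L2_norm (time_measure T) f / sqrt (2 * l)"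
    by (simp add: L2_inner_def abs_mult)
  show "\<bar>exp_moment f l \<tau>\<bar> \<le> L2_norm (time_measure T) f / sqrt (2 * l)"
    unfolding exp_moment_def using integral_abs_bound[of "time_measure \<tau>" "\<lambda>t. f t * ?e t"] b by linarith
qed

text \<open>Splitting off exp(-l tau) leaves an indefinite integral, which is continuous in its
  upper limit.\<close>

lemma continuous_on_exp_moment:
  assumes "f \<in> L2_space (time_measure T)" "l > 0" "0 \<le> T"
  shows "continuous_on {0..T} (exp_moment f l)"
proof -
  let ?g = "\<lambda>t. f t * exp (l * t)"
  have eq: "exp_moment f l \<tau> = exp (- l * \<tau>) * integral {0..\<tau>} ?g \<and> ?g integrable_on {0..\<tau>}"
    if \<tau>: "0 \<le> \<tau>" "\<tau> \<le> T" for \<tau>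
  proof -
    have e: "f t * exp (- l * (\<tau> - t)) = exp (- l * \<tau>) * ?g t" for t
      by (simp add: algebra_simps flip: exp_add)
    have "integrable (time_measure \<tau>) (\<lambda>t. exp (- l * \<tau>) * ?g t)"
      using exp_moment_bound(1)[OF assms(1,2) \<tau>] unfolding e .
    then have "integrable (time_measure \<tau>) ?g" by simp
    then have hi: "(?g has_integral (integral\<^sup>L (time_measure \<tau>) ?g)) {0..\<tau>}"
      unfolding has_integral_Icc_iff_Ioo by (intro has_integral_integral_lebesgue_on) auto
    have "exp_moment f l \<tau> = exp (- l * \<tau>) * integral\<^sup>L (time_measure \<tau>) ?g"
      unfolding exp_moment_def e by simp
    then show ?thesis using hi by (auto simp: integral_unique)
  qed
  have "continuous_on {0..T} (\<lambda>\<tau>. exp (- l * \<tau>) * integral {0..\<tau>} ?g)"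
    using eq[of T] assms by (intro continuous_intros indefinite_integral_continuous_1) auto
  then show ?thesis
    using eq by (subst continuous_on_cong[OF refl]) auto
qed

context degenerate_parabolic
begin

subsection \<open>Coefficients and summability\<close>

abbreviation "cf \<equiv> coef \<alpha> \<beta> \<mu>"

lemma coef_add:
  "z \<in> L2_space W \<Longrightarrow> w \<in> L2_space W \<Longrightarrow> k > 0 \<Longrightarrow> cf (\<lambda>x. z x + w x) k = cf z k + cf w k"
  unfolding coef_def by (intro L2_inner_add_left eigenfun_L2)

lemma coef_scale: "cf (\<lambda>x. c * z x) k = c * cf z k"
  unfolding coef_def by (rule L2_inner_scale_left)

lemma coef_eigenfun: "k > 0 \<Longrightarrow> l > 0 \<Longrightarrow> cf (\<Phi> l) k = (if k = l then 1 else 0)"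
  unfolding coef_def using eigenfun_orthonormal[of l k] by auto

lemma eigenfun_norm: "k > 0 \<Longrightarrow> L2_norm W (\<Phi> k) = 1"
  using eigenfun_orthonormal[of k k] by (simp add: L2_norm_def)

lemma coef_bound:
  assumes "z \<in> L2_space W" "k > 0"
  shows "\<bar>cf z k\<bar> \<le> L2_norm W z"
  using L2_Cauchy_Schwarz[OF assms(1) eigenfun_L2[OF assms(2)]] eigenfun_norm[OF assms(2)]
  by (simp add: coef_def)

lemma coef_square_sum:
  assumes "z \<in> L2_space W"
  shows "(\<Sum>k<n. (cf z (Suc k))\<^sup>2) \<le> (L2_norm W z)\<^sup>2"
proof -
  have "(\<Sum>k<n. (cf z (Suc k))\<^sup>2) = (\<Sum>k\<in>Suc ` {..<n}. (L2_inner W z (\<Phi> k))\<^sup>2)"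
    by (subst sum.reindex) (auto simp: coef_def)
  also have "\<dots> \<le> (L2_norm W z)\<^sup>2"
    by (intro L2_Bessel_inequality assms eigenfun_L2 eigenfun_orthonormal) auto
  finally show ?thesis .
qed

lemma coef_square_summable:
  assumes "z \<in> L2_space W"
  shows "summable (\<lambda>k. (cf z (Suc k))\<^sup>2)" "(\<Sum>k. (cf z (Suc k))\<^sup>2) \<le> (L2_norm W z)\<^sup>2"
proof -
  show s: "summable (\<lambda>k. (cf z (Suc k))\<^sup>2)"
  proof (rule bounded_imp_summable)
    show "(\<Sum>k\<le>n. (cf z (Suc k))\<^sup>2) \<le> (L2_norm W z)\<^sup>2" for n
      using coef_square_sum[OF assms, of "Suc n"] unfolding lessThan_Suc_atMost .
  qed simp
  show "(\<Sum>k. (cf z (Suc k))\<^sup>2) \<le> (L2_norm W z)\<^sup>2"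
    by (rule suminf_le_const[OF s coef_square_sum[OF assms]])
qed

text \<open>The sequence a in \<open>Hs\<close> is only asserted to exist. Pairing the remainder of
  the expansion with Phi_k identifies it with the coefficients.\<close>

lemma Hs_coef:
  assumes "z \<in> Hs \<alpha> \<beta> \<mu> s"
  shows "z \<in> L2_space W" "summable (\<lambda>k. (cf z (Suc k))\<^sup>2 * lam (Suc k) powr s)"
proof -
  from assms obtain a where z: "z \<in> L2_space W"
    and a: "(\<lambda>n. L2_norm W (\<lambda>x. z x - (\<Sum>k=1..n. a k * \<Phi> k x))) \<longlonglongrightarrow> 0"
    and s: "summable (\<lambda>k. (a (Suc k))\<^sup>2 * lam (Suc k) powr s)"
    unfolding Hs_def by blast
  have "cf z k = a k" if k: "k > 0" for k
  proof -
    let ?r = "\<lambda>n x. z x - (\<Sum>k=1..n. a k * \<Phi> k x)"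
    have S: "(\<lambda>x. \<Sum>k=1..n. a k * \<Phi> k x) \<in> L2_space W" for n
      by (intro L2_sum L2_scale eigenfun_L2) auto
    have "\<bar>cf z k - a k\<bar> \<le> L2_norm W (?r n)" if "n \<ge> k" for n
    proof -
      have "L2_inner W (\<lambda>x. \<Sum>l=1..n. a l * \<Phi> l x) (\<Phi> k) = (\<Sum>l=1..n. a l * L2_inner W (\<Phi> l) (\<Phi> k))"
        using k L2_inner_sum_left[of "{1..n}" "\<lambda>l x. a l * \<Phi> l x" W "\<Phi> k", OF L2_scale[OF eigenfun_L2]]
        by (simp add: L2_inner_scale_left eigenfun_L2)
      also have "\<dots> = (\<Sum>l=1..n. if l = k then a l else 0)"
        using k by (intro sum.cong) (auto simp: eigenfun_orthonormal)
      also have "\<dots> = a k" using that k by simp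
      finally have "cf (?r n) k = cf z k - a k"
        unfolding coef_def using L2_inner_diff_left[OF z S eigenfun_L2[OF k]] by simp
      then show ?thesis using coef_bound[OF L2_diff[OF z S[of n]] k] by simp
    qed
    then have "\<forall>\<^sub>F n in sequentially. \<bar>cf z k - a k\<bar> \<le> L2_norm W (?r n)"
      by (auto intro: eventually_sequentiallyI)
    with a have "\<bar>cf z k - a k\<bar> \<le> 0"
      by (intro tendsto_lowerbound) auto
    then show ?thesis by simp
  qed
  then show "z \<in> L2_space W" "summable (\<lambda>k. (cf z (Suc k))\<^sup>2 * lam (Suc k) powr s)"
    using z s by auto
qed

lemma eigenfun_Hs:
  assumes "k > 0"
  shows "\<Phi> k \<in> Hs \<alpha> \<beta> \<mu> s"
proof -
  let ?a = "\<lambda>l. if l = k then 1 else 0 :: real"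
  have "(\<Sum>l=1..n. ?a l * \<Phi> l x) = \<Phi> k x" if "n \<ge> k" for n x
  proof -
    have "(\<Sum>l=1..n. ?a l * \<Phi> l x) = (\<Sum>l=1..n. if l = k then \<Phi> l x else 0)"
      by (intro sum.cong) auto
    then show ?thesis using that assms by simp
  qed
  then have "\<forall>\<^sub>F n in sequentially. L2_norm W (\<lambda>x. \<Phi> k x - (\<Sum>l=1..n. ?a l * \<Phi> l x)) = 0"
    by (intro eventually_sequentiallyI[of k]) (simp add: L2_norm_def L2_inner_def)
  then have "(\<lambda>n. L2_norm W (\<lambda>x. \<Phi> k x - (\<Sum>l=1..n. ?a l * \<Phi> l x))) \<longlonglongrightarrow> 0"
    by (rule tendsto_eventually)
  moreover have "summable (\<lambda>l. (?a (Suc l))\<^sup>2 * lam (Suc l) powr s)"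
    by (rule summable_finite[of "{k - 1}"]) auto
  ultimately show ?thesis
    unfolding Hs_def using eigenfun_L2[OF assms] by (intro CollectI conjI exI[of _ ?a])
qed

lemma summable_inverse_lam: "summable (\<lambda>k. 1 / lam (Suc k))"
proof -
  have "summable (\<lambda>k. 1 / zk (Suc k))"
  proof (rule bounded_imp_summable[of _ "1/4"])
    show "0 \<le> 1 / zk (Suc n)" for n using zk_pos[of "Suc n"] by simp
    show "(\<Sum>k\<le>n. 1 / zk (Suc k)) \<le> 1 / 4" for n
      using sum_inverse_zk[of "Suc ` {..n}"] by (simp add: sum.reindex)
  qed
  from summable_mult[OF this, of "1 / \<kappa>\<^sup>2"] show ?thesis
    by (simp add: lam_eq field_simps)
qed

lemma summable_lam_exp:
  assumes "t > 0"
  shows "summable (\<lambda>k. lam (Suc k) powr p * exp (- lam (Suc k) * t))"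
proof -
  obtain C where C: "C > 0" "\<And>x. x \<ge> lam 1 \<Longrightarrow> x powr (p + 1) * exp (- t * x) \<le> C"
    using powr_exp_bound[OF assms lam_pos[of 1], of "p + 1"] by auto
  show ?thesis
  proof (rule summable_comparison_test)
    show "summable (\<lambda>k. C * (1 / lam (Suc k)))" by (intro summable_mult summable_inverse_lam)
    show "\<exists>N. \<forall>n\<ge>N. norm (lam (Suc n) powr p * exp (- lam (Suc n) * t)) \<le> C * (1 / lam (Suc n))"
    proof (intro exI allI impI)
      fix n
      have l: "lam (Suc n) > 0" "lam (Suc n) \<ge> lam 1" using lam_pos lam_mono by auto
      have "lam (Suc n) powr (p + 1) * exp (- lam (Suc n) * t) \<le> C"
        using C(2)[OF l(2)] by (simp add: mult.commute)
      then show "norm (lam (Suc n) powr p * exp (- lam (Suc n) * t)) \<le> C * (1 / lam (Suc n))"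
        using l by (simp add: powr_add field_simps)
    qed
  qed
qed

lemma bk_square_bound: "\<exists>C>0. \<forall>k>0. (bk k)\<^sup>2 \<le> C * j k powr (2 * \<nu> + 1)"
proof -
  obtain c where c: "c > 0" "\<And>k. k > 0 \<Longrightarrow> (j k) powr (2 * \<nu> + 3) * (bessel_F' \<nu> (zk k))\<^sup>2 \<ge> c"
    using bessel_F'_lower[OF nu_nonneg] unfolding zk_def by auto
  have "(bk k)\<^sup>2 \<le> \<kappa> / (2 * c) * j k powr (2 * \<nu> + 1)" if k: "k > 0" for k
  proof -
    have j: "j k > 0" using j_pos k by simp
    have "2 * \<nu> + 3 = (2 * \<nu> + 1) + 2" by simp
    then have jp: "j k powr (2 * \<nu> + 3) = j k powr (2 * \<nu> + 1) * zk k"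
      using j by (simp only: powr_add powr_numeral zk_def)
    have "(bk k)\<^sup>2 * c \<le> (bk k)\<^sup>2 * ((j k) powr (2 * \<nu> + 3) * (bessel_F' \<nu> (zk k))\<^sup>2)"
      by (intro mult_left_mono c k) auto
    also have "\<dots> = \<kappa> / 2 * j k powr (2 * \<nu> + 1)"
      unfolding bk_power2[OF k] jp using zk_pos[OF k] F'_zk[OF k] by (simp add: field_simps)
    finally show ?thesis using c by (simp add: field_simps)
  qed
  then show ?thesis using c kappa_pos by (intro exI[of _ "\<kappa> / (2 * c)"]) auto
qed

text \<open>Here the threshold s > nu arises: b_k^2 is at most of order j_k^(2 nu + 1), so the terms
  are at most of order j_k^(2 nu - 2 s - 1), and j_k grows at least linearly.\<close>

lemma summable_bk_lam:
  assumes "s > \<nu>"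
  shows "summable (\<lambda>k. (bk (Suc k))\<^sup>2 * lam (Suc k) powr (- s - 1))"
proof -
  obtain C where C: "C > 0" "\<And>k. k > 0 \<Longrightarrow> (bk k)\<^sup>2 \<le> C * j k powr (2 * \<nu> + 1)"
    using bk_square_bound by auto
  obtain c where c: "c > 0" "\<And>k. j k \<ge> c * real k"
    using bessel_zero_linear_growth[OF nu_nonneg] by auto
  define D where "D = C * (\<kappa>\<^sup>2) powr (- s - 1) * c powr (2 * \<nu> - 2 * s - 1)"
  show ?thesis
  proof (rule summable_comparison_test)
    have "summable (\<lambda>k. real k powr (2 * \<nu> - 2 * s - 1))"
      using assms by (subst summable_real_powr_iff) auto
    then have "summable (\<lambda>k. real (Suc k) powr (2 * \<nu> - 2 * s - 1))"
      by (subst summable_Suc_iff)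
    then show "summable (\<lambda>k. D * real (Suc k) powr (2 * \<nu> - 2 * s - 1))" by (rule summable_mult)
    show "\<exists>N. \<forall>n\<ge>N. norm ((bk (Suc n))\<^sup>2 * lam (Suc n) powr (- s - 1)) \<le> D * real (Suc n) powr (2 * \<nu> - 2 * s - 1)"
    proof (intro exI allI impI)
      fix n
      define k where "k = Suc n"
      have k: "k > 0" by (simp add: k_def)
      have j: "j k > 0" using j_pos k by simp
      have "lam k powr (- s - 1) = (\<kappa>\<^sup>2) powr (- s - 1) * (j k) powr (2 * (- s - 1))"
      proof -
        have "zk k = j k powr 2" using j by (simp add: zk_def powr_numeral)
        then have "lam k = \<kappa>\<^sup>2 * j k powr 2" by (simp only: lam_eq)
        then show ?thesis using j kappa_pos by (simp only: powr_mult powr_powr zero_le_power2 powr_ge_zero)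
      qed
      then have "(bk k)\<^sup>2 * lam k powr (- s - 1) \<le> C * j k powr (2 * \<nu> + 1) * ((\<kappa>\<^sup>2) powr (- s - 1) * (j k) powr (2 * (- s - 1)))"
        using C(2)[OF k] C(1) by (intro mult_mono) auto
      also have "\<dots> = C * (\<kappa>\<^sup>2) powr (- s - 1) * j k powr (2 * \<nu> - 2 * s - 1)"
      proof -
        have "2 * \<nu> - 2 * s - 1 = (2 * \<nu> + 1) + 2 * (- s - 1)" by simp
        then have "j k powr (2 * \<nu> - 2 * s - 1) = j k powr (2 * \<nu> + 1) * j k powr (2 * (- s - 1))"
          by (simp only: powr_add)
        then show ?thesis by simp
      qed
      also have "\<dots> \<le> C * (\<kappa>\<^sup>2) powr (- s - 1) * (c * real k) powr (2 * \<nu> - 2 * s - 1)"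
        using c(1) c(2)[of k] C(1) k assms by (intro mult_left_mono powr_mono2') auto
      also have "\<dots> = D * real k powr (2 * \<nu> - 2 * s - 1)"
        using c k by (simp add: D_def powr_mult)
      finally show "norm ((bk (Suc n))\<^sup>2 * lam (Suc n) powr (- s - 1)) \<le> D * real (Suc n) powr (2 * \<nu> - 2 * s - 1)"
        unfolding k_def by simp
    qed
  qed
qed

lemma summable_bk_exp:
  assumes "t > 0"
  shows "summable (\<lambda>k. bk (Suc k) * exp (- lam (Suc k) * t))"
proof (rule summable_comparison_test)
  let ?s = "\<nu> + 1"
  have "summable (\<lambda>k. lam (Suc k) powr (?s + 1) * exp (- lam (Suc k) * (2 * t)))"
    using assms by (intro summable_lam_exp) auto
  then show "summable (\<lambda>k. (bk (Suc k))\<^sup>2 * lam (Suc k) powr (- ?s - 1)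
      + lam (Suc k) powr (?s + 1) * exp (- lam (Suc k) * (2 * t)))"
    by (intro summable_add summable_bk_lam) auto
  show "\<exists>N. \<forall>n\<ge>N. norm (bk (Suc n) * exp (- lam (Suc n) * t)) \<le>
     (bk (Suc n))\<^sup>2 * lam (Suc n) powr (- ?s - 1) + lam (Suc n) powr (?s + 1) * exp (- lam (Suc n) * (2 * t))"
  proof (intro exI allI impI)
    fix n
    let ?l = "lam (Suc n)" and ?b = "bk (Suc n)"
    have l: "?l > 0" and b: "?b > 0" using lam_pos bk_pos by auto
    \<comment> \<open>The term in question is \<open>x * y\<close>, while x^2 and y^2 belong to the
      two summable series.\<close>
    define x where "x = ?b * ?l powr (- ((?s + 1) / 2))"
    define y where "y = ?l powr ((?s + 1) / 2) * exp (- ?l * t)"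
    have "?l powr (- ((?s + 1) / 2)) * ?l powr ((?s + 1) / 2) = 1"
      using l by (simp only: powr_minus) simp
    then have xy: "x * y = ?b * exp (- ?l * t)"
      by (simp add: x_def y_def mult_ac)
    have "(?l powr (- ((?s + 1) / 2)))\<^sup>2 = ?l powr (- ?s - 1)"
      unfolding power2_eq_square powr_add[symmetric] by (rule arg_cong[where f = "\<lambda>e. ?l powr e"]) (simp add: field_simps)
    then have "x\<^sup>2 = ?b\<^sup>2 * ?l powr (- ?s - 1)"
      by (simp only: x_def power_mult_distrib)
    moreover have "(?l powr ((?s + 1) / 2))\<^sup>2 = ?l powr (?s + 1)"
      unfolding power2_eq_square powr_add[symmetric] by (rule arg_cong[where f = "\<lambda>e. ?l powr e"]) (simp add: field_simps)
    then have "y\<^sup>2 = ?l powr (?s + 1) * exp (- ?l * (2 * t))"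
      unfolding y_def power_mult_distrib by (simp add: power2_eq_square flip: exp_add)
    moreover have "x * y \<le> x\<^sup>2 + y\<^sup>2"
      using sum_squares_bound[of x y] zero_le_power2[of x] zero_le_power2[of y] by linarith
    ultimately show "norm (?b * exp (- ?l * t)) \<le> ?b\<^sup>2 * ?l powr (- ?s - 1) + ?l powr (?s + 1) * exp (- ?l * (2 * t))"
      using xy b by simp
  qed
qed


subsection \<open>The semigroup\<close>

abbreviation "S \<equiv> semigroup_S \<alpha> \<beta> \<mu>"
abbreviation "bdry \<equiv> bdry_limit (\<alpha> + \<beta> + gamma_exp \<alpha> \<beta> \<mu>)"

lemma summable_semigroup:
  assumes z: "z \<in> L2_space W" and t: "t > 0"
  shows "summable (\<lambda>k. exp (- lam (Suc k) * t) * \<bar>cf z (Suc k)\<bar> * bk (Suc k))"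
proof (rule summable_comparison_test)
  show "summable (\<lambda>k. L2_norm W z * (bk (Suc k) * exp (- lam (Suc k) * t)))"
    using t by (intro summable_mult summable_bk_exp)
  show "\<exists>N. \<forall>n\<ge>N. norm (exp (- lam (Suc n) * t) * \<bar>cf z (Suc n)\<bar> * bk (Suc n)) \<le> L2_norm W z * (bk (Suc n) * exp (- lam (Suc n) * t))"
  proof (intro exI allI impI)
    fix n
    have "bk (Suc n) > 0" by (rule bk_pos) simp
    then have "\<bar>cf z (Suc n)\<bar> * (bk (Suc n) * exp (- lam (Suc n) * t)) \<le> L2_norm W z * (bk (Suc n) * exp (- lam (Suc n) * t))"
      using coef_bound[OF z, of "Suc n"] by (intro mult_right_mono) auto
    then show "norm (exp (- lam (Suc n) * t) * \<bar>cf z (Suc n)\<bar> * bk (Suc n)) \<le> L2_norm W z * (bk (Suc n) * exp (- lam (Suc n) * t))"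
      using \<open>bk (Suc n) > 0\<close> by (simp add: abs_mult mult_ac)
  qed
qed

text \<open>After multiplication by x^(-expo) the k-th term differs from its limit only by the
  factor F(z_k x^(2 kappa)), which tends to 1 and is at most 1 in modulus. So Tannery's theorem
  applies with a majorant independent of x.\<close>

lemma bdry_semigroup:
  assumes z: "z \<in> L2_space W" and t: "t > 0"
  shows "bdry (S t z) = (\<Sum>k. exp (- lam (Suc k) * t) * cf z (Suc k) * bk (Suc k))"
proof -
  let ?c = "\<lambda>k. exp (- lam (Suc k) * t) * cf z (Suc k) * bk (Suc k)"
  let ?a = "\<lambda>k x. ?c k * bessel_F \<nu> (zk (Suc k) * x powr (2 * \<kappa>))"
  have bound: "norm (?a k x) \<le> exp (- lam (Suc k) * t) * \<bar>cf z (Suc k)\<bar> * bk (Suc k)" for k x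
  proof -
    have "\<bar>bessel_F \<nu> (zk (Suc k) * x powr (2 * \<kappa>))\<bar> \<le> 1"
      using zk_pos[of "Suc k"] nu_nonneg by (intro bessel_F_abs_le_1) auto
    then have "\<bar>?c k\<bar> * \<bar>bessel_F \<nu> (zk (Suc k) * x powr (2 * \<kappa>))\<bar> \<le> \<bar>?c k\<bar> * 1"
      by (intro mult_left_mono) auto
    then show ?thesis using bk_pos[of "Suc k"] by (simp add: abs_mult)
  qed
  have lim: "(?a k \<longlongrightarrow> ?c k) (at_right 0)" for k
  proof -
    have "((\<lambda>x::real. x powr (2 * \<kappa>)) \<longlongrightarrow> 0) (at_right 0)"
      using kappa_pos by (intro tendsto_zero_powrI[where b = "2 * \<kappa>"] tendsto_intros) (auto simp: eventually_at_filter)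
    then have "((\<lambda>x. zk (Suc k) * x powr (2 * \<kappa>)) \<longlongrightarrow> zk (Suc k) * 0) (at_right 0)"
      by (intro tendsto_intros)
    moreover have "isCont (bessel_F \<nu>) 0"
      using DERIV_bessel_F1[OF nu_nonneg] by (rule DERIV_isCont)
    ultimately have "((\<lambda>x. bessel_F \<nu> (zk (Suc k) * x powr (2 * \<kappa>))) \<longlongrightarrow> bessel_F \<nu> 0) (at_right 0)"
      by (intro isCont_tendsto_compose[of 0 "bessel_F \<nu>"]) auto
    then have "(?a k \<longlongrightarrow> ?c k * bessel_F \<nu> 0) (at_right 0)"
      by (intro tendsto_intros)
    then show ?thesis by (simp add: bessel_F_0)
  qed
  have T: "((\<lambda>x. \<Sum>k. ?a k x) \<longlongrightarrow> (\<Sum>k. ?c k)) (at_right 0)"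
    by (rule tannerys_theorem[OF lim, THEN conjunct2, THEN conjunct2])
       (use bound summable_semigroup[OF z t] in \<open>auto intro!: always_eventually simp: trivial_limit_at_right_real\<close>)
  have eq: "x powr (\<alpha> + \<beta> + gamma_exp \<alpha> \<beta> \<mu>) * S t z x = (\<Sum>k. ?a k x)" if x: "x > 0" for x
  proof -
    have e: "?a k x = x powr (- expo) * (exp (- lam (Suc k) * t) * cf z (Suc k) * \<Phi> (Suc k) x)" for k
      using x by (simp add: eigenfun_eq powr_minus)
    have sm: "summable (\<lambda>k. ?a k x)"
      by (rule summable_comparison_test'[OF summable_semigroup[OF z t]]) (rule bound)
    have "summable (\<lambda>k. exp (- lam (Suc k) * t) * cf z (Suc k) * \<Phi> (Suc k) x)"
      using sm x unfolding e by (subst (asm) summable_cmult_iff) auto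
    then show ?thesis
      using t unfolding e boundary_exponent by (simp add: semigroup_S_def suminf_mult)
  qed
  have "((\<lambda>x. x powr (\<alpha> + \<beta> + gamma_exp \<alpha> \<beta> \<mu>) * S t z x) \<longlongrightarrow> (\<Sum>k. ?c k)) (at_right 0)"
    by (rule Lim_transform_eventually[OF T]) (auto simp: eq eventually_at_filter)
  then show ?thesis unfolding bdry_limit_def by (rule tendsto_Lim[OF trivial_limit_at_right_real])
qed

text \<open>Termwise integration: by Cauchy-Schwarz and the factor exp(-lam k t) the L^1 norms of
  the terms are summable.\<close>

lemma pivot_semigroup:
  assumes u0: "u0 \<in> L2_space W" and z: "z \<in> L2_space W" and t: "t > 0"
  shows "pivot \<beta> u0 (S t z) = (\<Sum>k. exp (- lam (Suc k) * t) * cf z (Suc k) * cf u0 (Suc k))"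
    "summable (\<lambda>k. \<bar>exp (- lam (Suc k) * t) * cf z (Suc k) * cf u0 (Suc k)\<bar>)"
proof -
  let ?c = "\<lambda>k. exp (- lam (Suc k) * t) * cf z (Suc k)"
  let ?f = "\<lambda>k x. ?c k * (u0 x * \<Phi> (Suc k) x)"
  have prod: "integrable W (\<lambda>x. u0 x * \<Phi> (Suc k) x)" for k
    by (intro L2_prod_integrable u0 eigenfun_L2) simp
  have s0: "summable (\<lambda>k. \<bar>?c k\<bar>)"
  proof (rule summable_comparison_test)
    have "summable (\<lambda>k. lam (Suc k) powr 0 * exp (- lam (Suc k) * t))" by (rule summable_lam_exp[OF t])
    then have "summable (\<lambda>k. exp (- lam (Suc k) * t))"
      using lam_pos by (simp add: less_imp_neq[symmetric])
    then show "summable (\<lambda>k. L2_norm W z * exp (- lam (Suc k) * t))" by (rule summable_mult)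
    show "\<exists>N. \<forall>n\<ge>N. norm \<bar>?c n\<bar> \<le> L2_norm W z * exp (- lam (Suc n) * t)"
      using coef_bound[OF z] by (auto simp: abs_mult mult.commute[of "L2_norm W z"])
  qed
  have int: "(\<integral>x. norm (?f k x) \<partial>W) \<le> \<bar>?c k\<bar> * L2_norm W u0" for k
  proof -
    have a: "(\<lambda>x. \<bar>u0 x\<bar>) \<in> L2_space W" "(\<lambda>x. \<bar>\<Phi> (Suc k) x\<bar>) \<in> L2_space W"
      using u0 eigenfun_L2[of "Suc k"] by (auto simp: L2_space_def)
    have "(\<integral>x. norm (?f k x) \<partial>W) = \<bar>?c k\<bar> * L2_inner W (\<lambda>x. \<bar>u0 x\<bar>) (\<lambda>x. \<bar>\<Phi> (Suc k) x\<bar>)"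
      by (simp add: L2_inner_def abs_mult mult.assoc)
    also have "\<dots> \<le> \<bar>?c k\<bar> * (L2_norm W (\<lambda>x. \<bar>u0 x\<bar>) * L2_norm W (\<lambda>x. \<bar>\<Phi> (Suc k) x\<bar>))"
      using L2_Cauchy_Schwarz[OF a] by (intro mult_left_mono) auto
    also have "L2_norm W (\<lambda>x. \<bar>u0 x\<bar>) = L2_norm W u0" by (simp add: L2_norm_def L2_inner_def)
    also have "L2_norm W (\<lambda>x. \<bar>\<Phi> (Suc k) x\<bar>) = L2_norm W (\<Phi> (Suc k))" by (simp add: L2_norm_def L2_inner_def)
    finally show ?thesis using eigenfun_norm[of "Suc k"] by simp
  qed
  have s1: "summable (\<lambda>k. \<integral>x. norm (?f k x) \<partial>W)"
    by (rule summable_comparison_test'[OF summable_mult2[OF s0, of "L2_norm W u0"], of 0]) (use int in auto)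
  have pt: "summable (\<lambda>k. norm (?f k x))" "u0 x * S t z x = (\<Sum>k. ?f k x)" if x: "x \<in> {0<..<1}" for x
  proof -
    have x0: "x > 0" using that by simp
    have s: "summable (\<lambda>k. \<bar>u0 x\<bar> * x powr expo * (exp (- lam (Suc k) * t) * \<bar>cf z (Suc k)\<bar> * bk (Suc k)))"
      by (intro summable_mult summable_semigroup z t)
    show s2: "summable (\<lambda>k. norm (?f k x))"
    proof (rule summable_comparison_test'[OF s, of 0])
      fix n
      have "norm (norm (?f n x)) = \<bar>u0 x\<bar> * (exp (- lam (Suc n) * t) * \<bar>cf z (Suc n)\<bar>) * \<bar>\<Phi> (Suc n) x\<bar>"
        by (simp add: abs_mult)
      also have "\<dots> \<le> \<bar>u0 x\<bar> * (exp (- lam (Suc n) * t) * \<bar>cf z (Suc n)\<bar>) * (bk (Suc n) * x powr expo)"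
        by (intro mult_left_mono eigenfun_bound x0) auto
      finally show "norm (norm (?f n x)) \<le> \<bar>u0 x\<bar> * x powr expo * (exp (- lam (Suc n) * t) * \<bar>cf z (Suc n)\<bar> * bk (Suc n))"
        by (simp add: mult_ac)
    qed
    have s': "summable (\<lambda>k. ?c k * \<Phi> (Suc k) x)"
    proof (rule summable_comparison_test'[OF summable_mult[OF summable_semigroup[OF z t], of "x powr expo"], of 0])
      fix n
      have "norm (?c n * \<Phi> (Suc n) x) = (exp (- lam (Suc n) * t) * \<bar>cf z (Suc n)\<bar>) * \<bar>\<Phi> (Suc n) x\<bar>"
        by (simp add: abs_mult)
      also have "\<dots> \<le> (exp (- lam (Suc n) * t) * \<bar>cf z (Suc n)\<bar>) * (bk (Suc n) * x powr expo)"
        by (intro mult_left_mono eigenfun_bound x0) auto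
      finally show "norm (?c n * \<Phi> (Suc n) x) \<le> x powr expo * (exp (- lam (Suc n) * t) * \<bar>cf z (Suc n)\<bar> * bk (Suc n))"
        by (simp add: mult_ac)
    qed
    show "u0 x * S t z x = (\<Sum>k. ?f k x)"
      using t suminf_mult[OF s', of "u0 x"] by (simp add: semigroup_S_def mult_ac)
  qed
  have "pivot \<beta> u0 (S t z) = (\<integral>x. (\<Sum>k. ?f k x) \<partial>W)"
    unfolding pivot_def L2_inner_def by (intro Bochner_Integration.integral_cong refl pt) simp
  also have "\<dots> = (\<Sum>k. \<integral>x. ?f k x \<partial>W)"
    using pt(1) by (intro integral_suminf integrable_mult_right prod s1 AE_I2) auto
  also have "\<dots> = (\<Sum>k. ?c k * cf u0 (Suc k))"
    by (simp add: coef_def L2_inner_def)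
  finally show "pivot \<beta> u0 (S t z) = (\<Sum>k. ?c k * cf u0 (Suc k))" .
  show "summable (\<lambda>k. \<bar>?c k * cf u0 (Suc k)\<bar>)"
    by (rule summable_comparison_test'[OF summable_mult2[OF s0, of "L2_norm W u0"], of 0])
       (use coef_bound[OF u0] in \<open>auto simp: abs_mult intro!: mult_left_mono\<close>)
qed

text \<open>Termwise integration in time up to t = tau, where exp(-lam k (tau - t)) degenerates. The
  moment still contributes lam_k^(-1/2), and the terms are split as (|c_k| lam_k^(s/2)) (b_k
  lam_k^(-(s+1)/2)): the first factor is square summable since z lies in H^s, the second since s >
  nu.\<close>

lemma boundary_integral:
  assumes f: "f \<in> L2_space (time_measure T)" and z: "z \<in> Hs \<alpha> \<beta> \<mu> s" and s: "s > \<nu>"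
    and \<tau>: "0 < \<tau>" "\<tau> \<le> T"
  shows "(\<integral>t. f t * bdry (S (\<tau> - t) z) \<partial>time_measure \<tau>) = (\<Sum>k. cf z (Suc k) * bk (Suc k) * exp_moment f (lam (Suc k)) \<tau>)"
    "summable (\<lambda>k. \<bar>cf z (Suc k) * bk (Suc k) * exp_moment f (lam (Suc k)) \<tau>\<bar>)"
proof -
  note zz = Hs_coef[OF z]
  let ?F = "L2_norm (time_measure T) f"
  let ?g = "\<lambda>k t. cf z (Suc k) * bk (Suc k) * (f t * exp (- lam (Suc k) * (\<tau> - t)))"
  have b: "\<bar>cf z (Suc k)\<bar> * bk (Suc k) * (?F / sqrt (2 * lam (Suc k)))
      \<le> ?F * ((cf z (Suc k))\<^sup>2 * lam (Suc k) powr s + (bk (Suc k))\<^sup>2 * lam (Suc k) powr (- s - 1))" for k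
  proof -
    let ?l = "lam (Suc k)"
    have l: "?l > 0" by (rule lam_pos) simp
    define x where "x = \<bar>cf z (Suc k)\<bar> * ?l powr (s / 2)"
    define y where "y = bk (Suc k) * ?l powr (- (s + 1) / 2)"
    have x2: "x\<^sup>2 = (cf z (Suc k))\<^sup>2 * ?l powr s"
      by (simp add: x_def power_mult_distrib power2_eq_square[of "_ powr _"] flip: powr_add)
    have "(?l powr (- (s + 1) / 2))\<^sup>2 = ?l powr (- s - 1)"
      unfolding power2_eq_square powr_add[symmetric] by (rule arg_cong[where f = "\<lambda>e. ?l powr e"]) (simp add: field_simps)
    then have y2: "y\<^sup>2 = (bk (Suc k))\<^sup>2 * ?l powr (- s - 1)"
      by (simp only: y_def power_mult_distrib)
    have "?l powr (s / 2) * ?l powr (- (s + 1) / 2) = 1 / sqrt ?l"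
    proof -
      have "?l powr (s / 2) * ?l powr (- (s + 1) / 2) = ?l powr (- (1/2))"
        unfolding powr_add[symmetric] by (rule arg_cong[where f = "\<lambda>e. ?l powr e"]) (simp add: field_simps)
      then show ?thesis using l by (simp add: powr_minus powr_half_sqrt inverse_eq_divide)
    qed
    then have xy: "x * y = \<bar>cf z (Suc k)\<bar> * bk (Suc k) * (1 / sqrt ?l)"
      by (simp add: x_def y_def mult_ac)
    have "\<bar>cf z (Suc k)\<bar> * bk (Suc k) * (?F / sqrt (2 * ?l)) = ?F * (x * y / sqrt 2)"
      unfolding xy by (simp add: real_sqrt_mult mult_ac)
    also have "\<dots> \<le> ?F * (x\<^sup>2 + y\<^sup>2)"
    proof (intro mult_left_mono L2_norm_nonneg)
      have "0 \<le> x * y" using bk_pos[of "Suc k"] by (simp add: x_def y_def)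
      then have "x * y / sqrt 2 \<le> x * y / 1" by (intro divide_left_mono) auto
      also have "\<dots> \<le> x\<^sup>2 + y\<^sup>2"
        using sum_squares_bound[of x y] zero_le_power2[of x] zero_le_power2[of y] by linarith
      finally show "x * y / sqrt 2 \<le> x\<^sup>2 + y\<^sup>2" .
    qed
    finally show ?thesis unfolding x2 y2 .
  qed
  have sb: "summable (\<lambda>k. \<bar>cf z (Suc k)\<bar> * bk (Suc k) * (?F / sqrt (2 * lam (Suc k))))"
  proof (rule summable_comparison_test'[where N = 0, OF summable_mult[OF summable_add[OF zz(2) summable_bk_lam[OF s]], of ?F]])
    fix n
    have "0 \<le> \<bar>cf z (Suc n)\<bar> * bk (Suc n) * (?F / sqrt (2 * lam (Suc n)))"
      using bk_pos[of "Suc n"] lam_pos[of "Suc n"] L2_norm_nonneg[of "time_measure T" f] by simp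
    then show "norm (\<bar>cf z (Suc n)\<bar> * bk (Suc n) * (?F / sqrt (2 * lam (Suc n))))
        \<le> ?F * ((cf z (Suc n))\<^sup>2 * lam (Suc n) powr s + (bk (Suc n))\<^sup>2 * lam (Suc n) powr (- s - 1))"
      using b[of n] by (simp only: real_norm_def abs_of_nonneg)
  qed
  have l: "lam (Suc k) > 0" for k by (rule lam_pos) simp
  have bp: "bk (Suc k) > 0" for k by (rule bk_pos) simp
  note em = exp_moment_bound[OF f l less_imp_le[OF \<tau>(1)] \<tau>(2)]
  show "summable (\<lambda>k. \<bar>cf z (Suc k) * bk (Suc k) * exp_moment f (lam (Suc k)) \<tau>\<bar>)"
  proof (rule summable_comparison_test'[OF sb, of 0])
    show "norm \<bar>cf z (Suc n) * bk (Suc n) * exp_moment f (lam (Suc n)) \<tau>\<bar> \<le> \<bar>cf z (Suc n)\<bar> * bk (Suc n) * (?F / sqrt (2 * lam (Suc n)))" for n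
      using mult_left_mono[OF em(3)[of n], of "\<bar>cf z (Suc n)\<bar> * bk (Suc n)"] bp[of n] by (simp add: abs_mult)
  qed
  have "(\<integral>t. f t * bdry (S (\<tau> - t) z) \<partial>time_measure \<tau>) = (\<integral>t. (\<Sum>k. ?g k t) \<partial>time_measure \<tau>)"
  proof (intro integral_lebesgue_on_cong)
    fix t assume t: "t \<in> {0<..<\<tau>}"
    then have t': "\<tau> - t > 0" by simp
    have "summable (\<lambda>k. exp (- lam (Suc k) * (\<tau> - t)) * cf z (Suc k) * bk (Suc k))"
      by (rule summable_comparison_test'[where N = 0, OF summable_semigroup[OF zz(1) t']])
         (use bp in \<open>auto simp: abs_mult less_imp_le\<close>)
    from suminf_mult[OF this, of "f t"]
    show "f t * bdry (S (\<tau> - t) z) = (\<Sum>k. ?g k t)"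
      by (simp add: bdry_semigroup[OF zz(1) t'] mult_ac)
  qed
  also have "\<dots> = (\<Sum>k. \<integral>t. ?g k t \<partial>time_measure \<tau>)"
  proof (rule integral_suminf)
    show "integrable (time_measure \<tau>) (?g k)" for k
      by (intro integrable_mult_right em(1))
    show "AE t in time_measure \<tau>. summable (\<lambda>k. norm (?g k t))"
    proof (rule AE_I2)
      fix t assume "t \<in> space (time_measure \<tau>)"
      then have t': "\<tau> - t > 0" by (simp add: space_restrict_space)
      show "summable (\<lambda>k. norm (?g k t))"
        using summable_mult[OF summable_semigroup[OF zz(1) t'], of "\<bar>f t\<bar>"] bp
        by (simp add: abs_mult mult_ac less_imp_le)
    qed
    show "summable (\<lambda>k. \<integral>t. norm (?g k t) \<partial>time_measure \<tau>)"
    proof (rule summable_comparison_test'[OF sb, of 0])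
      fix n
      have "(\<integral>t. norm (?g n t) \<partial>time_measure \<tau>) = \<bar>cf z (Suc n)\<bar> * bk (Suc n) * (\<integral>t. \<bar>f t * exp (- lam (Suc n) * (\<tau> - t))\<bar> \<partial>time_measure \<tau>)"
        using bp[of n] by (simp add: abs_mult)
      also have "\<dots> \<le> \<bar>cf z (Suc n)\<bar> * bk (Suc n) * (?F / sqrt (2 * lam (Suc n)))"
        using bp[of n] by (intro mult_left_mono em(2)) auto
      finally show "norm (\<integral>t. norm (?g n t) \<partial>time_measure \<tau>) \<le> \<bar>cf z (Suc n)\<bar> * bk (Suc n) * (?F / sqrt (2 * lam (Suc n)))"
        by simp
    qed
  qed
  also have "\<dots> = (\<Sum>k. cf z (Suc k) * bk (Suc k) * exp_moment f (lam (Suc k)) \<tau>)"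
    by (simp add: exp_moment_def)
  finally show "(\<integral>t. f t * bdry (S (\<tau> - t) z) \<partial>time_measure \<tau>) = (\<Sum>k. cf z (Suc k) * bk (Suc k) * exp_moment f (lam (Suc k)) \<tau>)" .
qed

lemma suminf_delta:
  fixes g :: "nat \<Rightarrow> real"
  assumes "k > 0"
  shows "(\<Sum>l. (if Suc l = k then 1 else 0) * g (Suc l)) = g k"
proof -
  have "(\<Sum>l. (if Suc l = k then 1 else 0) * g (Suc l)) = (\<Sum>l\<in>{k - 1}. (if Suc l = k then 1 else 0) * g (Suc l))"
    using assms by (intro suminf_finite) auto
  then show ?thesis using assms by simp
qed

text \<open>Testing the weak formulation with z = Phi_k isolates one mode; s = nu + 1 is one
  admissible choice.\<close>

lemma null_control_moments:
  assumes "f \<in> null_controls T \<alpha> \<beta> \<mu> u0" and u0: "u0 \<in> L2_space W" and T: "T > 0" and k: "k > 0"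
  shows "f \<in> L2_space (time_measure T)" "bk k * exp_moment f (lam k) T = exp (- lam k * T) * cf u0 k"
proof -
  show f: "f \<in> L2_space (time_measure T)" using assms by (simp add: null_controls_def)
  obtain u where u: "weak_solution \<alpha> \<beta> \<mu> (\<nu> + 1) T f (pivot \<beta> u0) u" "\<forall>z\<in>Hs \<alpha> \<beta> \<mu> (\<nu> + 1). u T z = 0"
  proof -
    have "\<forall>s>\<nu>. \<exists>u. weak_solution \<alpha> \<beta> \<mu> s T f (pivot \<beta> u0) u \<and> (\<forall>z\<in>Hs \<alpha> \<beta> \<mu> s. u T z = 0)"
      using assms(1) by (simp add: null_controls_def)
    from this[rule_format, of "\<nu> + 1"] show ?thesis using that by auto
  qed
  have z: "\<Phi> k \<in> Hs \<alpha> \<beta> \<mu> (\<nu> + 1)" by (rule eigenfun_Hs[OF k])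
  have c: "cf (\<Phi> k) (Suc l) = (if Suc l = k then 1 else 0)" for l
    using coef_eigenfun[of "Suc l" k] k by simp
  have "T \<in> {0<..T}" using T by simp
  from u(1)[unfolded weak_solution_def, THEN conjunct2, THEN conjunct2, THEN bspec, OF this, THEN bspec, OF z]
  have "0 = - (\<integral>t. f t * bdry (S (T - t) (\<Phi> k)) \<partial>time_measure T) + pivot \<beta> u0 (S T (\<Phi> k))"
    using u(2)[THEN bspec, OF z] by simp
  also have "(\<integral>t. f t * bdry (S (T - t) (\<Phi> k)) \<partial>time_measure T)
      = (\<Sum>l. (if Suc l = k then 1 else 0) * (bk (Suc l) * exp_moment f (lam (Suc l)) T))"
    using T by (subst boundary_integral(1)[OF f z]) (auto simp: c mult.assoc)
  also have "\<dots> = bk k * exp_moment f (lam k) T" by (rule suminf_delta[OF k])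
  also have "pivot \<beta> u0 (S T (\<Phi> k)) = (\<Sum>l. (if Suc l = k then 1 else 0) * (exp (- lam (Suc l) * T) * cf u0 (Suc l)))"
    using T k by (subst pivot_semigroup(1)[OF u0 eigenfun_L2]) (auto simp: c mult_ac)
  also have "\<dots> = exp (- lam k * T) * cf u0 k" by (rule suminf_delta[OF k])
  finally show "bk k * exp_moment f (lam k) T = exp (- lam k * T) * cf u0 k" by simp
qed

text \<open>The solution is written down by its coefficients and checked against the definition. The
  majorant \<open>M\<close>, uniform in time, gives membership in the dual and, through Tannery's
  theorem, continuity in time.\<close>

lemma null_controlI:
  assumes f: "f \<in> L2_space (time_measure T)" and u0: "u0 \<in> L2_space W" and T: "T > 0"
    and mom: "\<And>k. k > 0 \<Longrightarrow> bk k * exp_moment f (lam k) T = exp (- lam k * T) * cf u0 k"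
  shows "f \<in> null_controls T \<alpha> \<beta> \<mu> u0"
proof -
  let ?F = "L2_norm (time_measure T) f"
  \<comment> \<open>The k-th coefficient of the solution at time tau: response to f plus free decay
    of u0.\<close>
  define d where "d = (\<lambda>k \<tau>. - (bk k * exp_moment f (lam k) \<tau>) + exp (- lam k * \<tau>) * cf u0 k)"
  define u where "u = (\<lambda>\<tau> z. \<Sum>k. cf z (Suc k) * d (Suc k) \<tau>)"
  have l: "lam (Suc k) > 0" and bp: "bk (Suc k) > 0" for k by (rule lam_pos bk_pos, simp)+
  have "weak_solution \<alpha> \<beta> \<mu> s T f (pivot \<beta> u0) u \<and> (\<forall>z\<in>Hs \<alpha> \<beta> \<mu> s. u T z = 0)" if s: "s > \<nu>" for s
  proof -
    \<comment> \<open>The moments are of order lam_k^(-1/2), hence b_k^2 lam_k^(-s-1) in the first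
      part, summable for s > nu; the second part is the square-summable sequence of coefficients of
      u0.\<close>
    define M where "M = (\<lambda>k. ?F\<^sup>2 * ((bk (Suc k))\<^sup>2 * lam (Suc k) powr (- s - 1)) + 2 * lam 1 powr (- s) * (cf u0 (Suc k))\<^sup>2)"
    have M: "summable M"
      unfolding M_def by (intro summable_add summable_mult summable_bk_lam s coef_square_summable u0)
    have dM: "lam (Suc k) powr (- s) * (d (Suc k) \<tau>)\<^sup>2 \<le> M k" if \<tau>: "0 \<le> \<tau>" "\<tau> \<le> T" for k \<tau>
    proof -
      let ?l = "lam (Suc k)" and ?b = "bk (Suc k)"
      define x where "x = ?b * exp_moment f ?l \<tau>"
      define y where "y = exp (- ?l * \<tau>) * cf u0 (Suc k)"
      have "\<bar>exp_moment f ?l \<tau>\<bar>\<^sup>2 \<le> (?F / sqrt (2 * ?l))\<^sup>2"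
        by (intro power_mono exp_moment_bound(3)[OF f l \<tau>]) auto
      then have "?b\<^sup>2 * (exp_moment f ?l \<tau>)\<^sup>2 \<le> ?b\<^sup>2 * (?F\<^sup>2 / (2 * ?l))"
        using l[of k] by (intro mult_left_mono) (auto simp: power_divide)
      then have x2: "x\<^sup>2 \<le> ?b\<^sup>2 * (?F\<^sup>2 / (2 * ?l))" by (simp add: x_def power_mult_distrib)
      have "(exp (- ?l * \<tau>))\<^sup>2 * (cf u0 (Suc k))\<^sup>2 \<le> 1 * (cf u0 (Suc k))\<^sup>2"
        using l[of k] \<tau> by (intro mult_right_mono power_le_one) auto
      then have y2: "y\<^sup>2 \<le> (cf u0 (Suc k))\<^sup>2" by (simp add: y_def power_mult_distrib)
      have "(d (Suc k) \<tau>)\<^sup>2 = (y - x)\<^sup>2" by (simp add: d_def x_def y_def)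
      also have "\<dots> \<le> 2 * x\<^sup>2 + 2 * y\<^sup>2"
        using zero_le_power2[of "x + y"] by (simp add: power2_eq_square algebra_simps)
      also have "\<dots> \<le> 2 * (?b\<^sup>2 * (?F\<^sup>2 / (2 * ?l))) + 2 * (cf u0 (Suc k))\<^sup>2"
        using x2 y2 by linarith
      finally have "?l powr (- s) * (d (Suc k) \<tau>)\<^sup>2 \<le> ?l powr (- s) * (2 * (?b\<^sup>2 * (?F\<^sup>2 / (2 * ?l))) + 2 * (cf u0 (Suc k))\<^sup>2)"
        by (intro mult_left_mono) auto
      also have "\<dots> = ?F\<^sup>2 * (?b\<^sup>2 * ?l powr (- s - 1)) + 2 * ?l powr (- s) * (cf u0 (Suc k))\<^sup>2"
        using l[of k] by (simp add: powr_diff field_simps)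
      also have "\<dots> \<le> M k"
      proof -
        have "?l powr (- s) \<le> lam 1 powr (- s)"
          using s nu_nonneg lam_pos[of 1] lam_mono[of 1 "Suc k"] by (intro powr_mono2') auto
        then have "?l powr (- s) * (cf u0 (Suc k))\<^sup>2 \<le> lam 1 powr (- s) * (cf u0 (Suc k))\<^sup>2"
          by (intro mult_right_mono) auto
        then show ?thesis by (simp add: M_def)
      qed
      finally show ?thesis .
    qed
    have dsum: "summable (\<lambda>k. lam (Suc k) powr (- s) * (d (Suc k) \<tau>)\<^sup>2)" if "0 \<le> \<tau>" "\<tau> \<le> T" for \<tau>
      by (rule summable_comparison_test'[OF M, of 0]) (use dM[OF that] in auto)
    have pair: "summable (\<lambda>k. \<bar>cf z (Suc k) * d (Suc k) \<tau>\<bar>)"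
      "\<bar>u \<tau> z\<bar> \<le> sqrt (\<Sum>k. lam (Suc k) powr (- s) * (d (Suc k) \<tau>)\<^sup>2) * Hs_norm \<alpha> \<beta> \<mu> s z"
      if z: "z \<in> Hs \<alpha> \<beta> \<mu> s" and \<tau>: "0 \<le> \<tau>" "\<tau> \<le> T" for z \<tau>
    proof -
      let ?a = "\<lambda>k. cf z (Suc k) * lam (Suc k) powr (s / 2)" and ?b = "\<lambda>k. lam (Suc k) powr (- (s / 2)) * d (Suc k) \<tau>"
      have ab: "?a k * ?b k = cf z (Suc k) * d (Suc k) \<tau>" for k
        using l[of k] by (simp add: powr_minus)
      have a2: "(?a k)\<^sup>2 = (cf z (Suc k))\<^sup>2 * lam (Suc k) powr s" for k
        by (simp add: power_mult_distrib power2_eq_square[of "_ powr _"] flip: powr_add)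
      have b2: "(?b k)\<^sup>2 = lam (Suc k) powr (- s) * (d (Suc k) \<tau>)\<^sup>2" for k
        by (simp add: power_mult_distrib power2_eq_square[of "_ powr _"] flip: powr_add)
      have sa: "summable (\<lambda>k. (?a k)\<^sup>2)" unfolding a2 by (rule Hs_coef[OF z])
      have sb: "summable (\<lambda>k. (?b k)\<^sup>2)" unfolding b2 by (rule dsum[OF \<tau>])
      note CS = summable_suminf_Cauchy_Schwarz[OF sa sb]
      show "summable (\<lambda>k. \<bar>cf z (Suc k) * d (Suc k) \<tau>\<bar>)" using CS(1) unfolding ab .
      show "\<bar>u \<tau> z\<bar> \<le> sqrt (\<Sum>k. lam (Suc k) powr (- s) * (d (Suc k) \<tau>)\<^sup>2) * Hs_norm \<alpha> \<beta> \<mu> s z"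
        using CS(2) unfolding ab a2 b2 by (simp add: u_def Hs_norm_def mult.commute)
    qed
    have dual: "u \<tau> \<in> Hs_dual \<alpha> \<beta> \<mu> s" if \<tau>: "\<tau> \<in> {0..T}" for \<tau>
    proof -
      have \<tau>': "0 \<le> \<tau>" "\<tau> \<le> T" using \<tau> by auto
      have "u \<tau> (\<lambda>x. z x + w x) = u \<tau> z + u \<tau> w" if "z \<in> Hs \<alpha> \<beta> \<mu> s" "w \<in> Hs \<alpha> \<beta> \<mu> s" for z w
      proof -
        have s: "summable (\<lambda>k. cf z (Suc k) * d (Suc k) \<tau>)" "summable (\<lambda>k. cf w (Suc k) * d (Suc k) \<tau>)"
          by (rule summable_rabs_cancel, rule pair(1)[OF _ \<tau>'], rule that)+
        show ?thesis
          unfolding u_def suminf_add[OF s] by (simp add: coef_add[OF Hs_coef(1)[OF that(1)] Hs_coef(1)[OF that(2)]] distrib_right)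
      qed
      moreover have "u \<tau> (\<lambda>x. c * z x) = c * u \<tau> z" if "z \<in> Hs \<alpha> \<beta> \<mu> s" for z c
      proof -
        have "summable (\<lambda>k. cf z (Suc k) * d (Suc k) \<tau>)"
          by (rule summable_rabs_cancel, rule pair(1)[OF that \<tau>'])
        from suminf_mult[OF this, of c] show ?thesis unfolding u_def by (simp add: coef_scale mult_ac)
      qed
      moreover have "\<exists>C. \<forall>z\<in>Hs \<alpha> \<beta> \<mu> s. \<bar>u \<tau> z\<bar> \<le> C * Hs_norm \<alpha> \<beta> \<mu> s z"
        using pair(2)[OF _ \<tau>'] by blast
      ultimately show ?thesis unfolding Hs_dual_def by blast
    qed
    have u_eig: "u \<tau> (\<Phi> (Suc k)) = d (Suc k) \<tau>" for \<tau> k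
    proof -
      have "cf (\<Phi> (Suc k)) (Suc i) = (if Suc i = Suc k then 1 else 0)" for i
        using coef_eigenfun[of "Suc i" "Suc k"] by simp
      then show ?thesis unfolding u_def using suminf_delta[of "Suc k" "\<lambda>i. d i \<tau>"] by simp
    qed
    have cont: "((\<lambda>r. Hs_dual_norm \<alpha> \<beta> \<mu> s (\<lambda>z. u r z - u t z)) \<longlongrightarrow> 0) (at t within {0..T})" if t: "t \<in> {0..T}" for t
    proof (cases "at t within {0..T} = bot")
      case False
      let ?a = "\<lambda>k r. lam (Suc k) powr (- s) * (d (Suc k) r - d (Suc k) t)\<^sup>2"
      have "continuous_on {0..T} (d (Suc k))" for k
        unfolding d_def using T by (intro continuous_intros continuous_on_exp_moment[OF f l]) auto
      then have "((\<lambda>r. d (Suc k) r) \<longlongrightarrow> d (Suc k) t) (at t within {0..T})" for k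
        using t by (auto simp: continuous_on_def)
      then have "(?a k \<longlongrightarrow> lam (Suc k) powr (- s) * (d (Suc k) t - d (Suc k) t)\<^sup>2) (at t within {0..T})" for k
        by (intro tendsto_intros)
      then have lim: "(?a k \<longlongrightarrow> 0) (at t within {0..T})" for k by simp
      have bound: "norm (?a k r) \<le> 4 * M k" if r: "r \<in> {0..T}" for k r
      proof -
        have "(d (Suc k) r - d (Suc k) t)\<^sup>2 \<le> 2 * (d (Suc k) r)\<^sup>2 + 2 * (d (Suc k) t)\<^sup>2"
          using zero_le_power2[of "d (Suc k) r + d (Suc k) t"] by (simp add: power2_sum power2_diff)
        then have "?a k r \<le> lam (Suc k) powr (- s) * (2 * (d (Suc k) r)\<^sup>2 + 2 * (d (Suc k) t)\<^sup>2)"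
          by (intro mult_left_mono) auto
        also have "\<dots> \<le> 4 * M k"
          using dM[of r k] dM[of t k] r t by (simp add: algebra_simps)
        finally show ?thesis by simp
      qed
      have "((\<lambda>r. \<Sum>k. ?a k r) \<longlongrightarrow> (\<Sum>k. 0)) (at t within {0..T})"
      proof (rule tannerys_theorem[OF lim, THEN conjunct2, THEN conjunct2])
        have "\<forall>\<^sub>F r in at t within {0..T}. r \<in> {0..T}" by (auto simp: eventually_at_filter)
        then have "\<forall>\<^sub>F r in at t within {0..T}. \<forall>k. norm (?a k r) \<le> 4 * M k"
          by eventually_elim (use bound in blast)
        then show "\<forall>\<^sub>F (k, r) in at_top \<times>\<^sub>F (at t within {0..T}). norm (?a k r) \<le> 4 * M k"
          unfolding eventually_prod_filter
          by (intro exI[of _ "\<lambda>_. True"] exI[of _ "\<lambda>r. \<forall>k. norm (?a k r) \<le> 4 * M k"]) auto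
        show "summable (\<lambda>k. 4 * M k)" by (rule summable_mult[OF M])
      qed (rule False)
      then have "((\<lambda>r. sqrt (\<Sum>k. ?a k r)) \<longlongrightarrow> sqrt 0) (at t within {0..T})"
        by (intro tendsto_real_sqrt) simp
      then show ?thesis unfolding Hs_dual_norm_def u_eig by simp
    qed simp
    have weak: "u \<tau> z = - (\<integral>t. f t * bdry (S (\<tau> - t) z) \<partial>time_measure \<tau>) + pivot \<beta> u0 (S \<tau> z)"
      if \<tau>: "\<tau> \<in> {0<..T}" and z: "z \<in> Hs \<alpha> \<beta> \<mu> s" for \<tau> z
    proof -
      have \<tau>': "0 < \<tau>" "\<tau> \<le> T" using \<tau> by auto
      note bi = boundary_integral[OF f z s \<tau>'] and pv = pivot_semigroup[OF u0 Hs_coef(1)[OF z] \<tau>'(1)]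
      let ?x = "\<lambda>k. cf z (Suc k) * bk (Suc k) * exp_moment f (lam (Suc k)) \<tau>"
      let ?y = "\<lambda>k. exp (- lam (Suc k) * \<tau>) * cf z (Suc k) * cf u0 (Suc k)"
      have sx: "summable ?x" and sy: "summable ?y"
        using bi(2) pv(2) by (auto intro: summable_rabs_cancel)
      have "u \<tau> z = (\<Sum>k. ?y k - ?x k)"
        unfolding u_def d_def by (rule arg_cong[where f = suminf]) (auto simp: algebra_simps)
      also have "\<dots> = suminf ?y - suminf ?x" using suminf_diff[OF sy sx] by simp
      finally show ?thesis unfolding bi(1) pv(1) by simp
    qed
    have "u T z = 0" for z
      using mom by (simp add: u_def d_def)
    then show ?thesis
      unfolding weak_solution_def using dual cont weak by blast
  qed
  then show ?thesis unfolding null_controls_def using f by blast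
qed

end

section \<open>The lower bound\<close>

text \<open>All-pass filtering: \<open>p \<mapsto> p - 2\<mu>v\<close> with \<open>v' = p - \<mu>v\<close>, \<open>v 0 = 0\<close> does not increase
  \<open>\<integral>\<^sub>0\<^sup>R p\<^sup>2\<close>, because \<open>p\<^sup>2 - (p - 2\<mu>v)\<^sup>2 = (2\<mu>v\<^sup>2)'\<close>. The function \<open>G\<close> is a primitive of \<open>p\<^sup>2\<close>.\<close>

lemma exp_sum_small_L2:
  fixes m :: "nat \<Rightarrow> real"
  assumes "finite I" and m0: "m0 > 0" and "inj_on m I" and "\<And>i. i \<in> I \<Longrightarrow> m i > 0" and "\<And>i. i \<in> I \<Longrightarrow> m i \<noteq> m0"
  shows "\<exists>c G. (\<forall>t. (G has_real_derivative (exp (- m0 * t) + (\<Sum>i\<in>I. c i * exp (- m i * t)))\<^sup>2) (at t)) \<and>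
     (\<forall>R\<ge>0. G R - G 0 \<le> 1 / (2 * m0) * (\<Prod>i\<in>I. ((m i - m0) / (m i + m0))\<^sup>2))"
  using assms(1,3,4,5)
proof (induction I rule: finite_induct)
  case empty
  let ?G = "\<lambda>t. - exp (- (2 * m0) * t) / (2 * m0)"
  have "(?G has_real_derivative (exp (- m0 * t))\<^sup>2) (at t)" for t
    using m0 by (auto intro!: derivative_eq_intros simp: power2_eq_square simp flip: exp_add)
  moreover have "?G R - ?G 0 \<le> 1 / (2 * m0)" for R using m0 by simp
  ultimately show ?case by (intro exI[of _ "\<lambda>_. 0"] exI[of _ ?G]) auto
next
  case (insert x I)
  then obtain c G where G: "\<And>t. (G has_real_derivative (exp (- m0 * t) + (\<Sum>i\<in>I. c i * exp (- m i * t)))\<^sup>2) (at t)"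
    and GR: "\<And>R. R \<ge> 0 \<Longrightarrow> G R - G 0 \<le> 1 / (2 * m0) * (\<Prod>i\<in>I. ((m i - m0) / (m i + m0))\<^sup>2)"
    by auto
  define l where "l = m x"
  have l: "l > 0" "l \<noteq> m0" "\<And>i. i \<in> I \<Longrightarrow> m i \<noteq> l"
    using insert by (auto simp: l_def inj_on_def)
  define p where "p = (\<lambda>t. exp (- m0 * t) + (\<Sum>i\<in>I. c i * exp (- m i * t)))"
  \<comment> \<open>No resonance occurs, since l differs from all exponents in p; so v is again an
    exponential sum.\<close>
  define v where "v = (\<lambda>t. (exp (- m0 * t) - exp (- l * t)) / (l - m0) + (\<Sum>i\<in>I. c i * ((exp (- m i * t) - exp (- l * t)) / (l - m i))))"
  \<comment> \<open>The filter multiplies exp(-m0 t) by 1 - 2 l / (l - m0) = k. Dividing by k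
    restores the coefficient 1 and yields the factor ((l - m0) / (l + m0))^2.\<close>
  define k where "k = - (l + m0) / (l - m0)"
  have k: "k \<noteq> 0" "1 / k\<^sup>2 = ((l - m0) / (l + m0))\<^sup>2"
  proof -
    show "k \<noteq> 0" using l m0 by (simp add: k_def)
    have "k\<^sup>2 = ((l + m0) / (l - m0))\<^sup>2" by (simp add: k_def power_divide power2_eq_square algebra_simps)
    then show "1 / k\<^sup>2 = ((l - m0) / (l + m0))\<^sup>2" by (simp add: power_divide)
  qed
  have dv1: "((\<lambda>t. (exp (- a * t) - exp (- l * t)) / (l - a)) has_real_derivative
      exp (- a * t) - l * ((exp (- a * t) - exp (- l * t)) / (l - a))) (at t)" if "a \<noteq> l" for a t
  proof -
    have "((\<lambda>t. (exp (- a * t) - exp (- l * t)) / (l - a)) has_real_derivative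
      (exp (- a * t) * - a - exp (- l * t) * - l) / (l - a)) (at t)"
      by (intro DERIV_cdivide) (auto intro!: derivative_eq_intros)
    moreover have "(exp (- a * t) * - a - exp (- l * t) * - l) / (l - a) = exp (- a * t) - l * ((exp (- a * t) - exp (- l * t)) / (l - a))"
      using that by (simp add: field_simps)
    ultimately show ?thesis by metis
  qed
  have dv: "(v has_real_derivative p t - l * v t) (at t)" for t
  proof -
    have "(v has_real_derivative (exp (- m0 * t) - l * ((exp (- m0 * t) - exp (- l * t)) / (l - m0)))
       + (\<Sum>i\<in>I. c i * (exp (- m i * t) - l * ((exp (- m i * t) - exp (- l * t)) / (l - m i))))) (at t)"
      unfolding v_def using l by (intro DERIV_add DERIV_sum DERIV_cmult dv1) auto
    moreover have "(exp (- m0 * t) - l * ((exp (- m0 * t) - exp (- l * t)) / (l - m0)))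
       + (\<Sum>i\<in>I. c i * (exp (- m i * t) - l * ((exp (- m i * t) - exp (- l * t)) / (l - m i)))) = p t - l * v t"
      by (simp add: p_def v_def sum_distrib_left sum_subtractf algebra_simps)
    ultimately show ?thesis by metis
  qed
  define c' where "c' = (\<lambda>i. if i = x then (2 * l / (l - m0) + (\<Sum>i\<in>I. c i * (2 * l / (l - m i)))) / k
      else c i * (1 - 2 * l / (l - m i)) / k)"
  define G' where "G' = (\<lambda>t. (G t - 2 * l * (v t)\<^sup>2) / k\<^sup>2)"
  have q: "exp (- m0 * t) + (\<Sum>i\<in>insert x I. c' i * exp (- m i * t)) = (p t - 2 * l * v t) / k" for t
  proof -
    have "k * (\<Sum>i\<in>insert x I. c' i * exp (- m i * t)) =
       (2 * l / (l - m0) + (\<Sum>i\<in>I. c i * (2 * l / (l - m i)))) * exp (- l * t)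
       + (\<Sum>i\<in>I. c i * (1 - 2 * l / (l - m i)) * exp (- m i * t))"
    proof -
      have "(\<Sum>i\<in>I. c' i * exp (- m i * t)) = (\<Sum>i\<in>I. c i * (1 - 2 * l / (l - m i)) / k * exp (- m i * t))"
        using insert by (intro sum.cong) (auto simp: c'_def)
      also have "\<dots> = (\<Sum>i\<in>I. c i * (1 - 2 * l / (l - m i)) * exp (- m i * t)) / k"
        by (simp add: sum_divide_distrib)
      finally show ?thesis
        using insert k by (simp add: c'_def l_def[symmetric] distrib_left)
    qed
    moreover have "k * exp (- m0 * t) = exp (- m0 * t) - 2 * l * (exp (- m0 * t) / (l - m0))"
      using l by (simp add: k_def field_simps)
    moreover have "(\<Sum>i\<in>I. c i * (1 - 2 * l / (l - m i)) * exp (- m i * t)) + (\<Sum>i\<in>I. c i * (2 * l / (l - m i))) * exp (- l * t)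
      = (\<Sum>i\<in>I. c i * exp (- m i * t)) - 2 * l * (\<Sum>i\<in>I. c i * ((exp (- m i * t) - exp (- l * t)) / (l - m i)))"
      unfolding sum_distrib_right sum_distrib_left sum.distrib[symmetric] sum_subtractf[symmetric]
      by (intro sum.cong refl) (simp add: algebra_simps diff_divide_distrib)
    ultimately have "k * (exp (- m0 * t) + (\<Sum>i\<in>insert x I. c' i * exp (- m i * t))) = p t - 2 * l * v t"
      by (simp add: p_def v_def algebra_simps diff_divide_distrib)
    then show ?thesis using k by (simp add: field_simps)
  qed
  have dG': "(G' has_real_derivative (exp (- m0 * t) + (\<Sum>i\<in>insert x I. c' i * exp (- m i * t)))\<^sup>2) (at t)" for t
  proof -
    have "((\<lambda>t. (v t)\<^sup>2) has_real_derivative 2 * v t * (p t - l * v t)) (at t)"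
      using dv[of t] by (auto intro!: derivative_eq_intros)
    then have "(G' has_real_derivative ((p t)\<^sup>2 - 2 * l * (2 * v t * (p t - l * v t))) / k\<^sup>2) (at t)"
      unfolding G'_def using G[of t] by (intro DERIV_cdivide DERIV_diff DERIV_cmult) (simp_all add: p_def)
    moreover have "((p t)\<^sup>2 - 2 * l * (2 * v t * (p t - l * v t))) / k\<^sup>2 = ((p t - 2 * l * v t) / k)\<^sup>2"
      by (simp add: power_divide power2_eq_square algebra_simps)
    ultimately show ?thesis unfolding q by metis
  qed
  have "G' R - G' 0 \<le> 1 / (2 * m0) * (\<Prod>i\<in>insert x I. ((m i - m0) / (m i + m0))\<^sup>2)" if "R \<ge> 0" for R
  proof -
    have "v 0 = 0" by (simp add: v_def)
    then have "G' R - G' 0 = (G R - G 0 - 2 * l * (v R)\<^sup>2) * (1 / k\<^sup>2)"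
      by (simp add: G'_def diff_divide_distrib)
    also have "\<dots> \<le> (1 / (2 * m0) * (\<Prod>i\<in>I. ((m i - m0) / (m i + m0))\<^sup>2)) * (1 / k\<^sup>2)"
    proof (intro mult_right_mono)
      have "0 \<le> 2 * l * (v R)\<^sup>2" using l by simp
      then show "G R - G 0 - 2 * l * (v R)\<^sup>2 \<le> 1 / (2 * m0) * (\<Prod>i\<in>I. ((m i - m0) / (m i + m0))\<^sup>2)"
        using GR[OF that] by linarith
    qed simp
    finally show ?thesis unfolding k(2) using insert by (simp add: l_def mult_ac)
  qed
  with dG' show ?case by blast
qed

text \<open>Averaging over a time span \<open>1 / m\<^sub>0\<close> turns the \<open>L\<^sup>2\<close> estimate into a uniform one.\<close>

lemma exp_sum_small_sup:
  fixes l :: "nat \<Rightarrow> real"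
  assumes I: "finite I" "inj_on l I" "\<And>i. i \<in> I \<Longrightarrow> l i > l0" and l0: "l0 > 0" and d: "d \<ge> 0" and T: "T > 0"
  shows "\<exists>C0 C. C0 \<ge> 1 \<and> (\<forall>t. 0 \<le> t \<longrightarrow> t \<le> T \<longrightarrow> \<bar>C0 * exp (l0 * t) + (\<Sum>i\<in>I. C i * exp (l i * t))\<bar>
     \<le> exp 1 / sqrt 2 * exp ((l0 + d) * T) * (\<Prod>i\<in>I. (l i - l0) / (l i + l0 + 2 * d)))"
proof -
  \<comment> \<open>All exponents are raised by d. This improves the gain to (l_i - l0) / (l_i + l0
    + 2 d), and undoing the shift in \<open>Pp\<close> costs at most exp(d T').\<close>
  define m where "m = (\<lambda>i. l i + d)"
  define m0 where "m0 = l0 + d"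
  have m0: "m0 > 0" using l0 d by (simp add: m0_def)
  have mi: "m i > m0" if "i \<in> I" for i using I(3)[OF that] by (simp add: m_def m0_def)
  have inj: "inj_on m I" using I(2) by (auto simp: inj_on_def m_def)
  obtain c G where G: "\<And>t. (G has_real_derivative (exp (- m0 * t) + (\<Sum>i\<in>I. c i * exp (- m i * t)))\<^sup>2) (at t)"
    and GR: "\<And>R. R \<ge> 0 \<Longrightarrow> G R - G 0 \<le> 1 / (2 * m0) * (\<Prod>i\<in>I. ((m i - m0) / (m i + m0))\<^sup>2)"
    using exp_sum_small_L2[OF I(1) m0 inj less_trans[OF m0 mi] less_imp_neq[OF mi, THEN not_sym]] by blast
  define p where "p = (\<lambda>t. exp (- m0 * t) + (\<Sum>i\<in>I. c i * exp (- m i * t)))"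
  define Pr where "Pr = (\<Prod>i\<in>I. (l i - l0) / (l i + l0 + 2 * d))"
  have Pr_eq: "(\<Prod>i\<in>I. ((m i - m0) / (m i + m0))\<^sup>2) = Pr\<^sup>2"
    unfolding Pr_def prod_power_distrib by (intro prod.cong refl) (simp add: m_def m0_def algebra_simps)
  have Pr: "Pr > 0"
    unfolding Pr_def
  proof (intro prod_pos divide_pos_pos)
    fix i assume "i \<in> I"
    then show "0 < l i - l0" "0 < l i + l0 + 2 * d" using I(3)[of i] l0 d by linarith+
  qed
  have Gmono: "G a \<le> G b" if "a \<le> b" for a b
  proof (rule DERIV_nonneg_imp_nondecreasing[OF that])
    show "\<exists>y. (G has_real_derivative y) (at x) \<and> 0 \<le> y" for x
      using G[of x] zero_le_power2 by blast
  qed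
  define h where "h = 1 / m0"
  define T' where "T' = T + h"
  have h: "h > 0" using m0 by (simp add: h_def)
  \<comment> \<open>The mean of exp(a s) over [t, t + h] is E a exp(a t). Averaging thus keeps the
    form of the sum, and E l0 >= 1 keeps the leading coefficient from dropping below 1.\<close>
  define E where "E = (\<lambda>a. (exp (a * h) - 1) / (a * h))"
  define C where "C = (\<lambda>i. c i * exp ((l0 - l i) * T') * E (l i))"
  have E1: "E l0 \<ge> 1"
    using exp_ge_add_one_self[of "l0 * h"] l0 h by (simp add: E_def field_simps)
  have "\<bar>E l0 * exp (l0 * t) + (\<Sum>i\<in>I. C i * exp (l i * t))\<bar> \<le> exp 1 / sqrt 2 * exp ((l0 + d) * T) * Pr" if t: "0 \<le> t" "t \<le> T" for t
  proof -
    define A where "A = exp (m0 * T')"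
    \<comment> \<open>Minimises e Pr^2 / (4 m0) + h / (2 e) with h = 1 / m0, the bound that follows
      from Young's inequality |p| <= e p^2 / 2 + 1 / (2 e).\<close>
    define e where "e = sqrt 2 / Pr"
    have e: "e > 0" using Pr by (simp add: e_def)
    define P where "P = (\<lambda>s. exp (l0 * s) + (\<Sum>i\<in>I. c i * exp ((l0 - l i) * T') * exp (l i * s)))"
    define K where "K = (\<lambda>r. exp (l0 * (t + r)) / l0 + (\<Sum>i\<in>I. c i * exp ((l0 - l i) * T') * (exp (l i * (t + r)) / l i)))"
    \<comment> \<open>J is a primitive of a majorant of |P|, and K one of P; monotonicity of J + K
      and J - K plays the part of comparing integrals.\<close>
    define J where "J = (\<lambda>r. A * (e / 2 * (- G (T' - t - r)) + r / (2 * e)))"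
    have lpos: "l i > 0" if "i \<in> I" for i using I(3)[OF that] l0 by simp
    have dK: "(K has_real_derivative P (t + r)) (at r)" for r
      unfolding K_def P_def using l0 lpos
      by (intro DERIV_add DERIV_sum DERIV_cmult) (auto intro!: derivative_eq_intros simp: less_imp_neq[symmetric])
    \<comment> \<open>Time reversal s -> T' - s turns the decaying sum p into the growing sum
      P.\<close>
    have Pp: "P s = exp (l0 * T' + d * (T' - s)) * p (T' - s)" for s
    proof -
      have 1: "exp (l0 * T' + d * (T' - s)) * exp (- m0 * (T' - s)) = exp (l0 * s)"
        unfolding exp_add[symmetric] by (rule arg_cong[where f = exp]) (simp add: m0_def algebra_simps)
      have 2: "exp (l0 * T' + d * (T' - s)) * exp (- m i * (T' - s)) = exp ((l0 - l i) * T') * exp (l i * s)" for i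
        unfolding exp_add[symmetric] by (rule arg_cong[where f = exp]) (simp add: m_def algebra_simps)
      have "exp (l0 * T' + d * (T' - s)) * p (T' - s) = exp (l0 * s)
         + (\<Sum>i\<in>I. c i * (exp (l0 * T' + d * (T' - s)) * exp (- m i * (T' - s))))"
        unfolding p_def distrib_left 1 sum_distrib_left by (simp only: mult.left_commute)
      then show ?thesis unfolding 2 by (simp add: P_def mult.assoc)
    qed
    have dJ: "(J has_real_derivative A * (e / 2 * (p (T' - t - r))\<^sup>2 + 1 / (2 * e))) (at r)" for r
    proof -
      have "((\<lambda>r. - G (T' - t - r)) has_real_derivative (p (T' - t - r))\<^sup>2) (at r)"
      proof -
        have "((\<lambda>r. T' - t - r) has_real_derivative -1) (at r)" by (auto intro!: derivative_eq_intros)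
        from DERIV_minus[OF DERIV_chain2[OF G[of "T' - t - r"] this]] show ?thesis by (simp add: p_def)
      qed
      moreover have "((\<lambda>r. r / (2 * e)) has_real_derivative 1 / (2 * e)) (at r)"
        by (intro DERIV_cdivide DERIV_ident)
      ultimately show ?thesis unfolding J_def
        by (intro DERIV_cmult DERIV_add)
    qed
    have PJ: "\<bar>P (t + r)\<bar> \<le> A * (e / 2 * (p (T' - t - r))\<^sup>2 + 1 / (2 * e))" if "r \<ge> 0" for r
    proof -
      have "d * (T' - (t + r)) \<le> d * T'"
        using t that d by (intro mult_left_mono) auto
      then have "exp (l0 * T' + d * (T' - (t + r))) \<le> A"
        by (simp add: A_def m0_def algebra_simps)
      then have "\<bar>P (t + r)\<bar> \<le> A * \<bar>p (T' - (t + r))\<bar>"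
        unfolding Pp by (simp add: abs_mult mult_right_mono)
      also have "\<dots> \<le> A * (e / 2 * (p (T' - t - r))\<^sup>2 + 1 / (2 * e))"
      proof (intro mult_left_mono)
        have "0 \<le> (e * \<bar>p (T' - t - r)\<bar> - 1)\<^sup>2 / (2 * e)" using e by simp
        also have "\<dots> = e / 2 * (p (T' - t - r))\<^sup>2 + 1 / (2 * e) - \<bar>p (T' - t - r)\<bar>"
          using e by (simp add: power2_diff power_mult_distrib field_simps) (simp add: power2_eq_square)
        finally show "\<bar>p (T' - (t + r))\<bar> \<le> e / 2 * (p (T' - t - r))\<^sup>2 + 1 / (2 * e)"
          by (simp add: diff_diff_eq)
      qed (simp add: A_def)
      finally show ?thesis .
    qed
    have "J 0 + K 0 \<le> J h + K h"
    proof (rule DERIV_nonneg_imp_nondecreasing[where f = "\<lambda>r. J r + K r"])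
      fix r assume "0 \<le> r" "r \<le> h"
      then show "\<exists>y. ((\<lambda>r. J r + K r) has_real_derivative y) (at r) \<and> 0 \<le> y"
        using DERIV_add[OF dJ[of r] dK[of r]] PJ[of r] by (intro exI conjI) (assumption, linarith)
    qed (use h in auto)
    moreover have "J 0 - K 0 \<le> J h - K h"
    proof (rule DERIV_nonneg_imp_nondecreasing[where f = "\<lambda>r. J r - K r"])
      fix r assume "0 \<le> r" "r \<le> h"
      then show "\<exists>y. ((\<lambda>r. J r - K r) has_real_derivative y) (at r) \<and> 0 \<le> y"
        using DERIV_diff[OF dJ[of r] dK[of r]] PJ[of r] by (intro exI conjI) (assumption, linarith)
    qed (use h in auto)
    ultimately have KJ: "\<bar>K h - K 0\<bar> \<le> J h - J 0" by linarith
    have diff_exp: "exp (a * (t + h)) / a - exp (a * (t + 0)) / a = h * (E a * exp (a * t))" if "a > 0" for a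
      using that h by (simp add: E_def exp_add distrib_left field_simps)
    have "K h - K 0 = (exp (l0 * (t + h)) / l0 - exp (l0 * (t + 0)) / l0)
       + (\<Sum>i\<in>I. c i * exp ((l0 - l i) * T') * (exp (l i * (t + h)) / l i - exp (l i * (t + 0)) / l i))"
      by (simp add: K_def right_diff_distrib sum_subtractf)
    also have "\<dots> = h * (E l0 * exp (l0 * t)) + (\<Sum>i\<in>I. c i * exp ((l0 - l i) * T') * (h * (E (l i) * exp (l i * t))))"
      using diff_exp[OF l0] diff_exp[OF lpos] by simp
    also have "\<dots> = h * (E l0 * exp (l0 * t) + (\<Sum>i\<in>I. C i * exp (l i * t)))"
      by (simp add: C_def distrib_left sum_distrib_left mult_ac)
    finally have K: "K h - K 0 = h * (E l0 * exp (l0 * t) + (\<Sum>i\<in>I. C i * exp (l i * t)))" .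
    have "J h - J 0 = A * (e / 2 * (G (T' - t) - G (T' - t - h)) + h / (2 * e))"
      by (simp add: J_def algebra_simps)
    also have "\<dots> \<le> A * (e / 2 * (1 / (2 * m0) * Pr\<^sup>2) + h / (2 * e))"
    proof (intro mult_left_mono add_right_mono)
      have "G 0 \<le> G (T' - t - h)" using t by (intro Gmono) (simp add: T'_def)
      moreover have "G (T' - t) - G 0 \<le> 1 / (2 * m0) * Pr\<^sup>2"
        using GR[of "T' - t"] t h by (simp add: T'_def Pr_eq)
      ultimately show "G (T' - t) - G (T' - t - h) \<le> 1 / (2 * m0) * Pr\<^sup>2" by linarith
    qed (use e in \<open>auto simp: A_def\<close>)
    also have "\<dots> = h * (A * Pr / sqrt 2)"
      using Pr m0 by (simp add: e_def h_def field_simps power2_eq_square)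
    finally have "\<bar>h * (E l0 * exp (l0 * t) + (\<Sum>i\<in>I. C i * exp (l i * t)))\<bar> \<le> h * (A * Pr / sqrt 2)"
      using KJ K by simp
    then have "\<bar>E l0 * exp (l0 * t) + (\<Sum>i\<in>I. C i * exp (l i * t))\<bar> \<le> A * Pr / sqrt 2"
      unfolding abs_mult abs_of_pos[OF h] by (rule mult_left_le_imp_le[OF _ h])
    \<comment> \<open>As m0 h = 1, lengthening T to T' = T + h costs just the factor e.\<close>
    also have "A = exp 1 * exp ((l0 + d) * T)"
      using m0 by (simp add: A_def T'_def h_def m0_def[symmetric] distrib_left exp_add)
    finally show ?thesis by (simp add: mult_ac)
  qed
  then show ?thesis using E1 unfolding Pr_def by blast
qed

section \<open>Numerical inequalities and the count of zeros\<close>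

lemma ln_ge_rational:
  assumes "(x::real) \<ge> 1"
  shows "ln x \<ge> 2 * (x - 1) / (x + 1)"
proof -
  \<comment> \<open>The subtracted term is the [1/1] Pade approximant of ln at 1; the difference has
    derivative (y - 1)^2 / (y (y + 1)^2).\<close>
  let ?f = "\<lambda>x. ln x - 2 * (x - 1) / (x + 1)"
  have "?f 1 \<le> ?f x"
  proof (rule DERIV_nonneg_imp_nondecreasing[OF assms])
    fix y :: real assume y: "1 \<le> y" "y \<le> x"
    have "(?f has_real_derivative 1 / y - (2 * (y + 1) - 2 * (y - 1)) / (y + 1)\<^sup>2) (at y)"
      using y by (auto intro!: derivative_eq_intros simp: power2_eq_square)
    moreover have "1 / y - (2 * (y + 1) - 2 * (y - 1)) / (y + 1)\<^sup>2 = (y - 1)\<^sup>2 / (y * (y + 1)\<^sup>2)"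
      using y by (simp add: divide_simps) (simp add: algebra_simps power2_eq_square)
    ultimately show "\<exists>d. (?f has_real_derivative d) (at y) \<and> 0 \<le> d"
      using y by (intro exI[of _ "(y - 1)\<^sup>2 / (y * (y + 1)\<^sup>2)"]) auto
  qed
  then show ?thesis by simp
qed

text \<open>Machin's formula, with arctan(1/5) <= 1/5 and arctan(1/239) > 0.\<close>

lemma pi_less_16_5: "pi < 16 / 5"
proof -
  have arc: "arctan x \<le> x" if "x \<ge> 0" for x
  proof -
    have "0 - arctan 0 \<le> x - arctan x"
    proof (rule DERIV_nonneg_imp_nondecreasing[OF that])
      fix y :: real
      have "((\<lambda>x. x - arctan x) has_real_derivative 1 - inverse (1 + y\<^sup>2)) (at y)"
        by (auto intro!: derivative_eq_intros)
      moreover have "inverse (1 + y\<^sup>2) \<le> 1" by (simp add: inverse_le_1_iff)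
      ultimately show "\<exists>d. ((\<lambda>x. x - arctan x) has_real_derivative d) (at y) \<and> 0 \<le> d"
        by (intro exI[of _ "1 - inverse (1 + y\<^sup>2)"]) auto
    qed
    then show ?thesis by simp
  qed
  have "arctan (1/239) > 0" by (simp add: zero_less_arctan_iff)
  moreover have "arctan (1/5) \<le> 1/5" by (rule arc) simp
  ultimately show ?thesis using machin by linarith
qed

text \<open>To the right of A nu the potential is at least 1 - 1 / A^2, so from any point there the
  next zero is at most pi / w away.\<close>

lemma bessel_zero_Suc_upper:
  assumes nu: "\<nu> > 0" and A: "A > 1" and w: "w > 0" "w\<^sup>2 \<le> 1 - 1 / A\<^sup>2" and a: "a \<ge> A * \<nu>"
  shows "\<exists>x. a < x \<and> x \<le> a + pi / w \<and> bessel_F \<nu> (x\<^sup>2) = 0"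
proof (rule bessel_zero_in_interval)
  have a0: "a > 0" using nu A a by (meson less_le_trans mult_pos_pos order.strict_trans zero_less_one)
  then show "a > 0" .
  have "(A * \<nu>)\<^sup>2 \<le> a\<^sup>2" using a nu A by (intro power_mono) auto
  moreover have "A\<^sup>2 * (\<nu>\<^sup>2 - 1/4) \<le> A\<^sup>2 * \<nu>\<^sup>2" by (intro mult_left_mono) auto
  ultimately have "A\<^sup>2 * (\<nu>\<^sup>2 - 1/4) \<le> a\<^sup>2"
    unfolding power_mult_distrib by linarith
  then have "(\<nu>\<^sup>2 - 1/4) / a\<^sup>2 \<le> 1 / A\<^sup>2"
    using a0 A by (simp add: field_simps)
  then show "w\<^sup>2 \<le> 1 - (\<nu>\<^sup>2 - 1/4) / a\<^sup>2" using w by linarith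
  have "1 / A\<^sup>2 > 0" using A by simp
  then have "w\<^sup>2 \<le> 1" using w by linarith
  then have "w\<^sup>2 \<le> 1\<^sup>2" by simp
  then show "w \<le> 1" by (rule power2_le_imp_le) simp
qed (use nu w in auto)

text \<open>Starting from A nu, each zero costs a step of at most pi / w; so (A nu, B nu] contains
  at least the integer part of its length divided by pi / w.\<close>

lemma bessel_zeros_count:
  assumes nu: "\<nu> > 0" and A: "A > 1" and w: "w > 0" "w\<^sup>2 \<le> 1 - 1 / A\<^sup>2" and B: "B > A"
  shows "\<exists>I. finite I \<and> (\<forall>k\<in>I. A * \<nu> < bessel_zero \<nu> k \<and> bessel_zero \<nu> k \<le> B * \<nu>)
     \<and> real (card I) \<ge> (B - A) * \<nu> * w / pi - 1"
proof -
  have nu0: "\<nu> \<ge> 0" using nu by simp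
  have A\<nu>: "A * \<nu> \<ge> 0" using nu A by simp
  obtain k0 where k0: "k0 > 0" "bessel_zero \<nu> k0 > A * \<nu>"
    "\<And>y. y > A * \<nu> \<Longrightarrow> bessel_F \<nu> (y\<^sup>2) = 0 \<Longrightarrow> bessel_zero \<nu> k0 \<le> y"
    using ex_first_bessel_zero_gt[OF nu0 A\<nu>] by auto
  have mono: "bessel_zero \<nu> k0 \<le> bessel_zero \<nu> (k0 + i)" for i
    using strict_mono_less_eq[OF strict_mono_bessel_zero[OF nu0]] by simp
  have up: "bessel_zero \<nu> (k0 + i) \<le> A * \<nu> + real (Suc i) * (pi / w)" for i
  proof (induction i)
    case 0
    obtain x where "A * \<nu> < x" "x \<le> A * \<nu> + pi / w" "bessel_F \<nu> (x\<^sup>2) = 0"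
      using bessel_zero_Suc_upper[OF nu A w order_refl] by auto
    then show ?case using k0(3)[of x] by simp
  next
    case (Suc i)
    have "A * \<nu> \<le> bessel_zero \<nu> (k0 + i)" using k0(2) mono[of i] by simp
    from bessel_zero_Suc_upper[OF nu A w this] obtain x where x: "bessel_zero \<nu> (k0 + i) < x"
      "x \<le> bessel_zero \<nu> (k0 + i) + pi / w" "bessel_F \<nu> (x\<^sup>2) = 0" by auto
    have "bessel_zero \<nu> (Suc (k0 + i)) \<le> x" by (rule bessel_zero_Suc_le[OF nu0 x(1,3)])
    moreover have "real (Suc (Suc i)) * (pi / w) = real (Suc i) * (pi / w) + pi / w"
      by (simp add: algebra_simps)
    ultimately show ?case using Suc x(2) unfolding add_Suc_right by linarith
  qed
  define n where "n = nat \<lfloor>(B - A) * \<nu> * w / pi\<rfloor>"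
  have nn: "(B - A) * \<nu> * w / pi \<ge> 0" using B nu w by simp
  have n: "real n \<le> (B - A) * \<nu> * w / pi" "real n \<ge> (B - A) * \<nu> * w / pi - 1"
    unfolding n_def using nn by linarith+
  have "A * \<nu> < bessel_zero \<nu> k \<and> bessel_zero \<nu> k \<le> B * \<nu>" if k: "k \<in> {k0..<k0 + n}" for k
  proof -
    obtain i where i: "k = k0 + i" "i < n" using k by (auto simp: le_iff_add)
    have "bessel_zero \<nu> k \<le> A * \<nu> + real (Suc i) * (pi / w)" unfolding i by (rule up)
    also have "real (Suc i) * (pi / w) \<le> real n * (pi / w)"
      using i w by (intro mult_right_mono) auto
    also have "real n * (pi / w) \<le> (B - A) * \<nu> * w / pi * (pi / w)"
      using n w by (intro mult_right_mono) auto
    also have "\<dots> = (B - A) * \<nu>" using w by simp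
    finally show ?thesis using mono[of i] k0(2) i by (simp add: algebra_simps)
  qed
  then show ?thesis using n by (intro exI[of _ "{k0..<k0 + n}"]) auto
qed

lemma second_bessel_zero_upper:
  assumes nu: "\<nu> > 0"
  shows "bessel_zero \<nu> 2 \<le> 104 / 100 * \<nu> + 27"
proof -
  have nu0: "\<nu> \<ge> 0" using nu by simp
  \<comment> \<open>1 - 1 / 1.04^2 exceeds 1/16, which allows w = 1/4. Two steps of length 4 pi <
    12.8 stay below 27.\<close>
  let ?A = "104 / 100 :: real"
  have A: "?A > 1" and w: "(1/4 :: real) > 0" "(1/4::real)\<^sup>2 \<le> 1 - 1 / ?A\<^sup>2"
    by (auto simp: power2_eq_square)
  obtain x where x: "?A * \<nu> < x" "x \<le> ?A * \<nu> + pi / (1/4)" "bessel_F \<nu> (x\<^sup>2) = 0"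
    using bessel_zero_Suc_upper[OF nu A w order_refl] by auto
  have "0 < ?A * \<nu>" using nu by simp
  then have x0: "x > 0" using x(1) by linarith
  have 1: "bessel_zero \<nu> (Suc 0) \<le> x"
    by (rule bessel_zero_Suc_le[OF nu0 _ x(3)]) (simp only: bessel_zero.simps(1) x0)
  obtain y where y: "x < y" "y \<le> x + pi / (1/4)" "bessel_F \<nu> (y\<^sup>2) = 0"
    using bessel_zero_Suc_upper[OF nu A w less_imp_le[OF x(1)]] by auto
  have "bessel_zero \<nu> (Suc (Suc 0)) \<le> y"
    by (rule bessel_zero_Suc_le[OF nu0 le_less_trans[OF 1 y(1)] y(3)])
  moreover have "x \<le> ?A * \<nu> + 4 * pi" "y \<le> x + 4 * pi" using x(2) y(2) by simp_all
  ultimately show ?thesis using pi_less_16_5 unfolding numeral_2_eq_2 by linarith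
qed

text \<open>The five spans contain enough zeros: with \<open>w\<^sub>A \<le> (1 - A\<^sup>-\<^sup>2)\<^bsup>1/2\<^esup>\<close>, the sum of
  \<open>(B - A) w\<^sub>A ln ((B\<^sup>2 + 2) / (B\<^sup>2 - 1))\<close> over them exceeds \<open>1.04 (\<pi> / 2 - ln 2)\<close>.\<close>

lemma bessel_zeros_product:
  "\<exists>C. \<forall>\<nu>>0. \<exists>I. finite I \<and> I \<subseteq> {2..} \<and>
     exp ((1/2 - ln 2 / pi) * bessel_zero \<nu> 2 - C) \<le>
     (\<Prod>k\<in>I. ((bessel_zero \<nu> k)\<^sup>2 + (bessel_zero \<nu> 1)\<^sup>2 + (bessel_zero \<nu> 2)\<^sup>2) / ((bessel_zero \<nu> k)\<^sup>2 - (bessel_zero \<nu> 1)\<^sup>2))"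
proof -
  define g where "g = (\<lambda>B::real. ln ((B\<^sup>2 + 2) / (B\<^sup>2 - 1)))"
  \<comment> \<open>The g terms pay for the -1 in the five counts; 200 exceeds both 91.5, needed for
    nu <= 150 with the empty product, and 27/2, left over for larger nu.\<close>
  define C where "C = 200 + (g (3/2) + g 2 + g 3 + g 4 + g 6)"
  have g0: "g B \<ge> 0" if "B > 1" for B
  proof -
    have "B\<^sup>2 > 1" using that by (simp add: one_less_power)
    then show ?thesis by (simp add: g_def)
  qed
  have ln2: "ln 2 / pi > 0" by simp
  have half: "1/2 - ln 2 / pi \<le> 1/2" "0 \<le> 1/2 - ln 2 / pi"
    using ln2 pi_gt3 ln_2_less_1 by (auto simp: field_simps)
  have "\<exists>I. finite I \<and> I \<subseteq> {2..} \<and>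
     exp ((1/2 - ln 2 / pi) * bessel_zero \<nu> 2 - C) \<le>
     (\<Prod>k\<in>I. ((bessel_zero \<nu> k)\<^sup>2 + (bessel_zero \<nu> 1)\<^sup>2 + (bessel_zero \<nu> 2)\<^sup>2) / ((bessel_zero \<nu> k)\<^sup>2 - (bessel_zero \<nu> 1)\<^sup>2))"
    if nu: "\<nu> > 0" for \<nu>
  proof (cases "\<nu> \<le> 150")
    case True
    have "(1/2 - ln 2 / pi) * bessel_zero \<nu> 2 \<le> 1/2 * (104/100 * \<nu> + 27)"
      using half second_bessel_zero_upper[OF nu] bessel_zero_pos[of \<nu> 2] nu by (intro mult_mono) auto
    also have "\<dots> \<le> C" using True g0[of "3/2"] g0[of 2] g0[of 3] g0[of 4] g0[of 6] by (simp add: C_def)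
    finally show ?thesis by (intro exI[of _ "{}"]) auto
  next
    case False
    have nu0: "\<nu> \<ge> 0" using nu by simp
    define j where "j = bessel_zero \<nu>"
    have j1: "j 1 > \<nu>" using first_bessel_zero_gt[OF nu] by (simp add: j_def)
    have j12: "j 1 < j 2" using strict_monoD[OF strict_mono_bessel_zero[OF nu0], of 1 2] by (simp add: j_def)
    have j2: "j 2 \<le> 104/100 * \<nu> + 27" using second_bessel_zero_upper[OF nu] by (simp add: j_def)
    \<comment> \<open>0.21 nu > 27 for nu > 150; so the spans, which begin at 1.25 nu, contain
      neither j 1 nor j 2.\<close>
    then have j2': "j 2 < 5/4 * \<nu>" using False by simp
    let ?f = "\<lambda>k. ((j k)\<^sup>2 + (j 1)\<^sup>2 + (j 2)\<^sup>2) / ((j k)\<^sup>2 - (j 1)\<^sup>2)"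
    have span: "\<exists>I. finite I \<and> (\<forall>k\<in>I. A * \<nu> < j k \<and> j k \<le> B * \<nu>) \<and> I \<subseteq> {2..} \<and>
        exp (((B - A) * \<nu> * w / pi - 1) * g B) \<le> (\<Prod>k\<in>I. ?f k)"
      if A: "A \<ge> 5/4" and w: "w > 0" "w\<^sup>2 \<le> 1 - 1 / A\<^sup>2" and B: "B > A" for A B w :: real
    proof -
      have A1: "A > 1" using A by simp
      obtain I where I: "finite I" "\<And>k. k \<in> I \<Longrightarrow> A * \<nu> < j k \<and> j k \<le> B * \<nu>"
        "real (card I) \<ge> (B - A) * \<nu> * w / pi - 1"
        using bessel_zeros_count[OF nu A1 w B] unfolding j_def by blast
      have B1: "B\<^sup>2 > 1" using A1 B by (simp add: one_less_power)
      have Anu: "5/4 * \<nu> \<le> A * \<nu>" using A nu by simp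
      \<comment> \<open>The quotient increases with j 1 and j 2 and decreases with j k, so the worst
        case is j 1 = j 2 = nu and j k = B nu.\<close>
      have f: "?f k \<ge> (B\<^sup>2 + 2) / (B\<^sup>2 - 1)" if "k \<in> I" for k
      proof -
        have k: "j k > 5/4 * \<nu>" "j k \<le> B * \<nu>" using I(2)[OF that] Anu by auto
        have sq: "(j k)\<^sup>2 > (j 1)\<^sup>2" "(j k)\<^sup>2 \<le> B\<^sup>2 * \<nu>\<^sup>2" "(j 1)\<^sup>2 \<ge> \<nu>\<^sup>2" "(j 2)\<^sup>2 \<ge> \<nu>\<^sup>2"
          using k j1 j12 j2' nu by (auto intro!: power_strict_mono power_mono simp flip: power_mult_distrib)
        have "(B\<^sup>2 + 2) * ((j k)\<^sup>2 - (j 1)\<^sup>2) \<le> (B\<^sup>2 + 2) * ((j k)\<^sup>2 - \<nu>\<^sup>2)"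
          using sq B1 by (intro mult_left_mono) auto
        also have "\<dots> \<le> ((j k)\<^sup>2 + 2 * \<nu>\<^sup>2) * (B\<^sup>2 - 1)"
          using sq by (simp add: algebra_simps)
        also have "\<dots> \<le> ((j k)\<^sup>2 + (j 1)\<^sup>2 + (j 2)\<^sup>2) * (B\<^sup>2 - 1)"
          using sq B1 by (intro mult_right_mono) auto
        finally show ?thesis using sq B1 by (simp add: divide_simps)
      qed
      have "exp (((B - A) * \<nu> * w / pi - 1) * g B) \<le> exp (real (card I) * g B)"
        using I(3) g0[of B] A1 B by (simp add: mult_right_mono)
      also have "\<dots> = ((B\<^sup>2 + 2) / (B\<^sup>2 - 1)) ^ card I"
        using B1 by (simp add: g_def exp_of_nat_mult add_pos_pos)
      also have "\<dots> = (\<Prod>k\<in>I. (B\<^sup>2 + 2) / (B\<^sup>2 - 1))" by simp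
      also have "\<dots> \<le> (\<Prod>k\<in>I. ?f k)"
        using f B1 by (intro prod_mono) auto
      finally have "exp (((B - A) * \<nu> * w / pi - 1) * g B) \<le> (\<Prod>k\<in>I. ?f k)" .
      moreover have "k \<ge> 2" if "k \<in> I" for k
      proof (rule ccontr)
        assume "\<not> k \<ge> 2"
        then have "j k \<le> j 2" unfolding j_def
          using strict_mono_less_eq[OF strict_mono_bessel_zero[OF nu0], of k 2] by simp
        then show False using I(2)[OF that] j2' Anu by simp
      qed
      ultimately show ?thesis using I by (intro exI[of _ I]) auto
    qed
    obtain I1 where I1: "finite I1" "\<And>k. k \<in> I1 \<Longrightarrow> 5/4 * \<nu> < j k \<and> j k \<le> 3/2 * \<nu>" "I1 \<subseteq> {2..}"
      "exp (((3/2 - 5/4) * \<nu> * (3/5) / pi - 1) * g (3/2)) \<le> (\<Prod>k\<in>I1. ?f k)"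
      using span[of "5/4" "3/5" "3/2"] by (auto simp: power2_eq_square)
    obtain I2 where I2: "finite I2" "\<And>k. k \<in> I2 \<Longrightarrow> 3/2 * \<nu> < j k \<and> j k \<le> 2 * \<nu>" "I2 \<subseteq> {2..}"
      "exp (((2 - 3/2) * \<nu> * (149/200) / pi - 1) * g 2) \<le> (\<Prod>k\<in>I2. ?f k)"
      using span[of "3/2" "149/200" 2] by (auto simp: power2_eq_square)
    obtain I3 where I3: "finite I3" "\<And>k. k \<in> I3 \<Longrightarrow> 2 * \<nu> < j k \<and> j k \<le> 3 * \<nu>" "I3 \<subseteq> {2..}"
      "exp (((3 - 2) * \<nu> * (433/500) / pi - 1) * g 3) \<le> (\<Prod>k\<in>I3. ?f k)"
      using span[of 2 "433/500" 3] by (auto simp: power2_eq_square)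
    obtain I4 where I4: "finite I4" "\<And>k. k \<in> I4 \<Longrightarrow> 3 * \<nu> < j k \<and> j k \<le> 4 * \<nu>" "I4 \<subseteq> {2..}"
      "exp (((4 - 3) * \<nu> * (47/50) / pi - 1) * g 4) \<le> (\<Prod>k\<in>I4. ?f k)"
      using span[of 3 "47/50" 4] by (auto simp: power2_eq_square)
    obtain I5 where I5: "finite I5" "\<And>k. k \<in> I5 \<Longrightarrow> 4 * \<nu> < j k \<and> j k \<le> 6 * \<nu>" "I5 \<subseteq> {2..}"
      "exp (((6 - 4) * \<nu> * (121/125) / pi - 1) * g 6) \<le> (\<Prod>k\<in>I5. ?f k)"
      using span[of 4 "121/125" 6] by (auto simp: power2_eq_square)
    have disj: "I1 \<inter> I2 = {}" "(I1 \<union> I2) \<inter> I3 = {}" "(I1 \<union> I2 \<union> I3) \<inter> I4 = {}" "(I1 \<union> I2 \<union> I3 \<union> I4) \<inter> I5 = {}"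
      using I1(2) I2(2) I3(2) I4(2) I5(2) nu by fastforce+
    define I where "I = I1 \<union> I2 \<union> I3 \<union> I4 \<union> I5"
    have prod: "(\<Prod>k\<in>I. ?f k) = (\<Prod>k\<in>I1. ?f k) * (\<Prod>k\<in>I2. ?f k) * (\<Prod>k\<in>I3. ?f k) * (\<Prod>k\<in>I4. ?f k) * (\<Prod>k\<in>I5. ?f k)"
      unfolding I_def using I1(1) I2(1) I3(1) I4(1) I5(1) disj by (simp add: prod.union_disjoint)
    \<comment> \<open>The arguments of the five logarithms are 17/5, 2, 11/8, 6/5 and 38/35.\<close>
    have g_lower: "g (3/2) \<ge> 12/11" "g 2 \<ge> 2/3" "g 3 \<ge> 6/19" "g 4 \<ge> 2/11" "g 6 \<ge> 6/73"
      using ln_ge_rational[of "17/5"] ln2_ge_two_thirds ln_ge_rational[of "11/8"] ln_ge_rational[of "6/5"] ln_ge_rational[of "38/35"]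
      by (simp_all add: g_def power2_eq_square)
    have "(1/2 - ln 2 / pi) * j 2 \<le> (1/2 - ln 2 / pi) * (104/100 * \<nu> + 27)"
      using half j2 by (intro mult_left_mono) auto
    also have "\<dots> \<le> 104/100 * \<nu> * (1/2 - ln 2 / pi) + 27/2"
      using half by (simp add: algebra_simps)
    also have "\<dots> = \<nu> / pi * (104/100 * (pi / 2 - ln 2)) + 27/2"
      by (simp add: field_simps)
    also have "\<dots> \<le> \<nu> / pi * ((3/2 - 5/4) * (3/5) * g (3/2) + (2 - 3/2) * (149/200) * g 2 + (3 - 2) * (433/500) * g 3
        + (4 - 3) * (47/50) * g 4 + (6 - 4) * (121/125) * g 6) + 27/2"
    proof (intro add_right_mono mult_left_mono)
      \<comment> \<open>With these bounds the right side is at least 1.015 and the left side at most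
        1.04 (8/5 - 2/3) < 0.971.\<close>
      show "104/100 * (pi / 2 - ln 2) \<le> (3/2 - 5/4) * (3/5) * g (3/2) + (2 - 3/2) * (149/200) * g 2 + (3 - 2) * (433/500) * g 3
        + (4 - 3) * (47/50) * g 4 + (6 - 4) * (121/125) * g 6"
        using g_lower pi_less_16_5 ln2_ge_two_thirds by simp
    qed (use nu in auto)
    finally have main: "(1/2 - ln 2 / pi) * j 2 - C \<le> ((3/2 - 5/4) * \<nu> * (3/5) / pi - 1) * g (3/2)
       + ((2 - 3/2) * \<nu> * (149/200) / pi - 1) * g 2 + ((3 - 2) * \<nu> * (433/500) / pi - 1) * g 3
       + ((4 - 3) * \<nu> * (47/50) / pi - 1) * g 4 + ((6 - 4) * \<nu> * (121/125) / pi - 1) * g 6"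
      by (simp add: C_def algebra_simps)
    have "exp ((1/2 - ln 2 / pi) * j 2 - C) \<le> (\<Prod>k\<in>I. ?f k)"
      unfolding prod
    proof (rule order_trans[OF exp_le_cancel_iff[THEN iffD2, OF main]])
      note nn = order_trans[OF exp_ge_zero I1(4)] order_trans[OF exp_ge_zero I2(4)]
        order_trans[OF exp_ge_zero I3(4)] order_trans[OF exp_ge_zero I4(4)]
      show "exp (((3/2 - 5/4) * \<nu> * (3/5) / pi - 1) * g (3/2)
       + ((2 - 3/2) * \<nu> * (149/200) / pi - 1) * g 2 + ((3 - 2) * \<nu> * (433/500) / pi - 1) * g 3
       + ((4 - 3) * \<nu> * (47/50) / pi - 1) * g 4 + ((6 - 4) * \<nu> * (121/125) / pi - 1) * g 6)
       \<le> (\<Prod>k\<in>I1. ?f k) * (\<Prod>k\<in>I2. ?f k) * (\<Prod>k\<in>I3. ?f k) * (\<Prod>k\<in>I4. ?f k) * (\<Prod>k\<in>I5. ?f k)"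
        unfolding exp_add by (intro mult_mono I1(4) I2(4) I3(4) I4(4) I5(4) mult_nonneg_nonneg nn exp_ge_zero)
    qed
    then show ?thesis
      using I1 I2 I3 I4 I5 unfolding j_def by (intro exI[of _ I]) (auto simp: I_def)
  qed
  then show ?thesis by blast
qed

lemma L2_norm_const_time:
  assumes "T \<ge> 0"
  shows "(\<lambda>_. 1) \<in> L2_space (time_measure T)" "L2_norm (time_measure T) (\<lambda>_. 1) = sqrt T"
proof -
  have e: "emeasure (time_measure T) (space (time_measure T)) = ennreal T"
    using assms by (simp add: space_restrict_space emeasure_restrict_space)
  have "finite_measure (time_measure T)" by (rule finite_measureI) (unfold e, simp)
  then interpret finite_measure "time_measure T" .
  show "(\<lambda>_. 1) \<in> L2_space (time_measure T)" by (simp add: L2_space_def)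
  have "measure (time_measure T) (space (time_measure T)) = T"
    unfolding measure_def e using assms by simp
  then show "L2_norm (time_measure T) (\<lambda>_. 1) = sqrt T"
    by (simp add: L2_norm_def L2_inner_def)
qed

section \<open>The cost of steering Phi_1 to rest, by duality\<close>

context degenerate_parabolic
begin

text \<open>Against the exponential sum Q the control integrates to C0 / b_1 >= 1 / b_1, while |Q|
  <= B on (0,T). The factor sqrt T comes from passing from the L^1 norm of f to its L^2
  norm.\<close>

lemma control_norm_lower:
  assumes f: "f \<in> null_controls T \<alpha> \<beta> \<mu> (\<Phi> 1)" and T: "T > 0" and I: "finite I" "I \<subseteq> {2..}"
  shows "sqrt 2 / exp 1 / (bk 1 * sqrt T) * exp (- (lam 1 + lam 2 / 2) * T)
     * (\<Prod>k\<in>I. ((j k)\<^sup>2 + (j 1)\<^sup>2 + (j 2)\<^sup>2) / ((j k)\<^sup>2 - (j 1)\<^sup>2)) \<le> L2_norm (time_measure T) f"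
proof -
  have fL2: "f \<in> L2_space (time_measure T)"
    using null_control_moments(1)[OF f eigenfun_L2 T, of 1] by simp
  have b1: "bk 1 > 0" and l1: "lam 1 > 0" by (rule bk_pos lam_pos, simp)+
  have jlt: "j 1 < j k" if "k \<in> I" for k
    using that I(2) strict_monoD[OF strict_mono_bessel_zero[OF nu_nonneg], of 1 k] by force
  have j1: "j 1 > 0" by (rule j_pos) simp
  have sq: "(j 1)\<^sup>2 < (j k)\<^sup>2" if "k \<in> I" for k
    using jlt[OF that] j1 by (intro power_strict_mono) auto
  have lamlt: "lam k > lam 1" if "k \<in> I" for k
    using sq[OF that] kappa_pos by (simp add: lam_eq zk_def)
  have int_exp: "integrable (time_measure T) (\<lambda>t. f t * exp (lam k * t))"
    "(\<integral>t. f t * exp (lam k * t) \<partial>time_measure T) = (if k = 1 then 1 / bk 1 else 0)" if k: "k > 0" for k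
  proof -
    have e: "f t * exp (lam k * t) = exp (lam k * T) * (f t * exp (- lam k * (T - t)))" for t
      by (simp add: algebra_simps flip: exp_add)
    show "integrable (time_measure T) (\<lambda>t. f t * exp (lam k * t))"
      unfolding e using T by (intro integrable_mult_right exp_moment_bound(1)[OF fL2 lam_pos[OF k]]) auto
    have "(\<integral>t. f t * exp (lam k * t) \<partial>time_measure T) = exp (lam k * T) * exp_moment f (lam k) T"
      unfolding e exp_moment_def by simp
    moreover have "bk k * exp_moment f (lam k) T = exp (- lam k * T) * cf (\<Phi> 1) k"
      by (rule null_control_moments(2)[OF f eigenfun_L2 T k]) simp
    moreover have "cf (\<Phi> 1) k = (if k = 1 then 1 else 0)" by (rule coef_eigenfun) (use k in auto)
    ultimately show "(\<integral>t. f t * exp (lam k * t) \<partial>time_measure T) = (if k = 1 then 1 / bk 1 else 0)"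
      using bk_pos[OF k] by (auto simp: field_simps exp_minus)
  qed
  define Pr where "Pr = (\<Prod>k\<in>I. (lam k - lam 1) / (lam k + lam 1 + 2 * (lam 2 / 2)))"
  \<comment> \<open>The shift lam 2 / 2 accounts at once for j_2^2 / 2 in the exponential and for (j
    2)^2 in the numerators of the product.\<close>
  obtain C0 C where C0: "C0 \<ge> 1" and Q: "\<And>t. 0 \<le> t \<Longrightarrow> t \<le> T \<Longrightarrow> \<bar>C0 * exp (lam 1 * t) + (\<Sum>i\<in>I. C i * exp (lam i * t))\<bar>
     \<le> exp 1 / sqrt 2 * exp ((lam 1 + lam 2 / 2) * T) * Pr"
    using exp_sum_small_sup[of I lam "lam 1" "lam 2 / 2" T, OF I(1) _ lamlt l1 _ T] lam_pos[of 2] lam_inj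
    unfolding Pr_def by (auto simp: inj_on_def)
  define B where "B = exp 1 / sqrt 2 * exp ((lam 1 + lam 2 / 2) * T) * Pr"
  let ?Q = "\<lambda>t. C0 * exp (lam 1 * t) + (\<Sum>i\<in>I. C i * exp (lam i * t))"
  have pos: "i > 0" if "i \<in> I" for i using that I(2) by force
  have fQ: "f t * ?Q t = C0 * (f t * exp (lam 1 * t)) + (\<Sum>i\<in>I. C i * (f t * exp (lam i * t)))" for t
    by (simp add: distrib_left sum_distrib_left mult_ac)
  have iQ: "integrable (time_measure T) (\<lambda>t. f t * ?Q t)"
    unfolding fQ using pos
    by (intro Bochner_Integration.integrable_add Bochner_Integration.integrable_sum integrable_mult_right int_exp(1)) auto
  have "(\<integral>t. f t * ?Q t \<partial>time_measure T) = C0 * (\<integral>t. f t * exp (lam 1 * t) \<partial>time_measure T)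
      + (\<Sum>i\<in>I. C i * (\<integral>t. f t * exp (lam i * t) \<partial>time_measure T))"
    unfolding fQ using pos int_exp(1)
    by (subst Bochner_Integration.integral_add)
       (auto intro!: Bochner_Integration.integrable_sum simp: Bochner_Integration.integral_sum)
  also have "\<dots> = C0 / bk 1"
  proof -
    have "(\<Sum>i\<in>I. C i * (\<integral>t. f t * exp (lam i * t) \<partial>time_measure T)) = 0"
      using I(2) by (intro sum.neutral ballI) (subst int_exp(2)[OF pos], auto)
    then show ?thesis using int_exp(2)[of 1] by simp
  qed
  finally have eq: "C0 / bk 1 = (\<integral>t. f t * ?Q t \<partial>time_measure T)" ..
  have fi: "integrable (time_measure T) f"
    using L2_prod_integrable[OF fL2 L2_norm_const_time(1)] T by simp
  have "1 / bk 1 \<le> C0 / bk 1" using C0 b1 by (simp add: divide_right_mono)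
  also have "\<dots> \<le> (\<integral>t. \<bar>f t\<bar> * B \<partial>time_measure T)"
    unfolding eq
  proof (rule integral_mono[OF iQ])
    show "integrable (time_measure T) (\<lambda>t. \<bar>f t\<bar> * B)" using fi by simp
    fix t assume "t \<in> space (time_measure T)"
    then have "\<bar>?Q t\<bar> \<le> B" using Q[of t] by (simp add: space_restrict_space B_def)
    then have "\<bar>f t\<bar> * \<bar>?Q t\<bar> \<le> \<bar>f t\<bar> * B" by (intro mult_left_mono) auto
    then show "f t * ?Q t \<le> \<bar>f t\<bar> * B" using abs_ge_self[of "f t * ?Q t"] by (simp add: abs_mult)
  qed
  also have "\<dots> = B * (\<integral>t. \<bar>f t\<bar> \<partial>time_measure T)" by simp
  also have "\<dots> \<le> B * (L2_norm (time_measure T) f * sqrt T)"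
  proof (rule mult_left_mono)
    have a: "(\<lambda>t. \<bar>f t\<bar>) \<in> L2_space (time_measure T)" using fL2 by (auto simp: L2_space_def)
    have n: "L2_norm (time_measure T) (\<lambda>t. \<bar>f t\<bar>) = L2_norm (time_measure T) f"
      by (simp add: L2_norm_def L2_inner_def)
    show "(\<integral>t. \<bar>f t\<bar> \<partial>time_measure T) \<le> L2_norm (time_measure T) f * sqrt T"
      using L2_Cauchy_Schwarz[OF a L2_norm_const_time(1)] L2_norm_const_time(2)[of T] T n
      by (simp add: L2_inner_def)
    show "B \<ge> 0" using order_trans[OF abs_ge_zero Q[of 0]] T by (simp add: B_def)
  qed
  finally have main: "1 / bk 1 \<le> B * (L2_norm (time_measure T) f * sqrt T)" .
  have Pr_pos: "Pr > 0" unfolding Pr_def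
  proof (intro prod_pos divide_pos_pos)
    fix k assume "k \<in> I"
    then show "0 < lam k - lam 1" "0 < lam k + lam 1 + 2 * (lam 2 / 2)"
      using lamlt[of k] l1 lam_pos[of 2] by auto
  qed
  have prod: "(\<Prod>k\<in>I. ((j k)\<^sup>2 + (j 1)\<^sup>2 + (j 2)\<^sup>2) / ((j k)\<^sup>2 - (j 1)\<^sup>2)) = 1 / Pr"
  proof -
    have "1 / Pr = (\<Prod>k\<in>I. 1 / ((lam k - lam 1) / (lam k + lam 1 + 2 * (lam 2 / 2))))"
      unfolding Pr_def prod_dividef by simp
    also have "\<dots> = (\<Prod>k\<in>I. ((j k)\<^sup>2 + (j 1)\<^sup>2 + (j 2)\<^sup>2) / ((j k)\<^sup>2 - (j 1)\<^sup>2))"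
    proof (rule prod.cong[OF refl])
      fix k assume "k \<in> I"
      have "lam k - lam 1 = \<kappa>\<^sup>2 * ((j k)\<^sup>2 - (j 1)\<^sup>2)" "lam k + lam 1 + 2 * (lam 2 / 2) = \<kappa>\<^sup>2 * ((j k)\<^sup>2 + (j 1)\<^sup>2 + (j 2)\<^sup>2)"
        by (simp_all add: lam_eq zk_def algebra_simps)
      then show "1 / ((lam k - lam 1) / (lam k + lam 1 + 2 * (lam 2 / 2))) = ((j k)\<^sup>2 + (j 1)\<^sup>2 + (j 2)\<^sup>2) / ((j k)\<^sup>2 - (j 1)\<^sup>2)"
        using kappa_pos by simp
    qed
    finally show ?thesis ..
  qed
  have "sqrt 2 / exp 1 / (bk 1 * sqrt T) * exp (- (lam 1 + lam 2 / 2) * T) * (1 / Pr) = (1 / bk 1) / (B * sqrt T)"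
    by (simp add: B_def exp_minus field_simps)
  also have "\<dots> \<le> B * (L2_norm (time_measure T) f * sqrt T) / (B * sqrt T)"
    using main Pr_pos T by (intro divide_right_mono) (auto simp: B_def)
  also have "\<dots> = L2_norm (time_measure T) f"
    using Pr_pos T by (simp add: B_def)
  finally show ?thesis unfolding prod .
qed

lemma cost_ge:
  assumes "\<And>f. f \<in> null_controls T \<alpha> \<beta> \<mu> (\<Phi> 1) \<Longrightarrow> X \<le> L2_norm (time_measure T) f"
  shows "ereal X \<le> cost T \<alpha> \<beta> \<mu>"
proof -
  have "ereal X \<le> (INF f \<in> null_controls T \<alpha> \<beta> \<mu> (\<Phi> 1). ereal (L2_norm (time_measure T) f))"
    using assms by (intro INF_greatest) auto
  also have "\<dots> \<le> cost T \<alpha> \<beta> \<mu>"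
    unfolding cost_def using eigenfun_L2[of 1] eigenfun_norm[of 1]
    by (intro SUP_upper2[where i = "\<Phi> 1"]) auto
  finally show ?thesis .
qed

end

lemma cost_lower_bound:
  "\<exists>c::real > 0. \<forall>T \<alpha> \<beta> \<mu> :: real. T > 0 \<and> admissible \<alpha> \<beta> \<mu> \<longrightarrow>
           (let \<nu> = nu \<alpha> \<beta> \<mu>; j1 = bessel_zero \<nu> 1; j2 = bessel_zero \<nu> 2 in
             ereal (c * 2 powr \<nu> * Gamma (\<nu> + 1) * \<bar>deriv (bessel_J \<nu>) j1\<bar>
                      * exp ((1/2 - ln 2 / pi) * j2)
                    / ((2 * T * kappa \<alpha>) powr (1/2) * j1 powr \<nu>)
                    * exp (- ((j1\<^sup>2 + j2\<^sup>2 / 2) * (kappa \<alpha>)\<^sup>2 * T)))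
             \<le> cost T \<alpha> \<beta> \<mu>)"
proof -
  obtain C where C: "\<And>\<nu>. \<nu> > 0 \<Longrightarrow> \<exists>I. finite I \<and> I \<subseteq> {2..} \<and>
     exp ((1/2 - ln 2 / pi) * bessel_zero \<nu> 2 - C) \<le>
     (\<Prod>k\<in>I. ((bessel_zero \<nu> k)\<^sup>2 + (bessel_zero \<nu> 1)\<^sup>2 + (bessel_zero \<nu> 2)\<^sup>2) / ((bessel_zero \<nu> k)\<^sup>2 - (bessel_zero \<nu> 1)\<^sup>2))"
    using bessel_zeros_product by blast
  define c where "c = sqrt 2 / exp 1 * exp (- C)"
  have "ereal (c * 2 powr nu \<alpha> \<beta> \<mu> * Gamma (nu \<alpha> \<beta> \<mu> + 1) * \<bar>deriv (bessel_J (nu \<alpha> \<beta> \<mu>)) (bessel_zero (nu \<alpha> \<beta> \<mu>) 1)\<bar>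
                      * exp ((1/2 - ln 2 / pi) * bessel_zero (nu \<alpha> \<beta> \<mu>) 2)
                    / ((2 * T * kappa \<alpha>) powr (1/2) * bessel_zero (nu \<alpha> \<beta> \<mu>) 1 powr nu \<alpha> \<beta> \<mu>)
                    * exp (- (((bessel_zero (nu \<alpha> \<beta> \<mu>) 1)\<^sup>2 + (bessel_zero (nu \<alpha> \<beta> \<mu>) 2)\<^sup>2 / 2) * (kappa \<alpha>)\<^sup>2 * T)))
             \<le> cost T \<alpha> \<beta> \<mu>" if T: "T > 0" and adm: "admissible \<alpha> \<beta> \<mu>" for T \<alpha> \<beta> \<mu>
  proof -
    interpret degenerate_parabolic \<alpha> \<beta> \<mu> by standard (rule adm)
    obtain I where I: "finite I" "I \<subseteq> {2..}" and
      P: "exp ((1/2 - ln 2 / pi) * j 2 - C) \<le> (\<Prod>k\<in>I. ((j k)\<^sup>2 + (j 1)\<^sup>2 + (j 2)\<^sup>2) / ((j k)\<^sup>2 - (j 1)\<^sup>2))"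
      using C[OF nu_pos] by auto
    have j1: "j 1 > 0" and b1: "bk 1 > 0" by (rule j_pos bk_pos, simp)+
    have G: "Gamma (\<nu> + 1) > 0" using nu_nonneg by (intro Gamma_real_pos) auto
    have d: "deriv (bessel_J \<nu>) (j 1) \<noteq> 0"
      using bk_eq_deriv[of 1] b1 by auto
    \<comment> \<open>By \<open>bk_eq_deriv\<close> the Bessel factors in the claim amount to a
      multiple of 1 / (\<open>bk 1\<close> sqrt T).\<close>
    have X: "c * 2 powr \<nu> * Gamma (\<nu> + 1) * \<bar>deriv (bessel_J \<nu>) (j 1)\<bar> * exp ((1/2 - ln 2 / pi) * j 2)
        / ((2 * T * \<kappa>) powr (1/2) * (j 1) powr \<nu>) * exp (- (((j 1)\<^sup>2 + (j 2)\<^sup>2 / 2) * \<kappa>\<^sup>2 * T))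
      = sqrt 2 / exp 1 / (bk 1 * sqrt T) * exp (- (lam 1 + lam 2 / 2) * T) * exp ((1/2 - ln 2 / pi) * j 2 - C)"
    proof -
      have e1: "(2 * T * \<kappa>) powr (1/2) = sqrt (2 * \<kappa>) * sqrt T"
        using T kappa_pos by (simp add: powr_half_sqrt real_sqrt_mult mult_ac)
      have e2: "- (((j 1)\<^sup>2 + (j 2)\<^sup>2 / 2) * \<kappa>\<^sup>2 * T) = - (lam 1 + lam 2 / 2) * T"
        unfolding lam_eq zk_def by algebra
      have e3: "exp ((1/2 - ln 2 / pi) * j 2 - C) = exp ((1/2 - ln 2 / pi) * j 2) * exp (- C)"
        by (simp flip: exp_add)
      have "1 / bk 1 = 2 powr \<nu> * Gamma (\<nu> + 1) * \<bar>deriv (bessel_J \<nu>) (j 1)\<bar> / (sqrt (2 * \<kappa>) * (j 1) powr \<nu>)"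
        by (subst bk_eq_deriv) auto
      moreover have "sqrt 2 / exp 1 / (bk 1 * sqrt T) = sqrt 2 / exp 1 * (1 / bk 1) / sqrt T" by simp
      ultimately have e4: "sqrt 2 / exp 1 / (bk 1 * sqrt T) = sqrt 2 / exp 1 *
         (2 powr \<nu> * Gamma (\<nu> + 1) * \<bar>deriv (bessel_J \<nu>) (j 1)\<bar> / (sqrt (2 * \<kappa>) * (j 1) powr \<nu>)) / sqrt T"
        by simp
      show ?thesis
        unfolding c_def e1 e2 e3 e4 by (simp only: divide_inverse inverse_mult_distrib mult_ac)
    qed
    have "ereal (sqrt 2 / exp 1 / (bk 1 * sqrt T) * exp (- (lam 1 + lam 2 / 2) * T) * exp ((1/2 - ln 2 / pi) * j 2 - C)) \<le> cost T \<alpha> \<beta> \<mu>"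
    proof (rule cost_ge)
      fix f assume f: "f \<in> null_controls T \<alpha> \<beta> \<mu> (\<Phi> 1)"
      have "sqrt 2 / exp 1 / (bk 1 * sqrt T) * exp (- (lam 1 + lam 2 / 2) * T) * exp ((1/2 - ln 2 / pi) * j 2 - C)
        \<le> sqrt 2 / exp 1 / (bk 1 * sqrt T) * exp (- (lam 1 + lam 2 / 2) * T)
          * (\<Prod>k\<in>I. ((j k)\<^sup>2 + (j 1)\<^sup>2 + (j 2)\<^sup>2) / ((j k)\<^sup>2 - (j 1)\<^sup>2))"
        using b1 T by (intro mult_left_mono P mult_nonneg_nonneg divide_nonneg_nonneg) auto
      also have "\<dots> \<le> L2_norm (time_measure T) f" by (rule control_norm_lower[OF f T I])
      finally show "sqrt 2 / exp 1 / (bk 1 * sqrt T) * exp (- (lam 1 + lam 2 / 2) * T) * exp ((1/2 - ln 2 / pi) * j 2 - C)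
        \<le> L2_norm (time_measure T) f" .
    qed
    then show ?thesis unfolding X .
  qed
  moreover have "c > 0" by (simp add: c_def)
  ultimately show ?thesis unfolding Let_def by blast
qed

section \<open>A bump function with controlled derivatives\<close>

text \<open>Inversion maps the disc of radius r about t to the disc with diameter
  [1 / (t + r), 1 / (t - r)], whose leftmost point is 1 / (t + r).\<close>

lemma Re_inverse_lower:
  fixes z :: complex and t r :: real
  assumes "cmod (of_real t - z) \<le> r" "0 < r" "r < t"
  shows "Re (1 / z) \<ge> 1 / (t + r)" "z \<noteq> 0"
proof -
  obtain x y where z: "z = Complex x y" by (cases z)
  have sq: "(t - x)\<^sup>2 + y\<^sup>2 \<le> r\<^sup>2"
    using power_mono[OF assms(1), of 2] by (simp add: z cmod_power2)
  have "\<bar>t - x\<bar> \<le> r"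
    using sq by (intro power2_le_imp_le[of "\<bar>t - x\<bar>" r, simplified]) (use assms in \<open>auto intro: order_trans[rotated]\<close>)
  then have x: "0 < x" "x \<le> t + r" using assms by auto
  then show "z \<noteq> 0" by (auto simp: z complex_eq_iff)
  have pos: "x\<^sup>2 + y\<^sup>2 > 0" using x by (simp add: add_pos_nonneg)
  have "x\<^sup>2 + y\<^sup>2 \<le> x * (t + r)"
  proof -
    have "(t - r) * x \<le> (t - r) * (t + r)" using x assms by (intro mult_left_mono) auto
    then show ?thesis using sq by (simp add: power2_eq_square algebra_simps)
  qed
  then have "1 / (t + r) \<le> x / (x\<^sup>2 + y\<^sup>2)"
    using pos assms by (simp add: divide_simps mult_ac)
  then show "Re (1 / z) \<ge> 1 / (t + r)"
    by (simp add: z Re_divide)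
qed

text \<open>The bump continued to complex z, so that Cauchy's inequality bounds all its derivatives
  at once.\<close>

definition cbump :: "real \<Rightarrow> real \<Rightarrow> complex \<Rightarrow> complex" where
  "cbump a L z = exp (- (of_real a / z) - of_real a / (of_real L - z))"

text \<open>The i-th derivative of the bump, given for all i simultaneously and extended by 0. That
  these functions are successive derivatives, also at 0 and L, is \<open>DERIV_bump\<close>.\<close>

definition bump :: "real \<Rightarrow> real \<Rightarrow> nat \<Rightarrow> real \<Rightarrow> real" where
  "bump a L i t = (if 0 < t \<and> t < L then Re ((deriv ^^ i) (cbump a L) (of_real t)) else 0)"

lemma cbump_holomorphic: "cbump a L holomorphic_on - {0, of_real L}"
  unfolding cbump_def by (intro holomorphic_intros) auto

lemma cbump_deriv_holomorphic: "(deriv ^^ i) (cbump a L) holomorphic_on - {0, of_real L}"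
  by (intro holomorphic_higher_deriv cbump_holomorphic) auto

lemma cmod_cbump_le:
  assumes a: "a > 0" and t: "0 < r" "r < t" "r < L - t" and z: "cmod (of_real t - z) \<le> r"
  shows "cmod (cbump a L z) \<le> exp (- a / (t + r) - a / (L - t + r))" "z \<in> - {0, of_real L}"
proof -
  have z2: "cmod (of_real (L - t) - (of_real L - z)) \<le> r"
    using z by (simp add: norm_minus_commute)
  note R = Re_inverse_lower[OF z t(1,2)] and R2 = Re_inverse_lower[OF z2 t(1,3)]
  show "z \<in> - {0, of_real L}" using R(2) R2(2) by auto
  have e: "Re (of_real a / w) = a * Re (1 / w)" for w
    by (simp add: Re_divide)
  have "a * (1 / (t + r)) \<le> a * Re (1 / z)" "a * (1 / (L - t + r)) \<le> a * Re (1 / (of_real L - z))"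
    using mult_left_mono[OF R(1), of a] mult_left_mono[OF R2(1), of a] a by linarith+
  then have "Re (- (of_real a / z) - of_real a / (of_real L - z)) \<le> - a / (t + r) - a / (L - t + r)"
    by (simp add: e)
  then show "cmod (cbump a L z) \<le> exp (- a / (t + r) - a / (L - t + r))"
    by (simp add: cbump_def)
qed

text \<open>Cauchy's inequality on the circle of radius c m, with m the distance to the nearer
  endpoint. The choice of a makes a / (m + c m) = A / (c m); the farther endpoint contributes a
  factor of at most exp(-a / L), which later pays for a larger N.\<close>

lemma bump_bound:
  fixes A c L :: real
  assumes A: "A > 0" and c: "0 < c" "c < 1"
  defines "a \<equiv> (1 + c) * A / c"
  assumes t: "0 < t" "t < L"
  defines "m \<equiv> min t (L - t)"
  shows "\<bar>bump a L i t\<bar> \<le> fact i / (c * m) ^ i * exp (- A / (c * m) - a / L)"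
proof -
  have a: "a > 0" using A c by (simp add: a_def)
  have m: "m > 0" "m \<le> t" "m \<le> L - t" using t by (auto simp: m_def)
  define r where "r = c * m"
  have cm: "c * m < m" using c m by simp
  have r: "0 < r" "r < t" "r < L - t" using mult_pos_pos[OF c(1) m(1)] cm m(2,3) unfolding r_def by linarith+
  note B = cmod_cbump_le[OF a r]
  have sub: "cball (of_real t) r \<subseteq> - {0, of_real L :: complex}"
    using B(2) by (intro subsetI) (simp only: mem_cball dist_norm)
  have hol: "cbump a L holomorphic_on cball (of_real t) r"
    by (rule holomorphic_on_subset[OF cbump_holomorphic sub])
  have "norm ((deriv ^^ i) (cbump a L) (of_real t)) \<le> fact i * exp (- a / (t + r) - a / (L - t + r)) / r ^ i"
    by (rule Cauchy_inequality)
       (use hol r B(1) in \<open>auto intro: holomorphic_on_imp_continuous_on holomorphic_on_subset[OF _ ball_subset_cball]\<close>)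
  also have "\<dots> \<le> fact i * exp (- A / (c * m) - a / L) / r ^ i"
  proof (intro divide_right_mono mult_left_mono)
    have eq: "a / (m + r) = A / (c * m)"
    proof -
      have "m + r = m * (1 + c)" by (simp add: r_def algebra_simps)
      moreover have "1 + c \<noteq> 0" using c by simp
      ultimately show ?thesis using c m by (simp add: a_def)
    qed
    have "a / (m + r) + a / (L - m + r) = a / (t + r) + a / (L - t + r)"
      by (auto simp: m_def min_def)
    moreover have "a / L \<le> a / (L - m + r)"
    proof -
      have "L - m + r > 0" "L - m + r \<le> L" using r m cm t unfolding r_def by linarith+
      then show ?thesis using a t by (intro divide_left_mono) (auto intro!: mult_pos_pos)
    qed
    ultimately have "- a / (t + r) - a / (L - t + r) \<le> - A / (c * m) - a / L"
      using eq by simp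
    then show "exp (- a / (t + r) - a / (L - t + r)) \<le> exp (- A / (c * m) - a / L)" by simp
  qed (use r in auto)
  finally have "norm ((deriv ^^ i) (cbump a L) (of_real t)) \<le> fact i / (c * m) ^ i * exp (- A / (c * m) - a / L)"
    by (simp add: r_def)
  moreover have "\<bar>bump a L i t\<bar> \<le> norm ((deriv ^^ i) (cbump a L) (of_real t))"
    using t abs_Re_le_cmod[of "(deriv ^^ i) (cbump a L) (of_real t)"] by (simp add: bump_def)
  ultimately show ?thesis by linarith
qed

text \<open>Quadratic flatness at both ends yields differentiability there with derivative 0. It
  comes from the boundedness of x^(i + 2) exp(-A x) for x = 1 / (c m).\<close>

lemma bump_quadratic:
  assumes A: "A > 0" and c: "0 < c" "c < 1"
  defines "a \<equiv> (1 + c) * A / c"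
  shows "\<exists>K\<ge>0. \<forall>t. \<bar>bump a L i t\<bar> \<le> K * t\<^sup>2 \<and> \<bar>bump a L i t\<bar> \<le> K * (t - L)\<^sup>2"
proof -
  define K where "K = fact i * (fact (i + 2) / A ^ (i + 2)) * c\<^sup>2"
  have K: "K \<ge> 0" using A by (simp add: K_def)
  have "\<bar>bump a L i t\<bar> \<le> K * t\<^sup>2 \<and> \<bar>bump a L i t\<bar> \<le> K * (t - L)\<^sup>2" for t
  proof (cases "0 < t \<and> t < L")
    case True
    define m where "m = min t (L - t)"
    have m: "m > 0" "m \<le> t" "m \<le> L - t" using True by (auto simp: m_def)
    have a: "a > 0" using A c by (simp add: a_def)
    define x where "x = 1 / (c * m)"
    have x: "x > 0" using c m by (simp add: x_def)
    have "\<bar>bump a L i t\<bar> \<le> fact i / (c * m) ^ i * exp (- A / (c * m) - a / L)"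
      unfolding a_def m_def using True by (intro bump_bound A c) auto
    also have "\<dots> \<le> fact i / (c * m) ^ i * exp (- A / (c * m))"
      using c m a True by (intro mult_left_mono) auto
    also have "\<dots> = fact i * (x ^ (i + 2) * exp (- A * x)) * (c * m)\<^sup>2"
    proof -
      have "(1 / y) ^ (i + 2) * y\<^sup>2 = 1 / y ^ i" if "y > 0" for y :: real
        using that by (simp add: power_divide power_add power2_eq_square)
      from this[of "c * m"] have "x ^ (i + 2) * (c * m)\<^sup>2 = 1 / (c * m) ^ i"
        using c m by (simp add: x_def)
      then have "fact i * (x ^ (i + 2) * exp (- A * x)) * (c * m)\<^sup>2 = fact i * (1 / (c * m) ^ i) * exp (- A * x)"
        by (metis mult.assoc mult.commute)
      then show ?thesis by (simp add: x_def)
    qed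
    also have "\<dots> \<le> fact i * (fact (i + 2) / A ^ (i + 2)) * (c * m)\<^sup>2"
      using x A by (intro mult_right_mono mult_left_mono power_exp_le) auto
    also have "\<dots> = K * m\<^sup>2" by (simp add: K_def power_mult_distrib)
    finally have b: "\<bar>bump a L i t\<bar> \<le> K * m\<^sup>2" .
    have "K * m\<^sup>2 \<le> K * t\<^sup>2" using m K by (intro mult_left_mono power_mono) auto
    moreover have "K * m\<^sup>2 \<le> K * (L - t)\<^sup>2" using m K by (intro mult_left_mono power_mono) auto
    ultimately show ?thesis using b by (simp add: power2_commute[of t L])
  next
    case False
    then have "bump a L i t = 0" by (auto simp: bump_def)
    then show ?thesis using K by simp
  qed
  then show ?thesis using K by blast
qed

lemma DERIV_zero_of_quadratic:
  fixes f :: "real \<Rightarrow> real"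
  assumes "\<And>s. \<bar>f s\<bar> \<le> K * (s - t)\<^sup>2"
  shows "(f has_real_derivative 0) (at t)"
proof -
  have ft: "f t = 0" using assms[of t] by simp
  have "((\<lambda>s. (f s - f t) / (s - t)) \<longlongrightarrow> 0) (at t)"
  proof (rule Lim_null_comparison)
    show "\<forall>\<^sub>F s in at t. norm ((f s - f t) / (s - t)) \<le> K * \<bar>s - t\<bar>"
    proof (rule eventually_mono[OF eventually_neq_at_within])
      fix s assume "s \<noteq> t"
      then have "\<bar>f s\<bar> / \<bar>s - t\<bar> \<le> K * (s - t)\<^sup>2 / \<bar>s - t\<bar>"
        using assms[of s] by (intro divide_right_mono) auto
      also have "\<dots> = K * \<bar>s - t\<bar>"
        using \<open>s \<noteq> t\<close> by (simp add: power2_eq_square field_simps)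
      finally show "norm ((f s - f t) / (s - t)) \<le> K * \<bar>s - t\<bar>"
        by (simp add: ft)
    qed
    have "((\<lambda>s. K * \<bar>s - t\<bar>) \<longlongrightarrow> K * \<bar>t - t\<bar>) (at t)" by (intro tendsto_intros)
    then show "((\<lambda>s. K * \<bar>s - t\<bar>) \<longlongrightarrow> 0) (at t)" by simp
  qed
  then show ?thesis by (simp add: has_field_derivative_iff)
qed

lemma DERIV_bump:
  assumes A: "A > 0" and c: "0 < c" "c < 1"
  defines "a \<equiv> (1 + c) * A / c"
  shows "(bump a L i has_real_derivative bump a L (Suc i) t) (at t)"
proof -
  obtain K where K: "\<And>t. \<bar>bump a L i t\<bar> \<le> K * t\<^sup>2" "\<And>t. \<bar>bump a L i t\<bar> \<le> K * (t - L)\<^sup>2"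
    using bump_quadratic[OF A c, of L i] unfolding a_def by auto
  consider "0 < t \<and> t < L" | "t = 0" | "t = L" | "t < 0 \<or> t > L" by linarith
  then show ?thesis
  proof cases
    case 1
    let ?f = "(deriv ^^ i) (cbump a L)"
    have "(?f has_field_derivative deriv ?f (of_real t)) (at (of_real t))"
      by (rule holomorphic_derivI[OF cbump_deriv_holomorphic]) (use 1 in auto)
    then have "((\<lambda>x. ?f (of_real x)) has_vector_derivative deriv ?f (of_real t)) (at t)"
      by (rule has_vector_derivative_real_field)
    then have "((\<lambda>x. Re (?f (of_real x))) has_vector_derivative Re (deriv ?f (of_real t))) (at t)"
      by (rule bounded_linear.has_vector_derivative[OF bounded_linear_Re])
    then have "((\<lambda>x. Re (?f (of_real x))) has_real_derivative bump a L (Suc i) t) (at t)"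
      using 1 by (simp add: has_real_derivative_iff_has_vector_derivative bump_def)
    then show ?thesis
      by (rule has_field_derivative_transform_within_open[where S = "{0<..<L}"]) (use 1 in \<open>auto simp: bump_def\<close>)
  next
    case 2
    then have "bump a L (Suc i) t = 0" by (simp add: bump_def)
    then show ?thesis using DERIV_zero_of_quadratic[of "bump a L i" K t] K(1) 2 by simp
  next
    case 3
    then have "bump a L (Suc i) t = 0" by (simp add: bump_def)
    then show ?thesis using DERIV_zero_of_quadratic[of "bump a L i" K t] K(2) 3 by simp
  next
    case 4
    then have z: "bump a L (Suc i) t = 0" by (auto simp: bump_def)
    have "((\<lambda>_. 0) has_real_derivative 0) (at t)" by simp
    then have "(bump a L i has_real_derivative 0) (at t)"
      by (rule has_field_derivative_transform_within_open[where S = "{..<0} \<union> {L<..}"]) (use 4 in \<open>auto simp: bump_def\<close>)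
    then show ?thesis unfolding z .
  qed
qed

lemma bump_0:
  assumes "0 < t" "t < L"
  shows "bump a L 0 t = exp (- (a / t) - a / (L - t))"
proof -
  have "cbump a L (of_real t) = of_real (exp (- (a / t) - a / (L - t)))"
    unfolding cbump_def by (simp flip: of_real_divide of_real_diff of_real_minus exp_of_real)
  then show ?thesis using assms by (simp add: bump_def)
qed

lemma bump_0_nonneg: "bump a L 0 t \<ge> 0"
  using bump_0[of t L a] by (cases "0 < t \<and> t < L") (auto simp: bump_def[of _ _ 0])

lemma bump_0_lower:
  assumes a: "a > 0" and L: "L > 0" and t: "\<bar>t - L / 2\<bar> \<le> L / 100"
  shows "bump a L 0 t \<ge> exp (- (4 * a / L) * (2500 / 2499))"
proof -
  have "t - L / 2 \<le> L / 100" "- (t - L / 2) \<le> L / 100" using t by (simp_all only: abs_le_iff)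
  then have tt: "0 < t" "t < L" using L by linarith+
  have "(t - L / 2)\<^sup>2 \<le> (L / 100)\<^sup>2" using t L by (metis abs_ge_zero power2_abs power_mono)
  \<comment> \<open>L^2 / 4 - (L / 100)^2 is L^2 / 4 times 2499 / 2500; the reciprocal of this ratio
    is the loss in the exponent.\<close>
  then have "t * (L - t) \<ge> L\<^sup>2 / 4 - L\<^sup>2 / 10000"
    by (simp add: power2_eq_square algebra_simps)
  then have p: "t * (L - t) \<ge> L\<^sup>2 * 2499 / 10000" by simp
  have "a / t + a / (L - t) = a * L / (t * (L - t))"
    using tt by (simp add: field_simps)
  also have "\<dots> \<le> a * L / (L\<^sup>2 * 2499 / 10000)"
    using p a L tt by (intro divide_left_mono) auto
  also have "\<dots> = (4 * a / L) * (2500 / 2499)"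
    using L by (simp add: field_simps power2_eq_square)
  finally show ?thesis unfolding bump_0[OF tt] by simp
qed

section \<open>The weighted sum of the derivatives\<close>

lemma pochhammer_Suc_fact: "pochhammer (real N + 1) i = fact (N + i) / fact N"
proof (induction i)
  case (Suc i)
  show ?case unfolding pochhammer_Suc Suc.IH by (simp add: divide_simps)
qed simp

text \<open>As (N + 1)_i = (N + i)! / N!, the series with R replaced by x is N! / x^N times a tail
  of the series of exp x. The freedom x >= R permits x = max(R, N) later.\<close>

lemma sum_power_pochhammer_le:
  fixes x R :: real
  assumes "0 \<le> R" "R \<le> x" "0 < x"
  shows "summable (\<lambda>i. R ^ i / pochhammer (real N + 1) i)"
    "(\<Sum>i. R ^ i / pochhammer (real N + 1) i) \<le> fact N / x ^ N * exp x"
proof -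
  have e: "(\<lambda>k. x ^ k / fact k) sums exp x"
    using exp_converges[of x] by (simp add: divide_inverse mult.commute)
  have sh: "summable (\<lambda>i. x ^ (i + N) / fact (i + N))"
    using sums_summable[OF e] by (subst summable_iff_shift)
  have b: "R ^ i / pochhammer (real N + 1) i \<le> fact N / x ^ N * (x ^ (i + N) / fact (i + N))" for i
  proof -
    have "R ^ i / pochhammer (real N + 1) i \<le> x ^ i / pochhammer (real N + 1) i"
      using assms by (intro divide_right_mono power_mono) (auto simp: pochhammer_Suc_fact)
    also have "\<dots> = fact N / x ^ N * (x ^ (i + N) / fact (i + N))"
      unfolding pochhammer_Suc_fact using assms by (simp add: power_add add.commute)
    finally show ?thesis .
  qed
  have sm: "summable (\<lambda>i. fact N / x ^ N * (x ^ (i + N) / fact (i + N)))"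
    by (rule summable_mult[OF sh])
  have nn: "0 \<le> R ^ i / pochhammer (real N + 1) i" for i
    using assms by (simp add: pochhammer_Suc_fact)
  show s: "summable (\<lambda>i. R ^ i / pochhammer (real N + 1) i)"
    by (rule summable_comparison_test'[OF sm, of 0]) (use b nn in \<open>simp only: real_norm_def abs_of_nonneg\<close>)
  have "(\<Sum>i. R ^ i / pochhammer (real N + 1) i) \<le> (\<Sum>i. fact N / x ^ N * (x ^ (i + N) / fact (i + N)))"
    by (rule suminf_le[OF b s sm])
  also have "\<dots> = fact N / x ^ N * (\<Sum>i. x ^ (i + N) / fact (i + N))"
    by (rule suminf_mult[OF sh])
  also have "\<dots> \<le> fact N / x ^ N * exp x"
  proof (rule mult_left_mono)
    have "(\<Sum>i. x ^ (i + N) / fact (i + N)) = exp x - (\<Sum>i<N. x ^ i / fact i)"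
      using suminf_minus_initial_segment[OF sums_summable[OF e], of N] sums_unique[OF e] by simp
    also have "\<dots> \<le> exp x" using assms by (simp add: sum_nonneg)
    finally show "(\<Sum>i. x ^ (i + N) / fact (i + N)) \<le> exp x" .
  qed (use assms in auto)
  finally show "(\<Sum>i. R ^ i / pochhammer (real N + 1) i) \<le> fact N / x ^ N * exp x" .
qed

text \<open>The gain \<open>N! / N\<^sup>N \<approx> e\<^sup>-\<^sup>N\<close> for large \<open>\<nu>\<close> is what makes the constant \<open>3\<close> in the cost
  sufficient uniformly in \<open>\<nu>\<close>.\<close>

lemma bump_weighted_sum:
  fixes A c L \<nu> :: real
  assumes A: "A > 0" and c: "0 < c" "c < 1" and L: "L > 0" and N: "real N \<le> \<nu>" "real N \<le> (3 + c) * A / (c * L)"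
  defines "a \<equiv> (1 + c) * A / c"
  defines "w \<equiv> \<lambda>i. A ^ Suc i / (fact (Suc i) * pochhammer (\<nu> + 1) (Suc i))"
  shows "summable (\<lambda>i. w i * \<bar>bump a L i t\<bar>)"
    "(\<Sum>i. w i * \<bar>bump a L i t\<bar>) \<le> A * (fact N / real N ^ N)"
    "\<And>i. w i \<ge> 0"
proof -
  have nu: "\<nu> \<ge> 0" using N by linarith
  have pp: "pochhammer (\<nu> + 1) n > 0" for n using nu by (intro pochhammer_pos) auto
  show w0: "w i \<ge> 0" for i using A pp[of "Suc i"] by (simp add: w_def del: fact_Suc)
  have "summable (\<lambda>i. w i * \<bar>bump a L i t\<bar>) \<and> (\<Sum>i. w i * \<bar>bump a L i t\<bar>) \<le> A * (fact N / real N ^ N)"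
  proof (cases "0 < t \<and> t < L")
    case False
    then have "bump a L i t = 0" for i by (auto simp: bump_def)
    then show ?thesis using A by simp
  next
    case True
    define m where "m = min t (L - t)"
    have m: "m > 0" "m \<le> L / 2" using True by (auto simp: m_def min_def)
    have a: "a > 0" using A c by (simp add: a_def)
    \<comment> \<open>By the Cauchy bound the i-th term becomes a multiple of R^i: (i + 1)! in w
      absorbs i!, and convergence is left to the Pochhammer symbol.\<close>
    define R where "R = A / (c * m)"
    have R: "R > 0" using A c m by (simp add: R_def)
    have R_lower: "R \<ge> 2 * A / (c * L)"
    proof -
      have "A / (c * (L / 2)) \<le> A / (c * m)" using A c m L by (intro divide_left_mono mult_left_mono) auto
      then show ?thesis by (simp add: R_def mult.commute)
    qed
    \<comment> \<open>For R >= N the factor exp R is balanced by exp(-R). For R < N, where x = N,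
      the excess N - R is at most a / L, by R >= 2 A / (c L) and the second bound on N. Either way x
      >= N yields the gain.\<close>
    define x where "x = max R (real N)"
    have x: "R \<le> x" "0 < x" "real N \<le> x" using R by (auto simp: x_def)
    have wb: "w i * \<bar>bump a L i t\<bar> \<le> A * exp (- R - a / L) * (R ^ i / pochhammer (real N + 1) i)" for i
    proof -
      have "\<bar>bump a L i t\<bar> \<le> fact i / (c * m) ^ i * exp (- A / (c * m) - a / L)"
        unfolding a_def m_def using True by (intro bump_bound A c) auto
      then have "w i * \<bar>bump a L i t\<bar> \<le> w i * (fact i / (c * m) ^ i * exp (- R - a / L))"
        using w0 by (intro mult_left_mono) (auto simp: R_def)
      also have "\<dots> = A * exp (- R - a / L) * R ^ i * (1 / (real (Suc i) * pochhammer (\<nu> + 1) (Suc i)))"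
        by (simp add: w_def R_def power_divide mult_ac del: of_nat_Suc)
      also have "\<dots> \<le> A * exp (- R - a / L) * R ^ i * (1 / pochhammer (real N + 1) i)"
      proof (intro mult_left_mono divide_left_mono)
        have "pochhammer (real N + 1) i \<le> pochhammer (\<nu> + 2) i"
          unfolding pochhammer_prod using N by (intro prod_mono) auto
        also have "pochhammer (\<nu> + 2) i \<le> (\<nu> + 1) * pochhammer (\<nu> + 2) i"
          using nu pochhammer_pos[of "\<nu> + 2" i] by simp
        also have "\<dots> = pochhammer (\<nu> + 1) (Suc i)" by (simp add: pochhammer_rec add.commute)
        also have "\<dots> \<le> real (Suc i) * pochhammer (\<nu> + 1) (Suc i)" using pp[of "Suc i"] by simp
        finally show "pochhammer (real N + 1) i \<le> real (Suc i) * pochhammer (\<nu> + 1) (Suc i)" .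
        show "0 < real (Suc i) * pochhammer (\<nu> + 1) (Suc i) * pochhammer (real N + 1) i"
          using pp[of "Suc i"] by (simp add: pochhammer_Suc_fact)
      qed (use A R in auto)
      finally show ?thesis by simp
    qed
    note P = sum_power_pochhammer_le[OF less_imp_le[OF R] x(1,2), of N]
    have sm: "summable (\<lambda>i. A * exp (- R - a / L) * (R ^ i / pochhammer (real N + 1) i))"
      by (rule summable_mult[OF P(1)])
    have s: "summable (\<lambda>i. w i * \<bar>bump a L i t\<bar>)"
      by (rule summable_comparison_test'[OF sm, of 0]) (use wb w0 in auto)
    have "(\<Sum>i. w i * \<bar>bump a L i t\<bar>) \<le> (\<Sum>i. A * exp (- R - a / L) * (R ^ i / pochhammer (real N + 1) i))"
      by (rule suminf_le[OF wb s sm])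
    also have "\<dots> = A * exp (- R - a / L) * (\<Sum>i. R ^ i / pochhammer (real N + 1) i)"
      by (rule suminf_mult[OF P(1)])
    also have "\<dots> \<le> A * exp (- R - a / L) * (fact N / x ^ N * exp x)"
      using A by (intro mult_left_mono P(2)) auto
    also have "\<dots> = A * (fact N / x ^ N) * exp (x - R - a / L)"
    proof -
      have "exp (- R - a / L) * exp x = exp (x - R - a / L)"
        unfolding exp_add[symmetric] by (rule arg_cong[where f = exp]) simp
      then show ?thesis by (metis mult.assoc mult.commute)
    qed
    also have "\<dots> \<le> A * (fact N / real N ^ N) * 1"
    proof (intro mult_mono)
      have xN: "real N ^ N > 0" by (cases N) auto
      show "fact N / x ^ N \<le> fact N / real N ^ N"
        using x xN by (intro divide_left_mono power_mono) auto
      have aL: "a / L = (1 + c) * A / (c * L)" by (simp add: a_def)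
      have "x \<le> R + a / L"
      proof -
        have "real N \<le> 2 * A / (c * L) + (1 + c) * A / (c * L)"
          using N(2) by (simp add: algebra_simps add_divide_distrib)
        also have "\<dots> \<le> R + a / L" using R_lower aL by simp
        finally have "real N \<le> R + a / L" .
        moreover have "0 \<le> a / L" using a L by simp
        ultimately show ?thesis by (simp add: x_def)
      qed
      then show "exp (x - R - a / L) \<le> 1" by simp
    qed (use A x in auto)
    finally show ?thesis using s by simp
  qed
  then show "summable (\<lambda>i. w i * \<bar>bump a L i t\<bar>)" "(\<Sum>i. w i * \<bar>bump a L i t\<bar>) \<le> A * (fact N / real N ^ N)"
    by auto
qed

text \<open>Stirling's upper bound N! <= e N (N / e)^N, by induction from e <= (1 + 1 / k)^(k + 1).
  Writing N + 1 for the factor N includes N = 0, where \<open>real 0 ^ 0\<close> is 1.\<close>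

lemma fact_div_power_le: "fact N / real N ^ N \<le> exp 1 * (real N + 1) * exp (- real N)"
proof -
  have *: "fact (Suc n) \<le> exp 1 * real (Suc n) * (real (Suc n) ^ Suc n * exp (- real (Suc n)))" for n
  proof (induction n)
    case 0
    then show ?case by (simp flip: exp_add)
  next
    case (Suc n)
    define k where "k = real (Suc n)"
    have k: "k > 0" by (simp add: k_def)
    have "exp 1 * k ^ Suc n * k \<le> (k + 1) ^ Suc (Suc n)"
    proof -
      have "1 / (k + 1) \<le> ln (1 + 1 / k)"
      proof -
        have "ln (k / (k + 1)) \<le> k / (k + 1) - 1" using k by (intro ln_le_minus_one) auto
        also have "\<dots> = - (1 / (k + 1))" using k by (simp add: field_simps)
        finally have "1 / (k + 1) \<le> - ln (k / (k + 1))" by simp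
        also have "\<dots> = ln (1 + 1 / k)" using k by (subst ln_inverse[symmetric]) (auto simp: field_simps)
        finally show ?thesis .
      qed
      then have "exp (1 / (k + 1)) \<le> 1 + 1 / k"
        using k by (subst (asm) ln_ge_iff) (auto intro: add_pos_pos)
      then have "exp (1 / (k + 1)) ^ Suc (Suc n) \<le> (1 + 1 / k) ^ Suc (Suc n)"
        by (rule power_mono) simp
      also have "exp (1 / (k + 1)) ^ Suc (Suc n) = exp 1"
        unfolding exp_of_nat_mult[symmetric] by (rule arg_cong[where f = exp]) (simp add: k_def field_simps)
      finally have "exp 1 * k ^ Suc (Suc n) \<le> (1 + 1 / k) ^ Suc (Suc n) * k ^ Suc (Suc n)"
        using k by (intro mult_right_mono) auto
      also have "\<dots> = (k + 1) ^ Suc (Suc n)"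
      proof -
        have "(1 + 1 / k) * k = k + 1" using k by (simp add: field_simps)
        then show ?thesis by (simp only: power_mult_distrib[symmetric])
      qed
      finally show ?thesis by (simp add: mult_ac)
    qed
    then have st: "k * (k ^ Suc n * exp (- k)) \<le> (k + 1) ^ Suc (Suc n) * exp (- (k + 1))"
      by (simp add: exp_diff exp_minus field_simps)
    have "fact (Suc (Suc n)) = (k + 1) * (fact (Suc n) :: real)" by (simp add: k_def algebra_simps)
    also have "\<dots> \<le> (k + 1) * (exp 1 * k * (k ^ Suc n * exp (- k)))"
      using Suc k unfolding k_def by (intro mult_left_mono) auto
    also have "\<dots> = exp 1 * (k + 1) * (k * (k ^ Suc n * exp (- k)))" by (simp add: mult_ac)
    also have "\<dots> \<le> exp 1 * (k + 1) * ((k + 1) ^ Suc (Suc n) * exp (- (k + 1)))"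
      using k by (intro mult_left_mono st) auto
    also have "k + 1 = real (Suc (Suc n))" by (simp add: k_def)
    finally show ?case .
  qed
  show ?thesis
  proof (cases N)
    case 0
    have "(1::real) \<le> exp 1" by simp
    then show ?thesis using 0 by simp
  next
    case (Suc n)
    have "fact N / real N ^ N \<le> exp 1 * real N * exp (- real N)"
      using *[of n] unfolding Suc by (subst pos_divide_le_eq) (simp_all only: mult_ac, simp_all)
    also have "\<dots> \<le> exp 1 * (real N + 1) * exp (- real N)" by (intro mult_right_mono mult_left_mono) auto
    finally show ?thesis .
  qed
qed

section \<open>The Taylor series of \<open>F\<close>\<close>

definition bessel_Fd :: "real \<Rightarrow> nat \<Rightarrow> real \<Rightarrow> real" where
  "bessel_Fd \<nu> n z = (-1) ^ n * bessel_F (\<nu> + real n) z / (4 ^ n * pochhammer (\<nu> + 1) n)"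

lemma DERIV_bessel_Fd:
  assumes "\<nu> \<ge> 0"
  shows "(bessel_Fd \<nu> n has_real_derivative bessel_Fd \<nu> (Suc n) z) (at z)"
proof -
  have p: "pochhammer (\<nu> + 1) n > 0" using assms by (intro pochhammer_pos) auto
  have "(bessel_Fd \<nu> n has_real_derivative (-1) ^ n * (- bessel_F (\<nu> + real n + 1) z / (4 * (\<nu> + real n + 1)))
     / (4 ^ n * pochhammer (\<nu> + 1) n)) (at z)"
    unfolding bessel_Fd_def[abs_def] using assms by (intro DERIV_cdivide DERIV_cmult DERIV_bessel_F) auto
  moreover have "(-1) ^ n * (- bessel_F (\<nu> + real n + 1) z / (4 * (\<nu> + real n + 1))) / (4 ^ n * pochhammer (\<nu> + 1) n)
     = bessel_Fd \<nu> (Suc n) z"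
    by (simp add: bessel_Fd_def pochhammer_Suc add_ac mult_ac)
  ultimately show ?thesis by simp
qed

lemma bessel_Fd_bound:
  assumes "\<nu> \<ge> 0" "z \<ge> 0"
  shows "\<bar>bessel_Fd \<nu> n z\<bar> \<le> 1 / (4 ^ n * pochhammer (\<nu> + 1) n)"
proof -
  have p: "pochhammer (\<nu> + 1) n > 0" using assms by (intro pochhammer_pos) auto
  have "\<bar>bessel_F (\<nu> + real n) z\<bar> \<le> 1" using assms by (intro bessel_F_abs_le_1) auto
  then show ?thesis using p by (simp add: bessel_Fd_def abs_mult power_abs divide_right_mono)
qed

lemma bessel_Fd_bound_1:
  assumes "\<nu> \<ge> 0" "z \<ge> 0"
  shows "\<bar>bessel_Fd \<nu> n z\<bar> \<le> 1"
proof -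
  have "1 \<le> pochhammer (\<nu> + 1) n" by (rule pochhammer_ge_1[OF assms(1)])
  moreover have "(1::real) \<le> 4 ^ n" by simp
  ultimately have "1 * 1 \<le> 4 ^ n * pochhammer (\<nu> + 1) n" by (intro mult_mono) auto
  then have "1 / (4 ^ n * pochhammer (\<nu> + 1) n) \<le> 1" by simp
  then show ?thesis using bessel_Fd_bound[OF assms, of n] by linarith
qed

text \<open>On [0,oo) every derivative of F is at most 1 in modulus, so between two nonnegative
  points the Lagrange remainder is at most |y - z|^n / n!.\<close>

lemma bessel_F_Taylor:
  assumes nu: "\<nu> \<ge> 0" and z: "z \<ge> 0" "y \<ge> 0"
  shows "(\<lambda>n. bessel_Fd \<nu> n z / fact n * (y - z) ^ n) sums bessel_F \<nu> y"
proof (cases "y = z")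
  case True
  have "(\<lambda>n. bessel_Fd \<nu> n z / fact n * 0 ^ n) sums (bessel_Fd \<nu> 0 z)"
    using powser_sums_zero[of "\<lambda>n. bessel_Fd \<nu> n z / fact n"] by simp
  then show ?thesis using True by (simp add: bessel_Fd_def)
next
  case False
  have f0: "bessel_Fd \<nu> 0 = bessel_F \<nu>" by (simp add: bessel_Fd_def[abs_def])
  have "norm ((\<Sum>m<n. bessel_Fd \<nu> m z / fact m * (y - z) ^ m) - bessel_F \<nu> y) \<le> \<bar>y - z\<bar> ^ n / fact n" if n: "n > 0" for n
  proof -
    obtain t where t: "if y < z then y < t \<and> t < z else z < t \<and> t < y"
      "bessel_F \<nu> y = (\<Sum>m<n. (bessel_Fd \<nu> m z / fact m) * (y - z)^m) + (bessel_Fd \<nu> n t / fact n) * (y - z)^n"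
      using Taylor[of n "bessel_Fd \<nu>" "bessel_F \<nu>" 0 "max y z" z y, OF n f0] DERIV_bessel_Fd[OF nu] z False by auto
    have "t \<ge> 0" using t(1) z by (auto split: if_splits)
    have "\<bar>bessel_Fd \<nu> n t\<bar> * (\<bar>y - z\<bar> ^ n / fact n) \<le> 1 * (\<bar>y - z\<bar> ^ n / fact n)"
      by (intro mult_right_mono bessel_Fd_bound_1 nu \<open>t \<ge> 0\<close>) auto
    then show ?thesis unfolding t(2) by (simp add: abs_mult power_abs)
  qed
  then have "eventually (\<lambda>n. norm ((\<Sum>m<n. bessel_Fd \<nu> m z / fact m * (y - z) ^ m) - bessel_F \<nu> y) \<le> \<bar>y - z\<bar> ^ n / fact n) sequentially"
    by (intro eventually_sequentiallyI[of 1]) auto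
  moreover have "(\<lambda>n. \<bar>y - z\<bar> ^ n / fact n) \<longlonglongrightarrow> 0"
    using summable_LIMSEQ_zero[OF summable_exp[of "\<bar>y - z\<bar>"]] by (simp add: divide_inverse mult.commute)
  ultimately have "(\<lambda>n. (\<Sum>m<n. bessel_Fd \<nu> m z / fact m * (y - z) ^ m) - bessel_F \<nu> y) \<longlonglongrightarrow> 0"
    by (rule Lim_null_comparison)
  then show ?thesis unfolding sums_def by (rule LIM_zero_cancel)
qed

section \<open>Series of functions on a bounded time interval\<close>

lemma finite_measure_time: "finite_measure (time_measure T)"
proof (rule finite_measureI)
  have "emeasure (time_measure T) (space (time_measure T)) = emeasure lebesgue {0<..<T}"
    by (simp add: space_restrict_space emeasure_restrict_space)
  also have "\<dots> \<le> emeasure lebesgue {0..T}" by (intro emeasure_mono) auto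
  also have "\<dots> < \<infinity>" by (simp add: emeasure_lborel_Icc_eq)
  finally show "emeasure (time_measure T) (space (time_measure T)) \<noteq> \<infinity>" by simp
qed

text \<open>Since the measure is finite, a uniform bound on the absolute partial sums serves as an
  integrable majorant and allows termwise integration.\<close>

lemma time_suminf:
  fixes F :: "nat \<Rightarrow> real \<Rightarrow> real"
  assumes T: "T \<ge> 0" and meas: "\<And>i. F i \<in> borel_measurable (time_measure T)"
    and bound: "\<And>t n. 0 < t \<Longrightarrow> t < T \<Longrightarrow> (\<Sum>i<n. \<bar>F i t\<bar>) \<le> B"
  shows "integrable (time_measure T) (F i)"
    "(\<lambda>i. integral\<^sup>L (time_measure T) (F i)) sums (\<integral>t. (\<Sum>i. F i t) \<partial>time_measure T)"
    "\<And>t. 0 < t \<Longrightarrow> t < T \<Longrightarrow> \<bar>\<Sum>i. F i t\<bar> \<le> B"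
    "(\<lambda>t. \<Sum>i. F i t) \<in> borel_measurable (time_measure T)"
proof -
  interpret finite_measure "time_measure T" by (rule finite_measure_time)
  have sp: "t \<in> space (time_measure T) \<longleftrightarrow> 0 < t \<and> t < T" for t by (simp add: space_restrict_space)
  have le: "\<bar>F i t\<bar> \<le> B" if "0 < t" "t < T" for i t
  proof -
    have "\<bar>F i t\<bar> \<le> (\<Sum>k<Suc i. \<bar>F k t\<bar>)" by (simp add: sum_nonneg)
    then show ?thesis using bound[OF that, of "Suc i"] by linarith
  qed
  show int: "integrable (time_measure T) (F i)" for i
    using le sp by (intro integrable_const_bound[of _ B] meas AE_I2) auto
  have summ: "summable (\<lambda>i. \<bar>F i t\<bar>)" if "0 < t" "t < T" for t
  proof (rule bounded_imp_summable)
    show "(\<Sum>k\<le>n. \<bar>F k t\<bar>) \<le> B" for n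
      using bound[OF that, of "Suc n"] unfolding lessThan_Suc_atMost .
  qed simp
  have s1: "summable (\<lambda>i. \<integral>t. norm (F i t) \<partial>time_measure T)"
  proof (rule bounded_imp_summable)
    fix n
    have "(\<Sum>k\<le>n. \<integral>t. norm (F k t) \<partial>time_measure T) = (\<integral>t. (\<Sum>k\<le>n. norm (F k t)) \<partial>time_measure T)"
      using int by (intro Bochner_Integration.integral_sum[symmetric] integrable_norm)
    also have "\<dots> \<le> (\<integral>t. B \<partial>time_measure T)"
    proof (rule integral_mono)
      show "integrable (time_measure T) (\<lambda>t. \<Sum>k\<le>n. norm (F k t))"
        using int by (intro Bochner_Integration.integrable_sum integrable_norm)
      fix t assume "t \<in> space (time_measure T)"
      then show "(\<Sum>k\<le>n. norm (F k t)) \<le> B"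
        using bound[of t "Suc n"] sp unfolding lessThan_Suc_atMost by simp
    qed simp
    finally show "(\<Sum>k\<le>n. \<integral>t. norm (F k t) \<partial>time_measure T) \<le> (\<integral>t. B \<partial>time_measure T)" .
  qed simp
  show "(\<lambda>i. integral\<^sup>L (time_measure T) (F i)) sums (\<integral>t. (\<Sum>i. F i t) \<partial>time_measure T)"
    using summ sp by (intro sums_integral int s1 AE_I2) auto
  show "\<bar>\<Sum>i. F i t\<bar> \<le> B" if "0 < t" "t < T" for t
    using summable_rabs[OF summ[OF that]] suminf_le_const[OF summ[OF that] bound[OF that]] by linarith
  show "(\<lambda>t. \<Sum>i. F i t) \<in> borel_measurable (time_measure T)"
    by (intro borel_measurable_suminf meas)
qed

lemma continuous_integrable_time:
  fixes g :: "real \<Rightarrow> real"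
  assumes "continuous_on {0..T} g"
  shows "integrable (time_measure T) g"
  using continuous_imp_integrable_real[OF assms] by (rule lebesgue_on_subset(2)[rotated 3]) auto

lemma bounded_L2_norm:
  assumes T: "T \<ge> 0" and m: "f \<in> borel_measurable (time_measure T)" and b: "\<And>t. 0 < t \<Longrightarrow> t < T \<Longrightarrow> \<bar>f t\<bar> \<le> B" and B: "B \<ge> 0"
  shows "f \<in> L2_space (time_measure T)" "L2_norm (time_measure T) f \<le> sqrt T * B"
proof -
  interpret finite_measure "time_measure T" by (rule finite_measure_time)
  have sp: "t \<in> space (time_measure T) \<longleftrightarrow> 0 < t \<and> t < T" for t by (simp add: space_restrict_space)
  have b2: "(f t)\<^sup>2 \<le> B\<^sup>2" if "0 < t" "t < T" for t
    using power_mono[OF b[OF that], of 2] by simp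
  have i: "integrable (time_measure T) (\<lambda>t. (f t)\<^sup>2)"
    using b2 sp m by (intro integrable_const_bound[of _ "B\<^sup>2"] AE_I2) auto
  then show "f \<in> L2_space (time_measure T)" using m by (simp add: L2_space_def)
  have "(\<integral>t. (f t)\<^sup>2 \<partial>time_measure T) \<le> (\<integral>t. B\<^sup>2 * (1 * 1) \<partial>time_measure T)"
    using b2 sp by (intro integral_mono i) auto
  also have "\<dots> = B\<^sup>2 * L2_inner (time_measure T) (\<lambda>_. 1) (\<lambda>_. 1)"
    by (simp add: L2_inner_def)
  also have "\<dots> = B\<^sup>2 * T"
    using L2_norm_const_time(2)[OF T] L2_norm_power2[of "time_measure T" "\<lambda>_. 1"] T by simp
  finally have "L2_inner (time_measure T) f f \<le> T * B\<^sup>2" by (simp add: L2_inner_def power2_eq_square mult_ac)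
  then have "L2_norm (time_measure T) f \<le> sqrt (T * B\<^sup>2)"
    unfolding L2_norm_def by (rule real_sqrt_le_mono)
  then show "L2_norm (time_measure T) f \<le> sqrt T * B" using B by (simp add: real_sqrt_mult)
qed

section \<open>Construction of a control\<close>

text \<open>With \<open>E(s) = F(-s/\<kappa>\<^sup>2)\<close> the functions \<open>e\<^bsup>-\<lambda>\<^sub>kt\<^esup> \<Sum>\<^sub>i E\<^bsup>(i+1)\<^esup>(-\<lambda>\<^sub>k) / (i+1)! h\<^bsup>(i)\<^esup>(t)\<close>, that is,
  \<open>E(d/dt)\<close> applied to \<open>e\<^bsup>-\<lambda>\<^sub>kt\<^esup>\<close> times a primitive of the bump \<open>h\<close>, are biorthogonal to the \<open>e\<^bsup>\<lambda>\<^sub>mt\<^esup>\<close> up to scaling,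
  because \<open>E\<close> vanishes at all \<open>-\<lambda>\<^sub>m\<close>. The recursion \<open>F\<^sub>\<nu>' = -F\<^bsub>\<nu>+1\<^esub> / (4(\<nu>+1))\<close> and \<open>\<bar>F\<bar> \<le> 1\<close> bound all the
  coefficients independently of \<open>k\<close>.\<close>

context degenerate_parabolic
begin

text \<open>With E as above, the i-th Taylor coefficient at s = -lam k of the entire function E(s) /
  (s + lam k).\<close>

definition ecoef :: "nat \<Rightarrow> nat \<Rightarrow> real" where
  "ecoef k i = - (1 / \<kappa>\<^sup>2) * (bessel_Fd \<nu> (Suc i) (zk k) / fact (Suc i)) * (- (1 / \<kappa>\<^sup>2)) ^ i"

lemma ecoef_bound:
  assumes "k > 0"
  shows "\<bar>ecoef k i\<bar> \<le> (1 / (4 * \<kappa>\<^sup>2)) ^ Suc i / (fact (Suc i) * pochhammer (\<nu> + 1) (Suc i))"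
proof -
  have "\<bar>ecoef k i\<bar> = (1 / \<kappa>\<^sup>2) ^ Suc i / fact (Suc i) * \<bar>bessel_Fd \<nu> (Suc i) (zk k)\<bar>"
    by (simp add: ecoef_def abs_mult power_abs mult_ac del: fact_Suc)
  also have "\<dots> \<le> (1 / \<kappa>\<^sup>2) ^ Suc i / fact (Suc i) * (1 / (4 ^ Suc i * pochhammer (\<nu> + 1) (Suc i)))"
    using zk_pos[OF assms] nu_nonneg by (intro mult_left_mono bessel_Fd_bound) auto
  also have "\<dots> = (1 / (4 * \<kappa>\<^sup>2)) ^ Suc i / (fact (Suc i) * pochhammer (\<nu> + 1) (Suc i))"
    by (simp add: power_divide power_mult_distrib mult_ac del: fact_Suc power_Suc)
  finally show ?thesis .
qed

text \<open>Evaluates E(s) / (s + lam k) at s = -lam m: another zero of E if m differs from k, and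
  the removable singularity with value E'(-lam k) if m = k.\<close>

lemma ecoef_sums:
  assumes k: "k > 0" and m: "m > 0"
  shows "(\<lambda>i. ecoef k i * (lam k - lam m) ^ i) sums (if k = m then - (bessel_F' \<nu> (zk k) / \<kappa>\<^sup>2) else 0)"
proof -
  define w where "w = zk m - zk k"
  let ?\<phi> = "\<lambda>n. bessel_Fd \<nu> n (zk k) / fact n"
  have e: "ecoef k i * (lam k - lam m) ^ i = - (1 / \<kappa>\<^sup>2) * (?\<phi> (Suc i) * w ^ i)" for i
  proof -
    have "(- (1 / \<kappa>\<^sup>2)) ^ i * (lam k - lam m) ^ i = w ^ i"
      unfolding power_mult_distrib[symmetric]
      by (rule arg_cong[where f = "\<lambda>x. x ^ i"]) (use kappa_pos in \<open>simp add: lam_eq w_def field_simps\<close>)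
    then show ?thesis by (simp add: ecoef_def mult.assoc del: fact_Suc)
  qed
  show ?thesis
  proof (cases "k = m")
    case True
    then have w: "w = 0" by (simp add: w_def)
    have "(\<lambda>i. ?\<phi> (Suc i) * 0 ^ i) sums ?\<phi> (Suc 0)"
      by (rule powser_sums_zero[of "\<lambda>i. ?\<phi> (Suc i)"])
    then have "(\<lambda>i. - (1 / \<kappa>\<^sup>2) * (?\<phi> (Suc i) * 0 ^ i)) sums (- (1 / \<kappa>\<^sup>2) * ?\<phi> (Suc 0))"
      by (rule sums_mult)
    moreover have "?\<phi> (Suc 0) = bessel_F' \<nu> (zk k)"
      by (simp add: bessel_Fd_def bessel_F'_def)
    ultimately show ?thesis unfolding e w using True by simp
  next
    case False
    then have w: "w \<noteq> 0" using zk_inj by (simp add: w_def)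
    have "(\<lambda>n. ?\<phi> n * w ^ n) sums 0"
      using bessel_F_Taylor[OF nu_nonneg, of "zk k" "zk m"] zk_pos[OF k] zk_pos[OF m] F_zk[OF m]
      by (simp add: w_def)
    moreover have "?\<phi> 0 * w ^ 0 = 0" using F_zk[OF k] by (simp add: bessel_Fd_def)
    ultimately have "(\<lambda>i. ?\<phi> (Suc i) * w ^ Suc i) sums 0"
      by (subst sums_Suc_iff[of "\<lambda>n. ?\<phi> n * w ^ n"]) simp
    then have "(\<lambda>i. - (1 / \<kappa>\<^sup>2) / w * (?\<phi> (Suc i) * w ^ Suc i)) sums (- (1 / \<kappa>\<^sup>2) / w * 0)"
      by (rule sums_mult)
    moreover have "- (1 / \<kappa>\<^sup>2) / w * (?\<phi> (Suc i) * w ^ Suc i) = - (1 / \<kappa>\<^sup>2) * (?\<phi> (Suc i) * w ^ i)" for i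
      using w by simp
    ultimately show ?thesis unfolding e using False by simp
  qed
qed

text \<open>A fraction e of the decay is spent on (z exp(-y z))^2 <= 1 / y^2, which turns the
  summands into multiples of 1 / z_k; the remaining fraction 1 - e is estimated at the smallest
  eigenvalue.\<close>

lemma weighted_exp_sum:
  assumes t: "t > 0" and e: "0 < e" "e < 1"
  shows "summable (\<lambda>k. (j (Suc k) * exp (- lam (Suc k) * t))\<^sup>2)"
    "sqrt (\<Sum>k. (j (Suc k) * exp (- lam (Suc k) * t))\<^sup>2) \<le> 1 / (2 * e * \<kappa>\<^sup>2 * t) * exp (- (1 - e) * lam 1 * t)"
proof -
  define y where "y = e * \<kappa>\<^sup>2 * t"
  have y: "y > 0" using t e kappa_pos by (simp add: y_def)
  define Q where "Q = (1 / y)\<^sup>2 * exp (- (2 * (1 - e) * lam 1 * t))"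
  have b: "(j (Suc k) * exp (- lam (Suc k) * t))\<^sup>2 \<le> Q * (1 / zk (Suc k))" for k
  proof -
    let ?z = "zk (Suc k)"
    have z: "?z > 0" by (rule zk_pos) simp
    have "?z * exp (- y * ?z) \<le> 1 / y" using power_exp_le[of ?z y 1] z y by simp
    then have "(?z * exp (- y * ?z))\<^sup>2 \<le> (1 / y)\<^sup>2" using z by (intro power_mono) auto
    then have 1: "(?z * exp (- y * ?z))\<^sup>2 * exp (- (2 * (1 - e) * lam (Suc k) * t)) \<le> Q"
      unfolding Q_def using lam_mono[of 1 "Suc k"] e t
      by (intro mult_mono) (auto intro!: mult_left_mono mult_right_mono)
    have "(exp (- y * ?z))\<^sup>2 * exp (- (2 * (1 - e) * lam (Suc k) * t)) = (exp (- lam (Suc k) * t))\<^sup>2"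
      unfolding power2_eq_square exp_add[symmetric] by (rule arg_cong[where f = exp]) (simp add: y_def lam_eq algebra_simps)
    moreover have "(j (Suc k))\<^sup>2 = ?z" by (simp only: zk_def)
    ultimately have "(j (Suc k) * exp (- lam (Suc k) * t))\<^sup>2
        = ?z * ((exp (- y * ?z))\<^sup>2 * exp (- (2 * (1 - e) * lam (Suc k) * t)))"
      by (simp only: power_mult_distrib)
    also have "\<dots> = (?z * exp (- y * ?z))\<^sup>2 * exp (- (2 * (1 - e) * lam (Suc k) * t)) * (1 / ?z)"
      unfolding power_mult_distrib using z by (simp add: power2_eq_square[of ?z])
    finally have "(j (Suc k) * exp (- lam (Suc k) * t))\<^sup>2 = (?z * exp (- y * ?z))\<^sup>2 * exp (- (2 * (1 - e) * lam (Suc k) * t)) * (1 / ?z)" .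
    also have "\<dots> \<le> Q * (1 / ?z)" using 1 z by (intro mult_right_mono) auto
    finally show ?thesis .
  qed
  have sz: "summable (\<lambda>k. 1 / zk (Suc k))" "(\<Sum>k. 1 / zk (Suc k)) \<le> 1 / 4"
  proof -
    have le: "(\<Sum>k<n. 1 / zk (Suc k)) \<le> 1 / 4" for n
      using sum_inverse_zk[of "Suc ` {..<n}"] by (simp add: sum.reindex)
    show s: "summable (\<lambda>k. 1 / zk (Suc k))"
    proof (rule bounded_imp_summable)
      show "0 \<le> 1 / zk (Suc n)" for n using zk_pos[of "Suc n"] by simp
      show "(\<Sum>k\<le>n. 1 / zk (Suc k)) \<le> 1 / 4" for n using le[of "Suc n"] unfolding lessThan_Suc_atMost .
    qed
    show "(\<Sum>k. 1 / zk (Suc k)) \<le> 1 / 4" by (rule suminf_le_const[OF s le])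
  qed
  have sQ: "summable (\<lambda>k. Q * (1 / zk (Suc k)))" by (rule summable_mult[OF sz(1)])
  show s: "summable (\<lambda>k. (j (Suc k) * exp (- lam (Suc k) * t))\<^sup>2)"
    by (rule summable_comparison_test'[OF sQ, of 0]) (use b in simp)
  have "(\<Sum>k. (j (Suc k) * exp (- lam (Suc k) * t))\<^sup>2) \<le> (\<Sum>k. Q * (1 / zk (Suc k)))"
    by (rule suminf_le[OF b s sQ])
  also have "\<dots> = Q * (\<Sum>k. 1 / zk (Suc k))" by (rule suminf_mult[OF sz(1)])
  also have "\<dots> \<le> Q * (1 / 4)" using sz(2) by (intro mult_left_mono) (auto simp: Q_def)
  also have "\<dots> = (1 / (2 * y) * exp (- (1 - e) * lam 1 * t))\<^sup>2"
  proof -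
    have "exp (- (2 * (1 - e) * lam 1 * t)) = (exp (- (1 - e) * lam 1 * t))\<^sup>2"
      unfolding power2_eq_square exp_add[symmetric] by (rule arg_cong[where f = exp]) (simp add: algebra_simps)
    then show ?thesis unfolding Q_def by (simp add: power_mult_distrib power_divide)
  qed
  finally have "sqrt (\<Sum>k. (j (Suc k) * exp (- lam (Suc k) * t))\<^sup>2) \<le> sqrt ((1 / (2 * y) * exp (- (1 - e) * lam 1 * t))\<^sup>2)"
    by (rule real_sqrt_le_mono)
  also have "\<dots> = 1 / (2 * y) * exp (- (1 - e) * lam 1 * t)" using y by simp
  finally show "sqrt (\<Sum>k. (j (Suc k) * exp (- lam (Suc k) * t))\<^sup>2) \<le> 1 / (2 * e * \<kappa>\<^sup>2 * t) * exp (- (1 - e) * lam 1 * t)"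
    by (simp add: y_def mult.assoc)
qed

text \<open>The control constructed here acts only during the last L units of time. Left for later
  tuning are L, the share e of the dissipation on (0, T - L) given up for the sum over k, and N,
  which sets the factorial gain.\<close>

lemma control_exists:
  assumes T: "0 < L" "L < T" and N: "real N \<le> \<nu>" "real N \<le> 1 / (\<kappa>\<^sup>2 * L)" and e: "0 < e" "e < 1"
    and u0: "u0 \<in> L2_space W"
  shows "\<exists>f\<in>null_controls T \<alpha> \<beta> \<mu> u0. L2_norm (time_measure T) f \<le>
     sqrt T * (10 * \<kappa> powr (- (1/2)) * (fact N / real N ^ N) * (1 / L) * (1 / (e * \<kappa>\<^sup>2 * (T - L)))
       * exp (2011/1000 / (\<kappa>\<^sup>2 * L)) * exp (- (1 - e) * lam 1 * (T - L))) * L2_norm W u0"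
proof -
  \<comment> \<open>The base in \<open>ecoef_bound\<close>: 1 / kappa^2 from the scaling of E, 1/4
    from the recursion for F'.\<close>
  define A where "A = 1 / (4 * \<kappa>\<^sup>2)"
  \<comment> \<open>The constant \<open>2.011\<close> in the exponent exceeds \<open>(1 + c) / c \<cdot> 2500 / 2499\<close>.\<close>
  define c :: real where "c = 99/100"
  define a where "a = (1 + c) * A / c"
  define t1 where "t1 = T - L"
  have A: "A > 0" using kappa_pos by (simp add: A_def)
  have c: "0 < c" "c < 1" by (auto simp: c_def)
  have a: "a > 0" using A c by (simp add: a_def)
  have t1: "0 < t1" "t1 < T" using T by (auto simp: t1_def)
  have T0: "0 < T" using T by simp
  \<comment> \<open>(3 + c) / c is at least 4.\<close>
  have N': "real N \<le> (3 + c) * A / (c * L)"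
  proof -
    have "1 / (\<kappa>\<^sup>2 * L) = 4 * A / L" by (simp add: A_def)
    also have "\<dots> \<le> (3 + c) * A / (c * L)" using A T by (simp add: c_def field_simps)
    finally show ?thesis using N by linarith
  qed
  define w where "w = (\<lambda>i. A ^ Suc i / (fact (Suc i) * pochhammer (\<nu> + 1) (Suc i)))"
  define hh where "hh = (\<lambda>i t. bump a L i (t - t1))"
  define S0 where "S0 = A * (fact N / real N ^ N)"
  have "fact N / real N ^ N \<ge> (0::real)" by simp
  then have S0: "S0 \<ge> 0" using A by (simp add: S0_def)
  have ws: "summable (\<lambda>i. w i * \<bar>hh i t\<bar>)" "(\<Sum>i. w i * \<bar>hh i t\<bar>) \<le> S0" "w i \<ge> 0" for t i
    using bump_weighted_sum[OF A c T(1) N(1) N'] unfolding w_def hh_def S0_def a_def by auto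
  have dhh: "(hh i has_real_derivative hh (Suc i) t) (at t)" for i t
    unfolding hh_def a_def using DERIV_shift[of "bump ((1 + c) * A / c) L i" _ t "- t1"] DERIV_bump[OF A c, of L i "t - t1"] by simp
  have chh: "continuous_on X (hh i)" for X i
    by (rule DERIV_at_continuous_on[OF dhh])
  have hh0: "hh i t = 0" if "t \<le> t1 \<or> t \<ge> T" for i t
    using that by (auto simp: hh_def bump_def t1_def)
  define I0 where "I0 = integral\<^sup>L (time_measure T) (hh 0)"
  have I0: "I0 \<ge> L / 50 * exp (- (4 * a / L) * (2500 / 2499))"
  proof -
    \<comment> \<open>The middle fiftieth of the support, where the bump is close to its maximum.
      The integral \<open>I0\<close> enters the cost through its reciprocal.\<close>
    let ?J = "{t1 + L / 2 - L / 100 .. t1 + L / 2 + L / 100}"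
    let ?E = "exp (- (4 * a / L) * (2500 / 2499))"
    have sub: "?J \<subseteq> {0<..<T}" using T t1 by (auto simp: t1_def)
    interpret finite_measure "time_measure T" by (rule finite_measure_time)
    have Jm: "?J \<in> sets (time_measure T)" using sub by (simp add: sets_restrict_space_iff)
    have "L / 50 * ?E = measure (time_measure T) ?J * ?E"
      using sub T by (simp add: measure_restrict_space)
    also have "\<dots> = (\<integral>t. ?E * indicator ?J t \<partial>time_measure T)"
      using Jm sub by (simp add: Int_absorb2 space_restrict_space)
    also have "\<dots> \<le> I0"
      unfolding I0_def
    proof (rule integral_mono)
      show "integrable (time_measure T) (hh 0)" by (rule continuous_integrable_time[OF chh])
      show "integrable (time_measure T) (\<lambda>t. ?E * indicator ?J t)"
        using Jm by (intro integrable_mult_right integrable_real_indicator) (auto simp: emeasure_eq_measure)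
      show "?E * indicator ?J t \<le> hh 0 t" for t
      proof (cases "t \<in> ?J")
        case True
        then have "t1 + L / 2 - L / 100 \<le> t" "t \<le> t1 + L / 2 + L / 100" by auto
        then have "\<bar>(t - t1) - L / 2\<bar> \<le> L / 100" by linarith
        from bump_0_lower[OF a T(1) this] show ?thesis using True by (simp add: hh_def)
      next
        case False
        then show ?thesis using bump_0_nonneg by (simp add: hh_def)
      qed
    qed
    finally show ?thesis .
  qed
  then have I0_pos: "I0 > 0" using T(1) by (meson less_le_trans mult_pos_pos exp_gt_zero divide_pos_pos zero_less_numeral)
  \<comment> \<open>Repeated integration by parts without boundary terms, as the bump and its
    derivatives vanish at 0 and T.\<close>
  have parts: "integral\<^sup>L (time_measure T) (\<lambda>t. hh i t * exp (m * t)) = (- m) ^ i * integral\<^sup>L (time_measure T) (\<lambda>t. hh 0 t * exp (m * t))" for i m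
  proof (induction i)
    case (Suc i)
    have int: "integrable (time_measure T) (\<lambda>t. hh i t * exp (m * t))" for i
      by (intro continuous_integrable_time continuous_intros chh)
    have d: "((\<lambda>t. hh i t * exp (m * t)) has_real_derivative hh (Suc i) t * exp (m * t) + m * (hh i t * exp (m * t))) (at t)" for t
      by (rule derivative_eq_intros dhh refl)+ simp
    have "integral\<^sup>L (time_measure T) (\<lambda>t. hh (Suc i) t * exp (m * t) + m * (hh i t * exp (m * t))) = hh i T * exp (m * T) - hh i 0 * exp (m * 0)"
      using T0 by (intro integral_lebesgue_on_FTC d continuous_intros chh Bochner_Integration.integrable_add integrable_mult_right int) auto
    also have "\<dots> = 0" using hh0[of T i] hh0[of 0 i] t1 by simp
    finally show ?case using Suc int by (simp add: Bochner_Integration.integral_add)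
  qed simp
  \<comment> \<open>Integrated against exp(lam m t), the i-th term gives \<open>ecoef k i\<close>
    (lam k - lam m)^i times a common integral, so \<open>ecoef_sums\<close> shows biorthogonality up
    to scaling.\<close>
  define \<psi> where "\<psi> = (\<lambda>k t. exp (- lam k * t) * (\<Sum>i. ecoef k i * hh i t))"
  have ew: "\<bar>ecoef k i\<bar> \<le> w i" if "k > 0" for k i
    using ecoef_bound[OF that] by (simp add: w_def A_def)
  have esum: "(\<Sum>i<n. \<bar>ecoef k i * hh i t\<bar>) \<le> S0" if k: "k > 0" for k n t
  proof -
    have "(\<Sum>i<n. \<bar>ecoef k i * hh i t\<bar>) \<le> (\<Sum>i<n. w i * \<bar>hh i t\<bar>)"
      using ew[OF k] by (intro sum_mono) (auto simp: abs_mult intro!: mult_right_mono)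
    also have "\<dots> \<le> (\<Sum>i. w i * \<bar>hh i t\<bar>)"
      using ws(1,3) by (intro sum_le_suminf) auto
    finally show ?thesis using ws(2)[of t] by linarith
  qed
  have mhh: "hh i \<in> borel_measurable (time_measure T)" for i
    by (intro continuous_on_borel_measurable_lebesgue_on chh) auto
  have mexp: "(\<lambda>t. exp (m * t)) \<in> borel_measurable (time_measure T)" for m :: real
    by (intro continuous_on_borel_measurable_lebesgue_on continuous_intros) auto
  have m\<psi>: "\<psi> k \<in> borel_measurable (time_measure T)" for k
    unfolding \<psi>_def by (intro borel_measurable_times mexp borel_measurable_suminf borel_measurable_const mhh)
  have \<psi>_bound: "\<bar>\<psi> k t\<bar> \<le> exp (- lam k * t1) * S0" if k: "k > 0" and t: "0 < t" "t < T" for k t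
  proof (cases "t \<le> t1")
    case True
    then show ?thesis using S0 by (simp add: \<psi>_def hh0)
  next
    case False
    have "\<bar>\<Sum>i. ecoef k i * hh i t\<bar> \<le> S0"
      by (rule time_suminf(3)[where T = T]) (use T0 t esum[OF k] mhh in auto)
    moreover have "exp (- lam k * t) \<le> exp (- lam k * t1)" using False lam_pos[OF k] by simp
    ultimately show ?thesis unfolding \<psi>_def abs_mult using S0 by (intro mult_mono) auto
  qed
  have \<psi>_int: "integral\<^sup>L (time_measure T) (\<lambda>t. \<psi> k t * exp (lam m * t)) = (if k = m then - (bessel_F' \<nu> (zk k) / \<kappa>\<^sup>2) * I0 else 0)"
    if k: "k > 0" and m: "m > 0" for k m
  proof -
    let ?g = "\<lambda>i t. ecoef k i * (hh i t * exp ((lam m - lam k) * t))"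
    have e1: "exp (- lam k * t) * exp (lam m * t) = exp ((lam m - lam k) * t)" for t
      unfolding exp_add[symmetric] by (rule arg_cong[where f = exp]) (simp add: algebra_simps)
    have eq: "\<psi> k t * exp (lam m * t) = (\<Sum>i. ?g i t)" for t
    proof -
      have "summable (\<lambda>i. \<bar>ecoef k i * hh i t\<bar>)"
      proof (rule bounded_imp_summable)
        show "(\<Sum>i\<le>n. \<bar>ecoef k i * hh i t\<bar>) \<le> S0" for n using esum[OF k, of t "Suc n"] unfolding lessThan_Suc_atMost .
      qed simp
      from suminf_mult[OF summable_rabs_cancel[OF this], of "exp ((lam m - lam k) * t)"]
      have "(\<Sum>i. ?g i t) = exp ((lam m - lam k) * t) * (\<Sum>i. ecoef k i * hh i t)" by (simp add: mult_ac)
      also have "\<dots> = \<psi> k t * exp (lam m * t)"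
        unfolding \<psi>_def e1[symmetric] by (simp only: mult_ac)
      finally show ?thesis ..
    qed
    have s1: "(\<lambda>i. integral\<^sup>L (time_measure T) (?g i)) sums (\<integral>t. (\<Sum>i. ?g i t) \<partial>time_measure T)"
    proof (rule time_suminf(2))
      show "?g i \<in> borel_measurable (time_measure T)" for i
        by (intro borel_measurable_times mexp mhh borel_measurable_const)
      fix t n assume t: "0 < t" "t < T"
      have "(\<Sum>i<n. \<bar>?g i t\<bar>) = (\<Sum>i<n. \<bar>ecoef k i * hh i t\<bar>) * exp ((lam m - lam k) * t)"
        unfolding sum_distrib_right by (intro sum.cong refl) (simp add: abs_mult)
      also have "\<dots> \<le> S0 * exp (\<bar>lam m - lam k\<bar> * T)"
      proof (intro mult_mono esum k)
        have "(lam m - lam k) * t \<le> \<bar>lam m - lam k\<bar> * t" using t by (intro mult_right_mono) auto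
        also have "\<dots> \<le> \<bar>lam m - lam k\<bar> * T" using t by (intro mult_left_mono) auto
        finally show "exp ((lam m - lam k) * t) \<le> exp (\<bar>lam m - lam k\<bar> * T)" by simp
      qed (use S0 in auto)
      finally show "(\<Sum>i<n. \<bar>?g i t\<bar>) \<le> S0 * exp (\<bar>lam m - lam k\<bar> * T)" .
    qed (use T0 in simp)
    have eqI: "integral\<^sup>L (time_measure T) (?g i) = ecoef k i * (lam k - lam m) ^ i * integral\<^sup>L (time_measure T) (\<lambda>t. hh 0 t * exp ((lam m - lam k) * t))" for i
      using parts[of i "lam m - lam k"] by simp
    have s3: "(\<lambda>i. ecoef k i * (lam k - lam m) ^ i * integral\<^sup>L (time_measure T) (\<lambda>t. hh 0 t * exp ((lam m - lam k) * t)))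
        sums ((if k = m then - (bessel_F' \<nu> (zk k) / \<kappa>\<^sup>2) else 0) * integral\<^sup>L (time_measure T) (\<lambda>t. hh 0 t * exp ((lam m - lam k) * t)))"
      by (intro sums_mult2 ecoef_sums k m)
    have "(\<integral>t. (\<Sum>i. ?g i t) \<partial>time_measure T) = (if k = m then - (bessel_F' \<nu> (zk k) / \<kappa>\<^sup>2) else 0) * integral\<^sup>L (time_measure T) (\<lambda>t. hh 0 t * exp ((lam m - lam k) * t))"
      using s1 s3 unfolding eqI by (rule sums_unique2)
    then show ?thesis unfolding eq by (auto simp: I0_def)
  qed
  \<comment> \<open>Chosen so that g m times the integral of psi m against exp(lam m t) is cf u0 m /
    bk m, the moment required of the control.\<close>
  define g where "g = (\<lambda>k. - (\<kappa>\<^sup>2 * cf u0 k / (bk k * bessel_F' \<nu> (zk k) * I0)))"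
  \<comment> \<open>b_k |F'(z_k)| = sqrt(2 kappa) / (2 j_k), so dividing by this product costs only
    a factor j_k, whatever the size of b_k.\<close>
  have g_abs: "\<bar>g k\<bar> = \<bar>cf u0 k\<bar> * j k * (2 * \<kappa>\<^sup>2 / (sqrt (2 * \<kappa>) * I0))" if k: "k > 0" for k
  proof -
    have "bk k * \<bar>bessel_F' \<nu> (zk k)\<bar> = sqrt (2 * \<kappa>) / (2 * j k)"
      using F'_zk[OF k] by (simp add: bk_def)
    then have "\<bar>g k\<bar> = \<kappa>\<^sup>2 * \<bar>cf u0 k\<bar> / (sqrt (2 * \<kappa>) / (2 * j k) * I0)"
      using bk_pos[OF k] I0_pos by (simp add: g_def abs_mult)
    then show ?thesis using j_pos[OF k] by (simp add: mult_ac)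
  qed
  define D where "D = 2 * \<kappa>\<^sup>2 / (sqrt (2 * \<kappa>) * I0)"
  have D: "D > 0" using kappa_pos I0_pos by (simp add: D_def)
  define Fb where "Fb = D * S0 * (L2_norm W u0 * (1 / (2 * e * \<kappa>\<^sup>2 * t1) * exp (- (1 - e) * lam 1 * t1)))"
  have Fb0: "Fb \<ge> 0" unfolding Fb_def using D S0 L2_norm_nonneg[of W u0] e t1 by (intro mult_nonneg_nonneg) auto
  note WE = weighted_exp_sum[OF t1(1) e]
  note CU = coef_square_summable[OF u0]
  have fsum: "(\<Sum>k<n. \<bar>g (Suc k) * \<psi> (Suc k) t\<bar>) \<le> Fb" if t: "0 < t" "t < T" for n t
  proof -
    note CS = summable_suminf_Cauchy_Schwarz[OF CU(1) WE(1)]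
    have "(\<Sum>k<n. \<bar>g (Suc k) * \<psi> (Suc k) t\<bar>) \<le> (\<Sum>k<n. D * S0 * \<bar>cf u0 (Suc k) * (j (Suc k) * exp (- lam (Suc k) * t1))\<bar>)"
    proof (rule sum_mono)
      fix k
      have "\<bar>g (Suc k) * \<psi> (Suc k) t\<bar> \<le> \<bar>g (Suc k)\<bar> * (exp (- lam (Suc k) * t1) * S0)"
        unfolding abs_mult by (intro mult_left_mono \<psi>_bound t) auto
      also have "\<dots> = D * S0 * \<bar>cf u0 (Suc k) * (j (Suc k) * exp (- lam (Suc k) * t1))\<bar>"
        using g_abs[of "Suc k"] j_pos[of "Suc k"] by (simp add: D_def abs_mult mult_ac)
      finally show "\<bar>g (Suc k) * \<psi> (Suc k) t\<bar> \<le> D * S0 * \<bar>cf u0 (Suc k) * (j (Suc k) * exp (- lam (Suc k) * t1))\<bar>" .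
    qed
    also have "\<dots> = D * S0 * (\<Sum>k<n. \<bar>cf u0 (Suc k) * (j (Suc k) * exp (- lam (Suc k) * t1))\<bar>)"
      by (simp add: sum_distrib_left)
    also have "\<dots> \<le> D * S0 * (L2_norm W u0 * (1 / (2 * e * \<kappa>\<^sup>2 * t1) * exp (- (1 - e) * lam 1 * t1)))"
    proof (rule mult_left_mono)
      have "(\<Sum>k<n. \<bar>cf u0 (Suc k) * (j (Suc k) * exp (- lam (Suc k) * t1))\<bar>) \<le> (\<Sum>k. \<bar>cf u0 (Suc k) * (j (Suc k) * exp (- lam (Suc k) * t1))\<bar>)"
        by (intro sum_le_suminf CS(1)) auto
      also have "\<dots> \<le> sqrt (\<Sum>k. (cf u0 (Suc k))\<^sup>2) * sqrt (\<Sum>k. (j (Suc k) * exp (- lam (Suc k) * t1))\<^sup>2)"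
        by (rule CS(3))
      also have "\<dots> \<le> L2_norm W u0 * (1 / (2 * e * \<kappa>\<^sup>2 * t1) * exp (- (1 - e) * lam 1 * t1))"
      proof (intro mult_mono WE(2))
        show "sqrt (\<Sum>k. (cf u0 (Suc k))\<^sup>2) \<le> L2_norm W u0"
          using CU(2) L2_norm_nonneg[of W u0] by (intro real_le_lsqrt) auto
      qed (intro L2_norm_nonneg real_sqrt_ge_zero suminf_nonneg WE(1) zero_le_power2)+
      finally show "(\<Sum>k<n. \<bar>cf u0 (Suc k) * (j (Suc k) * exp (- lam (Suc k) * t1))\<bar>) \<le> L2_norm W u0 * (1 / (2 * e * \<kappa>\<^sup>2 * t1) * exp (- (1 - e) * lam 1 * t1))" .
    qed (use D S0 in auto)
    finally show ?thesis by (simp add: Fb_def)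
  qed
  define f where "f = (\<lambda>t. \<Sum>k. g (Suc k) * \<psi> (Suc k) t)"
  have mg: "(\<lambda>t. g (Suc k) * \<psi> (Suc k) t) \<in> borel_measurable (time_measure T)" for k
    by (intro borel_measurable_times borel_measurable_const m\<psi>)
  have fm: "f \<in> borel_measurable (time_measure T)"
    unfolding f_def by (intro borel_measurable_suminf mg)
  have fb: "\<bar>f t\<bar> \<le> Fb" if "0 < t" "t < T" for t
    unfolding f_def by (rule time_suminf(3)[OF less_imp_le[OF T0] mg _ that]) (rule fsum)
  note L2 = bounded_L2_norm[OF less_imp_le[OF T0] fm fb Fb0]
  have mom: "integral\<^sup>L (time_measure T) (\<lambda>t. f t * exp (lam m * t)) = cf u0 m / bk m" if m: "m > 0" for m
  proof -
    let ?h = "\<lambda>k t. g (Suc k) * (\<psi> (Suc k) t * exp (lam m * t))"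
    have "(\<lambda>k. integral\<^sup>L (time_measure T) (?h k)) sums (\<integral>t. (\<Sum>k. ?h k t) \<partial>time_measure T)"
    proof (rule time_suminf(2))
      show "?h k \<in> borel_measurable (time_measure T)" for k
        by (intro borel_measurable_times borel_measurable_const m\<psi> mexp)
      fix t n assume t: "0 < t" "t < T"
      have "(\<Sum>k<n. \<bar>?h k t\<bar>) = (\<Sum>k<n. \<bar>g (Suc k) * \<psi> (Suc k) t\<bar>) * exp (lam m * t)"
        unfolding sum_distrib_right by (intro sum.cong refl) (simp add: abs_mult)
      also have "\<dots> \<le> Fb * exp (lam m * T)"
        using t lam_pos[OF m] Fb0 by (intro mult_mono fsum) auto
      finally show "(\<Sum>k<n. \<bar>?h k t\<bar>) \<le> Fb * exp (lam m * T)" .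
    qed (use T0 in simp)
    moreover have "(\<integral>t. (\<Sum>k. ?h k t) \<partial>time_measure T) = integral\<^sup>L (time_measure T) (\<lambda>t. f t * exp (lam m * t))"
    proof (rule integral_lebesgue_on_cong)
      fix t assume "t \<in> {0<..<T}"
      then have t: "0 < t" "t < T" by auto
      have "summable (\<lambda>k. \<bar>g (Suc k) * \<psi> (Suc k) t\<bar>)"
      proof (rule bounded_imp_summable)
        show "(\<Sum>k\<le>n. \<bar>g (Suc k) * \<psi> (Suc k) t\<bar>) \<le> Fb" for n using fsum[OF t, of "Suc n"] unfolding lessThan_Suc_atMost .
      qed simp
      from suminf_mult[OF summable_rabs_cancel[OF this], of "exp (lam m * t)"]
      show "(\<Sum>k. ?h k t) = f t * exp (lam m * t)" by (simp add: f_def mult_ac)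
    qed
    moreover have "integral\<^sup>L (time_measure T) (?h k) = (if Suc k = m then 1 else 0) * (g (Suc k) * (- (bessel_F' \<nu> (zk (Suc k)) / \<kappa>\<^sup>2) * I0))" for k
      using \<psi>_int[of "Suc k" m] m by simp
    ultimately have "integral\<^sup>L (time_measure T) (\<lambda>t. f t * exp (lam m * t))
        = (\<Sum>k. (if Suc k = m then 1 else 0) * (g (Suc k) * (- (bessel_F' \<nu> (zk (Suc k)) / \<kappa>\<^sup>2) * I0)))"
      by (simp add: sums_unique)
    also have "\<dots> = g m * (- (bessel_F' \<nu> (zk m) / \<kappa>\<^sup>2) * I0)" by (rule suminf_delta[OF m])
    also have "\<dots> = cf u0 m / bk m"
      using F'_zk[OF m] I0_pos kappa_pos by (simp add: g_def)
    finally show ?thesis .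
  qed
  have "f \<in> null_controls T \<alpha> \<beta> \<mu> u0"
  proof (rule null_controlI[OF L2(1) u0 T0])
    fix k :: nat assume k: "k > 0"
    have ex: "f t * exp (- lam k * (T - t)) = exp (- lam k * T) * (f t * exp (lam k * t))" for t
      by (simp add: algebra_simps flip: exp_add)
    have "exp_moment f (lam k) T = exp (- lam k * T) * (cf u0 k / bk k)"
      unfolding exp_moment_def ex using mom[OF k] by simp
    then show "bk k * exp_moment f (lam k) T = exp (- lam k * T) * cf u0 k"
      using bk_pos[OF k] by simp
  qed
  moreover have "L2_norm (time_measure T) f \<le> sqrt T * (10 * \<kappa> powr (- (1/2)) * (fact N / real N ^ N) * (1 / L) * (1 / (e * \<kappa>\<^sup>2 * (T - L)))
       * exp (2011/1000 / (\<kappa>\<^sup>2 * L)) * exp (- (1 - e) * lam 1 * (T - L))) * L2_norm W u0"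
  proof -
    define X where "X = fact N / real N ^ N * (1 / (e * \<kappa>\<^sup>2 * t1)) * exp (- (1 - e) * lam 1 * t1) * L2_norm W u0"
    have X: "X \<ge> 0" unfolding X_def using e t1 L2_norm_nonneg[of W u0] by (intro mult_nonneg_nonneg) auto
    have sk: "\<kappa> powr (- (1/2)) = 1 / sqrt \<kappa>" using kappa_pos by (simp add: powr_minus powr_half_sqrt inverse_eq_divide)
    have "Fb = 1 / (4 * sqrt 2) * (1 / sqrt \<kappa>) * (1 / I0) * X"
    proof -
      have "D * A = 1 / (2 * sqrt 2 * sqrt \<kappa> * I0)"
        using kappa_pos by (simp add: D_def A_def real_sqrt_mult)
      then have "D * S0 = 1 / (2 * sqrt 2 * sqrt \<kappa> * I0) * (fact N / real N ^ N)"
        unfolding S0_def by (metis mult.assoc)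
      then show ?thesis unfolding Fb_def X_def by (simp add: mult_ac)
    qed
    also have "\<dots> \<le> 1 / (4 * sqrt 2) * (1 / sqrt \<kappa>) * (50 / L * exp (2011/1000 / (\<kappa>\<^sup>2 * L))) * X"
    proof (intro mult_right_mono mult_left_mono X)
      have "4 * a / L * (2500 / 2499) \<le> 2011/1000 / (\<kappa>\<^sup>2 * L)"
      proof -
        have "4 * a / L * (2500 / 2499) = (199 / 99 * (2500 / 2499)) * (1 / (\<kappa>\<^sup>2 * L))"
          by (simp add: a_def A_def c_def)
        also have "\<dots> \<le> 2011/1000 * (1 / (\<kappa>\<^sup>2 * L))" using T by (intro mult_right_mono) auto
        finally show ?thesis by simp
      qed
      then have "L / 50 * exp (- (2011/1000 / (\<kappa>\<^sup>2 * L))) \<le> L / 50 * exp (- (4 * a / L) * (2500 / 2499))"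
        using T by (intro mult_left_mono) auto
      also have "\<dots> \<le> I0" by (rule I0)
      finally have "1 / I0 \<le> 1 / (L / 50 * exp (- (2011/1000 / (\<kappa>\<^sup>2 * L))))"
        using T I0_pos by (intro divide_left_mono) auto
      also have "\<dots> = 50 / L * exp (2011/1000 / (\<kappa>\<^sup>2 * L))" by (simp add: exp_minus field_simps)
      finally show "1 / I0 \<le> 50 / L * exp (2011/1000 / (\<kappa>\<^sup>2 * L))" .
    qed (use kappa_pos in auto)
    also have "\<dots> = (50 / (4 * sqrt 2)) * ((1 / sqrt \<kappa>) * (1 / L * exp (2011/1000 / (\<kappa>\<^sup>2 * L))) * X)" by (simp add: mult_ac)
    also have "\<dots> \<le> 10 * ((1 / sqrt \<kappa>) * (1 / L * exp (2011/1000 / (\<kappa>\<^sup>2 * L))) * X)"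
    proof (rule mult_right_mono)
      have "5/4 \<le> sqrt 2" by (rule real_le_rsqrt) (simp add: power2_eq_square)
      then show "50 / (4 * sqrt 2) \<le> 10" by (simp add: field_simps)
    qed (use X T kappa_pos in auto)
    finally have "sqrt T * Fb \<le> sqrt T * (10 * ((1 / sqrt \<kappa>) * (1 / L * exp (2011/1000 / (\<kappa>\<^sup>2 * L))) * X))"
      using T0 by (intro mult_left_mono) auto
    then have "sqrt T * Fb \<le> sqrt T * (10 * (1 / sqrt \<kappa>) * (fact N / real N ^ N) * (1 / L) * (1 / (e * \<kappa>\<^sup>2 * t1))
       * exp (2011/1000 / (\<kappa>\<^sup>2 * L)) * exp (- (1 - e) * lam 1 * t1)) * L2_norm W u0"
      unfolding X_def by (simp only: mult_ac)
    then show ?thesis unfolding sk t1_def[symmetric] using L2(2) by (rule order_trans[rotated])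
  qed
  ultimately show ?thesis by blast
qed

end

section \<open>The upper bound\<close>

definition const_small :: real where "const_small = 450 * (20/3) * exp 34"
definition const_gain :: real where "const_gain = 20 * exp 2 * 3 * 200 * 1000"
definition const_long :: real where "const_long = 10 * 4000 * 14000 * exp 8044"
definition const_all :: real where "const_all = const_small + const_gain + const_long"

context degenerate_parabolic
begin

text \<open>lam 1 T = (tau j_1)^2 / tau, and tau j_1 <= 1.04 * 1.15 + 27 tau = 1.196 + 27 tau, whose
  square is below 1.431 + 66 tau for tau <= 1/1000.\<close>

lemma lam_1_T_upper:
  assumes "\<tau> = \<kappa>\<^sup>2 * T" "0 < \<tau>" "\<tau> \<le> 1/1000" "\<nu> * \<tau> \<le> 23/20"
  shows "lam 1 * T \<le> 1431/1000 / \<tau> + 66"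
proof -
  have "j 1 \<le> j 2" by (rule j_mono) simp
  also have "j 2 \<le> 104/100 * \<nu> + 27" by (rule second_bessel_zero_upper[OF nu_pos])
  finally have "\<tau> * j 1 \<le> \<tau> * (104/100 * \<nu> + 27)" using assms by (intro mult_left_mono) auto
  also have "\<dots> \<le> 104/100 * (23/20) + 27 * \<tau>" using assms(4) by (simp add: algebra_simps)
  finally have b: "\<tau> * j 1 \<le> 1196/1000 + 27 * \<tau>" by simp
  have j1: "j 1 > 0" by (rule j_pos) simp
  have "lam 1 * T * \<tau> = (\<tau> * j 1)\<^sup>2"
    by (simp add: lam_eq zk_def assms(1) power2_eq_square)
  also have "\<dots> \<le> (1196/1000 + 27 * \<tau>)\<^sup>2"
    using b assms(2) j1 by (intro power_mono) auto
  also have "\<dots> = (1196/1000)\<^sup>2 + 2 * (1196/1000) * 27 * \<tau> + 729 * \<tau> * \<tau>"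
    by (simp add: power2_sum power_mult_distrib power2_eq_square algebra_simps)
  also have "729 * \<tau> * \<tau> \<le> 729 * \<tau> * (1/1000)"
    using assms by (intro mult_left_mono) auto
  finally have "lam 1 * T * \<tau> \<le> 1431/1000 + 66 * \<tau>"
    using assms(2) by (simp add: power2_eq_square)
  then show ?thesis using assms(2) by (simp add: field_simps)
qed

lemma rate_le:
  assumes "0 < \<tau>" "\<tau> \<le> 1/1000"
  shows "1/2 + min 1 (sqrt \<tau>) / 8 \<le> 504/1000"
proof -
  have "sqrt \<tau> \<le> sqrt ((32/1000)\<^sup>2)"
    using assms by (intro real_sqrt_le_mono) (simp add: power2_eq_square)
  then show ?thesis by simp
qed

text \<open>The decay to be reached. It is at most exp(-T kappa^2 j_1^2 / 2) times the last factor
  of \<open>M_bound\<close>, for every delta in (0,1), because kappa sqrt(T / (1 + T)) <= min(1,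
  sqrt(kappa^2 T)).\<close>

definition rate :: "real \<Rightarrow> real" where
  "rate T = exp (- (1/2 + min 1 (sqrt (\<kappa>\<^sup>2 * T)) / 8) * (lam 1 * T))"

text \<open>Budget of exponents in units of x = 1 / tau: 2.12 for the bump with L = 0.95 T, 0.722
  for the reciprocal of \<open>rate\<close>, since the dissipation is estimated by 1, and 0.15 for a
  surplus factor x; together 2.992 < 3.\<close>

lemma control_small_order:
  assumes T: "T > 0" and \<tau>: "\<tau> = \<kappa>\<^sup>2 * T" "\<tau> \<le> 1/1000" "\<nu> * \<tau> \<le> 23/20" and u0: "u0 \<in> L2_space W"
  shows "\<exists>f\<in>null_controls T \<alpha> \<beta> \<mu> u0. L2_norm (time_measure T) f \<le>
     sqrt T * (\<kappa> powr (- (1/2)) * (const_small * (1 + 1 / \<tau>) * exp (3 / \<tau>) * rate T)) * L2_norm W u0"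
proof -
  define x where "x = 1 / \<tau>"
  have \<tau>0: "\<tau> > 0" using T kappa_pos \<tau> by simp
  have x: "x > 0" using \<tau>0 by (simp add: x_def)
  define L where "L = 95/100 * T"
  have L: "0 < L" "L < T" using T by (auto simp: L_def)
  have kL: "\<kappa>\<^sup>2 * L = 95/100 * \<tau>" "\<kappa>\<^sup>2 * (T - L) = 5/100 * \<tau>" by (simp_all add: L_def \<tau>(1) algebra_simps)
  obtain f where f: "f \<in> null_controls T \<alpha> \<beta> \<mu> u0" "L2_norm (time_measure T) f \<le>
     sqrt T * (10 * \<kappa> powr (- (1/2)) * (fact 0 / real 0 ^ 0) * (1 / L) * (1 / (1/2 * \<kappa>\<^sup>2 * (T - L)))
       * exp (2011/1000 / (\<kappa>\<^sup>2 * L)) * exp (- (1 - 1/2) * lam 1 * (T - L))) * L2_norm W u0"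
    using control_exists[OF L, of 0 "1/2" u0] nu_nonneg kappa_pos L u0 by auto
  have "10 * \<kappa> powr (- (1/2)) * (fact 0 / real 0 ^ 0) * (1 / L) * (1 / (1/2 * \<kappa>\<^sup>2 * (T - L)))
       * exp (2011/1000 / (\<kappa>\<^sup>2 * L)) * exp (- (1 - 1/2) * lam 1 * (T - L))
     \<le> \<kappa> powr (- (1/2)) * (const_small * (1 + 1 / \<tau>) * exp (3 / \<tau>) * rate T)"
  proof -
    have 1: "1 / L \<le> 11/10 * x"
    proof -
      have "\<kappa>\<^sup>2 \<le> 1" using kappa_pos kappa_le_1 by (simp add: power_le_one)
      then have "\<kappa>\<^sup>2 * L \<le> 1 * L" using L by (intro mult_right_mono) auto
      then have "1 / L \<le> 1 / (\<kappa>\<^sup>2 * L)" using L kappa_pos by (intro divide_left_mono) auto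
      also have "\<dots> \<le> 11/10 * x" unfolding kL x_def using \<tau>0 by (simp add: field_simps)
      finally show ?thesis .
    qed
    have 2: "1 / (1/2 * \<kappa>\<^sup>2 * (T - L)) = 40 * x"
      unfolding mult.assoc kL x_def by simp
    have 3: "exp (2011/1000 / (\<kappa>\<^sup>2 * L)) \<le> exp (212/100 * x)"
      unfolding kL x_def using \<tau>0 by (simp add: field_simps)
    have 4: "exp (- (1 - 1/2) * lam 1 * (T - L)) \<le> 1"
      using lam_pos[of 1] L by simp
    have 5: "x * exp (212/100 * x) \<le> 20/3 * exp 34 * (exp (3 / \<tau>) * rate T)"
    proof -
      have xe: "x \<le> 20/3 * exp (15/100 * x)" using exp_ge_add_one_self[of "15/100 * x"] by linarith
      have "(1/2 + min 1 (sqrt \<tau>) / 8) * (lam 1 * T) \<le> 504/1000 * (1431/1000 / \<tau> + 66)"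
        using lam_1_T_upper[OF \<tau>(1) \<tau>0 \<tau>(2,3)] rate_le[OF \<tau>0 \<tau>(2)] lam_pos[of 1] T by (intro mult_mono) auto
      also have "1431/1000 / \<tau> = 1431/1000 * x" by (simp add: x_def)
      also have "504/1000 * (1431/1000 * x + 66) \<le> 722/1000 * x + 34" using x by (simp add: algebra_simps)
      finally have P: "(1/2 + min 1 (sqrt \<tau>) / 8) * (lam 1 * T) \<le> 722/1000 * x + 34" .
      have "15/100 * x + 212/100 * x \<le> 34 + (3 * x + - P)" if "P \<le> 722/1000 * x + 34" for P
        using that x by simp
      from this[OF P] have e: "15/100 * x + 212/100 * x \<le> 34 + (3 / \<tau> + - (1/2 + min 1 (sqrt \<tau>) / 8) * (lam 1 * T))"
        unfolding mult_minus_left by (simp only: x_def times_divide_eq_right mult_1_right)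
      have "x * exp (212/100 * x) \<le> 20/3 * exp (15/100 * x) * exp (212/100 * x)"
        using xe by (intro mult_right_mono) auto
      also have "\<dots> = 20/3 * exp (15/100 * x + 212/100 * x)" by (simp only: exp_add mult.assoc)
      also have "\<dots> \<le> 20/3 * exp (34 + (3 / \<tau> + - (1/2 + min 1 (sqrt \<tau>) / 8) * (lam 1 * T)))"
        using e by simp
      also have "\<dots> = 20/3 * exp 34 * (exp (3 / \<tau>) * rate T)"
        unfolding exp_add rate_def \<tau>(1)[symmetric] by simp
      finally show ?thesis .
    qed
    have "10 * \<kappa> powr (- (1/2)) * (fact 0 / real 0 ^ 0) * (1 / L) * (1 / (1/2 * \<kappa>\<^sup>2 * (T - L)))
       * exp (2011/1000 / (\<kappa>\<^sup>2 * L)) * exp (- (1 - 1/2) * lam 1 * (T - L))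
      \<le> 10 * \<kappa> powr (- (1/2)) * (fact 0 / real 0 ^ 0) * (11/10 * x) * (40 * x) * exp (212/100 * x) * 1"
      unfolding 2 using 1 3 4 x L by (intro mult_mono) auto
    also have "\<dots> = \<kappa> powr (- (1/2)) * (440 * x * (x * exp (212/100 * x)))" by simp
    also have "\<dots> \<le> \<kappa> powr (- (1/2)) * (450 * (1 + x) * (20/3 * exp 34 * (exp (3 / \<tau>) * rate T)))"
      by (intro mult_left_mono mult_mono[OF _ 5]) (use x in auto)
    also have "\<dots> = \<kappa> powr (- (1/2)) * (const_small * (1 + 1 / \<tau>) * exp (3 / \<tau>) * rate T)"
      unfolding const_small_def x_def by (simp only: mult_ac)
    finally show ?thesis .
  qed
  then have "sqrt T * (10 * \<kappa> powr (- (1/2)) * (fact 0 / real 0 ^ 0) * (1 / L) * (1 / (1/2 * \<kappa>\<^sup>2 * (T - L)))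
       * exp (2011/1000 / (\<kappa>\<^sup>2 * L)) * exp (- (1 - 1/2) * lam 1 * (T - L))) * L2_norm W u0
    \<le> sqrt T * (\<kappa> powr (- (1/2)) * (const_small * (1 + 1 / \<tau>) * exp (3 / \<tau>) * rate T)) * L2_norm W u0"
    using T by (intro mult_right_mono mult_left_mono L2_norm_nonneg) auto
  then show ?thesis using f by (intro bexI[of _ f]) linarith+
qed

text \<open>With L = 0.49 T the bump costs 4.105 x, where x = 1 / tau. Taking N close to 1.15 x,
  allowed by nu tau >= 1.15, regains 1.15 x, and 0.045 x absorbs x^2: in all exactly 3 x. The
  dissipation on (0, T - L) retains 0.99 * 0.51 = 0.5049 of lam 1 T, more than the at most 0.504
  that \<open>rate\<close> requires.\<close>

lemma control_large_order:
  assumes T: "T > 0" and \<tau>: "\<tau> = \<kappa>\<^sup>2 * T" "\<tau> \<le> 1/1000" "\<nu> * \<tau> \<ge> 23/20" and u0: "u0 \<in> L2_space W"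
  shows "\<exists>f\<in>null_controls T \<alpha> \<beta> \<mu> u0. L2_norm (time_measure T) f \<le>
     sqrt T * (\<kappa> powr (- (1/2)) * (const_gain * (1 + 1 / \<tau>) * exp (3 / \<tau>) * rate T)) * L2_norm W u0"
proof -
  define x where "x = 1 / \<tau>"
  have \<tau>0: "\<tau> > 0" using T kappa_pos \<tau> by simp
  have x: "x > 0" using \<tau>0 by (simp add: x_def)
  define L where "L = 49/100 * T"
  have L: "0 < L" "L < T" using T by (auto simp: L_def)
  have kL: "\<kappa>\<^sup>2 * L = 49/100 * \<tau>" "\<kappa>\<^sup>2 * (T - L) = 51/100 * \<tau>" by (simp_all add: L_def \<tau>(1) algebra_simps)
  define N where "N = nat \<lfloor>23/20 * x\<rfloor>"
  have N: "real N \<le> 23/20 * x" "real N \<ge> 23/20 * x - 1" unfolding N_def using x by linarith+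
  have N\<nu>: "real N \<le> \<nu>"
  proof -
    have "23/20 * x \<le> \<nu>" using \<tau>(3) \<tau>0 by (simp add: x_def field_simps)
    then show ?thesis using N by linarith
  qed
  have NL: "real N \<le> 1 / (\<kappa>\<^sup>2 * L)"
  proof -
    have "23/20 * x \<le> 1 / (\<kappa>\<^sup>2 * L)" unfolding kL x_def using \<tau>0 by (simp add: field_simps)
    then show ?thesis using N by linarith
  qed
  obtain f where f: "f \<in> null_controls T \<alpha> \<beta> \<mu> u0" "L2_norm (time_measure T) f \<le>
     sqrt T * (10 * \<kappa> powr (- (1/2)) * (fact N / real N ^ N) * (1 / L) * (1 / (1/100 * \<kappa>\<^sup>2 * (T - L)))
       * exp (2011/1000 / (\<kappa>\<^sup>2 * L)) * exp (- (1 - 1/100) * lam 1 * (T - L))) * L2_norm W u0"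
    using control_exists[OF L N\<nu> NL, of "1/100" u0] u0 by auto
  have "10 * \<kappa> powr (- (1/2)) * (fact N / real N ^ N) * (1 / L) * (1 / (1/100 * \<kappa>\<^sup>2 * (T - L)))
       * exp (2011/1000 / (\<kappa>\<^sup>2 * L)) * exp (- (1 - 1/100) * lam 1 * (T - L))
     \<le> \<kappa> powr (- (1/2)) * (const_gain * (1 + 1 / \<tau>) * exp (3 / \<tau>) * rate T)"
  proof -
    have 0: "fact N / real N ^ N \<le> exp 2 * (2 * (1 + x)) * exp (- (23/20 * x))"
    proof -
      have "fact N / real N ^ N \<le> exp 1 * (real N + 1) * exp (- real N)" by (rule fact_div_power_le)
      also have "\<dots> \<le> exp 1 * (2 * (1 + x)) * exp (1 - 23/20 * x)"
        using N x by (intro mult_mono) auto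
      also have "exp (1 - 23/20 * x) = exp 1 * exp (- (23/20 * x))" by (simp flip: exp_add)
      also have "exp 1 * (2 * (1 + x)) * (exp 1 * exp (- (23/20 * x))) = exp 1 * exp 1 * (2 * (1 + x)) * exp (- (23/20 * x))"
        by (simp only: mult_ac)
      also have "exp 1 * exp 1 = exp (2::real)" by (simp flip: exp_add)
      finally show ?thesis .
    qed
    have 1: "1 / L \<le> 3 * x"
    proof -
      have "\<kappa>\<^sup>2 \<le> 1" using kappa_pos kappa_le_1 by (simp add: power_le_one)
      then have "\<kappa>\<^sup>2 * L \<le> 1 * L" using L by (intro mult_right_mono) auto
      then have "1 / L \<le> 1 / (\<kappa>\<^sup>2 * L)" using L kappa_pos by (intro divide_left_mono) auto
      also have "\<dots> \<le> 3 * x" unfolding kL x_def using \<tau>0 by (simp add: field_simps)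
      finally show ?thesis .
    qed
    have 2: "1 / (1/100 * \<kappa>\<^sup>2 * (T - L)) \<le> 200 * x"
      unfolding mult.assoc kL x_def using \<tau>0 by (simp add: field_simps)
    have 3: "exp (2011/1000 / (\<kappa>\<^sup>2 * L)) \<le> exp (4105/1000 * x)"
      unfolding kL x_def using \<tau>0 by (simp add: field_simps)
    have 4: "exp (- (1 - 1/100) * lam 1 * (T - L)) \<le> rate T"
    proof -
      have "(1/2 + min 1 (sqrt \<tau>) / 8) * (lam 1 * T) \<le> 504/1000 * (lam 1 * T)"
        using rate_le[OF \<tau>0 \<tau>(2)] lam_pos[of 1] T by (intro mult_right_mono) auto
      also have "\<dots> \<le> 5049/10000 * (lam 1 * T)" using lam_pos[of 1] T by (intro mult_right_mono) auto
      also have "\<dots> = (1 - 1/100) * lam 1 * (T - L)" by (simp add: L_def algebra_simps)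
      finally have key: "(1/2 + min 1 (sqrt \<tau>) / 8) * (lam 1 * T) \<le> (1 - 1/100) * lam 1 * (T - L)" .
      show ?thesis unfolding rate_def \<tau>(1)[symmetric] exp_le_cancel_iff mult_minus_left
        by (rule le_imp_neg_le[OF key])
    qed
    have 5: "x\<^sup>2 \<le> 1000 * exp (45/1000 * x)"
    proof -
      have "x ^ 2 * exp (- (45/1000) * x) \<le> fact 2 / (45/1000) ^ 2" using x by (intro power_exp_le) auto
      also have "\<dots> \<le> 1000" by (simp add: power2_eq_square)
      finally show ?thesis by (simp add: exp_minus field_simps)
    qed
    have "10 * \<kappa> powr (- (1/2)) * (fact N / real N ^ N) * (1 / L) * (1 / (1/100 * \<kappa>\<^sup>2 * (T - L)))
       * exp (2011/1000 / (\<kappa>\<^sup>2 * L)) * exp (- (1 - 1/100) * lam 1 * (T - L))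
     \<le> 10 * \<kappa> powr (- (1/2)) * (exp 2 * (2 * (1 + x)) * exp (- (23/20 * x))) * (3 * x) * (200 * x) * exp (4105/1000 * x) * rate T"
      using 0 1 2 3 4 x L kappa_pos by (intro mult_mono) (auto intro!: mult_nonneg_nonneg)
    also have "\<dots> = \<kappa> powr (- (1/2)) * (20 * exp 2 * 3 * 200 * (1 + x) * (x\<^sup>2 * exp (2955/1000 * x)) * rate T)"
    proof -
      have "exp (- (23/20 * x)) * exp (4105/1000 * x) = exp (2955/1000 * x)"
        unfolding exp_add[symmetric] by (rule arg_cong[where f = exp]) simp
      then show ?thesis by (simp add: power2_eq_square mult_ac)
    qed
    also have "\<dots> \<le> \<kappa> powr (- (1/2)) * (20 * exp 2 * 3 * 200 * (1 + x) * (1000 * exp (45/1000 * x) * exp (2955/1000 * x)) * rate T)"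
      using x 5 by (intro mult_left_mono mult_right_mono) (auto simp: rate_def)
    also have "1000 * exp (45/1000 * x) * exp (2955/1000 * x) = 1000 * exp (3 * x)"
    proof -
      have "exp (45/1000 * x) * exp (2955/1000 * x) = exp (3 * x)"
        unfolding exp_add[symmetric] by (rule arg_cong[where f = exp]) simp
      then show ?thesis by simp
    qed
    finally show ?thesis by (simp add: const_gain_def x_def mult_ac)
  qed
  then have "sqrt T * (10 * \<kappa> powr (- (1/2)) * (fact N / real N ^ N) * (1 / L) * (1 / (1/100 * \<kappa>\<^sup>2 * (T - L)))
       * exp (2011/1000 / (\<kappa>\<^sup>2 * L)) * exp (- (1 - 1/100) * lam 1 * (T - L))) * L2_norm W u0
    \<le> sqrt T * (\<kappa> powr (- (1/2)) * (const_gain * (1 + 1 / \<tau>) * exp (3 / \<tau>) * rate T)) * L2_norm W u0"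
    using T by (intro mult_right_mono mult_left_mono L2_norm_nonneg) auto
  then show ?thesis using f by (intro bexI[of _ f]) linarith+
qed

text \<open>The window has fixed length on the scale 1 / kappa^2, so the bump costs the constant exp
  8044, 8044 being 2.011 * 4000. As T - L >= 3 T / 4, the retained share 0.9 * 0.75 of lam 1 T
  exceeds 5/8, the largest share that \<open>rate\<close> can require.\<close>

lemma control_long_time:
  assumes T: "T > 0" and \<tau>: "\<tau> = \<kappa>\<^sup>2 * T" "\<tau> \<ge> 1/1000" and u0: "u0 \<in> L2_space W"
  shows "\<exists>f\<in>null_controls T \<alpha> \<beta> \<mu> u0. L2_norm (time_measure T) f \<le>
     sqrt T * (\<kappa> powr (- (1/2)) * (const_long * (1 + 1 / \<tau>) * exp (3 / \<tau>) * rate T)) * L2_norm W u0"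
proof -
  have \<tau>0: "\<tau> > 0" using T kappa_pos \<tau> by simp
  define L where "L = 1 / (4000 * \<kappa>\<^sup>2)"
  have k1: "\<kappa>\<^sup>2 \<le> 1" using kappa_pos kappa_le_1 by (simp add: power_le_one)
  have kL: "\<kappa>\<^sup>2 * L = 1/4000" using kappa_pos by (simp add: L_def)
  have LT: "L \<le> T / 4"
  proof -
    have "1 \<le> 1000 * (\<kappa>\<^sup>2 * T)" using \<tau> by simp
    then show ?thesis using kappa_pos by (simp add: L_def field_simps)
  qed
  have L: "0 < L" "L < T" using LT T kappa_pos by (auto simp: L_def)
  obtain f where f: "f \<in> null_controls T \<alpha> \<beta> \<mu> u0" "L2_norm (time_measure T) f \<le>
     sqrt T * (10 * \<kappa> powr (- (1/2)) * (fact 0 / real 0 ^ 0) * (1 / L) * (1 / (1/10 * \<kappa>\<^sup>2 * (T - L)))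
       * exp (2011/1000 / (\<kappa>\<^sup>2 * L)) * exp (- (1 - 1/10) * lam 1 * (T - L))) * L2_norm W u0"
    using control_exists[OF L, of 0 "1/10" u0] nu_nonneg kappa_pos L u0 by auto
  have "10 * \<kappa> powr (- (1/2)) * (fact 0 / real 0 ^ 0) * (1 / L) * (1 / (1/10 * \<kappa>\<^sup>2 * (T - L)))
       * exp (2011/1000 / (\<kappa>\<^sup>2 * L)) * exp (- (1 - 1/10) * lam 1 * (T - L))
     \<le> \<kappa> powr (- (1/2)) * (const_long * (1 + 1 / \<tau>) * exp (3 / \<tau>) * rate T)"
  proof -
    have 1: "1 / L \<le> 4000" using k1 by (simp add: L_def)
    have TL: "3/4 * \<tau> \<le> \<kappa>\<^sup>2 * (T - L)"
      using mult_left_mono[OF LT, of "\<kappa>\<^sup>2"] by (simp add: \<tau>(1) algebra_simps)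
    have 2: "1 / (1/10 * \<kappa>\<^sup>2 * (T - L)) \<le> 14000"
    proof -
      have "1 / (1/10 * \<kappa>\<^sup>2 * (T - L)) \<le> 1 / (1/10 * (3/4 * (1/1000)))"
        unfolding mult.assoc using TL \<tau>(2) by (intro divide_left_mono) auto
      then show ?thesis by simp
    qed
    have 3: "exp (2011/1000 / (\<kappa>\<^sup>2 * L)) = exp 8044" unfolding kL by simp
    have 4: "exp (- (1 - 1/10) * lam 1 * (T - L)) \<le> rate T"
    proof -
      have "(1/2 + min 1 (sqrt \<tau>) / 8) * (lam 1 * T) \<le> 5/8 * (lam 1 * T)"
        using lam_pos[of 1] T by (intro mult_right_mono) auto
      also have "\<dots> \<le> 9/10 * (lam 1 * (3/4 * T))" using lam_pos[of 1] T by simp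
      also have "\<dots> \<le> 9/10 * (lam 1 * (T - L))" using lam_pos[of 1] LT by (intro mult_left_mono) auto
      also have "\<dots> = (1 - 1/10) * lam 1 * (T - L)" by simp
      finally have key: "(1/2 + min 1 (sqrt \<tau>) / 8) * (lam 1 * T) \<le> (1 - 1/10) * lam 1 * (T - L)" .
      show ?thesis unfolding rate_def \<tau>(1)[symmetric] exp_le_cancel_iff mult_minus_left
        by (rule le_imp_neg_le[OF key])
    qed
    have 5: "1 \<le> (1 + 1 / \<tau>) * exp (3 / \<tau>)"
    proof -
      have "1 * 1 \<le> (1 + 1 / \<tau>) * exp (3 / \<tau>)" using \<tau>0 by (intro mult_mono) auto
      then show ?thesis by simp
    qed
    have "10 * \<kappa> powr (- (1/2)) * (fact 0 / real 0 ^ 0) * (1 / L) * (1 / (1/10 * \<kappa>\<^sup>2 * (T - L)))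
       * exp (2011/1000 / (\<kappa>\<^sup>2 * L)) * exp (- (1 - 1/10) * lam 1 * (T - L))
      \<le> 10 * \<kappa> powr (- (1/2)) * (fact 0 / real 0 ^ 0) * 4000 * 14000 * exp 8044 * rate T"
      unfolding 3 using 1 2 4 L kappa_pos by (intro mult_mono) (auto intro!: mult_nonneg_nonneg)
    also have "\<dots> = \<kappa> powr (- (1/2)) * (const_long * 1 * rate T)" by (simp add: const_long_def)
    also have "\<dots> \<le> \<kappa> powr (- (1/2)) * (const_long * ((1 + 1 / \<tau>) * exp (3 / \<tau>)) * rate T)"
      using 5 by (intro mult_left_mono mult_right_mono) (auto simp: rate_def const_long_def)
    finally show ?thesis by (simp add: mult.assoc)
  qed
  then have "sqrt T * (10 * \<kappa> powr (- (1/2)) * (fact 0 / real 0 ^ 0) * (1 / L) * (1 / (1/10 * \<kappa>\<^sup>2 * (T - L)))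
       * exp (2011/1000 / (\<kappa>\<^sup>2 * L)) * exp (- (1 - 1/10) * lam 1 * (T - L))) * L2_norm W u0
    \<le> sqrt T * (\<kappa> powr (- (1/2)) * (const_long * (1 + 1 / \<tau>) * exp (3 / \<tau>) * rate T)) * L2_norm W u0"
    using T by (intro mult_right_mono mult_left_mono L2_norm_nonneg) auto
  then show ?thesis using f by (intro bexI[of _ f]) linarith+
qed

text \<open>The three regimes: for \<open>\<kappa>\<^sup>2 T\<close> bounded below a short window at the end suffices. Otherwise nearly all of
  \<open>(0,T)\<close> is used if \<open>\<nu> \<kappa>\<^sup>2 T\<close> is small; if it is large, half of the time is left to the dissipation, which
  doubles the exponent of the bump, and the gain \<open>N! / N\<^sup>N\<close> with \<open>N \<approx> 1.15 / (\<kappa>\<^sup>2 T)\<close> compensates.\<close>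

lemma control_bound:
  assumes T: "T > 0" and u0: "u0 \<in> L2_space W"
  shows "\<exists>f\<in>null_controls T \<alpha> \<beta> \<mu> u0. L2_norm (time_measure T) f \<le>
     sqrt T * (\<kappa> powr (- (1/2)) * (const_all * ((1 + 1 / (\<kappa>\<^sup>2 * T)) * exp (3 / (\<kappa>\<^sup>2 * T)) * rate T))) * L2_norm W u0"
proof -
  define \<tau> where "\<tau> = \<kappa>\<^sup>2 * T"
  have \<tau>0: "\<tau> > 0" using T kappa_pos by (simp add: \<tau>_def)
  let ?R = "(1 + 1 / \<tau>) * exp (3 / \<tau>) * rate T"
  have R: "?R \<ge> 0" using \<tau>0 by (simp add: rate_def)
  have "\<exists>c\<le>const_all. \<exists>f\<in>null_controls T \<alpha> \<beta> \<mu> u0. L2_norm (time_measure T) f \<le>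
     sqrt T * (\<kappa> powr (- (1/2)) * (c * (1 + 1 / \<tau>) * exp (3 / \<tau>) * rate T)) * L2_norm W u0"
  proof -
    have pos: "const_small \<ge> 0" "const_gain \<ge> 0" "const_long \<ge> 0"
      by (simp_all add: const_small_def const_gain_def const_long_def)
    consider "\<tau> \<ge> 1/1000" | "\<tau> \<le> 1/1000" "\<nu> * \<tau> \<le> 23/20" | "\<tau> \<le> 1/1000" "\<nu> * \<tau> \<ge> 23/20" by linarith
    then show ?thesis
    proof cases
      case 1
      then show ?thesis
        using control_long_time[OF T \<tau>_def 1 u0] pos by (intro exI[of _ const_long]) (simp add: const_all_def)
    next
      case 2
      then show ?thesis
        using control_small_order[OF T \<tau>_def 2 u0] pos by (intro exI[of _ const_small]) (simp add: const_all_def)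
    next
      case 3
      then show ?thesis
        using control_large_order[OF T \<tau>_def 3 u0] pos by (intro exI[of _ const_gain]) (simp add: const_all_def)
    qed
  qed
  then obtain c f where c: "c \<le> const_all" and f: "f \<in> null_controls T \<alpha> \<beta> \<mu> u0" "L2_norm (time_measure T) f \<le>
     sqrt T * (\<kappa> powr (- (1/2)) * (c * (1 + 1 / \<tau>) * exp (3 / \<tau>) * rate T)) * L2_norm W u0" by blast
  note f(2)
  also have "sqrt T * (\<kappa> powr (- (1/2)) * (c * (1 + 1 / \<tau>) * exp (3 / \<tau>) * rate T)) * L2_norm W u0
    \<le> sqrt T * (\<kappa> powr (- (1/2)) * (const_all * ?R)) * L2_norm W u0"
    using T mult_right_mono[OF c R]
    by (intro mult_right_mono mult_left_mono L2_norm_nonneg) (auto simp: mult.assoc)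
  finally show ?thesis using f(1) unfolding \<tau>_def by blast
qed

text \<open>Of all \<open>\<delta> \<in> (0,1)\<close> and, after rescaling time by \<open>\<kappa>\<^sup>2\<close>, all \<open>\<kappa> \<le> 1\<close>, the smallest bound is the one for \<open>\<delta> \<rightarrow> 0\<close>, \<open>\<kappa> = 1\<close>.\<close>

lemma M_bound_lower:
  assumes T: "T > 0" and d: "0 < \<delta>" "\<delta> < 1"
  shows "(1 + 1 / (\<kappa>\<^sup>2 * T)) * exp (3 / (\<kappa>\<^sup>2 * T)) * rate T \<le> M_bound T \<alpha> \<nu> \<delta> * exp (- (T / 2 * \<kappa>\<^sup>2 * (j 1)\<^sup>2))"
proof -
  define \<tau> where "\<tau> = \<kappa>\<^sup>2 * T"
  have \<tau>: "\<tau> > 0" using T kappa_pos by (simp add: \<tau>_def)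
  have d\<tau>: "(1 - \<delta>) * \<kappa>\<^sup>2 * T = (1 - \<delta>) * \<tau>" by (simp add: \<tau>_def)
  have le: "(1 - \<delta>) * \<tau> \<le> \<tau>" "(1 - \<delta>) * \<tau> > 0"
    using mult_right_mono[of "1 - \<delta>" 1 \<tau>] d \<tau> by auto
  have 1: "1 + 1 / \<tau> \<le> 1 + 1 / ((1 - \<delta>) * \<tau>)"
    using le \<tau> d by (intro add_left_mono divide_left_mono mult_pos_pos) auto
  have 2: "exp (3 / \<tau>) \<le> exp (1 / (sqrt 2 * \<kappa>)) + 1 / \<delta> ^ 3 * exp (3 / ((1 - \<delta>) * \<tau>))"
  proof -
    have "3 / \<tau> \<le> 3 / ((1 - \<delta>) * \<tau>)" using le \<tau> d by (intro divide_left_mono mult_pos_pos) auto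
    moreover have "1 \<le> 1 / \<delta> ^ 3" using d by (simp add: power_le_one)
    ultimately have "1 * exp (3 / \<tau>) \<le> 1 / \<delta> ^ 3 * exp (3 / ((1 - \<delta>) * \<tau>))"
      using d by (intro mult_mono) auto
    then show ?thesis using exp_ge_zero[of "1 / (sqrt 2 * \<kappa>)"] by linarith
  qed
  have 3: "rate T \<le> exp (- ((1 - \<delta>) powr (3/2) * T powr (3/2) / (8 * (1 + T) powr (1/2)) * \<kappa> ^ 3 * (j 1)\<^sup>2))
     * exp (- (T / 2 * \<kappa>\<^sup>2 * (j 1)\<^sup>2))"
  proof -
    have "T powr (3/2) = T powr 1 * T powr (1/2)" unfolding powr_add[symmetric] by simp
    then have T32: "T powr (3/2) = T * sqrt T" using T by (simp add: powr_half_sqrt)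
    have T12: "(1 + T) powr (1/2) = sqrt (1 + T)" using T by (simp add: powr_half_sqrt)
    have s1: "sqrt T / sqrt (1 + T) \<le> 1" using T by simp
    have s2: "sqrt T / sqrt (1 + T) \<le> sqrt T"
    proof -
      have "sqrt T / sqrt (1 + T) \<le> sqrt T / 1" using T by (intro divide_left_mono) auto
      then show ?thesis by simp
    qed
    have m: "sqrt T / sqrt (1 + T) * \<kappa> \<le> min 1 (sqrt \<tau>)"
    proof -
      have "sqrt T / sqrt (1 + T) * \<kappa> \<le> 1 * 1" using s1 kappa_pos kappa_le_1 T by (intro mult_mono) auto
      moreover have "sqrt T / sqrt (1 + T) * \<kappa> \<le> sqrt T * \<kappa>" using s2 kappa_pos by (intro mult_right_mono) auto
      moreover have "sqrt \<tau> = sqrt T * \<kappa>" using kappa_pos by (simp add: \<tau>_def real_sqrt_mult mult.commute)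
      ultimately show ?thesis by simp
    qed
    have d1: "(1 - \<delta>) powr (3/2) \<le> 1" using d by (intro powr_le1) auto
    have "(1 - \<delta>) powr (3/2) * T powr (3/2) / (8 * (1 + T) powr (1/2)) * \<kappa> ^ 3 * (j 1)\<^sup>2
      = (1 - \<delta>) powr (3/2) * ((sqrt T / sqrt (1 + T) * \<kappa>) / 8 * (lam 1 * T))"
      unfolding T32 T12 by (simp add: lam_eq zk_def power3_eq_cube power2_eq_square mult_ac)
    also have "\<dots> \<le> 1 * (min 1 (sqrt \<tau>) / 8 * (lam 1 * T))"
      using d1 m lam_pos[of 1] T kappa_pos \<tau> by (intro mult_mono divide_right_mono) auto
    finally have a: "(1 - \<delta>) powr (3/2) * T powr (3/2) / (8 * (1 + T) powr (1/2)) * \<kappa> ^ 3 * (j 1)\<^sup>2 \<le> 1 * (min 1 (sqrt \<tau>) / 8 * (lam 1 * T))" .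
    have b: "T / 2 * \<kappa>\<^sup>2 * (j 1)\<^sup>2 = 1/2 * (lam 1 * T)" by (simp add: lam_eq zk_def)
    have "(1 - \<delta>) powr (3/2) * T powr (3/2) / (8 * (1 + T) powr (1/2)) * \<kappa> ^ 3 * (j 1)\<^sup>2 + T / 2 * \<kappa>\<^sup>2 * (j 1)\<^sup>2
       \<le> (1/2 + min 1 (sqrt \<tau>) / 8) * (lam 1 * T)"
      by (rule order_trans[OF add_mono[OF a eq_refl[OF b]]]) (simp add: algebra_simps)
    then show ?thesis unfolding exp_add[symmetric] rate_def \<tau>_def[symmetric] exp_le_cancel_iff by linarith
  qed
  have "(1 + 1 / \<tau>) * exp (3 / \<tau>) * rate T \<le> (1 + 1 / ((1 - \<delta>) * \<tau>))
      * (exp (1 / (sqrt 2 * \<kappa>)) + 1 / \<delta> ^ 3 * exp (3 / ((1 - \<delta>) * \<tau>)))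
      * (exp (- ((1 - \<delta>) powr (3/2) * T powr (3/2) / (8 * (1 + T) powr (1/2)) * \<kappa> ^ 3 * (j 1)\<^sup>2))
         * exp (- (T / 2 * \<kappa>\<^sup>2 * (j 1)\<^sup>2)))"
    using 1 2 3 le d by (intro mult_mono) (auto simp: rate_def intro!: mult_nonneg_nonneg add_nonneg_nonneg)
  then show ?thesis unfolding M_bound_def d\<tau> \<tau>_def[symmetric] by (simp only: mult.assoc)
qed

lemma cost_upper:
  assumes T: "T > 0" and d: "0 < \<delta>" "\<delta> < 1"
  shows "cost T \<alpha> \<beta> \<mu> \<le> ereal (const_all * M_bound T \<alpha> \<nu> \<delta> * T powr (1/2) * \<kappa> powr (- (1/2)) * exp (- (T / 2 * \<kappa>\<^sup>2 * (j 1)\<^sup>2)))"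
proof -
  let ?X = "const_all * M_bound T \<alpha> \<nu> \<delta> * T powr (1/2) * \<kappa> powr (- (1/2)) * exp (- (T / 2 * \<kappa>\<^sup>2 * (j 1)\<^sup>2))"
  let ?R = "(1 + 1 / (\<kappa>\<^sup>2 * T)) * exp (3 / (\<kappa>\<^sup>2 * T)) * rate T"
  have C: "const_all \<ge> 0" by (simp add: const_all_def const_small_def const_gain_def const_long_def)
  have R: "?R \<ge> 0" using T kappa_pos by (simp add: rate_def)
  show ?thesis
    unfolding cost_def
  proof (rule SUP_least)
    fix u0 assume u: "u0 \<in> {u0 \<in> L2_space W. L2_norm W u0 \<le> 1}"
    then obtain f where f: "f \<in> null_controls T \<alpha> \<beta> \<mu> u0" "L2_norm (time_measure T) f \<le>
      sqrt T * (\<kappa> powr (- (1/2)) * (const_all * ?R)) * L2_norm W u0"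
      using control_bound[OF T, of u0] by auto
    note f(2)
    also have "sqrt T * (\<kappa> powr (- (1/2)) * (const_all * ?R)) * L2_norm W u0
      \<le> sqrt T * (\<kappa> powr (- (1/2)) * (const_all * ?R)) * 1"
      using u T C R by (intro mult_left_mono) (auto intro!: mult_nonneg_nonneg)
    also have "\<dots> \<le> sqrt T * (\<kappa> powr (- (1/2)) * (const_all * (M_bound T \<alpha> \<nu> \<delta> * exp (- (T / 2 * \<kappa>\<^sup>2 * (j 1)\<^sup>2))))) * 1"
      using T C by (intro mult_right_mono mult_left_mono M_bound_lower[OF T d]) auto
    also have "\<dots> = ?X" using T by (simp add: powr_half_sqrt mult_ac)
    finally have "ereal (L2_norm (time_measure T) f) \<le> ereal ?X" by simp
    then show "(INF f\<in>null_controls T \<alpha> \<beta> \<mu> u0. ereal (L2_norm (time_measure T) f)) \<le> ereal ?X"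
      by (intro INF_lower2[OF f(1)])
  qed
qed

end

theorem theorem1:
  shows "(\<forall>T \<alpha> \<beta> \<mu> :: real. T > 0 \<and> admissible \<alpha> \<beta> \<mu> \<longrightarrow>
           (\<forall>u0 \<in> L2_space (weight_measure \<beta>). \<exists>f. f \<in> null_controls T \<alpha> \<beta> \<mu> u0))
    \<and> (\<exists>c::real > 0. \<forall>T \<alpha> \<beta> \<mu> :: real. T > 0 \<and> admissible \<alpha> \<beta> \<mu> \<longrightarrow>
           (\<forall>\<delta>::real. 0 < \<delta> \<and> \<delta> < 1 \<longrightarrow>
             cost T \<alpha> \<beta> \<mu> \<le>
               ereal (c * M_bound T \<alpha> (nu \<alpha> \<beta> \<mu>) \<delta> * T powr (1/2) * kappa \<alpha> powr (- (1/2))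
                      * exp (- (T / 2 * (kappa \<alpha>)\<^sup>2 * (bessel_zero (nu \<alpha> \<beta> \<mu>) 1)\<^sup>2)))))
    \<and> (\<exists>c::real > 0. \<forall>T \<alpha> \<beta> \<mu> :: real. T > 0 \<and> admissible \<alpha> \<beta> \<mu> \<longrightarrow>
           (let \<nu> = nu \<alpha> \<beta> \<mu>; j1 = bessel_zero \<nu> 1; j2 = bessel_zero \<nu> 2 in
             ereal (c * 2 powr \<nu> * Gamma (\<nu> + 1) * \<bar>deriv (bessel_J \<nu>) j1\<bar>
                      * exp ((1/2 - ln 2 / pi) * j2)
                    / ((2 * T * kappa \<alpha>) powr (1/2) * j1 powr \<nu>)
                    * exp (- ((j1\<^sup>2 + j2\<^sup>2 / 2) * (kappa \<alpha>)\<^sup>2 * T)))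
             \<le> cost T \<alpha> \<beta> \<mu>))"
proof (intro conjI cost_lower_bound)
  show "\<forall>T \<alpha> \<beta> \<mu> :: real. T > 0 \<and> admissible \<alpha> \<beta> \<mu> \<longrightarrow>
           (\<forall>u0 \<in> L2_space (weight_measure \<beta>). \<exists>f. f \<in> null_controls T \<alpha> \<beta> \<mu> u0)"
    using degenerate_parabolic.control_bound[OF degenerate_parabolic.intro] by blast
  have "const_all > 0"
    by (simp add: const_all_def const_small_def const_gain_def const_long_def add_pos_pos)
  then show "\<exists>c::real > 0. \<forall>T \<alpha> \<beta> \<mu> :: real. T > 0 \<and> admissible \<alpha> \<beta> \<mu> \<longrightarrow>
           (\<forall>\<delta>::real. 0 < \<delta> \<and> \<delta> < 1 \<longrightarrow>
             cost T \<alpha> \<beta> \<mu> \<le>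
               ereal (c * M_bound T \<alpha> (nu \<alpha> \<beta> \<mu>) \<delta> * T powr (1/2) * kappa \<alpha> powr (- (1/2))
                      * exp (- (T / 2 * (kappa \<alpha>)\<^sup>2 * (bessel_zero (nu \<alpha> \<beta> \<mu>) 1)\<^sup>2))))"
    using degenerate_parabolic.cost_upper[OF degenerate_parabolic.intro] by blast
qed

end
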